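(* Let $s>0$, $q>0$, $R>1$ be such that Condition A and Condition B (both stated in the context) hold for the Lorenz system $$x'=s(y-x),\qquad y'=Rx-y-xz,\qquad z'=xy-qz .$$ Suppose also that two of the eigenvalues of the linearization of this system at the equilibrium $p_0=(\sqrt{q(R-1)},\sqrt{q(R-1)},R-1)$ are complex (non-real). Let $\{M_j\}_{j\ge 1}$ be any infinite sequence with each $M_j\in\{1,3\}$. Then there is a solution $p=(x,y,z)$ of the system such that $x$ has an infinite number of zeros in $0<t<\infty$, and such that, if $t_1<t_2<t_3<\cdots$ is the sequence of consecutive zeros of $x$ in $[0,\infty)$ and $\sigma_i$ is the number of sign changes of $x'$ in $(t_i,t_{i+1})$, then $\sigma_i=M_i$ for all $1\le i<\infty$.
   Context: Notation. For $R>1$ the equilibrium $(0,0,0)$ of the system is unstable and has a one-dimensional unstable manifold $\gamma$. The positive branch $\gamma^+$ of $\gamma$ is the orbit of the solutions $p(t)=(x(t),y(t),z(t))$ for which $p(t)\to(0,0,0)$ as $t\to-\infty$ and $x(t),y(t),z(t)$ are all positive for all sufficiently large negative $t$. Condition A. If $p=(x,y,z)$ is a solution with $p(0)\in\gamma^+$, then $x'$ has at least five sign changes and $x$ has at least one zero. If $\tau_1<\tau_2<\tau_3<\tau_4<\tau_5$ are the first five sign changes of $x'$, and $t_1<t_2$ are the first two zeros of $x$ (with $t_2=\infty$ if $x$ does not have a second zero), then $\tau_1<t_1<\tau_2<\tau_3<\tau_4<\tau_5<t_2$. Suppose Condition A holds. Then $\gamma^+$, followed from the origin in the direction of increasing $t$,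 first crosses the plane $x=y$ at some point, denoted $p_1$. The point $p_0=(\sqrt{q(R-1)},\sqrt{q(R-1)},R-1)$ is the equilibrium of the system in the positive octant; it lies in the plane $x=y$. Let $L$ be the line segment connecting $p_0$ and $p_1$ (it lies in the plane $x=y$). Let $M$ be the line $\{(x,y,z)\in\mathbb{R}^3: x=y,\ z=R-1\}$. Condition B. Suppose $p=(x,y,z)$ is a nonconstant solution with $p(0)\in M$. Then at least one of the following is true: (2a) $p(t)\notin L$ for all $t<0$ (in the interval of existence of $p$); (2b) there is some interval of $t$ containing $t=0$ on which $x\neq 0$ and in which $x'$ changes sign four times. *)

theory Defs
  imports "HOL-Analysis.Analysis"
begin

definition lorenz :: "real \<Rightarrow> real \<Rightarrow> real \<Rightarrow> real ^ 3 \<Rightarrow> real ^ 3" where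
  "lorenz s q R p =
     vector [s * (p $ 2 - p $ 1), R * p $ 1 - p $ 2 - p $ 1 * p $ 3, p $ 1 * p $ 2 - q * p $ 3]"

definition p0 :: "real \<Rightarrow> real \<Rightarrow> real ^ 3" where
  "p0 q R = vector [sqrt (q * (R - 1)), sqrt (q * (R - 1)), R - 1]"

definition solves_on :: "real \<Rightarrow> real \<Rightarrow> real \<Rightarrow> real set \<Rightarrow> (real \<Rightarrow> real ^ 3) \<Rightarrow> bool" where
  "solves_on s q R J p \<longleftrightarrow>
     open J \<and> is_interval J \<and> J \<noteq> {} \<and>
     (\<forall>t\<in>J. (p has_vector_derivative lorenz s q R (p t)) (at t))"

(* J is the interval of existence of p; the values of p outside J carry no information. *)
definition solution :: "real \<Rightarrow> real \<Rightarrow> real \<Rightarrow> real set \<Rightarrow> (real \<Rightarrow> real ^ 3) \<Rightarrow> bool" where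
  "solution s q R J p \<longleftrightarrow>
     solves_on s q R J p \<and>
     (\<forall>K u. solves_on s q R K u \<and> J \<subseteq> K \<and> (\<forall>t\<in>J. u t = p t) \<longrightarrow> K = J)"

definition changes_sign_at :: "(real \<Rightarrow> real) \<Rightarrow> real \<Rightarrow> bool" where
  "changes_sign_at f \<tau> \<longleftrightarrow>
     (\<forall>\<^sub>F t in at_left \<tau>. f t < 0) \<and> (\<forall>\<^sub>F t in at_right \<tau>. f t > 0) \<or>
     (\<forall>\<^sub>F t in at_left \<tau>. f t > 0) \<and> (\<forall>\<^sub>F t in at_right \<tau>. f t < 0)"

definition sign_changes_x' :: "(real \<Rightarrow> real ^ 3) \<Rightarrow> real set \<Rightarrow> real set" where
  "sign_changes_x' p I = {\<tau> \<in> I. changes_sign_at (deriv (\<lambda>t. p t $ 1)) \<tau>}"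

definition zeros_x :: "(real \<Rightarrow> real ^ 3) \<Rightarrow> real set \<Rightarrow> real set" where
  "zeros_x p I = {t \<in> I. p t $ 1 = 0}"

(* us lists, in increasing order, the first (length us) elements of S. *)
definition first_elements :: "real list \<Rightarrow> real set \<Rightarrow> bool" where
  "first_elements us S \<longleftrightarrow>
     sorted_wrt (<) us \<and> set us \<subseteq> S \<and> (\<forall>v \<in> S - set us. \<forall>u \<in> set us. u < v)"

definition unstable_branch_solution ::
    "real \<Rightarrow> real \<Rightarrow> real \<Rightarrow> real set \<Rightarrow> (real \<Rightarrow> real ^ 3) \<Rightarrow> bool" where
  "unstable_branch_solution s q R J p \<longleftrightarrow>
     solution s q R J p \<and> (\<exists>T. {..T} \<subseteq> J) \<and>
     (p \<longlongrightarrow> 0) at_bot \<and>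
     (\<forall>\<^sub>F t in at_bot. p t $ 1 > 0 \<and> p t $ 2 > 0 \<and> p t $ 3 > 0)"

definition gamma_plus :: "real \<Rightarrow> real \<Rightarrow> real \<Rightarrow> (real ^ 3) set" where
  "gamma_plus s q R = {p t |J p t. unstable_branch_solution s q R J p \<and> t \<in> J}"

(* The convention t2 = \<infinity> in the absence of a second zero makes the last inequality
   vacuous in that case. *)
definition condition_A :: "real \<Rightarrow> real \<Rightarrow> real \<Rightarrow> bool" where
  "condition_A s q R \<longleftrightarrow>
     (\<forall>J p. solution s q R J p \<and> 0 \<in> J \<and> p 0 \<in> gamma_plus s q R \<longrightarrow>
        (\<exists>T \<subseteq> sign_changes_x' p J. card T = 5) \<and>
        zeros_x p J \<noteq> {} \<and>
        (\<forall>\<tau>1 \<tau>2 \<tau>3 \<tau>4 \<tau>5 t1.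
           first_elements [\<tau>1, \<tau>2, \<tau>3, \<tau>4, \<tau>5] (sign_changes_x' p J) \<and>
           first_elements [t1] (zeros_x p J) \<longrightarrow>
             \<tau>1 < t1 \<and> t1 < \<tau>2 \<and> \<tau>2 < \<tau>3 \<and> \<tau>3 < \<tau>4 \<and> \<tau>4 < \<tau>5 \<and>
             (\<forall>t2. first_elements [t1, t2] (zeros_x p J) \<longrightarrow> \<tau>5 < t2)))"

(* The point where gamma_plus, followed from the origin, first crosses the plane x = y. *)
definition first_crossing :: "real \<Rightarrow> real \<Rightarrow> real \<Rightarrow> real ^ 3 \<Rightarrow> bool" where
  "first_crossing s q R P \<longleftrightarrow>
     (\<exists>J p \<tau>. unstable_branch_solution s q R J p \<and>
        first_elements [\<tau>] {t \<in> J. changes_sign_at (\<lambda>t. p t $ 1 - p t $ 2) t} \<and>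
        P = p \<tau>)"

definition line_M :: "real \<Rightarrow> (real ^ 3) set" where
  "line_M R = {v. v $ 1 = v $ 2 \<and> v $ 3 = R - 1}"

(* Under condition_A there is exactly one first crossing point p1. *)
definition condition_B :: "real \<Rightarrow> real \<Rightarrow> real \<Rightarrow> bool" where
  "condition_B s q R \<longleftrightarrow>
     (\<forall>p1. first_crossing s q R p1 \<longrightarrow>
        (\<forall>J p. solution s q R J p \<and> 0 \<in> J \<and> \<not> p constant_on J \<and> p 0 \<in> line_M R \<longrightarrow>
           (\<forall>t \<in> J. t < 0 \<longrightarrow> p t \<notin> closed_segment (p0 q R) p1) \<or>
           (\<exists>I \<subseteq> J. is_interval I \<and> 0 \<in> I \<and> (\<forall>t\<in>I. p t $ 1 \<noteq> 0) \<and>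
              card (sign_changes_x' p I) = 4)))"

definition complex_eigenvalue :: "real ^ 'n ^ 'n \<Rightarrow> complex \<Rightarrow> bool" where
  "complex_eigenvalue A c \<longleftrightarrow>
     (\<exists>v :: complex ^ 'n. v \<noteq> 0 \<and> map_matrix complex_of_real A *v v = c *s v)"

end

theory Submission
  imports Defs
begin

text \<open>Put \<open>W = y - x\<close>, so that \<open>x' = s W\<close>, and \<open>Z = z - (R - 1)\<close>. While \<open>x \<noteq> 0\<close>, the derivative
  \<open>x'\<close> changes sign exactly at the zeros of \<open>W\<close> with \<open>Z \<noteq> 0\<close>. Follow an orbit from \<open>x = 0\<close>, \<open>W > 0\<close>
  to its next zero of \<open>x\<close>, reflect by \<open>(x, y, z) \<mapsto> (- x, - y, z)\<close>, and count the sign changes of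
  \<open>x'\<close> on the way. Along a curve of starting points this count is locally constant unless the
  orbit meets \<open>W = Z = 0\<close> or never returns to \<open>x = 0\<close>. On orbits from the segment \<open>L\<close>, Condition B
  attaches at least four sign changes to the former event (a Lyapunov function excludes it on the
  first descent from \<open>L\<close>). Near a non-returning orbit that converges to \<open>p\<^sub>0\<close>, the orbits which do
  leave \<open>p\<^sub>0\<close> oscillate at least four times. Hence a count below four can change only at an orbit converging to the origin. Orbits
  close to that one leave the origin along either branch of the unstable manifold, and Condition A
  tells what they do next: the count \<open>m\<close> persists and is followed by a count 1 and then by at
  least 4, or it becomes \<open>m + 2\<close> and is followed by at least 4.

  Therefore a curve whose counts range from 1 (followed by at least 4) near one end to at least 4
  at the other contains, for \<open>m = 1\<close> and for \<open>m = 3\<close>, a subcurve with constant count \<open>m\<close> whose image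
  under the return map is a curve of the same kind. Nested intervals then realize every sequence.\<close>

text \<open>Sign changes of \<open>x'\<close> appear or disappear in pairs where the orbit is
  tangent to \<open>W = 0\<close>, that is at \<open>W = Z = 0\<close>. Condition B reacts to such a
  point with four sign changes on an interval free of zeros of \<open>x\<close>. Once the orbit has
  crossed \<open>x = 0\<close> after leaving \<open>L\<close>, that interval cannot reach back
  beyond the crossing, so the four changes belong to the current leg. On the first descent from
  \<open>L\<close> nothing keeps the interval from reaching back beyond the starting point, which is
  why tangencies must be excluded there by other means. The function doing this increases only for
  \<open>3 * s > 2 * q + 1\<close>. This inequality is extracted from Condition A: in the opposite
  case the unstable branch never returns to \<open>x = 0\<close>. Counts of four or more are never
  resolved; "at least four" is an open condition that only signals that a smaller count must have
  ended somewhere before. The return map is undefined at the end of a curve whose orbit runs into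
  the origin, so curves are parametrized by a half-open interval, with their behaviour at the
  missing end recorded as an eventual property.\<close>

section \<open>Flows of bounded Lipschitz fields\<close>

lemma lipschitz_ode_dist:
  fixes p q :: "real \<Rightarrow> 'a::real_inner"
  assumes p: "\<And>t. t \<in> closed_segment a b \<Longrightarrow> (p has_vector_derivative p' t) (at t)"
    and q: "\<And>t. t \<in> closed_segment a b \<Longrightarrow> (q has_vector_derivative q' t) (at t)"
    and lip: "\<And>t. t \<in> closed_segment a b \<Longrightarrow> norm (p' t - q' t) \<le> L * norm (p t - q t)"
  shows "norm (p b - q b) \<le> exp (L * \<bar>b - a\<bar>) * norm (p a - q a)"
proof -
  \<comment> \<open>The square is differentiable even where the distance vanishes. The bound
    \<open>\<bar>r'\<bar> \<le> 2 * L * r\<close> makes \<open>r\<close> with an exponential weight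
    monotone in either time direction; the factor 2 goes away with the square root.\<close>
  define r where "r t = (p t - q t) \<bullet> (p t - q t)" for t
  define r' where "r' t = 2 * ((p t - q t) \<bullet> (p' t - q' t))" for t
  have r: "(r has_real_derivative r' t) (at t)" if "t \<in> closed_segment a b" for t
  proof -
    have d: "((\<lambda>t. p t - q t) has_derivative (\<lambda>h. h *\<^sub>R (p' t - q' t))) (at t)"
      using has_vector_derivative_diff[OF p[OF that] q[OF that]]
      by (simp add: has_vector_derivative_def)
    have "r' t * h = 2 * ((p t - q t) \<bullet> (h *\<^sub>R (p' t - q' t)))" for h
      by (simp add: r'_def)
    then show ?thesis
      unfolding has_field_derivative_def r_def
      by (intro has_derivative_eq_rhs[OF has_derivative_inner[OF d d]])
         (auto simp: r'_def inner_commute)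
  qed
  have bnd: "\<bar>r' t\<bar> \<le> 2 * L * r t" if "t \<in> closed_segment a b" for t
  proof -
    have "\<bar>(p t - q t) \<bullet> (p' t - q' t)\<bar> \<le> norm (p t - q t) * norm (p' t - q' t)"
      by (rule Cauchy_Schwarz_ineq2)
    also have "\<dots> \<le> norm (p t - q t) * (L * norm (p t - q t))"
      by (intro mult_left_mono lip that) auto
    also have "\<dots> = L * r t"
      by (simp add: r_def dot_square_norm power2_eq_square)
    finally show ?thesis by (simp add: r'_def abs_mult)
  qed
  have key: "r b \<le> exp (2 * L * \<bar>b - a\<bar>) * r a"
  proof (cases "a \<le> b")
    case True
    have "exp (- 2 * L * b) * r b \<le> exp (- 2 * L * a) * r a"
    proof (rule DERIV_nonpos_imp_nonincreasing[OF True])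
      fix t assume t: "a \<le> t" "t \<le> b"
      then have ts: "t \<in> closed_segment a b" using True by (auto simp: closed_segment_eq_real_ivl)
      have "((\<lambda>t. exp (- 2 * L * t) * r t) has_real_derivative
          exp (- 2 * L * t) * (r' t - 2 * L * r t)) (at t)"
        by (auto intro!: derivative_eq_intros r[OF ts] simp: algebra_simps)
      moreover have "exp (- 2 * L * t) * (r' t - 2 * L * r t) \<le> 0"
        using bnd[OF ts] by (intro mult_nonneg_nonpos) auto
      ultimately show "\<exists>y. ((\<lambda>t. exp (- 2 * L * t) * r t) has_real_derivative y) (at t) \<and> y \<le> 0"
        by blast
    qed
    from mult_left_mono[OF this, of "exp (2 * L * b)"]
    have "exp (2 * L * b + - 2 * L * b) * r b \<le> exp (2 * L * b + - 2 * L * a) * r a"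
      unfolding exp_add by (simp add: mult.assoc)
    moreover have "2 * L * b + - 2 * L * a = 2 * L * \<bar>b - a\<bar>"
      using True by (simp add: algebra_simps)
    ultimately show ?thesis by simp
  next
    case False
    then have ba: "b \<le> a" by simp
    have "exp (2 * L * b) * r b \<le> exp (2 * L * a) * r a"
    proof (rule DERIV_nonneg_imp_nondecreasing[OF ba])
      fix t assume t: "b \<le> t" "t \<le> a"
      then have ts: "t \<in> closed_segment a b" using ba by (auto simp: closed_segment_eq_real_ivl)
      have "((\<lambda>t. exp (2 * L * t) * r t) has_real_derivative
          exp (2 * L * t) * (r' t + 2 * L * r t)) (at t)"
        by (auto intro!: derivative_eq_intros r[OF ts] simp: algebra_simps)
      moreover have "exp (2 * L * t) * (r' t + 2 * L * r t) \<ge> 0"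
        using bnd[OF ts] by (intro mult_nonneg_nonneg) auto
      ultimately show "\<exists>y. ((\<lambda>t. exp (2 * L * t) * r t) has_real_derivative y) (at t) \<and> 0 \<le> y"
        by blast
    qed
    from mult_left_mono[OF this, of "exp (- 2 * L * b)"]
    have "exp (- 2 * L * b + 2 * L * b) * r b \<le> exp (- 2 * L * b + 2 * L * a) * r a"
      unfolding exp_add by (simp add: mult.assoc)
    moreover have "- 2 * L * b + 2 * L * a = 2 * L * \<bar>b - a\<bar>"
      using ba by (simp add: algebra_simps)
    ultimately show ?thesis by simp
  qed
  have "(norm (p b - q b))\<^sup>2 \<le> (exp (L * \<bar>b - a\<bar>) * norm (p a - q a))\<^sup>2"
    using key by (simp add: r_def dot_square_norm power_mult_distrib exp_double[symmetric] mult.assoc)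
  then show ?thesis
    by (rule power2_le_imp_le) auto
qed

text \<open>Picard iteration in a weighted norm: for
  \<open>p t = exp (K * \<bar>t\<bar>) *\<^sub>R g t\<close> with \<open>g\<close> bounded, the
  integral operator acting on \<open>g\<close> contracts by the factor \<open>L / K\<close>, so a
  single fixed point is a solution on the whole line. The bound on \<open>F\<close> keeps the
  operator inside the bounded functions.\<close>

lemma lipschitz_bounded_ode_exists:
  fixes F :: "'a::euclidean_space \<Rightarrow> 'a"
  assumes lip: "\<And>x y. norm (F x - F y) \<le> L * norm (x - y)" and L: "L > 0"
    and bnd: "\<And>x. norm (F x) \<le> B"
  shows "\<exists>p. p 0 = P \<and> (\<forall>t. (p has_vector_derivative F (p t)) (at t))"
proof -
  define K where "K = 2 * L"
  have K: "K > 0" using L by (simp add: K_def)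
  have B: "B \<ge> 0" using bnd[of 0] norm_ge_zero order_trans by blast
  have contF: "continuous_on UNIV F"
    using lip L by (intro lipschitz_on_continuous_on[of L]) (auto intro!: lipschitz_onI simp: dist_norm)
  define f where "f g u = F (exp (K * \<bar>u\<bar>) *\<^sub>R apply_bcontfun g u)" for g :: "real \<Rightarrow>\<^sub>C 'a" and u
  have contf: "isCont (f g) u" for g u
  proof -
    have "continuous_on UNIV (f g)"
      unfolding f_def
      by (intro continuous_on_compose2[OF contF] continuous_intros) auto
    then show ?thesis by (simp add: continuous_on_eq_continuous_at)
  qed
  have "\<exists>G. G 0 = 0 \<and> (\<forall>t. (G has_vector_derivative f g t) (at t))" for g
  proof -
    obtain G where G: "\<And>t. (G has_vector_derivative f g t) (at t)"
      using einterval_antiderivative[of "-\<infinity>" "\<infinity>" "f g"] contf by auto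
    have "((\<lambda>t. G t - G 0) has_vector_derivative f g t) (at t)" for t
      using has_vector_derivative_diff[OF G has_vector_derivative_const[of "G 0"]] by simp
    then show ?thesis by (intro exI[of _ "\<lambda>t. G t - G 0"]) auto
  qed
  then obtain A where A0: "\<And>g. A g 0 = 0" and A: "\<And>g t. (A g has_vector_derivative f g t) (at t)"
    by metis
  have contA: "continuous_on S (A g)" for g S
    by (meson A continuous_at_imp_continuous_on has_vector_derivative_continuous)
  \<comment> \<open>Used twice, for the boundedness of the image and for the contraction;
    \<open>h\<close> is an antiderivative, or a difference of two, vanishing at 0.\<close>
  have gen: "norm (h t) \<le> D / K * (exp (K * \<bar>t\<bar>) - 1)"
    if h0: "h 0 = 0" and h: "\<And>u. (h has_vector_derivative h' u) (at u)"
      and hb: "\<And>u. norm (h' u) \<le> D * exp (K * \<bar>u\<bar>)" for h h' :: "real \<Rightarrow> 'a" and D t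
  proof -
    have ch: "continuous_on S h" for S
      by (meson h continuous_at_imp_continuous_on has_vector_derivative_continuous)
    consider "t = 0" | "t > 0" | "t < 0" by linarith
    then show ?thesis
    proof cases
      case 1 then show ?thesis by (simp add: h0)
    next
      case 2
      have "norm (h t - h 0) \<le> D / K * exp (K * t) - D / K * exp (K * 0)"
      proof (rule differentiable_bound_general[OF 2, where f' = h' and \<phi>' = "\<lambda>u. D * exp (K * u)"])
        show "((\<lambda>t. D / K * exp (K * t)) has_vector_derivative D * exp (K * u)) (at u)" for u
          unfolding has_real_derivative_iff_has_vector_derivative[symmetric] using K
          by (auto intro!: derivative_eq_intros)
        show "norm (h' u) \<le> D * exp (K * u)" if "0 < u" for u
          using hb[of u] that by simp
      qed (use K in \<open>auto intro!: ch h continuous_intros\<close>)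
      then show ?thesis using 2 by (simp add: h0 algebra_simps)
    next
      case 3
      have "norm (h 0 - h t) \<le> - D / K * exp (- K * 0) - - D / K * exp (- K * t)"
      proof (rule differentiable_bound_general[OF 3, where f' = h' and \<phi>' = "\<lambda>u. D * exp (- K * u)"])
        show "((\<lambda>t. - D / K * exp (- K * t)) has_vector_derivative D * exp (- K * u)) (at u)" for u
          unfolding has_real_derivative_iff_has_vector_derivative[symmetric] using K
          by (auto intro!: derivative_eq_intros)
        show "norm (h' u) \<le> D * exp (- K * u)" if "u < 0" for u
          using hb[of u] that by simp
      qed (use K in \<open>auto intro!: ch h continuous_intros\<close>)
      then show ?thesis using 3 by (simp add: h0 algebra_simps)
    qed
  qed
  have expand: "exp (- K * \<bar>t\<bar>) * (D / K * (exp (K * \<bar>t\<bar>) - 1)) \<le> D / K" if "D \<ge> 0" for D t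
  proof -
    have "exp (- K * \<bar>t\<bar>) * (D / K * (exp (K * \<bar>t\<bar>) - 1)) = D / K * (1 - exp (- K * \<bar>t\<bar>))"
      by (simp add: algebra_simps exp_minus)
    also have "\<dots> \<le> D / K * 1"
      using that K by (intro mult_left_mono) auto
    finally show ?thesis by simp
  qed
  define T where "T g = Bcontfun (\<lambda>t. exp (- K * \<bar>t\<bar>) *\<^sub>R (P + A g t))" for g
  have T: "apply_bcontfun (T g) t = exp (- K * \<bar>t\<bar>) *\<^sub>R (P + A g t)" for g t
  proof -
    have "norm (exp (- K * \<bar>t\<bar>) *\<^sub>R (P + A g t)) \<le> norm P + B / K" for t
    proof -
      have "norm (A g t) \<le> B / K * (exp (K * \<bar>t\<bar>) - 1)"
      proof (rule gen[OF A0 A])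
        have "norm (f g u) \<le> B * 1" for u by (simp add: f_def bnd)
        also have "B * 1 \<le> B * exp (K * \<bar>u\<bar>)" for u
          using B K by (intro mult_left_mono) auto
        finally show "norm (f g u) \<le> B * exp (K * \<bar>u\<bar>)" for u .
      qed
      then have 1: "exp (- K * \<bar>t\<bar>) * norm (A g t) \<le> exp (- K * \<bar>t\<bar>) * (B / K * (exp (K * \<bar>t\<bar>) - 1))"
        by (intro mult_left_mono) auto
      have 2: "exp (- K * \<bar>t\<bar>) * norm P \<le> 1 * norm P"
        using K by (intro mult_right_mono) auto
      have "norm (exp (- K * \<bar>t\<bar>) *\<^sub>R (P + A g t)) \<le> exp (- K * \<bar>t\<bar>) * (norm P + norm (A g t))"
        by (simp add: norm_triangle_ineq)
      with 1 2 expand[OF B, of t] show ?thesis by (simp add: distrib_left)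
    qed
    then have "(\<lambda>t. exp (- K * \<bar>t\<bar>) *\<^sub>R (P + A g t)) \<in> bcontfun"
      by (intro bcontfun_normI continuous_intros contA)
    then show ?thesis by (simp add: T_def Bcontfun_inverse)
  qed
  have contr: "dist (T g) (T h) \<le> (1/2) * dist g h" for g h
  proof (rule dist_bound)
    fix t
    have "norm (A g t - A h t) \<le> (L * dist g h) / K * (exp (K * \<bar>t\<bar>) - 1)"
    proof (rule gen[of "\<lambda>t. A g t - A h t"])
      show "((\<lambda>t. A g t - A h t) has_vector_derivative (f g u - f h u)) (at u)" for u
        by (intro has_vector_derivative_diff A)
      show "norm (f g u - f h u) \<le> L * dist g h * exp (K * \<bar>u\<bar>)" for u
      proof -
        have "norm (f g u - f h u) \<le> L * norm (exp (K * \<bar>u\<bar>) *\<^sub>R g u - exp (K * \<bar>u\<bar>) *\<^sub>R h u)"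
          unfolding f_def by (rule lip)
        also have "\<dots> = L * (exp (K * \<bar>u\<bar>) * dist (g u) (h u))"
          by (simp add: dist_norm flip: scaleR_diff_right)
        also have "\<dots> \<le> L * (exp (K * \<bar>u\<bar>) * dist g h)"
          using L by (intro mult_left_mono dist_bounded) auto
        finally show ?thesis by (simp add: mult_ac)
      qed
    qed (simp add: A0)
    then have "exp (- K * \<bar>t\<bar>) * norm (A g t - A h t)
        \<le> exp (- K * \<bar>t\<bar>) * ((L * dist g h) / K * (exp (K * \<bar>t\<bar>) - 1))"
      by (intro mult_left_mono) auto
    also have "\<dots> \<le> (L * dist g h) / K" using L by (intro expand) auto
    also have "\<dots> = (1/2) * dist g h" using L by (simp add: K_def)
    finally show "dist (T g t) (T h t) \<le> (1/2) * dist g h"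
      by (simp add: T dist_norm flip: scaleR_diff_right)
  qed
  obtain g where g: "T g = g"
    using banach_fix_type[of "1/2" T] contr by auto
  define p where "p t = exp (K * \<bar>t\<bar>) *\<^sub>R g t" for t
  have p: "p t = P + A g t" for t
  proof -
    have "p t = exp (K * \<bar>t\<bar>) *\<^sub>R (T g) t" by (simp add: p_def g)
    then show ?thesis by (simp add: T flip: exp_add)
  qed
  have "(p has_vector_derivative F (p t)) (at t)" for t
  proof -
    have "((\<lambda>t. P + A g t) has_vector_derivative f g t) (at t)"
      using has_vector_derivative_add[OF has_vector_derivative_const[of P] A[of g]] by simp
    moreover have "(\<lambda>t. P + A g t) = p" by (simp add: p fun_eq_iff)
    moreover have "f g t = F (p t)" by (simp add: f_def p_def)
    ultimately show ?thesis by simp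
  qed
  then show ?thesis using p[of 0] A0 by (intro exI[of _ p]) auto
qed

text \<open>The group law is uniqueness: the time-shifted solution and the solution from the shifted
  point agree at time 0, and the distance estimate keeps them equal.\<close>

lemma lipschitz_bounded_flow_exists:
  fixes F :: "'a::euclidean_space \<Rightarrow> 'a"
  assumes lip: "\<And>x y. norm (F x - F y) \<le> L * norm (x - y)" and L: "L > 0"
    and bnd: "\<And>x. norm (F x) \<le> B"
  shows "\<exists>\<phi>. (\<forall>P. \<phi> 0 P = P) \<and>
           (\<forall>t P. ((\<lambda>t. \<phi> t P) has_vector_derivative F (\<phi> t P)) (at t)) \<and>
           (\<forall>t u P. \<phi> (t + u) P = \<phi> t (\<phi> u P)) \<and>
           (\<forall>t P Q. dist (\<phi> t P) (\<phi> t Q) \<le> exp (L * \<bar>t\<bar>) * dist P Q)"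
proof -
  from lipschitz_bounded_ode_exists[OF assms] obtain p
    where p0: "\<And>P. p P 0 = P" and p: "\<And>P t. (p P has_vector_derivative F (p P t)) (at t)"
    by metis
  have dist: "norm (p P t - p Q t) \<le> exp (L * \<bar>t\<bar>) * norm (P - Q)" for P Q t
    using lipschitz_ode_dist[of 0 t "p P" "\<lambda>t. F (p P t)" "p Q" "\<lambda>t. F (p Q t)" L] p lip
    by (simp add: p0)
  have grp: "p P (t + u) = p (p P u) t" for P t u
  proof -
    have "((\<lambda>t. p P (t + u)) has_vector_derivative F (p P (t + u))) (at t)" for t
    proof -
      have "((p P \<circ> (\<lambda>t. t + u)) has_vector_derivative 1 *\<^sub>R F (p P (t + u))) (at t)"
        by (rule vector_diff_chain_at)
           (auto intro!: derivative_eq_intros p simp: has_real_derivative_iff_has_vector_derivative[symmetric])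
      then show ?thesis by (simp add: o_def)
    qed
    then have "norm (p P (t + u) - p (p P u) t) \<le> exp (L * \<bar>t - 0\<bar>) * norm (p P (0 + u) - p (p P u) 0)"
      by (intro lipschitz_ode_dist[where p' = "\<lambda>t. F (p P (t + u))" and q' = "\<lambda>t. F (p (p P u) t)"] p lip)
    then show ?thesis by (simp add: p0)
  qed
  show ?thesis
    by (intro exI[of _ "\<lambda>t P. p P t"]) (use p0 p grp dist in \<open>auto simp: dist_norm\<close>)
qed

section \<open>Elementary facts about functions of one real variable\<close>

lemma first_time:
  fixes f :: "real \<Rightarrow> 'a::topological_space"
  assumes "continuous_on {a..b} f" "closed C" "t \<in> {a..b}" "f t \<in> C"
  shows "\<exists>u\<in>{a..t}. f u \<in> C \<and> (\<forall>v\<in>{a..<u}. f v \<notin> C)"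
proof -
  have "closed ({a..b} \<inter> f -` C)"
    by (rule continuous_closed_preimage[OF assms(1) _ assms(2)]) auto
  then have "compact ({a..b} \<inter> f -` C)"
    by (simp add: compact_eq_bounded_closed bounded_Int)
  then obtain u where u: "u \<in> {a..b} \<inter> f -` C" "\<And>v. v \<in> {a..b} \<inter> f -` C \<Longrightarrow> u \<le> v"
    using compact_attains_inf[of "{a..b} \<inter> f -` C"] assms(3,4) by blast
  have "f v \<notin> C" if "v \<in> {a..<u}" for v
    using u(1) u(2)[of v] that by auto
  then show ?thesis using u(1) u(2)[of t] assms(3,4) by (intro bexI[of _ u]) auto
qed

text \<open>Turns the failure of a neighbourhood statement into a sequence of counterexamples, from
  which compactness can extract a limit.\<close>

lemma not_eventually_nhds_sequence:
  fixes Q :: "'a::metric_space"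
  assumes "\<not> (\<forall>\<^sub>F C in nhds Q. \<Phi> C)"
  shows "\<exists>C. C \<longlonglongrightarrow> Q \<and> (\<forall>n. \<not> \<Phi> (C n))"
proof -
  have "\<forall>d>0. \<exists>C. dist C Q < d \<and> \<not> \<Phi> C"
    using assms by (auto simp: eventually_nhds_metric)
  then have "\<exists>C. dist C Q < inverse (real (Suc n)) \<and> \<not> \<Phi> C" for n by simp
  then obtain C where C: "\<And>n. dist (C n) Q < inverse (real (Suc n))" "\<And>n. \<not> \<Phi> (C n)"
    by metis
  have "C \<longlonglongrightarrow> Q"
  proof (rule metric_LIMSEQ_I)
    fix r :: real assume "r > 0"
    then obtain n where n: "inverse (real (Suc n)) < r" using reals_Archimedean by blast
    have "dist (C m) Q < r" if "m \<ge> n" for m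
    proof -
      have "inverse (real (Suc m)) \<le> inverse (real (Suc n))"
        using that by (intro le_imp_inverse_le) auto
      then show ?thesis using C(1)[of m] n by linarith
    qed
    then show "\<exists>no. \<forall>n\<ge>no. dist (C n) Q < r" by blast
  qed
  then show ?thesis using C(2) by blast
qed

text \<open>Transports an inequality along an orbit that emanates from an equilibrium, where the
  limit at time minus infinity takes the place of an initial value. The sign of the derivative is
  asked for strictly before \<open>T\<close> only.\<close>

lemma nonneg_derivative_from_at_bot:
  fixes f :: "real \<Rightarrow> real"
  assumes "\<And>t. t < T \<Longrightarrow> (f has_real_derivative f' t) (at t)" "\<And>t. t < T \<Longrightarrow> f' t \<ge> 0"
    and lim: "(f \<longlongrightarrow> l) at_bot" and cont: "isCont f T" and "t \<le> T"
  shows "l \<le> f t"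
proof -
  have *: "l \<le> f t" if "t < T" for t
  proof (rule tendsto_upperbound[OF lim])
    have "f u \<le> f t" if "u \<le> t" for u
    proof (rule DERIV_nonneg_imp_nondecreasing[OF that])
      fix x assume "u \<le> x" "x \<le> t"
      then have "x < T" using \<open>t < T\<close> by simp
      then show "\<exists>y. (f has_real_derivative y) (at x) \<and> 0 \<le> y"
        using assms(1,2) by blast
    qed
    then show "\<forall>\<^sub>F u in at_bot. f u \<le> f t"
      by (rule eventually_mono[OF eventually_le_at_bot[of t]])
  qed auto
  show ?thesis
  proof (cases "t < T")
    case False
    then have "t = T" using assms(5) by simp
    moreover have "l \<le> f T"
    proof (rule tendsto_lowerbound)
      show "(f \<longlongrightarrow> f T) (at_left T)"
        using cont by (simp add: isCont_def filterlim_at_split)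
      show "\<forall>\<^sub>F t in at_left T. l \<le> f t"
        using * by (auto simp: eventually_at_left_real intro: eventually_at_leftI[of "T - 1"])
    qed simp
    ultimately show ?thesis by simp
  qed (rule *)
qed

lemma exp_weighted_tendsto_0_at_bot:
  fixes f :: "real \<Rightarrow> real"
  assumes "(f \<longlongrightarrow> 0) at_bot" "k > 0"
  shows "((\<lambda>t. exp (k * t) * f t) \<longlongrightarrow> 0) at_bot"
proof -
  have "filterlim (\<lambda>t. k * t) at_bot at_bot"
    using assms(2) by (simp add: filterlim_tendsto_pos_mult_at_bot[OF tendsto_const] filterlim_ident)
  then have "((\<lambda>t. exp (k * t)) \<longlongrightarrow> 0) at_bot"
    by (rule filterlim_compose[OF exp_at_bot])
  from tendsto_mult[OF this assms(1)] show ?thesis by simp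
qed

lemma mono_bounded_tendsto_at_top:
  fixes f :: "real \<Rightarrow> real"
  assumes mono: "\<And>u v. u0 \<le> u \<Longrightarrow> u \<le> v \<Longrightarrow> f u \<le> f v" and bnd: "\<And>u. u0 \<le> u \<Longrightarrow> f u \<le> B"
  shows "\<exists>l. (f \<longlongrightarrow> l) at_top \<and> (\<forall>u\<ge>u0. f u \<le> l)"
proof -
  define l where "l = Sup (f ` {u0..})"
  have bdd: "bdd_above (f ` {u0..})" using bnd by (auto intro!: bdd_aboveI[of _ B])
  have le: "f u \<le> l" if "u \<ge> u0" for u
    unfolding l_def using that by (intro cSup_upper bdd) auto
  have "(f \<longlongrightarrow> l) at_top"
  proof (rule order_tendstoI)
    fix a assume "a < l"
    then obtain u where u: "u \<ge> u0" "a < f u"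
      using less_cSup_iff[of "f ` {u0..}" a] bdd by (auto simp: l_def)
    show "\<forall>\<^sub>F x in at_top. a < f x"
      using eventually_ge_at_top[of u]
    proof eventually_elim
      case (elim x)
      then show ?case using mono[of u x] u by linarith
    qed
  next
    fix a assume "l < a"
    show "\<forall>\<^sub>F x in at_top. f x < a"
      using eventually_ge_at_top[of u0]
    proof eventually_elim
      case (elim x)
      then show ?case using le[of x] \<open>l < a\<close> by linarith
    qed
  qed
  then show ?thesis using le by blast
qed

lemma pos_derivative_crossing:
  fixes f :: "real \<Rightarrow> real"
  assumes "(f has_real_derivative d) (at t)" "d > 0" "f t = 0"
  shows "\<exists>e>0. \<forall>h. 0 < h \<and> h < e \<longrightarrow> f (t - h) < 0 \<and> 0 < f (t + h)"
proof -
  obtain e1 where e1: "e1 > 0" "\<forall>h>0. h < e1 \<longrightarrow> f t < f (t + h)"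
    using DERIV_pos_inc_right[OF assms(1,2)] by blast
  obtain e2 where e2: "e2 > 0" "\<forall>h>0. h < e2 \<longrightarrow> f (t - h) < f t"
    using DERIV_pos_inc_left[OF assms(1,2)] by blast
  show ?thesis
    by (rule exI[of _ "min e1 e2"]) (use e1 e2 assms(3) in auto)
qed

lemma neg_derivative_crossing:
  fixes f :: "real \<Rightarrow> real"
  assumes "(f has_real_derivative d) (at t)" "d < 0" "f t = 0"
  shows "\<exists>e>0. \<forall>h. 0 < h \<and> h < e \<longrightarrow> 0 < f (t - h) \<and> f (t + h) < 0"
  using pos_derivative_crossing[OF DERIV_minus[OF assms(1)]] assms(2,3) by auto

lemma strict_local_max:
  fixes f :: "real \<Rightarrow> real"
  assumes f: "\<And>u. \<bar>u - t\<bar> < e0 \<Longrightarrow> (f has_real_derivative f' u) (at u)" and e0: "e0 > 0"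
    and f': "(f' has_real_derivative d) (at t)" and "d < 0" "f t = 0" "f' t = 0"
  shows "\<exists>e>0. \<forall>h. 0 < h \<and> h < e \<longrightarrow> f (t - h) < 0 \<and> f (t + h) < 0"
proof -
  obtain e where e: "e > 0" "\<And>h. 0 < h \<Longrightarrow> h < e \<Longrightarrow> 0 < f' (t - h) \<and> f' (t + h) < 0"
    using neg_derivative_crossing[OF f' assms(4,6)] by blast
  have "f (t - h) < 0 \<and> f (t + h) < 0" if h: "0 < h" "h < min e e0" for h
  proof
    have "\<exists>z>t. z < t + h \<and> f (t + h) - f t = (t + h - t) * f' z"
      by (rule MVT2) (use h f in auto)
    then obtain z where z: "z > t" "z < t + h" "f (t + h) = h * f' z" using assms(5) by auto
    then show "f (t + h) < 0" using e(2)[of "z - t"] h by (simp add: mult_pos_neg)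
    have "\<exists>z>t - h. z < t \<and> f t - f (t - h) = (t - (t - h)) * f' z"
      by (rule MVT2) (use h f in auto)
    then obtain z where z: "z > t - h" "z < t" "f (t - h) = - (h * f' z)" using assms(5) by auto
    then show "f (t - h) < 0" using e(2)[of "t - z"] h by simp
  qed
  then show ?thesis using e(1) e0 by (intro exI[of _ "min e e0"]) auto
qed

lemma DERIV_of_constant:
  assumes "(f has_real_derivative d) (at t)" "\<And>u. f u = c"
  shows "d = 0"
proof -
  have "f = (\<lambda>_. c)" using assms(2) by auto
  then show ?thesis using DERIV_unique[OF assms(1)] by auto
qed

lemma changes_sign_at_iff_explicit:
  "changes_sign_at f t \<longleftrightarrow>
     (\<exists>e>0. \<forall>h. 0 < h \<and> h < e \<longrightarrow> f (t - h) < 0 \<and> 0 < f (t + h)) \<or>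
     (\<exists>e>0. \<forall>h. 0 < h \<and> h < e \<longrightarrow> 0 < f (t - h) \<and> f (t + h) < 0)"
proof -
  have L: "(\<forall>\<^sub>F u in at_left t. Q u) \<longleftrightarrow> (\<exists>e>0. \<forall>h. 0 < h \<and> h < e \<longrightarrow> Q (t - h))" for Q
  proof
    assume "\<forall>\<^sub>F u in at_left t. Q u"
    then obtain b where b: "b < t" "\<And>y. b < y \<Longrightarrow> y < t \<Longrightarrow> Q y"
      by (auto simp: eventually_at_left_field)
    then show "\<exists>e>0. \<forall>h. 0 < h \<and> h < e \<longrightarrow> Q (t - h)" by (intro exI[of _ "t - b"]) auto
  next
    assume "\<exists>e>0. \<forall>h. 0 < h \<and> h < e \<longrightarrow> Q (t - h)"
    then obtain e where e: "e > 0" "\<And>h. 0 < h \<Longrightarrow> h < e \<Longrightarrow> Q (t - h)" by blast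
    have "Q y" if "t - e < y" "y < t" for y using e(2)[of "t - y"] that by simp
    then show "\<forall>\<^sub>F u in at_left t. Q u"
      using e(1) by (auto simp: eventually_at_left_field intro!: exI[of _ "t - e"])
  qed
  have Rr: "(\<forall>\<^sub>F u in at_right t. Q u) \<longleftrightarrow> (\<exists>e>0. \<forall>h. 0 < h \<and> h < e \<longrightarrow> Q (t + h))" for Q
  proof
    assume "\<forall>\<^sub>F u in at_right t. Q u"
    then obtain b where b: "b > t" "\<And>y. t < y \<Longrightarrow> y < b \<Longrightarrow> Q y"
      by (auto simp: eventually_at_right_field)
    then show "\<exists>e>0. \<forall>h. 0 < h \<and> h < e \<longrightarrow> Q (t + h)" by (intro exI[of _ "b - t"]) auto
  next
    assume "\<exists>e>0. \<forall>h. 0 < h \<and> h < e \<longrightarrow> Q (t + h)"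
    then obtain e where e: "e > 0" "\<And>h. 0 < h \<Longrightarrow> h < e \<Longrightarrow> Q (t + h)" by blast
    have "Q y" if "t < y" "y < t + e" for y using e(2)[of "y - t"] that by simp
    then show "\<forall>\<^sub>F u in at_right t. Q u"
      using e(1) by (auto simp: eventually_at_right_field intro!: exI[of _ "t + e"])
  qed
  have comb: "(\<exists>e>0. \<forall>h. 0 < h \<and> h < e \<longrightarrow> A h) \<and> (\<exists>e>0. \<forall>h. 0 < h \<and> h < e \<longrightarrow> B h)
      \<longleftrightarrow> (\<exists>e>0. \<forall>h. 0 < h \<and> h < e \<longrightarrow> A h \<and> B h)" for A B :: "real \<Rightarrow> bool"
  proof (rule iffI, elim conjE exE)
    fix e1 e2 assume "e1 > 0" "\<forall>h. 0 < h \<and> h < e1 \<longrightarrow> A h" "e2 > 0" "\<forall>h. 0 < h \<and> h < e2 \<longrightarrow> B h"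
    then show "\<exists>e>0. \<forall>h. 0 < h \<and> h < e \<longrightarrow> A h \<and> B h" by (intro exI[of _ "min e1 e2"]) auto
  qed blast
  show ?thesis unfolding changes_sign_at_def L Rr comb ..
qed

lemma first_nonpos:
  fixes f :: "real \<Rightarrow> real"
  assumes "continuous_on {a..b} f" "f a > 0" "t \<in> {a..b}" "f t \<le> 0"
  shows "\<exists>u. a < u \<and> u \<le> t \<and> f u = 0 \<and> (\<forall>v\<in>{a..<u}. f v > 0)"
proof -
  obtain u where u: "u \<in> {a..t}" "f u \<le> 0" "\<And>v. v \<in> {a..<u} \<Longrightarrow> f v > 0"
    using first_time[OF assms(1) closed_atMost[of 0] assms(3)] assms(4) by (auto simp: not_le)
  have "continuous_on {a..u} f"
    using assms(1) by (rule continuous_on_subset) (use u assms in auto)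
  then obtain x where x: "a \<le> x" "x \<le> u" "f x = 0"
    using IVT2'[of f u 0 a] u assms(2) by auto
  then have "x = u" using u(3)[of x] by force
  moreover have "a \<noteq> u" using x \<open>x = u\<close> assms(2) by auto
  ultimately show ?thesis using x u by (intro exI[of _ u]) auto
qed

lemma last_nonneg:
  fixes f :: "real \<Rightarrow> real"
  assumes "continuous_on {a..b} f" "f b < 0" "t \<in> {a..b}" "f t \<ge> 0"
  shows "\<exists>u. t \<le> u \<and> u < b \<and> f u = 0 \<and> (\<forall>v\<in>{u<..b}. f v < 0)"
proof -
  have "continuous_on {-b..-a} (\<lambda>v. - f (- v))"
    by (intro continuous_on_minus continuous_on_compose2[OF assms(1)]) (auto intro!: continuous_intros)
  from first_nonpos[OF this, of "- t"] assms
  obtain u where u: "- b < u" "u \<le> - t" "f (- u) = 0" "\<And>v. v \<in> {-b..<u} \<Longrightarrow> f (- v) < 0"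
    by auto
  have "f v < 0" if "v \<in> {-u<..b}" for v using u(4)[of "- v"] that by auto
  then show ?thesis using u by (intro exI[of _ "- u"]) auto
qed

text \<open>Condition A quantifies over lists of first elements, so it yields information only when
  such lists are exhibited. Finiteness to the left of every bound makes the elements of
  \<open>N\<close> enumerable in increasing order.\<close>

lemma first_elements_exist:
  assumes fin: "\<And>B. finite (N \<inter> {..B :: real})" and T: "T \<subseteq> N" "finite T" "card T = k"
  shows "\<exists>us. length us = k \<and> first_elements us N"
proof (cases "T = {}")
  case True
  then show ?thesis using T by (intro exI[of _ "[]"]) (auto simp: first_elements_def)
next
  case False
  define N' where "N' = N \<inter> {..Max T}"
  define xs where "xs = sorted_list_of_set N'"
  have N': "finite N'" unfolding N'_def by (rule fin)
  have xs: "sorted_wrt (<) xs" "set xs = N'" "length xs = card N'"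
    using N' by (auto simp: xs_def)
  have "T \<subseteq> N'" using T False by (auto simp: N'_def)
  then have "k \<le> length xs" using xs T N' by (metis card_mono)
  have app: "\<forall>x\<in>set (take k xs). \<forall>y\<in>set (drop k xs). x < y"
    using xs(1) sorted_wrt_append[of "(<)" "take k xs" "drop k xs"] by simp
  have "u < v" if "v \<in> N - set (take k xs)" "u \<in> set (take k xs)" for u v
  proof (cases "v \<le> Max T")
    case True
    then have "v \<in> set xs" using that xs by (auto simp: N'_def)
    then have "v \<in> set (drop k xs)" using that by (metis Diff_iff Un_iff append_take_drop_id set_append)
    then show ?thesis using app that by blast
  next
    case False
    have "u \<in> N'" using that(2) xs(2) by (auto dest: in_set_takeD)
    then show ?thesis using False by (auto simp: N'_def)
  qed
  moreover have "sorted_wrt (<) (take k xs)" using xs(1) by (rule sorted_wrt_take)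
  moreover have "set (take k xs) \<subseteq> N" using xs(2) by (auto dest: in_set_takeD simp: N'_def)
  ultimately show ?thesis using \<open>k \<le> length xs\<close>
    by (intro exI[of _ "take k xs"]) (auto simp: first_elements_def)
qed

lemma changes_sign_at_imp_zero:
  assumes "changes_sign_at f t" "isCont f t"
  shows "f t = 0"
proof (rule ccontr)
  assume n: "f t \<noteq> 0"
  obtain e where e: "e > 0" "\<And>h. 0 < h \<Longrightarrow> h < e \<Longrightarrow> f (t - h) * f (t + h) < 0"
  proof -
    have "(\<exists>e>0. \<forall>h. 0 < h \<and> h < e \<longrightarrow> f (t - h) < 0 \<and> 0 < f (t + h)) \<or>
        (\<exists>e>0. \<forall>h. 0 < h \<and> h < e \<longrightarrow> 0 < f (t - h) \<and> f (t + h) < 0)"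
      using assms(1) changes_sign_at_iff_explicit by blast
    then show ?thesis using that by (auto simp: mult_less_0_iff)
  qed
  have "\<forall>\<^sub>F u in nhds t. f u * f t > 0"
  proof (rule order_tendstoD(1))
    show "((\<lambda>u. f u * f t) \<longlongrightarrow> f t * f t) (nhds t)"
      using assms(2) by (intro tendsto_mult tendsto_const) (simp add: isCont_def tendsto_nhds_iff)
  qed (use n in \<open>auto simp: zero_less_mult_iff\<close>)
  then obtain d where d: "d > 0" "\<And>u. \<bar>u - t\<bar> < d \<Longrightarrow> f u * f t > 0"
    by (auto simp: eventually_nhds_metric dist_real_def)
  define h where "h = min e d / 2"
  have h: "0 < h" "h < e" "h < d" using e d by (auto simp: h_def min_def)
  have "f (t - h) * f t > 0" "f (t + h) * f t > 0" using d(2) h by auto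
  then have "(f (t - h) * f (t + h)) * (f t * f t) > 0" by (metis mult.assoc mult.left_commute mult_pos_pos)
  moreover have "f t * f t > 0" using n by (auto simp: zero_less_mult_iff)
  ultimately show False using e(2)[OF h(1,2)] by (auto simp: zero_less_mult_iff mult_less_0_iff)
qed

lemma changes_sign_at_cmult:
  assumes "c > 0"
  shows "changes_sign_at (\<lambda>t. c * f t) = changes_sign_at f"
  using assms by (auto simp: changes_sign_at_def fun_eq_iff zero_less_mult_iff mult_less_0_iff)

lemma changes_sign_at_uminus: "changes_sign_at (\<lambda>t. - f t) = changes_sign_at f"
  by (auto simp: changes_sign_at_def fun_eq_iff)

lemma first_ge_zero:
  fixes f :: "real \<Rightarrow> real"
  assumes "continuous_on {a..b} f" "f a < 0" "t \<in> {a..b}" "f t \<ge> 0"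
  shows "\<exists>u. a < u \<and> u \<le> t \<and> f u = 0 \<and> (\<forall>v\<in>{a..<u}. f v < 0)"
  using first_nonpos[of a b "\<lambda>t. - f t" t] assms by (auto intro: continuous_on_minus)

text \<open>The images of the compositions of \<open>f 0, ..., f (n - 1)\<close> are nested nonempty
  compact sets, hence have a common point \<open>r\<close>; injectivity makes the preimages of
  \<open>r\<close> a coherent sequence.\<close>

lemma inverse_limit_intervals:
  fixes f :: "nat \<Rightarrow> real \<Rightarrow> real"
  assumes c: "\<And>n. continuous_on {0..1} (f n)" and inj: "\<And>n. inj_on (f n) {0..1}"
    and im: "\<And>n. f n ` {0..1} \<subseteq> {0..1}"
  shows "\<exists>x. \<forall>n. x n \<in> {0..1} \<and> x n = f n (x (Suc n))"
proof -
  define F where "F = rec_nat id (\<lambda>n g. g \<circ> f n)"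
  have F: "F 0 = id" "F (Suc n) = F n \<circ> f n" for n by (simp_all add: F_def)
  have FF: "continuous_on {0..1} (F n) \<and> inj_on (F n) {0..1}" for n
  proof (induction n)
    case (Suc n)
    then have "continuous_on (f n ` {0..1}) (F n)" "inj_on (F n) (f n ` {0..1})"
      using continuous_on_subset inj_on_subset im[of n] by blast+
    then show ?case
      unfolding F using comp_inj_on[OF inj[of n]] continuous_on_compose[OF c[of n]] by blast
  qed (simp add: F)
  have "\<Inter> (range (\<lambda>n. F n ` {0..1})) \<noteq> {}"
  proof (rule compact_nest)
    show "compact (F n ` {0..1})" for n using FF compact_continuous_image by blast
    fix m n :: nat assume "m \<le> n"
    then show "F n ` {0..1} \<subseteq> F m ` {0..1}"
    proof (induction n rule: dec_induct)
      case (step n)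
      have "F (Suc n) ` {0..1} = F n ` f n ` {0..1}" by (simp add: F image_comp)
      then show ?case using step.IH im[of n] by blast
    qed simp
  qed simp
  then obtain r where r: "\<And>n. r \<in> F n ` {0..1}" by blast
  define x where "x n = inv_into {0..1} (F n) r" for n
  have x: "x n \<in> {0..1}" "F n (x n) = r" for n
    using inv_into_into[OF r[of n]] f_inv_into_f[OF r[of n]] by (auto simp: x_def)
  have "x n = f n (x (Suc n))" for n
  proof (rule inj_onD[of "F n" "{0..1}"])
    show "f n (x (Suc n)) \<in> {0..1}" using im x(1)[of "Suc n"] by blast
    have "F (Suc n) (x (Suc n)) = r" by (rule x(2))
    then show "F n (x n) = F n (f n (x (Suc n)))" using x(2)[of n] by (simp add: F)
  qed (use FF x in auto)
  then show ?thesis using x(1) by blast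
qed

locale lorenz_system =
  fixes s q R :: real
  assumes s_pos: "s > 0" and q_pos: "q > 0" and R_gt_1: "R > 1"
begin

subsection \<open>The flow of the Lorenz system\<close>

abbreviation field :: "real ^ 3 \<Rightarrow> real ^ 3" where "field \<equiv> lorenz s q R"

definition W :: "real ^ 3 \<Rightarrow> real" where "W p = p $ 2 - p $ 1"
definition Z :: "real ^ 3 \<Rightarrow> real" where "Z p = p $ 3 - (R - 1)"

text \<open>The classical ellipsoid of the Lorenz system. Equal weights of \<open>y\<close> and
  \<open>z\<close> cancel the terms \<open>x * y * z\<close> of the derivative, and the centre
  \<open>2 * R\<close> cancels the terms \<open>x * y\<close>; what remains is a negative definite
  quadratic form and a term linear in \<open>z\<close>.\<close>

definition energy :: "real ^ 3 \<Rightarrow> real" where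
  "energy p = R * (p $ 1)\<^sup>2 + s * (p $ 2)\<^sup>2 + s * (p $ 3 - 2 * R)\<^sup>2"

text \<open>\<open>2 * s\<close> and \<open>2\<close> are the damping rates of the squares of
  \<open>x\<close> and \<open>y\<close>. For \<open>z\<close> only half of the rate
  \<open>2 * q\<close> is claimed; the other half absorbs the linear term.\<close>

definition decay :: real where "decay = min (2 * s) (min 2 q)"

text \<open>Above the first value the energy decreases. The second bounds the energy on the ball of
  radius \<open>norm (p0 q R) + 1\<close>, so that \<open>trap\<close> contains the neighbourhoods
  of the origin and of \<open>p0 q R\<close> in which orbits are studied.\<close>

definition level :: real where
  "level = max (8 * R\<^sup>2 * s * q / decay)
     ((R + s) * (norm (p0 q R) + 1)\<^sup>2 + s * (norm (p0 q R) + 1 + 2 * R)\<^sup>2)"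

definition trap :: "(real ^ 3) set" where "trap = {p. energy p \<le> level}"

text \<open>A crude bound for the coordinates on \<open>trap\<close>, obtained from
  \<open>\<bar>a\<bar> \<le> a\<^sup>2 + 1\<close> and the three squares in
  \<open>energy\<close>.\<close>

definition rho :: real where "rho = level / R + level / s + 2 * R + 2"

definition region :: "(real ^ 3) set" where "region = {p. \<forall>i. \<bar>p $ i\<bar> < rho}"

text \<open>The flow is that of the system clamped to the box \<open>region\<close>, which makes it Lipschitz and
  hence global in both time directions. It is the Lorenz flow as long as it stays in \<open>region\<close>, in
  particular on forward orbits from the invariant ellipsoid \<open>trap\<close>.\<close>

definition trunc :: "real ^ 3 \<Rightarrow> real ^ 3" where
  "trunc p = (\<chi> i. max (- rho) (min rho (p $ i)))"

definition rfl :: "real ^ 3 \<Rightarrow> real ^ 3" where "rfl p = vector [- p $ 1, - p $ 2, p $ 3]"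

lemma field_nth [simp]:
  "field p $ 1 = s * W p" "field p $ 2 = R * p $ 1 - p $ 2 - p $ 1 * p $ 3"
  "field p $ 3 = p $ 1 * p $ 2 - q * p $ 3"
  by (simp_all add: lorenz_def vector_3 W_def)

lemma rfl_nth [simp]: "rfl p $ 1 = - p $ 1" "rfl p $ 2 = - p $ 2" "rfl p $ 3 = p $ 3"
  by (simp_all add: rfl_def vector_3)

lemma vec3_eqI: "p $ 1 = r $ 1 \<Longrightarrow> p $ 2 = r $ 2 \<Longrightarrow> p $ 3 = r $ 3 \<Longrightarrow> p = r" for p r :: "real ^ 3"
  by (simp add: vec_eq_iff forall_3)

lemma W_rfl [simp]: "W (rfl p) = - W p" and Z_rfl [simp]: "Z (rfl p) = Z p"
  by (simp_all add: W_def Z_def)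

lemma rfl_rfl [simp]: "rfl (rfl p) = p"
  by (rule vec3_eqI) auto

lemma rfl_0 [simp]: "rfl 0 = 0"
  by (rule vec3_eqI) auto

lemma field_rfl: "field (rfl p) = rfl (field p)"
  by (rule vec3_eqI) (auto simp: W_def algebra_simps)

lemma decay: "decay > 0" "decay \<le> 2 * s" "decay \<le> 2" "decay \<le> q"
  using s_pos q_pos by (auto simp: decay_def)

lemma energy_derivative_bound:
  "2 * R * p $ 1 * (s * W p) + 2 * s * p $ 2 * (R * p $ 1 - p $ 2 - p $ 1 * p $ 3)
     + 2 * s * (p $ 3 - 2 * R) * (p $ 1 * p $ 2 - q * p $ 3)
   \<le> 8 * R\<^sup>2 * s * q - decay * energy p"
proof -
  define x y z k where "x = p $ 1" and "y = p $ 2" and "z = p $ 3" and "k = decay"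
  have k: "0 < k" "k \<le> 2 * s" "k \<le> 2" "k \<le> q" using decay by (auto simp: k_def)
  have 1: "R * x\<^sup>2 * (k - 2 * s) \<le> 0" "s * y\<^sup>2 * (k - 2) \<le> 0"
    using k s_pos R_gt_1 by (auto intro!: mult_nonneg_nonpos)
  have 2: "s * z\<^sup>2 * (k - q) \<le> 0"
    using k s_pos by (auto intro!: mult_nonneg_nonpos)
  have "(q - k)\<^sup>2 \<le> q\<^sup>2" using k by (intro power_mono) auto
  \<comment> \<open>The square is completed in \<open>z\<close> after multiplication by
    \<open>q\<close>, which is cancelled at the end.\<close>
  have 3: "- s * q * z\<^sup>2 + 4 * R * s * (q - k) * z \<le> 4 * R\<^sup>2 * s * q"
  proof -
    have "0 \<le> s * (q * z - 2 * R * (q - k))\<^sup>2" using s_pos by simp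
    then have "q * (- s * q * z\<^sup>2 + 4 * R * s * (q - k) * z) \<le> 4 * R\<^sup>2 * s * (q - k)\<^sup>2"
      by (simp add: power2_eq_square algebra_simps)
    also have "\<dots> \<le> 4 * R\<^sup>2 * s * q\<^sup>2"
      using \<open>(q - k)\<^sup>2 \<le> q\<^sup>2\<close> s_pos by (intro mult_left_mono) auto
    also have "\<dots> = q * (4 * R\<^sup>2 * s * q)" by (simp add: power2_eq_square)
    finally show ?thesis using q_pos by (simp only: mult_le_cancel_left_pos)
  qed
  have 4: "4 * s * R\<^sup>2 * k \<le> 4 * s * R\<^sup>2 * q"
    using k s_pos by (intro mult_left_mono) auto
  have "2 * R * x * (s * (y - x)) + 2 * s * y * (R * x - y - x * z) + 2 * s * (z - 2 * R) * (x * y - q * z)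
        + k * (R * x\<^sup>2 + s * y\<^sup>2 + s * (z - 2 * R)\<^sup>2)
      = R * x\<^sup>2 * (k - 2 * s) + s * y\<^sup>2 * (k - 2) + s * z\<^sup>2 * (k - q)
        + (- s * q * z\<^sup>2 + 4 * R * s * (q - k) * z) + 4 * s * R\<^sup>2 * k"
    by (simp add: power2_eq_square algebra_simps)
  with 1 2 3 4 show ?thesis
    unfolding energy_def W_def x_def[symmetric] y_def[symmetric] z_def[symmetric] k_def[symmetric]
    by (simp add: mult_ac)
qed

lemma level_pos: "level > 0"
proof -
  have "8 * R\<^sup>2 * s * q / decay > 0" using s_pos q_pos R_gt_1 decay by simp
  then show ?thesis by (simp add: level_def)
qed

lemma cball_subset_trap: "cball 0 (norm (p0 q R) + 1) \<subseteq> trap"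
proof
  fix p :: "real ^ 3" assume "p \<in> cball 0 (norm (p0 q R) + 1)"
  then have n: "norm p \<le> norm (p0 q R) + 1" by simp
  let ?N = "norm (p0 q R) + 1"
  have c: "\<bar>p $ i\<bar> \<le> ?N" for i using component_le_norm_cart[of p i] n by linarith
  have "(p $ 1)\<^sup>2 \<le> ?N\<^sup>2" "(p $ 2)\<^sup>2 \<le> ?N\<^sup>2"
    using c[of 1] c[of 2] by (auto simp: abs_le_square_iff[symmetric])
  moreover have "\<bar>p $ 3 - 2 * R\<bar> \<le> \<bar>?N + 2 * R\<bar>" using c[of 3] R_gt_1 by linarith
  then have "(p $ 3 - 2 * R)\<^sup>2 \<le> (?N + 2 * R)\<^sup>2" by (simp only: abs_le_square_iff)
  ultimately have "energy p \<le> R * ?N\<^sup>2 + s * ?N\<^sup>2 + s * (?N + 2 * R)\<^sup>2"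
    unfolding energy_def using s_pos R_gt_1 by (intro add_mono mult_left_mono) auto
  also have "\<dots> \<le> level" by (simp add: level_def algebra_simps)
  finally show "p \<in> trap" by (simp add: trap_def)
qed

lemma abs_le_square_plus_1: "\<bar>a\<bar> \<le> a\<^sup>2 + 1" for a :: real
proof -
  have "0 \<le> (\<bar>a\<bar> - 1/2)\<^sup>2" by simp
  then show ?thesis by (simp add: power2_eq_square algebra_simps)
qed

lemma trap_subset_region: "trap \<subseteq> region"
proof
  fix p assume "p \<in> trap"
  then have e: "R * (p $ 1)\<^sup>2 + s * (p $ 2)\<^sup>2 + s * (p $ 3 - 2 * R)\<^sup>2 \<le> level"
    by (simp add: trap_def energy_def)
  have nn: "0 \<le> R * (p $ 1)\<^sup>2" "0 \<le> s * (p $ 2)\<^sup>2" "0 \<le> s * (p $ 3 - 2 * R)\<^sup>2"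
    using s_pos R_gt_1 by auto
  have "R * (p $ 1)\<^sup>2 \<le> level" "s * (p $ 2)\<^sup>2 \<le> level" "s * (p $ 3 - 2 * R)\<^sup>2 \<le> level"
    using e nn by linarith+
  then have 1: "(p $ 1)\<^sup>2 \<le> level / R"
    and 2: "(p $ 2)\<^sup>2 \<le> level / s" "(p $ 3 - 2 * R)\<^sup>2 \<le> level / s"
    using s_pos R_gt_1 by (simp_all add: field_simps)
  have 3: "level / R > 0" "level / s > 0" using level_pos s_pos R_gt_1 by auto
  have "\<bar>p $ 1\<bar> < rho" "\<bar>p $ 2\<bar> < rho" "\<bar>p $ 3\<bar> < rho"
    using abs_le_square_plus_1[of "p $ 1"] abs_le_square_plus_1[of "p $ 2"]
      abs_le_square_plus_1[of "p $ 3 - 2 * R"] 1 2 3 R_gt_1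
    unfolding rho_def by linarith+
  then show "p \<in> region" by (simp add: region_def forall_3)
qed

lemma continuous_on_W [continuous_intros]: "continuous_on S f \<Longrightarrow> continuous_on S (\<lambda>t. W (f t))"
  and continuous_on_Z [continuous_intros]: "continuous_on S f \<Longrightarrow> continuous_on S (\<lambda>t. Z (f t))"
  unfolding W_def Z_def by (auto intro!: continuous_intros)

lemma tendsto_W [tendsto_intros]: "(f \<longlongrightarrow> l) F \<Longrightarrow> ((\<lambda>t. W (f t)) \<longlongrightarrow> W l) F"
  and tendsto_Z [tendsto_intros]: "(f \<longlongrightarrow> l) F \<Longrightarrow> ((\<lambda>t. Z (f t)) \<longlongrightarrow> Z l) F"
  unfolding W_def Z_def by (auto intro!: tendsto_intros)

lemma closed_trap: "closed trap"
  unfolding trap_def energy_def by (intro closed_Collect_le continuous_intros)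

lemma open_region: "open region"
proof -
  have "region = {p. \<bar>p $ 1\<bar> < rho} \<inter> {p. \<bar>p $ 2\<bar> < rho} \<inter> {p. \<bar>p $ 3\<bar> < rho}"
    by (auto simp: region_def forall_3)
  then show ?thesis by (auto intro!: open_Int open_Collect_less continuous_intros)
qed

lemma bounded_region: "bounded region"
proof -
  have "norm p \<le> 3 * rho" if "p \<in> region" for p
  proof -
    have "norm p \<le> (\<Sum>i\<in>UNIV. \<bar>p $ i\<bar>)" by (rule norm_le_l1_cart)
    also have "\<dots> \<le> (\<Sum>i\<in>(UNIV::3 set). rho)" using that by (intro sum_mono) (auto simp: region_def less_imp_le)
    finally show ?thesis by simp
  qed
  then show ?thesis by (auto simp: bounded_iff)
qed

lemma compact_trap: "compact trap"
  using closed_trap bounded_region trap_subset_region bounded_subset compact_eq_bounded_closed by blast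

lemma rho_pos: "rho > 0"
  using level_pos s_pos R_gt_1 by (simp add: rho_def add_pos_pos)

lemma trunc_region: "p \<in> region \<Longrightarrow> trunc p = p"
proof -
  assume p: "p \<in> region"
  have "max (- rho) (min rho (p $ i)) = p $ i" for i
  proof -
    have "\<bar>p $ i\<bar> < rho" using p by (auto simp: region_def)
    then show ?thesis by auto
  qed
  then show ?thesis by (simp add: trunc_def vec_eq_iff)
qed

lemma trunc_bound: "\<bar>trunc p $ i\<bar> \<le> rho"
  using rho_pos by (simp add: trunc_def)

lemma trunc_rfl: "trunc (rfl p) = rfl (trunc p)"
  using rho_pos by (intro vec3_eqI) (auto simp: trunc_def)

lemma norm_le_sum3: "norm p \<le> \<bar>p $ 1\<bar> + \<bar>p $ 2\<bar> + \<bar>p $ 3\<bar>" for p :: "real ^ 3"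
  using norm_le_l1_cart[of p] by (simp add: sum_3)

lemma prod_diff_bound:
  fixes a b c d :: real
  assumes "\<bar>a\<bar> \<le> r" "\<bar>d\<bar> \<le> r" "\<bar>a - c\<bar> \<le> n" "\<bar>b - d\<bar> \<le> n"
  shows "\<bar>a * b - c * d\<bar> \<le> 2 * r * n"
proof -
  have "a * b - c * d = a * (b - d) + d * (a - c)" by (simp add: algebra_simps)
  moreover have "\<bar>a * (b - d)\<bar> \<le> r * n" "\<bar>d * (a - c)\<bar> \<le> r * n"
    using assms by (auto simp: abs_mult intro!: mult_mono)
  ultimately show ?thesis by linarith
qed

definition lip :: real where "lip = 2 * s + (R + 1 + 2 * rho) + (2 * rho + q)"

lemma field_lipschitz:
  assumes "\<And>i. \<bar>p $ i\<bar> \<le> c" "\<And>i. \<bar>r $ i\<bar> \<le> c"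
  shows "norm (field p - field r) \<le> (2 * s + (R + 1 + 2 * c) + (2 * c + q)) * norm (p - r)"
proof -
  let ?n = "norm (p - r)"
  have d: "\<bar>p $ i - r $ i\<bar> \<le> ?n" for i using component_le_norm_cart[of "p - r" i] by simp
  have sc: "\<bar>k * (p $ i - r $ i)\<bar> \<le> k * ?n" if "k \<ge> 0" for k i
    using d[of i] that by (simp add: abs_mult mult_left_mono)
  have pr: "\<bar>p $ i * p $ j - r $ i * r $ j\<bar> \<le> 2 * c * ?n" for i j
    by (rule prod_diff_bound) (use d assms in auto)
  have "\<bar>s * (p $ 2 - p $ 1) - s * (r $ 2 - r $ 1)\<bar> \<le> 2 * s * ?n"
    using sc[of s 2] sc[of s 1] s_pos by (simp add: algebra_simps abs_le_iff)
  moreover have "\<bar>(R * p $ 1 - p $ 2 - p $ 1 * p $ 3) - (R * r $ 1 - r $ 2 - r $ 1 * r $ 3)\<bar>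
      \<le> (R + 1 + 2 * c) * ?n"
    using sc[of R 1] sc[of 1 2] pr[of 1 3] R_gt_1 by (simp add: algebra_simps abs_le_iff)
  moreover have "\<bar>(p $ 1 * p $ 2 - q * p $ 3) - (r $ 1 * r $ 2 - q * r $ 3)\<bar> \<le> (2 * c + q) * ?n"
    using sc[of q 3] pr[of 1 2] q_pos by (simp add: algebra_simps abs_le_iff)
  ultimately show ?thesis
    using norm_le_sum3[of "field p - field r"] by (simp add: distrib_right W_def)
qed

lemma truncated_lipschitz: "norm (field (trunc p) - field (trunc r)) \<le> lip * norm (p - r)"
proof -
  have "\<bar>trunc p $ i - trunc r $ i\<bar> \<le> \<bar>p $ i - r $ i\<bar>" for i
    using rho_pos by (auto simp: trunc_def)
  then have "norm (trunc p - trunc r) \<le> norm (p - r)"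
    by (intro norm_le_componentwise_cart) simp
  moreover have "lip \<ge> 0" using s_pos q_pos R_gt_1 rho_pos by (simp add: lip_def)
  ultimately have "lip * norm (trunc p - trunc r) \<le> lip * norm (p - r)" by (rule mult_left_mono)
  moreover have "norm (field (trunc p) - field (trunc r)) \<le> lip * norm (trunc p - trunc r)"
    unfolding lip_def by (rule field_lipschitz) (rule trunc_bound)+
  ultimately show ?thesis by linarith
qed

lemma lip_pos: "lip > 0"
  using s_pos q_pos R_gt_1 rho_pos by (simp add: lip_def add_pos_pos)

lemma truncated_bounded: "norm (field (trunc p)) \<le> lip * (3 * rho) + norm (field (trunc 0))"
proof -
  have t: "trunc (trunc p) = trunc p"
    by (simp add: trunc_def vec_eq_iff max_def min_def)
  have "norm (trunc p) \<le> 3 * rho"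
    using norm_le_sum3[of "trunc p"] trunc_bound[of p 1] trunc_bound[of p 2] trunc_bound[of p 3] by simp
  then have "norm (field (trunc (trunc p)) - field (trunc 0)) \<le> lip * (3 * rho)"
    using order_trans[OF truncated_lipschitz[of "trunc p" 0] mult_left_mono[of "norm (trunc p - 0)" "3 * rho" lip]]
      lip_pos by simp
  then show ?thesis using t norm_triangle_sub[of "field (trunc p)" "field (trunc 0)"] by simp
qed

definition flow :: "real \<Rightarrow> real ^ 3 \<Rightarrow> real ^ 3" where
  "flow = (SOME \<phi>. (\<forall>P. \<phi> 0 P = P) \<and>
           (\<forall>t P. ((\<lambda>t. \<phi> t P) has_vector_derivative field (trunc (\<phi> t P))) (at t)) \<and>
           (\<forall>t u P. \<phi> (t + u) P = \<phi> t (\<phi> u P)) \<and>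
           (\<forall>t P Q. dist (\<phi> t P) (\<phi> t Q) \<le> exp (lip * \<bar>t\<bar>) * dist P Q))"

lemma flow_spec: "(\<forall>P. flow 0 P = P) \<and>
           (\<forall>t P. ((\<lambda>t. flow t P) has_vector_derivative field (trunc (flow t P))) (at t)) \<and>
           (\<forall>t u P. flow (t + u) P = flow t (flow u P)) \<and>
           (\<forall>t P Q. dist (flow t P) (flow t Q) \<le> exp (lip * \<bar>t\<bar>) * dist P Q)"
  unfolding flow_def
  by (rule someI_ex[OF lipschitz_bounded_flow_exists[OF truncated_lipschitz lip_pos truncated_bounded]])

lemma flow_0 [simp]: "flow 0 P = P"
  and flow_has_vector_derivative: "((\<lambda>t. flow t P) has_vector_derivative field (trunc (flow t P))) (at t)"
  and flow_add: "flow (t + u) P = flow t (flow u P)"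
  and flow_dist: "dist (flow t P) (flow t Q) \<le> exp (lip * \<bar>t\<bar>) * dist P Q"
  using flow_spec by blast+

lemma flow_minus [simp]: "flow (- t) (flow t P) = P" "flow t (flow (- t) P) = P"
  using flow_add[of "- t" t P] flow_add[of t "- t" P] by simp_all

lemma tendsto_flow [tendsto_intros]:
  assumes "(f \<longlongrightarrow> t) F" "(g \<longlongrightarrow> P) F"
  shows "((\<lambda>n. flow (f n) (g n)) \<longlongrightarrow> flow t P) F"
proof -
  have "isCont (\<lambda>t. flow t P) t"
    by (rule has_vector_derivative_continuous[OF flow_has_vector_derivative])
  then have 1: "((\<lambda>n. flow (f n) P) \<longlongrightarrow> flow t P) F"
    using assms(1) by (rule isCont_tendsto_compose)
  have "((\<lambda>n. exp (lip * \<bar>f n\<bar>) * dist (g n) P) \<longlongrightarrow> exp (lip * \<bar>t\<bar>) * dist P P) F"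
    by (rule tendsto_mult[OF tendsto_exp[OF tendsto_mult[OF tendsto_const tendsto_rabs[OF assms(1)]]]
          tendsto_dist[OF assms(2) tendsto_const]])
  then have "((\<lambda>n. exp (lip * \<bar>f n\<bar>) * dist (g n) P) \<longlongrightarrow> 0) F"
    by (simp only: dist_self mult_zero_right)
  then have "((\<lambda>n. dist (flow (f n) (g n)) (flow (f n) P)) \<longlongrightarrow> 0) F"
    by (rule Lim_null_comparison[rotated]) (auto intro!: always_eventually flow_dist)
  from tendsto_add[OF this tendsto_dist[OF 1 tendsto_const[of "flow t P"]]]
  have "((\<lambda>n. dist (flow (f n) (g n)) (flow (f n) P) + dist (flow (f n) P) (flow t P)) \<longlongrightarrow> 0) F"
    by (simp only: dist_self add_0_left)
  then have "((\<lambda>n. dist (flow (f n) (g n)) (flow t P)) \<longlongrightarrow> 0) F"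
    by (rule Lim_null_comparison[rotated]) (auto intro!: always_eventually dist_triangle)
  then show ?thesis by (simp only: tendsto_dist_iff[symmetric])
qed

lemma continuous_on_flow [continuous_intros]:
  "continuous_on S f \<Longrightarrow> continuous_on S g \<Longrightarrow> continuous_on S (\<lambda>x. flow (f x) (g x))"
  unfolding continuous_on_def by (intro ballI tendsto_flow) blast+

lemma flow_component:
  "((\<lambda>t. flow t P $ i) has_real_derivative field (trunc (flow t P)) $ i) (at t)"
proof -
  have "((\<lambda>t. flow t P $ i) has_vector_derivative field (trunc (flow t P)) $ i) (at t)"
    using bounded_linear.has_vector_derivative[OF bounded_linear_vec_nth flow_has_vector_derivative] .
  then show ?thesis by (simp add: has_real_derivative_iff_has_vector_derivative)
qed

lemma
  assumes "flow t P \<in> region"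
  shows flow_x: "((\<lambda>t. flow t P $ 1) has_real_derivative s * W (flow t P)) (at t)"
    and flow_y: "((\<lambda>t. flow t P $ 2) has_real_derivative
          R * flow t P $ 1 - flow t P $ 2 - flow t P $ 1 * flow t P $ 3) (at t)"
    and flow_z: "((\<lambda>t. flow t P $ 3) has_real_derivative
          flow t P $ 1 * flow t P $ 2 - q * flow t P $ 3) (at t)"
    and flow_W: "((\<lambda>t. W (flow t P)) has_real_derivative
          - (s + 1) * W (flow t P) - flow t P $ 1 * Z (flow t P)) (at t)"
    and flow_Z: "((\<lambda>t. Z (flow t P)) has_real_derivative
          flow t P $ 1 * flow t P $ 2 - q * flow t P $ 3) (at t)"
proof -
  show 1: "((\<lambda>t. flow t P $ 1) has_real_derivative s * W (flow t P)) (at t)"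
    and 2: "((\<lambda>t. flow t P $ 2) has_real_derivative
          R * flow t P $ 1 - flow t P $ 2 - flow t P $ 1 * flow t P $ 3) (at t)"
    and 3: "((\<lambda>t. flow t P $ 3) has_real_derivative
          flow t P $ 1 * flow t P $ 2 - q * flow t P $ 3) (at t)"
    using flow_component[of P 1 t] flow_component[of P 2 t] flow_component[of P 3 t] assms
    by (simp_all add: trunc_region)
  show "((\<lambda>t. W (flow t P)) has_real_derivative
          - (s + 1) * W (flow t P) - flow t P $ 1 * Z (flow t P)) (at t)"
    unfolding W_def Z_def
    by (rule DERIV_cong[OF DERIV_diff[OF 2 1]]) (simp add: W_def algebra_simps)
  show "((\<lambda>t. Z (flow t P)) has_real_derivative
          flow t P $ 1 * flow t P $ 2 - q * flow t P $ 3) (at t)"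
    unfolding Z_def by (rule DERIV_cong[OF DERIV_diff[OF 3 DERIV_const]]) simp
qed

text \<open>The energy inequality holds only while the orbit is in \<open>region\<close>, where
  clamping is inactive; \<open>flow_trap\<close> removes this assumption by considering the first
  exit from \<open>region\<close>.\<close>

lemma energy_decreasing:
  assumes "\<And>u. 0 \<le> u \<Longrightarrow> u \<le> t \<Longrightarrow> flow u P \<in> region" "0 \<le> t" "P \<in> trap"
  shows "flow t P \<in> trap"
proof -
  define K where "K = 8 * R\<^sup>2 * s * q"
  define g where "g u = exp (decay * u) * (energy (flow u P) - K / decay)" for u
  have "g t \<le> g 0"
  proof (rule DERIV_nonpos_imp_nonincreasing[OF \<open>0 \<le> t\<close>])
    fix u assume u: "0 \<le> u" "u \<le> t"
    let ?p = "flow u P"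
    let ?e = "2 * R * ?p $ 1 * (s * W ?p) + 2 * s * ?p $ 2 * (R * ?p $ 1 - ?p $ 2 - ?p $ 1 * ?p $ 3)
     + 2 * s * (?p $ 3 - 2 * R) * (?p $ 1 * ?p $ 2 - q * ?p $ 3)"
    note D = flow_x[OF assms(1)[OF u]] flow_y[OF assms(1)[OF u]] flow_z[OF assms(1)[OF u]]
    have e: "((\<lambda>u. energy (flow u P)) has_real_derivative ?e) (at u)"
    proof -
      have sq: "((\<lambda>u. c * (f u)\<^sup>2) has_real_derivative 2 * c * f u * f') (at u)"
        if "(f has_real_derivative f') (at u)" for f f' c
        by (rule DERIV_cong[OF DERIV_cmult[OF DERIV_power[OF that]]]) simp
      show ?thesis
        unfolding energy_def
        by (rule DERIV_cong[OF DERIV_add[OF DERIV_add[OF sq[OF D(1)] sq[OF D(2)]]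
              sq[OF DERIV_diff[OF D(3) DERIV_const]]]]) simp
    qed
    have "((\<lambda>u. exp (decay * u)) has_real_derivative exp (decay * u) * decay) (at u)"
      by (rule DERIV_cong[OF DERIV_fun_exp[OF DERIV_cmult_Id]]) simp
    from DERIV_mult[OF this DERIV_diff[OF e DERIV_const[of "K / decay"]]]
    have "(g has_real_derivative exp (decay * u) * decay * (energy ?p - K / decay)
        + (?e - 0) * exp (decay * u)) (at u)"
      unfolding g_def .
    also have "exp (decay * u) * decay * (energy ?p - K / decay) + (?e - 0) * exp (decay * u)
        = exp (decay * u) * (?e + (decay * energy ?p - decay * (K / decay)))"
      by (simp only: algebra_simps diff_0_right)
    also have "decay * (K / decay) = K" using decay(1) by simp
    finally have "(g has_real_derivative exp (decay * u) * (?e + (decay * energy ?p - K))) (at u)" .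
    moreover have "exp (decay * u) * (?e + (decay * energy ?p - K)) \<le> 0"
      using energy_derivative_bound[of ?p] by (intro mult_nonneg_nonpos) (auto simp: K_def)
    ultimately show "\<exists>y. (g has_real_derivative y) (at u) \<and> y \<le> 0" by blast
  qed
  then have a: "exp (decay * t) * (energy (flow t P) - K / decay) \<le> energy P - K / decay"
    by (simp add: g_def)
  have b: "energy P \<le> level" "K / decay \<le> level" using \<open>P \<in> trap\<close> by (auto simp: trap_def level_def K_def)
  have "energy (flow t P) \<le> level"
  proof (rule ccontr)
    assume "\<not> energy (flow t P) \<le> level"
    then have c: "energy (flow t P) > level" by simp
    then have "1 * (energy (flow t P) - K / decay) \<le> exp (decay * t) * (energy (flow t P) - K / decay)"
      using b assms(2) decay(1) by (intro mult_right_mono) auto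
    then have "energy (flow t P) - K / decay \<le> energy P - K / decay" using a by simp
    then show False using b c by linarith
  qed
  then show ?thesis by (simp add: trap_def)
qed

lemma flow_trap:
  assumes "P \<in> trap" "t \<ge> 0"
  shows "flow t P \<in> trap"
proof (cases "\<forall>u. 0 \<le> u \<longrightarrow> u \<le> t \<longrightarrow> flow u P \<in> region")
  case True
  then show ?thesis using energy_decreasing assms by blast
next
  case False
  then obtain u where u: "0 \<le> u" "u \<le> t" "flow u P \<in> - region" by auto
  have "continuous_on {0..t} (\<lambda>t. flow t P)" by (intro continuous_intros)
  from first_time[OF this, of "- region" u] u open_region
  obtain v where v: "v \<in> {0..u}" "flow v P \<in> - region" "\<And>w. w \<in> {0..<v} \<Longrightarrow> flow w P \<notin> - region"
    by (auto simp: closed_def)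
  have "v \<noteq> 0" using v assms trap_subset_region by auto
  then have vp: "v > 0" using v by auto
  have "flow w P \<in> trap" if "w \<in> {0..<v}" for w
    using that v(3) assms by (intro energy_decreasing) auto
  \<comment> \<open>Before the first exit the orbit lies in the closed set \<open>trap\<close>,
    hence also at the exit time; but \<open>trap\<close> is contained in
    \<open>region\<close>.\<close>
  then have ev: "\<forall>\<^sub>F w in at_left v. flow w P \<in> trap"
    using vp by (intro eventually_at_leftI[of 0]) auto
  have "((\<lambda>w. flow w P) \<longlongrightarrow> flow v P) (at_left v)"
    by (intro tendsto_intros)
  then have "flow v P \<in> trap"
    using closed_trap ev by (intro Lim_in_closed_set[of trap "\<lambda>w. flow w P" "at_left v"]) auto
  then show ?thesis using v trap_subset_region by auto
qed

lemma flow_region: "P \<in> trap \<Longrightarrow> t \<ge> 0 \<Longrightarrow> flow t P \<in> region"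
  using flow_trap trap_subset_region by blast

lemma flow_unique:
  assumes "\<And>t. (p has_vector_derivative field (trunc (p t))) (at t)"
  shows "p t = flow t (p 0)"
proof -
  have "norm (p t - flow t (p 0)) \<le> exp (lip * \<bar>t - 0\<bar>) * norm (p 0 - flow 0 (p 0))"
    by (rule lipschitz_ode_dist[where p' = "\<lambda>t. field (trunc (p t))"
          and q' = "\<lambda>t. field (trunc (flow t (p 0)))"])
       (auto intro: assms flow_has_vector_derivative truncated_lipschitz)
  then show ?thesis by simp
qed

lemma bounded_linear_rfl: "bounded_linear rfl"
proof -
  have "linear rfl"
    by (intro linearI vec3_eqI) auto
  then show ?thesis by (rule linear_conv_bounded_linear[THEN iffD1])
qed

lemma tendsto_rfl [tendsto_intros]: "(f \<longlongrightarrow> l) F \<Longrightarrow> ((\<lambda>t. rfl (f t)) \<longlongrightarrow> rfl l) F"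
  by (rule bounded_linear.tendsto[OF bounded_linear_rfl])

lemma flow_rfl: "flow t (rfl P) = rfl (flow t P)"
proof -
  have "((\<lambda>t. rfl (flow t P)) has_vector_derivative field (trunc (rfl (flow t P)))) (at t)" for t
    using bounded_linear.has_vector_derivative[OF bounded_linear_rfl flow_has_vector_derivative[of P t]]
    by (simp add: trunc_rfl field_rfl)
  from flow_unique[OF this, of t] show ?thesis by simp
qed

lemma rfl_trap [simp]: "rfl P \<in> trap \<longleftrightarrow> P \<in> trap"
  by (simp add: trap_def energy_def)

lemma rfl_region [simp]: "rfl P \<in> region \<longleftrightarrow> P \<in> region"
  by (simp add: region_def forall_3)

lemma norm_rfl [simp]: "norm (rfl P) = norm P"
  by (simp add: norm_vec_def L2_set_def sum_3)

text \<open>Continuous dependence, uniform over a compact set of times. Every open condition on an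
  orbit is perturbed through this lemma: violating times for starting points tending to
  \<open>Q\<close> would accumulate at a violating time for \<open>Q\<close>.\<close>

lemma flow_tube:
  assumes "compact K" "open U" "\<And>t. t \<in> K \<Longrightarrow> flow t Q \<in> U"
  shows "\<forall>\<^sub>F C in nhds Q. \<forall>t\<in>K. flow t C \<in> U"
proof (rule ccontr)
  assume "\<not> ?thesis"
  from not_eventually_nhds_sequence[OF this]
  obtain C where CQ: "C \<longlonglongrightarrow> Q" and C: "\<And>n. \<exists>t\<in>K. flow t (C n) \<notin> U" by blast
  obtain t where t: "\<And>n. t n \<in> K" "\<And>n. flow (t n) (C n) \<notin> U" using C by metis
  obtain l r where l: "l \<in> K" "strict_mono (r :: nat \<Rightarrow> nat)" "(t \<circ> r) \<longlonglongrightarrow> l"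
    using assms(1) t(1) unfolding compact_def by blast
  have "(\<lambda>n. flow ((t \<circ> r) n) ((C \<circ> r) n)) \<longlonglongrightarrow> flow l Q"
    by (intro tendsto_intros l LIMSEQ_subseq_LIMSEQ CQ)
  moreover have "flow ((t \<circ> r) n) ((C \<circ> r) n) \<in> - U" for n using t(2) by simp
  ultimately have "flow l Q \<in> - U"
    using assms(2) by (intro Lim_in_closed_set[of "- U"]) (auto simp: closed_def)
  then show False using assms(3) l by auto
qed

section \<open>Equilibria, crossings and tangencies of the plane \<open>W = 0\<close>\<close>

text \<open>The only possible limit of an orbit in \<open>trap\<close> whose first coordinate tends
  to \<open>l\<close>. It is an equilibrium just for \<open>l = 0\<close> and for
  \<open>l\<^sup>2 = q * (R - 1)\<close>.\<close>

definition eq_at :: "real \<Rightarrow> real ^ 3" where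
  "eq_at l = (if l = 0 then 0 else vector [l, l, R - 1])"

text \<open>Chosen so that \<open>Z < 0\<close> on the ball about the origin. There
  \<open>- x * Z\<close> has the sign of \<open>x\<close>, which is what the quadrant arguments near
  the origin rest on.\<close>

definition d0 :: real where "d0 = min 1 ((R - 1) / 2)"

lemma d0: "d0 > 0" "d0 \<le> 1" "d0 < R - 1"
  using R_gt_1 by (auto simp: d0_def min_less_iff_disj)

lemma p0_nth [simp]: "p0 q R $ 1 = sqrt (q * (R - 1))" "p0 q R $ 2 = sqrt (q * (R - 1))"
  "p0 q R $ 3 = R - 1"
  by (simp_all add: p0_def vector_3)

lemma X0_pos: "q * (R - 1) > 0" using q_pos R_gt_1 by simp

lemma cball_0_trap: "cball 0 d0 \<subseteq> trap"
  by (rule order_trans[OF subset_cball cball_subset_trap]) (use d0 in \<open>simp add: add_increasing\<close>)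

lemma cball_p0_trap: "cball (p0 q R) 1 \<subseteq> trap"
proof
  fix p assume "p \<in> cball (p0 q R) 1"
  then have "norm p \<le> norm (p0 q R) + 1"
    using norm_triangle_sub[of p "p0 q R"] by (simp add: dist_norm norm_minus_commute)
  then show "p \<in> trap" using cball_subset_trap by auto
qed

lemma Z_neg_near_0: "p \<in> cball 0 d0 \<Longrightarrow> Z p < 0"
  using component_le_norm_cart[of p 3] d0 by (simp add: Z_def)

lemma flow_equilibrium:
  assumes "field e = 0" "e \<in> region"
  shows "flow t e = e"
proof -
  have "((\<lambda>_. e) has_vector_derivative field (trunc e)) (at t)" for t
    using assms by (simp add: trunc_region)
  from flow_unique[OF this, of t] show ?thesis by simp
qed

lemma flow_eq_equilibriumD:
  assumes "field (flow t P) = 0" "flow t P \<in> region"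
  shows "flow t P = P"
  using flow_equilibrium[OF assms, of "- t"] by simp

text \<open>The axis is the fixed set of the reflection \<open>rfl\<close>, with which the flow
  commutes.\<close>

lemma z_axis: "P $ 1 = 0 \<Longrightarrow> W P = 0 \<Longrightarrow> flow t P $ 1 = 0 \<and> W (flow t P) = 0"
proof -
  assume "P $ 1 = 0" "W P = 0"
  then have "rfl P = P" by (intro vec3_eqI) (auto simp: W_def)
  then have *: "rfl (flow t P) = flow t P" by (simp flip: flow_rfl)
  have "flow t P $ 1 = 0" "flow t P $ 2 = 0"
    using arg_cong[OF *, of "\<lambda>p. p $ 1"] arg_cong[OF *, of "\<lambda>p. p $ 2"] by simp_all
  then show ?thesis by (simp add: W_def)
qed

lemma z_axis_iff: "flow t P $ 1 = 0 \<and> W (flow t P) = 0 \<longleftrightarrow> P $ 1 = 0 \<and> W P = 0"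
  using z_axis[of P t] z_axis[of "flow t P" "- t"] by auto

lemma field_zero_iff:
  "field p = 0 \<longleftrightarrow> W p = 0 \<and> p $ 1 * Z p = 0 \<and> p $ 1 * p $ 2 = q * p $ 3"
proof -
  have "field p = 0 \<longleftrightarrow> s * W p = 0 \<and> R * p $ 1 - p $ 2 - p $ 1 * p $ 3 = 0 \<and> p $ 1 * p $ 2 - q * p $ 3 = 0"
    by (simp add: vec_eq_iff forall_3)
  moreover have "R * p $ 1 - p $ 2 - p $ 1 * p $ 3 = - W p - p $ 1 * Z p"
    by (simp add: W_def Z_def algebra_simps)
  ultimately show ?thesis using s_pos by auto
qed

lemma field_nonzero_x:
  assumes "field p \<noteq> 0" "W p = 0" "Z p = 0"
  shows "(p $ 1)\<^sup>2 \<noteq> q * (R - 1)"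
  using assms by (auto simp: field_zero_iff W_def Z_def power2_eq_square)

lemma field_p0: "field (p0 q R) = 0"
  using X0_pos by (simp add: field_zero_iff W_def Z_def)

lemma field_0: "field 0 = 0"
  by (simp add: field_zero_iff W_def)

lemma p0_trap: "p0 q R \<in> trap" and zero_trap: "0 \<in> trap"
  using cball_p0_trap cball_0_trap d0 by (auto simp: subset_iff)

lemma flow_region_near:
  assumes "flow t P \<in> region"
  obtains e where "e > 0" "\<And>u. \<bar>u - t\<bar> < e \<Longrightarrow> flow u P \<in> region"
proof -
  have "\<forall>\<^sub>F u in nhds t. flow u P \<in> region"
    by (rule topological_tendstoD[OF tendsto_flow[OF filterlim_ident tendsto_const] open_region assms])
  then show ?thesis using that by (auto simp: eventually_nhds_metric dist_real_def)
qed

text \<open>Where \<open>W = 0\<close>, the derivative of \<open>W\<close> is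
  \<open>- x * Z\<close>, so a zero with \<open>x * Z \<noteq> 0\<close> is transversal.\<close>

lemma W_crossing:
  assumes "flow t P \<in> region" "W (flow t P) = 0"
  shows "flow t P $ 1 * Z (flow t P) < 0 \<Longrightarrow>
           \<exists>e>0. \<forall>h. 0 < h \<and> h < e \<longrightarrow> W (flow (t - h) P) < 0 \<and> 0 < W (flow (t + h) P)"
    and "0 < flow t P $ 1 * Z (flow t P) \<Longrightarrow>
           \<exists>e>0. \<forall>h. 0 < h \<and> h < e \<longrightarrow> 0 < W (flow (t - h) P) \<and> W (flow (t + h) P) < 0"
  using pos_derivative_crossing[OF flow_W[OF assms(1)]] neg_derivative_crossing[OF flow_W[OF assms(1)]]
    assms(2) by auto

text \<open>The second derivative of \<open>W\<close> at a tangency: in the derivative of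
  \<open>- (s + 1) * W - x * Z\<close> all terms with a factor \<open>W\<close>, \<open>W'\<close>
  or \<open>Z\<close> vanish, and \<open>- x * Z'\<close> remains.\<close>

lemma flow_W':
  assumes "flow t P \<in> region" "W (flow t P) = 0" "Z (flow t P) = 0"
  shows "((\<lambda>t. - (s + 1) * W (flow t P) - flow t P $ 1 * Z (flow t P)) has_real_derivative
          - flow t P $ 1 * ((flow t P $ 1)\<^sup>2 - q * (R - 1))) (at t)"
proof -
  have y: "flow t P $ 2 = flow t P $ 1" and z: "flow t P $ 3 = R - 1"
    using assms by (auto simp: W_def Z_def)
  show ?thesis
    by (rule DERIV_cong[OF DERIV_diff[OF DERIV_cmult[OF flow_W[OF assms(1)]]
            DERIV_mult[OF flow_x[OF assms(1)] flow_Z[OF assms(1)]]]])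
       (simp only: assms(2,3) y z, simp add: power2_eq_square algebra_simps)
qed

text \<open>At a tangency that is not an equilibrium the second derivative is nonzero, so
  \<open>W\<close> has a strict local extremum of value 0 and the same sign on both sides.\<close>

lemma W_touching:
  assumes "flow t P \<in> region" "W (flow t P) = 0" "Z (flow t P) = 0"
  shows "0 < flow t P $ 1 * ((flow t P $ 1)\<^sup>2 - q * (R - 1)) \<Longrightarrow>
           \<exists>e>0. \<forall>h. 0 < h \<and> h < e \<longrightarrow> W (flow (t - h) P) < 0 \<and> W (flow (t + h) P) < 0"
    and "flow t P $ 1 * ((flow t P $ 1)\<^sup>2 - q * (R - 1)) < 0 \<Longrightarrow>
           \<exists>e>0. \<forall>h. 0 < h \<and> h < e \<longrightarrow> 0 < W (flow (t - h) P) \<and> 0 < W (flow (t + h) P)"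
proof -
  obtain e0 where e0: "e0 > 0" "\<And>u. \<bar>u - t\<bar> < e0 \<Longrightarrow> flow u P \<in> region"
    using flow_region_near[OF assms(1)] by blast
  show "0 < flow t P $ 1 * ((flow t P $ 1)\<^sup>2 - q * (R - 1)) \<Longrightarrow>
           \<exists>e>0. \<forall>h. 0 < h \<and> h < e \<longrightarrow> W (flow (t - h) P) < 0 \<and> W (flow (t + h) P) < 0"
    by (rule strict_local_max[OF flow_W[OF e0(2)] e0(1) flow_W'[OF assms]]) (use assms in auto)
  show "flow t P $ 1 * ((flow t P $ 1)\<^sup>2 - q * (R - 1)) < 0 \<Longrightarrow>
           \<exists>e>0. \<forall>h. 0 < h \<and> h < e \<longrightarrow> 0 < W (flow (t - h) P) \<and> 0 < W (flow (t + h) P)"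
    using strict_local_max[OF DERIV_minus[OF flow_W[OF e0(2)]] e0(1) DERIV_minus[OF flow_W'[OF assms]]]
      assms by auto
qed

text \<open>Translates the sign changes of the problem into a condition on single points of the
  orbit. If \<open>P\<close> is no equilibrium, neither is any point of its orbit inside
  \<open>region\<close>, so the second derivative test decides every tangency.\<close>

lemma changes_sign_at_W_iff:
  assumes "flow t P \<in> region" "flow t P $ 1 \<noteq> 0" "field P \<noteq> 0"
  shows "changes_sign_at (\<lambda>u. W (flow u P)) t \<longleftrightarrow> W (flow t P) = 0 \<and> Z (flow t P) \<noteq> 0"
proof
  assume "W (flow t P) = 0 \<and> Z (flow t P) \<noteq> 0"
  moreover from this have "flow t P $ 1 * Z (flow t P) < 0 \<or> 0 < flow t P $ 1 * Z (flow t P)"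
    using assms(2) by (auto simp: neq_iff[symmetric] simp del: mult_less_0_iff zero_less_mult_iff)
  ultimately show "changes_sign_at (\<lambda>u. W (flow u P)) t"
    unfolding changes_sign_at_iff_explicit using W_crossing[OF assms(1)] by blast
next
  assume cs: "changes_sign_at (\<lambda>u. W (flow u P)) t"
  obtain e \<sigma> where e: "e > 0" "\<And>h. 0 < h \<Longrightarrow> h < e \<Longrightarrow> W (flow (t - h) P) * W (flow (t + h) P) < 0"
    using cs unfolding changes_sign_at_iff_explicit by (auto simp: mult_less_0_iff)
  have no: False if "e' > 0" "\<And>h. 0 < h \<Longrightarrow> h < e' \<Longrightarrow> 0 < W (flow (t - h) P) * W (flow (t + h) P)" for e'
  proof -
    define m where "m = min e e' / 2"
    have "0 < m" "m < e" "m < e'" using e(1) that(1) by (auto simp: m_def min_def)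
    then show False using e(2)[of m] that(2)[of m] by simp
  qed
  have W0: "W (flow t P) = 0"
  proof (rule ccontr)
    assume n: "W (flow t P) \<noteq> 0"
    have lim: "((\<lambda>h. W (flow (t - h) P) * W (flow (t + h) P)) \<longlongrightarrow> W (flow (t - 0) P) * W (flow (t + 0) P)) (at_right 0)"
      by (intro tendsto_mult tendsto_W tendsto_flow tendsto_diff tendsto_add tendsto_const tendsto_ident_at)
    have "W (flow (t - 0) P) * W (flow (t + 0) P) > 0" using n by (auto simp: zero_less_mult_iff neq_iff)
    from order_tendstoD(1)[OF lim this]
    obtain b where "b > 0" "\<And>y. 0 < y \<Longrightarrow> y < b \<Longrightarrow> 0 < W (flow (t - y) P) * W (flow (t + y) P)"
      by (auto simp: eventually_at_right_field)
    then show False using no by blast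
  qed
  have "Z (flow t P) \<noteq> 0"
  proof
    assume Z0: "Z (flow t P) = 0"
    have "field (flow t P) \<noteq> 0"
      using flow_eq_equilibriumD[of t P] assms by auto
    then have "flow t P $ 1 * ((flow t P $ 1)\<^sup>2 - q * (R - 1)) \<noteq> 0"
      using field_nonzero_x W0 Z0 assms(2) by auto
    then consider "0 < flow t P $ 1 * ((flow t P $ 1)\<^sup>2 - q * (R - 1))"
      | "flow t P $ 1 * ((flow t P $ 1)\<^sup>2 - q * (R - 1)) < 0" by linarith
    then obtain e' where "e' > 0" "\<And>h. 0 < h \<Longrightarrow> h < e' \<Longrightarrow> 0 < W (flow (t - h) P) * W (flow (t + h) P)"
      using W_touching[OF assms(1) W0 Z0] by cases (fastforce intro: mult_neg_neg mult_pos_pos)+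
    then show False using no by blast
  qed
  with W0 show "W (flow t P) = 0 \<and> Z (flow t P) \<noteq> 0" by blast
qed

text \<open>On the axis \<open>z\<close> is a multiple of \<open>exp (- q * t)\<close>, which is
  bounded in backward time only if the multiple is 0.\<close>

lemma z_axis_backward_bounded:
  assumes "\<And>v. v \<le> 0 \<Longrightarrow> flow v P \<in> region" "P $ 1 = 0" "W P = 0"
  shows "P = 0"
proof -
  have ax: "flow v P $ 1 = 0" "W (flow v P) = 0" "flow v P $ 2 = 0" for v
    using z_axis[OF assms(2,3), of v] by (auto simp: W_def)
  have c: "exp (q * v) * flow v P $ 3 = P $ 3" if "v \<le> 0" for v
  proof -
    have D: "((\<lambda>v. exp (q * v) * flow v P $ 3) has_real_derivative 0) (at u)" if "u \<le> 0" for u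
    proof -
      have "((\<lambda>v. exp (q * v)) has_real_derivative exp (q * u) * q) (at u)"
        by (rule DERIV_cong[OF DERIV_fun_exp[OF DERIV_cmult_Id]]) simp
      from DERIV_mult[OF this flow_z[OF assms(1)[OF that]]] show ?thesis
        by (rule DERIV_cong) (simp add: ax algebra_simps)
    qed
    have "exp (q * v) * flow v P $ 3 \<le> exp (q * 0) * flow 0 P $ 3"
      using that by (rule DERIV_nonneg_imp_nondecreasing) (rule exI[of _ 0], auto intro: D)
    moreover have "exp (q * v) * flow v P $ 3 \<ge> exp (q * 0) * flow 0 P $ 3"
      using that by (rule DERIV_nonpos_imp_nonincreasing) (rule exI[of _ 0], auto intro: D)
    ultimately show ?thesis by simp
  qed
  have "P $ 3 = 0"
  proof (rule ccontr)
    assume n: "P $ 3 \<noteq> 0"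
    \<comment> \<open>So far back that \<open>exp (q * v) * rho\<close> is at most half of
      \<open>\<bar>P $ 3\<bar>\<close>.\<close>
    define v where "v = min 0 (ln (\<bar>P $ 3\<bar> / (2 * rho)) / q)"
    have "q * v \<le> ln (\<bar>P $ 3\<bar> / (2 * rho))"
      using q_pos by (simp add: v_def min_def field_simps)
    then have "exp (q * v) \<le> \<bar>P $ 3\<bar> / (2 * rho)"
      using n rho_pos by (subst ln_ge_iff[symmetric]) auto
    moreover have "\<bar>flow v P $ 3\<bar> < rho" using assms(1)[of v] by (auto simp: region_def v_def)
    ultimately have "exp (q * v) * \<bar>flow v P $ 3\<bar> \<le> (\<bar>P $ 3\<bar> / (2 * rho)) * rho"
      by (intro mult_mono) auto
    also have "\<dots> = \<bar>P $ 3\<bar> / 2" using rho_pos by simp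
    finally have "exp (q * v) * \<bar>flow v P $ 3\<bar> \<le> \<bar>P $ 3\<bar> / 2" .
    moreover have "exp (q * v) * \<bar>flow v P $ 3\<bar> = \<bar>P $ 3\<bar>"
    proof -
      have "v \<le> 0" by (simp add: v_def)
      from arg_cong[OF c[OF this], of abs] show ?thesis by (simp add: abs_mult)
    qed
    ultimately show False using n by simp
  qed
  then show ?thesis using assms(2,3) by (intro vec3_eqI) (auto simp: W_def)
qed

text \<open>A limit set argument in forward or backward time, according to \<sigma>. On the orbit of
  a limit point \<open>x\<close> is constantly \<open>l\<close>, so \<open>W\<close> vanishes, then
  \<open>l * Z\<close> vanishes; for \<open>l = 0\<close> the orbit lies on the axis, is bounded in
  the past and is therefore the origin.\<close>

lemma limit_equilibrium:
  assumes \<sigma>: "\<sigma> = 1 \<or> \<sigma> = - 1" and K: "compact K" "K \<subseteq> trap"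
    and inK: "\<And>u. u \<ge> u0 \<Longrightarrow> flow (\<sigma> * u) P \<in> K"
    and lim: "((\<lambda>u. flow (\<sigma> * u) P $ 1) \<longlongrightarrow> l) at_top"
  shows "((\<lambda>u. flow (\<sigma> * u) P) \<longlongrightarrow> eq_at l) at_top \<and> eq_at l \<in> K \<and> (l = 0 \<or> l\<^sup>2 = q * (R - 1))"
proof -
  have \<sigma>2: "\<sigma> * \<sigma> = 1" using \<sigma> by auto
  have key: "\<exists>r. strict_mono r \<and> (\<lambda>n. flow (\<sigma> * t (r n)) P) \<longlonglongrightarrow> eq_at l \<and> eq_at l \<in> K \<and>
      (l = 0 \<or> l\<^sup>2 = q * (R - 1))"
    if t: "filterlim t at_top sequentially" and tu: "\<And>n. t n \<ge> u0" for t :: "nat \<Rightarrow> real"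
  proof -
    have inKn: "\<forall>n. flow (\<sigma> * t n) P \<in> K" using inK tu by blast
    obtain P' r where P': "P' \<in> K" "strict_mono (r :: nat \<Rightarrow> nat)" "((\<lambda>n. flow (\<sigma> * t n) P) \<circ> r) \<longlonglongrightarrow> P'"
      by (rule seq_compactE[OF compact_imp_seq_compact[OF K(1)] inKn])
    have tr: "filterlim (\<lambda>n. t (r n)) at_top sequentially"
      using filterlim_compose[OF t filterlim_subseq[OF P'(2)]] .
    have F: "flow v P' \<in> K \<and> flow v P' $ 1 = l" for v
    proof -
      have eq: "flow v (flow (\<sigma> * t (r n)) P) = flow (\<sigma> * (\<sigma> * v + t (r n))) P" for n
        using \<sigma>2 by (simp add: distrib_left mult.assoc[symmetric] flip: flow_add)
      have lim1: "(\<lambda>n. flow v (((\<lambda>n. flow (\<sigma> * t n) P) \<circ> r) n)) \<longlonglongrightarrow> flow v P'"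
        by (rule tendsto_flow[OF tendsto_const P'(3)])
      then have lim2: "(\<lambda>n. flow (\<sigma> * (\<sigma> * v + t (r n))) P) \<longlonglongrightarrow> flow v P'"
        by (simp add: eq)
      have top: "filterlim (\<lambda>n. \<sigma> * v + t (r n)) at_top sequentially"
        by (rule filterlim_tendsto_add_at_top[OF tendsto_const tr])
      have "\<forall>\<^sub>F n in sequentially. flow (\<sigma> * (\<sigma> * v + t (r n))) P \<in> K"
        using filterlim_at_top[THEN iffD1, OF top, rule_format, of u0] by eventually_elim (rule inK)
      then have "flow v P' \<in> K"
        using lim2 compact_imp_closed[OF K(1)] by (intro Lim_in_closed_set[of K _ sequentially]) auto
      moreover have "(\<lambda>n. flow (\<sigma> * (\<sigma> * v + t (r n))) P $ 1) \<longlonglongrightarrow> l"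
        by (rule filterlim_compose[OF lim top])
      then have "flow v P' $ 1 = l"
        using LIMSEQ_unique tendsto_vec_nth[OF lim2] by blast
      ultimately show ?thesis by blast
    qed
    have reg: "flow v P' \<in> region" for v using F K(2) trap_subset_region by blast
    have W0: "W (flow v P') = 0" for v
      using DERIV_of_constant[OF flow_x[OF reg], of l] F s_pos by simp
    have lZ: "l * Z (flow v P') = 0" for v
      using DERIV_of_constant[OF flow_W[OF reg], of 0] W0 F by simp
    have "P' = eq_at l \<and> (l = 0 \<or> l\<^sup>2 = q * (R - 1))"
    proof (cases "l = 0")
      case True
      then have "P' = 0"
        using z_axis_backward_bounded[of P'] reg F[of 0] W0[of 0] by simp
      then show ?thesis using True by (simp add: eq_at_def)
    next
      case False
      then have Z0: "Z (flow v P') = 0" for v using lZ by simp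
      have "flow 0 P' $ 1 * flow 0 P' $ 2 - q * flow 0 P' $ 3 = 0"
        using DERIV_of_constant[OF flow_Z[OF reg], of 0] Z0 by blast
      moreover have p: "P' $ 1 = l" "P' $ 2 = l" "P' $ 3 = R - 1"
        using F[of 0] W0[of 0] Z0[of 0] by (auto simp: W_def Z_def)
      ultimately have "l\<^sup>2 = q * (R - 1)" by (simp add: power2_eq_square)
      then show ?thesis using False p by (auto simp: eq_at_def vector_3 intro: vec3_eqI)
    qed
    then show ?thesis using P' by (auto simp: o_def)
  qed
  have seq: "filterlim (\<lambda>n. max u0 (real n)) at_top sequentially"
    by (rule filterlim_at_top_mono[OF filterlim_real_sequentially]) auto
  have fin: "eq_at l \<in> K" "l = 0 \<or> l\<^sup>2 = q * (R - 1)"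
    using key[OF seq] by auto
  have "((\<lambda>u. flow (\<sigma> * u) P) \<longlongrightarrow> eq_at l) at_top"
  proof (rule ccontr)
    assume "\<not> ?thesis"
    then obtain e where e: "e > 0" "\<not> (\<forall>\<^sub>F u in at_top. dist (flow (\<sigma> * u) P) (eq_at l) < e)"
      by (auto simp: tendsto_iff)
    have "\<exists>u. u \<ge> max u0 (real n) \<and> dist (flow (\<sigma> * u) P) (eq_at l) \<ge> e" for n
      using e(2) unfolding eventually_at_top_linorder by (meson not_le)
    then obtain t where t: "\<And>n. t n \<ge> max u0 (real n)" "\<And>n. dist (flow (\<sigma> * t n) P) (eq_at l) \<ge> e"
      by metis
    have "filterlim t at_top sequentially"
      by (rule filterlim_at_top_mono[OF seq]) (use t in auto)
    then obtain r where "(\<lambda>n. flow (\<sigma> * t (r n)) P) \<longlonglongrightarrow> eq_at l" using key[of t] t(1) by auto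
    from tendstoD[OF this e(1)] have "\<forall>\<^sub>F n in sequentially. False"
      by eventually_elim (use t(2) in \<open>auto simp: not_less[symmetric]\<close>)
    then show False by simp
  qed
  then show ?thesis using fin by blast
qed

text \<open>The exit times from the ball tend to infinity because the orbit of \<open>A\<close>
  never leaves it. A limit \<open>b\<close> of the exit points therefore has its whole past in the
  closed ball. Near the origin such a \<open>b\<close> lies on the unstable manifold; near
  \<open>p0 q R\<close> its past forces oscillation.\<close>

lemma departure:
  fixes a :: "nat \<Rightarrow> real ^ 3"
  assumes "a \<longlonglongrightarrow> A" and stay: "\<And>t. t \<ge> 0 \<Longrightarrow> dist (flow t A) e < d"
    and leave: "\<And>n. \<exists>t\<ge>0. dist (flow t (a n)) e \<ge> d"
  obtains b r T where "strict_mono (r :: nat \<Rightarrow> nat)" "(\<lambda>n. flow (T n) (a (r n))) \<longlonglongrightarrow> b" "dist b e = d"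
    "\<And>t. t \<le> 0 \<Longrightarrow> dist (flow t b) e \<le> d" "filterlim T at_top sequentially" "\<And>n. T n \<ge> 0"
    "\<And>n t. 0 \<le> t \<Longrightarrow> t \<le> T n \<Longrightarrow> dist (flow t (a (r n))) e \<le> d"
proof -
  have "\<exists>t\<ge>0. dist (flow t (a n)) e \<ge> d \<and> (\<forall>v\<in>{0..<t}. dist (flow v (a n)) e < d)" for n
  proof -
    obtain t where t: "t \<ge> 0" "dist (flow t (a n)) e \<ge> d" using leave by blast
    have "continuous_on {0..t} (\<lambda>t. dist (flow t (a n)) e)"
      by (intro continuous_on_dist continuous_on_flow continuous_on_id continuous_on_const)
    from first_time[OF this closed_atLeast[of d], of t] t show ?thesis by force
  qed
  then obtain \<tau> where \<tau>: "\<And>n. \<tau> n \<ge> 0" "\<And>n. dist (flow (\<tau> n) (a n)) e \<ge> d"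
    "\<And>n v. 0 \<le> v \<Longrightarrow> v < \<tau> n \<Longrightarrow> dist (flow v (a n)) e < d"
    by (metis atLeastLessThan_iff)
  have top: "filterlim \<tau> at_top sequentially"
    unfolding filterlim_at_top
  proof
    fix B
    have "\<forall>\<^sub>F C in nhds A. \<forall>t\<in>{0..max 0 B}. flow t C \<in> ball e d"
      by (rule flow_tube) (use stay in \<open>auto simp: dist_commute\<close>)
    then have "\<forall>\<^sub>F n in sequentially. \<forall>t\<in>{0..max 0 B}. flow t (a n) \<in> ball e d"
      using assms(1) by (rule eventually_compose_filterlim)
    then show "\<forall>\<^sub>F n in sequentially. B \<le> \<tau> n"
    proof eventually_elim
      case (elim n)
      show ?case
      proof (rule ccontr)
        assume "\<not> B \<le> \<tau> n"
        then have "flow (\<tau> n) (a n) \<in> ball e d" using elim \<tau>(1)[of n] by auto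
        then show False using \<tau>(2)[of n] by (simp add: dist_commute)
      qed
    qed
  qed
  then obtain N where N: "\<And>n. n \<ge> N \<Longrightarrow> \<tau> n \<ge> 1"
    unfolding filterlim_at_top eventually_sequentially by metis
  have dist_eq: "dist (flow (\<tau> n) (a n)) e = d" if "n \<ge> N" for n
  proof (rule antisym)
    have "((\<lambda>v. dist (flow v (a n)) e) \<longlongrightarrow> dist (flow (\<tau> n) (a n)) e) (at_left (\<tau> n))"
      by (intro tendsto_dist tendsto_flow tendsto_ident_at tendsto_const)
    moreover have "\<forall>\<^sub>F v in at_left (\<tau> n). dist (flow v (a n)) e \<le> d"
      using N[OF that] \<tau>(3)[of _ n] by (intro eventually_at_leftI[of 0]) (auto intro: less_imp_le)
    ultimately show "dist (flow (\<tau> n) (a n)) e \<le> d"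
      by (rule tendsto_upperbound) simp
  qed (rule \<tau>(2))
  have sph: "\<forall>n. flow (\<tau> (n + N)) (a (n + N)) \<in> sphere e d"
    using dist_eq by (auto simp: dist_commute)
  obtain b r where b: "b \<in> sphere e d" "strict_mono (r :: nat \<Rightarrow> nat)"
    "((\<lambda>n. flow (\<tau> (n + N)) (a (n + N))) \<circ> r) \<longlonglongrightarrow> b"
    by (rule seq_compactE[OF compact_imp_seq_compact[OF compact_sphere] sph])
  define r' where "r' n = r n + N" for n
  define T where "T n = \<tau> (r' n)" for n
  have r': "strict_mono r'" using b(2) by (auto simp: r'_def strict_mono_def)
  have lim: "(\<lambda>n. flow (T n) (a (r' n))) \<longlonglongrightarrow> b" using b(3) by (simp add: o_def T_def r'_def)
  have Ttop: "filterlim T at_top sequentially"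
    unfolding T_def using filterlim_compose[OF top filterlim_subseq[OF r']] .
  have le: "dist (flow t (a (r' n))) e \<le> d" if "0 \<le> t" "t \<le> T n" for n t
    using \<tau>(3)[of t "r' n"] dist_eq[of "r' n"] that by (cases "t = T n") (auto simp: T_def r'_def)
  have bwd: "dist (flow t b) e \<le> d" if "t \<le> 0" for t
  proof -
    have "(\<lambda>n. dist (flow t (flow (T n) (a (r' n)))) e) \<longlonglongrightarrow> dist (flow t b) e"
      by (intro tendsto_dist tendsto_flow tendsto_const lim)
    moreover have "\<forall>\<^sub>F n in sequentially. dist (flow t (flow (T n) (a (r' n)))) e \<le> d"
      using filterlim_at_top[THEN iffD1, OF Ttop, rule_format, of "- t"]
    proof eventually_elim
      case (elim n)
      then show ?case using le[of "t + T n" n] that by (simp flip: flow_add)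
    qed
    ultimately show ?thesis by (rule tendsto_upperbound) (rule sequentially_bot)
  qed
  show ?thesis
    by (rule that[OF r' lim _ bwd Ttop _ le]) (use b \<tau> in \<open>auto simp: dist_commute T_def\<close>)
qed

lemma continuous_on_flow_t [continuous_intros]: "continuous_on S (\<lambda>t. flow t P)"
  by (intro continuous_on_flow continuous_on_id continuous_on_const)

lemma continuous_on_x: "continuous_on S (\<lambda>t. flow t P $ i)"
  by (intro continuous_on_component continuous_on_flow_t)

lemma continuous_on_Wf: "continuous_on S (\<lambda>t. W (flow t P))"
  by (intro continuous_on_W continuous_on_flow_t)

lemma open_sets:
  "open {p. W p < 0}" "open {p. W p > 0}" "open {p :: real ^ 3. p $ 1 > 0}" "open {p :: real ^ 3. p $ 1 < 0}"
  "open {p. Z p \<noteq> 0}" "open {p. W p \<noteq> 0}" "open {p. - (s + 1) * W p - p $ 1 * Z p \<noteq> 0}"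
  by (intro open_Collect_less open_Collect_neq continuous_intros)+

lemma x_mono:
  assumes "a \<le> b" "\<And>t. a \<le> t \<Longrightarrow> t \<le> b \<Longrightarrow> flow t P \<in> region" "\<And>t. a \<le> t \<Longrightarrow> t \<le> b \<Longrightarrow> W (flow t P) \<ge> 0"
  shows "flow a P $ 1 \<le> flow b P $ 1"
proof (rule DERIV_nonneg_imp_nondecreasing[OF assms(1)])
  fix t assume "a \<le> t" "t \<le> b"
  then show "\<exists>y. ((\<lambda>t. flow t P $ 1) has_real_derivative y) (at t) \<and> 0 \<le> y"
    using flow_x[OF assms(2)] assms(3) s_pos by (intro exI[of _ "s * W (flow t P)"]) auto
qed

lemma x_antimono:
  assumes "a \<le> b" "\<And>t. a \<le> t \<Longrightarrow> t \<le> b \<Longrightarrow> flow t P \<in> region" "\<And>t. a \<le> t \<Longrightarrow> t \<le> b \<Longrightarrow> W (flow t P) \<le> 0"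
  shows "flow b P $ 1 \<le> flow a P $ 1"
  using x_mono[of a b "rfl P"] assms by (simp add: flow_rfl)

text \<open>With this integrating factor \<open>W\<close> becomes monotone as long as
  \<open>x * Z\<close> keeps its sign.\<close>

lemma weighted_W:
  assumes "flow t P \<in> region"
  shows "((\<lambda>t. exp ((s + 1) * t) * W (flow t P)) has_real_derivative
    - (exp ((s + 1) * t) * (flow t P $ 1 * Z (flow t P)))) (at t)"
proof -
  have "((\<lambda>v. exp ((s + 1) * v)) has_real_derivative exp ((s + 1) * t) * (s + 1)) (at t)"
    by (rule DERIV_cong[OF DERIV_fun_exp[OF DERIV_cmult_Id]]) simp
  from DERIV_mult[OF this flow_W[OF assms]] show ?thesis
    by (rule DERIV_cong) (simp add: algebra_simps)
qed

lemma one_signed_limit: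
  assumes P: "P \<in> trap" and a: "a \<ge> 0"
    and sg: "(\<forall>t>a. W (flow t P) \<ge> 0) \<or> (\<forall>t>a. W (flow t P) \<le> 0)"
  shows "\<exists>l. ((\<lambda>t. flow t P $ 1) \<longlongrightarrow> l) at_top \<and> ((\<lambda>t. flow t P) \<longlongrightarrow> eq_at l) at_top \<and> (l = 0 \<or> l\<^sup>2 = q * (R - 1))"
proof -
  have bnd: "\<bar>flow t P $ 1\<bar> \<le> rho" if "t \<ge> 0" for t
    using flow_region[OF P that] by (auto simp: region_def intro: less_imp_le)
  have reg: "flow t P \<in> region" if "t \<ge> a + 1" for t using flow_region[OF P, of t] that a by simp
  have "\<exists>l. ((\<lambda>t. flow t P $ 1) \<longlongrightarrow> l) at_top"
    using sg
  proof
    assume s1: "\<forall>t>a. W (flow t P) \<ge> 0"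
    have "\<exists>l. ((\<lambda>t. flow t P $ 1) \<longlongrightarrow> l) at_top \<and> (\<forall>u\<ge>a + 1. flow u P $ 1 \<le> l)"
    proof (rule mono_bounded_tendsto_at_top)
      fix u v assume "a + 1 \<le> u" "u \<le> v"
      then show "flow u P $ 1 \<le> flow v P $ 1" using s1 reg by (intro x_mono) auto
    next
      fix u assume "a + 1 \<le> u"
      then show "flow u P $ 1 \<le> rho" using bnd[of u] a by simp
    qed
    then show ?thesis by blast
  next
    assume s1: "\<forall>t>a. W (flow t P) \<le> 0"
    have "\<exists>l. ((\<lambda>t. - flow t P $ 1) \<longlongrightarrow> l) at_top \<and> (\<forall>u\<ge>a + 1. - flow u P $ 1 \<le> l)"
    proof (rule mono_bounded_tendsto_at_top)
      fix u v assume uv: "a + 1 \<le> u" "u \<le> v"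
      have "flow v P $ 1 \<le> flow u P $ 1" using s1 reg uv by (intro x_antimono) auto
      then show "- flow u P $ 1 \<le> - flow v P $ 1" by simp
    next
      fix u assume "a + 1 \<le> u"
      then show "- flow u P $ 1 \<le> rho" using bnd[of u] a by simp
    qed
    then obtain l where "((\<lambda>t. - flow t P $ 1) \<longlongrightarrow> l) at_top" by blast
    from tendsto_minus[OF this] show ?thesis by auto
  qed
  then obtain l where l: "((\<lambda>t. flow t P $ 1) \<longlongrightarrow> l) at_top" by blast
  have "((\<lambda>u. flow (1 * u) P) \<longlongrightarrow> eq_at l) at_top \<and> eq_at l \<in> trap \<and> (l = 0 \<or> l\<^sup>2 = q * (R - 1))"
    by (rule limit_equilibrium[of 1 trap 0]) (use compact_trap flow_trap[OF P] l in auto)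
  then show ?thesis using l by auto
qed

lemma eq_at_p0:
  assumes "l > 0" "l\<^sup>2 = q * (R - 1)"
  shows "eq_at l = p0 q R"
proof -
  have "sqrt (q * (R - 1)) = l" using assms real_sqrt_unique[of l] by simp
  then show ?thesis using assms(1) by (simp add: eq_at_def p0_def)
qed

subsection \<open>Dynamics near the origin\<close>

lemma near_0_region: "p \<in> cball 0 d0 \<Longrightarrow> p \<in> region"
  using cball_0_trap trap_subset_region by blast

text \<open>Since \<open>Z < 0\<close>, the weighted \<open>W\<close> grows while
  \<open>x \<ge> 0\<close>, and \<open>x\<close> grows while \<open>W \<ge> 0\<close>. The two
  implications are closed into a loop at a hypothetical first zero of \<open>x\<close>: up to it
  \<open>W \<ge> 0\<close>, so \<open>x\<close> could not have decreased to 0.\<close>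

lemma quadrant_1:
  assumes near: "\<And>t. t \<in> {a..b} \<Longrightarrow> flow t P \<in> cball 0 d0"
    and "flow a P $ 1 > 0" "W (flow a P) \<ge> 0" and t: "t \<in> {a..b}"
  shows "flow t P $ 1 > 0 \<and> (a < t \<longrightarrow> W (flow t P) > 0)"
proof -
  have reg: "flow t P \<in> region" if "t \<in> {a..b}" for t using near[OF that] by (rule near_0_region)
  have Wnn: "W (flow v P) \<ge> 0" if v: "a \<le> v" "v \<le> b" and x: "\<And>u. a \<le> u \<Longrightarrow> u \<le> v \<Longrightarrow> flow u P $ 1 \<ge> 0" for v
  proof -
    have "exp ((s + 1) * a) * W (flow a P) \<le> exp ((s + 1) * v) * W (flow v P)"
    proof (rule DERIV_nonneg_imp_nondecreasing[OF v(1)])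
      fix u assume u: "a \<le> u" "u \<le> v"
      have "flow u P $ 1 * Z (flow u P) \<le> 0"
        using x[OF u] Z_neg_near_0[OF near[of u]] u v by (intro mult_nonneg_nonpos) auto
      then have "0 \<le> - (exp ((s + 1) * u) * (flow u P $ 1 * Z (flow u P)))"
        by (simp add: mult_nonneg_nonpos)
      then show "\<exists>y. ((\<lambda>t. exp ((s + 1) * t) * W (flow t P)) has_real_derivative y) (at u) \<and> 0 \<le> y"
        using weighted_W[OF reg[of u]] u v by auto
    qed
    moreover have "0 \<le> exp ((s + 1) * a) * W (flow a P)" using assms(3) by simp
    ultimately have "0 \<le> exp ((s + 1) * v) * W (flow v P)" by linarith
    then show ?thesis by (simp add: zero_le_mult_iff)
  qed
  have pos: "flow v P $ 1 > 0" if v: "v \<in> {a..b}" for v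
  proof (rule ccontr)
    assume "\<not> flow v P $ 1 > 0"
    then obtain u where u: "a < u" "u \<le> v" "flow u P $ 1 = 0" "\<forall>w\<in>{a..<u}. flow w P $ 1 > 0"
      using first_nonpos[OF continuous_on_x assms(2) v] by auto
    have nn: "flow w P $ 1 \<ge> 0" if "a \<le> w" "w \<le> u" for w
      using u that by (cases "w = u") (auto intro: less_imp_le)
    have "flow a P $ 1 \<le> flow u P $ 1"
      using u v by (intro x_mono reg Wnn nn) auto
    then show False using u assms(2) by simp
  qed
  have "W (flow t P) > 0" if "a < t"
  proof -
    have "exp ((s + 1) * a) * W (flow a P) < exp ((s + 1) * t) * W (flow t P)"
    proof (rule DERIV_pos_imp_increasing[OF that])
      fix u assume u: "a \<le> u" "u \<le> t"
      then have ub: "u \<in> {a..b}" using t by auto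
      have "flow u P $ 1 * Z (flow u P) < 0"
        using pos[OF ub] Z_neg_near_0[OF near[OF ub]] by (rule mult_pos_neg)
      then have "0 < - (exp ((s + 1) * u) * (flow u P $ 1 * Z (flow u P)))"
        by (simp add: mult_pos_neg)
      then show "\<exists>y. ((\<lambda>t. exp ((s + 1) * t) * W (flow t P)) has_real_derivative y) (at u) \<and> 0 < y"
        using weighted_W[OF reg[OF ub]] by blast
    qed
    moreover have "0 \<le> exp ((s + 1) * a) * W (flow a P)" using assms(3) by simp
    ultimately have "0 < exp ((s + 1) * t) * W (flow t P)" by linarith
    then show ?thesis by (simp add: zero_less_mult_iff)
  qed
  then show ?thesis using pos[OF t] by blast
qed

lemma x_zero_crossing:
  assumes "flow t P \<in> region" "flow t P $ 1 = 0"
  shows "W (flow t P) < 0 \<Longrightarrow> \<exists>e>0. \<forall>h. 0 < h \<and> h < e \<longrightarrow> 0 < flow (t - h) P $ 1 \<and> flow (t + h) P $ 1 < 0"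
    and "0 < W (flow t P) \<Longrightarrow> \<exists>e>0. \<forall>h. 0 < h \<and> h < e \<longrightarrow> flow (t - h) P $ 1 < 0 \<and> 0 < flow (t + h) P $ 1"
  using neg_derivative_crossing[OF flow_x[OF assms(1)]] pos_derivative_crossing[OF flow_x[OF assms(1)]]
    assms(2) s_pos by (auto simp: mult_pos_neg)

lemma W_near:
  assumes "open U" "flow t P \<in> U"
  shows "\<exists>e>0. \<forall>u. \<bar>u - t\<bar> < e \<longrightarrow> flow u P \<in> U"
proof -
  have "\<forall>\<^sub>F u in nhds t. flow u P \<in> U"
    by (rule topological_tendstoD[OF tendsto_flow[OF filterlim_ident tendsto_const] assms])
  then show ?thesis by (auto simp: eventually_nhds_metric dist_real_def)
qed

lemma quadrant_1_from_axis:
  assumes near: "\<And>t. t \<in> {a..b} \<Longrightarrow> flow t P \<in> cball 0 d0"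
    and "flow a P $ 1 = 0" "W (flow a P) > 0" and t: "a < t" "t \<le> b"
  shows "flow t P $ 1 > 0 \<and> W (flow t P) > 0"
proof -
  have "flow a P \<in> region" using near[of a] t by (intro near_0_region) auto
  then obtain e where e: "e > 0" "\<And>h. 0 < h \<Longrightarrow> h < e \<Longrightarrow> 0 < flow (a + h) P $ 1"
    using x_zero_crossing(2) assms(2,3) by blast
  obtain e' where e': "e' > 0" "\<And>u. \<bar>u - a\<bar> < e' \<Longrightarrow> W (flow u P) > 0"
    using W_near[OF open_sets(2), of a P] assms(3) by auto
  define h where "h = min (min e e') (t - a) / 2"
  have h: "0 < h" "h < e" "h < e'" "a + h < t" using e e' t by (auto simp: h_def min_def field_simps)
  show ?thesis
    using quadrant_1[of "a + h" b P t] near e(2)[of h] e'(2)[of "a + h"] h t by auto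
qed

text \<open>Going backward, the quadrant cannot be left through \<open>W = 0\<close>, because the
  forward orbit from such a point would have entered \<open>W > 0\<close> for good.\<close>

lemma quadrant_4_backward:
  assumes near: "\<And>t. t \<in> {a..b} \<Longrightarrow> flow t P \<in> cball 0 d0"
    and "flow b P $ 1 > 0" "W (flow b P) < 0" and t: "t \<in> {a..b}"
  shows "flow b P $ 1 \<le> flow t P $ 1 \<and> W (flow t P) < 0"
proof -
  have reg: "flow t P \<in> region" if "t \<in> {a..b}" for t using near[OF that] by (rule near_0_region)
  have neg: "W (flow t P) < 0" if tab: "t \<in> {a..b}" for t
  proof (rule ccontr)
    assume "\<not> W (flow t P) < 0"
    then obtain u where u: "t \<le> u" "u < b" "W (flow u P) = 0" "\<forall>v\<in>{u<..b}. W (flow v P) < 0"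
      using last_nonneg[OF continuous_on_Wf assms(3) tab] by auto
    have "W (flow v P) \<le> 0" if "u \<le> v" "v \<le> b" for v
      using u that by (cases "v = u") (auto intro: less_imp_le)
    then have "flow b P $ 1 \<le> flow u P $ 1"
      using u tab by (intro x_antimono reg) auto
    then have "W (flow b P) > 0"
      using quadrant_1[of u b P b] near u tab assms(2) by auto
    then show False using assms(3) by simp
  qed
  have "flow b P $ 1 \<le> flow t P $ 1"
    using t by (intro x_antimono reg less_imp_le[OF neg]) auto
  then show ?thesis using neg t by blast
qed

text \<open>The saddle behaviour at the origin. The orbit leaves the quadrant at most once, through
  one of its two sides, into a quadrant that keeps it while it is near the origin. It cannot leave
  through both sides at once, since the axis \<open>x = W = 0\<close> is invariant.\<close>

lemma passage_near_0:
  assumes near: "\<And>t. t \<in> {a..b} \<Longrightarrow> flow t P \<in> cball 0 d0" and ab: "a \<le> b"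
    and "flow a P $ 1 > 0" "W (flow a P) < 0"
  shows "(\<forall>t\<in>{a..b}. flow t P $ 1 > 0 \<and> W (flow t P) < 0) \<or>
     (\<exists>u. a < u \<and> u \<le> b \<and> flow u P $ 1 = 0 \<and> (\<forall>t\<in>{a..<u}. flow t P $ 1 > 0) \<and>
        (\<forall>t\<in>{a..b}. W (flow t P) < 0) \<and> (\<forall>t\<in>{u<..b}. flow t P $ 1 < 0)) \<or>
     (\<exists>u. a < u \<and> u \<le> b \<and> W (flow u P) = 0 \<and> (\<forall>t\<in>{a..<u}. W (flow t P) < 0) \<and>
        (\<forall>t\<in>{a..b}. flow t P $ 1 > 0) \<and> (\<forall>t\<in>{u<..b}. W (flow t P) > 0))"
proof (cases "\<forall>t\<in>{a..b}. flow t P $ 1 > 0 \<and> W (flow t P) < 0")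
  case False
  define f where "f t = min (flow t P $ 1) (- W (flow t P))" for t
  have "continuous_on {a..b} f"
    unfolding f_def by (intro continuous_on_min continuous_on_x continuous_on_minus continuous_on_Wf)
  moreover obtain t where "t \<in> {a..b}" "f t \<le> 0" using False by (auto simp: f_def min_le_iff_disj not_less)
  moreover have "f a > 0" using assms by (simp add: f_def)
  ultimately obtain u where u: "a < u" "u \<le> t" "f u = 0" "\<forall>v\<in>{a..<u}. f v > 0" and tb: "t \<in> {a..b}"
    using first_nonpos[of a b f t] by blast
  have ub: "u \<le> b" using u tb by auto
  have bef: "flow v P $ 1 > 0" "W (flow v P) < 0" if "v \<in> {a..<u}" for v
    using u(4) that by (auto simp: f_def)
  have na: "\<not> (flow u P $ 1 = 0 \<and> W (flow u P) = 0)"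
    using z_axis_iff[of u P] z_axis_iff[of a P] assms(3) by auto
  have at: "flow u P $ 1 \<ge> 0" "W (flow u P) \<le> 0" "flow u P $ 1 = 0 \<or> W (flow u P) = 0"
    using u(3) by (auto simp: f_def min_def split: if_splits)
  show ?thesis
  proof (cases "W (flow u P) = 0")
    case True
    then have xu: "flow u P $ 1 > 0" using at na by auto
    have aft: "flow v P $ 1 > 0 \<and> (u < v \<longrightarrow> W (flow v P) > 0)" if "v \<in> {u..b}" for v
      using quadrant_1[of u b P v] near xu True that u by auto
    have "\<forall>t\<in>{a..b}. flow t P $ 1 > 0"
    proof
      fix v assume "v \<in> {a..b}"
      then show "flow v P $ 1 > 0" using bef(1)[of v] aft[of v] by (cases "v < u") auto
    qed
    moreover have "\<forall>t\<in>{u<..b}. W (flow t P) > 0" using aft by auto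
    ultimately show ?thesis using u ub True bef by (intro disjI2 exI[of _ u]) auto
  next
    case False
    then have Wu: "W (flow u P) < 0" and xu: "flow u P $ 1 = 0" using at by auto
    have aft: "flow v P $ 1 < 0 \<and> W (flow v P) < 0" if "u < v" "v \<le> b" for v
      using quadrant_1_from_axis[of u b "rfl P" v] near xu Wu that u by (auto simp: flow_rfl)
    have "\<forall>t\<in>{a..b}. W (flow t P) < 0"
    proof
      fix v assume "v \<in> {a..b}"
      then consider "v < u" | "v = u" | "v > u" by linarith
      then show "W (flow v P) < 0" using bef(2)[of v] aft[of v] Wu \<open>v \<in> {a..b}\<close> by cases auto
    qed
    moreover have "\<forall>t\<in>{u<..b}. flow t P $ 1 < 0" using aft by auto
    ultimately show ?thesis using u ub xu bef by (intro disjI2 disjI1 exI[of _ u]) auto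
  qed
qed blast

lemma eq_at_near_0: "eq_at l \<in> cball 0 d0 \<Longrightarrow> l = 0"
  using component_le_norm_cart[of "eq_at l" 3] d0 by (auto simp: eq_at_def vector_3 split: if_splits)

text \<open>Otherwise \<open>x\<close> would grow in backward time from a positive value and
  converge; but the limit is an equilibrium in the ball, hence has \<open>x = 0\<close>.\<close>

lemma no_backward_quadrant_4:
  assumes near: "\<And>t. t \<le> 0 \<Longrightarrow> flow t b \<in> cball 0 d0" and t: "t \<le> 0" "flow t b $ 1 > 0"
  shows "W (flow t b) \<ge> 0"
proof (rule ccontr)
  assume n: "\<not> W (flow t b) \<ge> 0"
  have q4: "flow t b $ 1 \<le> flow v b $ 1 \<and> W (flow v b) < 0" if "v \<le> t" for v
    using quadrant_4_backward[of v t b v] near t n that by auto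
  have reg: "flow v b \<in> region" if "v \<le> 0" for v using near[OF that] by (rule near_0_region)
  have "\<exists>l. ((\<lambda>u. flow (- 1 * u) b $ 1) \<longlongrightarrow> l) at_top \<and> (\<forall>u\<ge>- t. flow (- 1 * u) b $ 1 \<le> l)"
  proof (rule mono_bounded_tendsto_at_top)
    fix u v assume "- t \<le> u" "u \<le> v"
    then show "flow (- 1 * u) b $ 1 \<le> flow (- 1 * v) b $ 1"
      using t by (intro x_antimono reg less_imp_le[OF conjunct2[OF q4]]) auto
  next
    fix u assume "- t \<le> u"
    then have "flow (- u) b \<in> cball 0 d0" using t by (intro near) auto
    then show "flow (- 1 * u) b $ 1 \<le> d0" using component_le_norm_cart[of "flow (- u) b" 1] by simp
  qed
  then obtain l where l: "((\<lambda>u. flow (- 1 * u) b $ 1) \<longlongrightarrow> l) at_top" "\<And>u. u \<ge> - t \<Longrightarrow> flow (- 1 * u) b $ 1 \<le> l"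
    by blast
  have "eq_at l \<in> cball 0 d0"
    using limit_equilibrium[of "- 1" "cball 0 d0" 0 b l] l(1) near cball_0_trap by auto
  then have "l = 0" by (rule eq_at_near_0)
  then show False using l(2)[of "- t"] t by simp
qed

text \<open>The quadrants with \<open>x * W < 0\<close> are excluded by the preceding lemma, and
  points on their boundaries because the orbit would have been inside such a quadrant an instant
  earlier. What is left are the two branches of the unstable manifold.\<close>

lemma backward_near_0:
  assumes near: "\<And>t. t \<le> 0 \<Longrightarrow> flow t b \<in> cball 0 d0" and "b \<noteq> 0"
  shows "(\<forall>t\<le>0. flow t b $ 1 > 0 \<and> W (flow t b) > 0) \<or> (\<forall>t\<le>0. flow t b $ 1 < 0 \<and> W (flow t b) < 0)"
proof -
  have reg: "flow v b \<in> region" if "v \<le> 0" for v using near[OF that] by (rule near_0_region)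
  have nearr: "flow t (rfl b) \<in> cball 0 d0" if "t \<le> 0" for t using near[OF that] by (simp add: flow_rfl)
  have A: "W (flow t P) > 0"
    if P: "\<And>t. t \<le> 0 \<Longrightarrow> flow t P \<in> cball 0 d0" and t: "t \<le> 0" "flow t P $ 1 > 0" for P t
  proof (rule ccontr)
    assume "\<not> W (flow t P) > 0"
    then have W0: "W (flow t P) = 0" using no_backward_quadrant_4[OF P t] by simp
    have r: "flow t P \<in> region" using P[OF t(1)] by (rule near_0_region)
    have "flow t P $ 1 * Z (flow t P) < 0" using t(2) Z_neg_near_0[OF P[OF t(1)]] by (rule mult_pos_neg)
    then obtain e where e: "e > 0" "\<And>h. 0 < h \<Longrightarrow> h < e \<Longrightarrow> W (flow (t - h) P) < 0"
      using W_crossing(1)[OF r W0] by blast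
    obtain e' where e': "e' > 0" "\<And>u. \<bar>u - t\<bar> < e' \<Longrightarrow> flow u P $ 1 > 0"
      using W_near[OF open_sets(3), of t P] t by auto
    define h where "h = min e e' / 2"
    have h: "0 < h" "h < e" "h < e'" using e e' by (auto simp: h_def min_def)
    show False using no_backward_quadrant_4[OF P, of "t - h"] e(2)[of h] e'(2)[of "t - h"] h t by auto
  qed
  have B: False if P: "\<And>t. t \<le> 0 \<Longrightarrow> flow t P \<in> cball 0 d0" and t: "t \<le> 0" "flow t P $ 1 = 0" "W (flow t P) < 0" for P t
  proof -
    have r: "flow t P \<in> region" using P[OF t(1)] by (rule near_0_region)
    obtain e where e: "e > 0" "\<And>h. 0 < h \<Longrightarrow> h < e \<Longrightarrow> flow (t - h) P $ 1 > 0"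
      using x_zero_crossing(1)[OF r] t by blast
    obtain e' where e': "e' > 0" "\<And>u. \<bar>u - t\<bar> < e' \<Longrightarrow> W (flow u P) < 0"
      using W_near[OF open_sets(1), of t P] t by auto
    define h where "h = min e e' / 2"
    have h: "0 < h" "h < e" "h < e'" using e e' by (auto simp: h_def min_def)
    show False using A[OF P, of "t - h"] e(2)[of h] e'(2)[of "t - h"] h t by auto
  qed
  have x0: "flow t b $ 1 \<noteq> 0" if "t \<le> 0" for t
  proof
    assume x: "flow t b $ 1 = 0"
    have "W (flow t b) \<noteq> 0"
    proof
      assume "W (flow t b) = 0"
      then have "b $ 1 = 0" "W b = 0" using x z_axis_iff[of t b] by auto
      then show False using z_axis_backward_bounded[of b] reg \<open>b \<noteq> 0\<close> by blast
    qed
    then show False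
      using B[OF near that x] B[OF nearr that] x by (auto simp: flow_rfl neq_iff)
  qed
  have same: "flow t b $ 1 > 0 \<longleftrightarrow> b $ 1 > 0" if "t \<le> 0" for t
  proof (rule ccontr)
    assume n: "\<not> ?thesis"
    have c: "continuous_on {t..0} (\<lambda>t. flow t b $ 1)" by (rule continuous_on_x)
    have "\<exists>u\<ge>t. u \<le> 0 \<and> flow u b $ 1 = 0"
      using n IVT'[OF _ _ that c, of 0] IVT2'[OF _ _ that c, of 0] by (auto simp: not_less)
    then show False using x0 by blast
  qed
  show ?thesis
  proof (cases "b $ 1 > 0")
    case True
    then show ?thesis using same A[OF near] by blast
  next
    case False
    then have neg: "flow t b $ 1 < 0" if "t \<le> 0" for t using same[OF that] x0[OF that] by auto
    have "W (flow t b) < 0" if "t \<le> 0" for t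
      using A[OF nearr that] neg[OF that] by (simp add: flow_rfl)
    then show ?thesis using neg by blast
  qed
qed

text \<open>A point of \<open>unst\<close> lies on the branch of the unstable manifold; uniqueness of that branch is
  never needed.\<close>

definition unst :: "real ^ 3 \<Rightarrow> bool" where
  "unst b \<longleftrightarrow> (\<forall>t\<le>0. flow t b \<in> cball 0 d0 \<and> flow t b $ 1 > 0 \<and> W (flow t b) > 0)"

lemma unst_trap: "unst b \<Longrightarrow> b \<in> trap"
  using cball_0_trap by (auto simp: unst_def dest!: spec[of _ 0])

lemma unst_region: "unst b \<Longrightarrow> flow t b \<in> region"
  using flow_region[OF unst_trap] near_0_region by (cases "t \<le> 0") (auto simp: unst_def)

lemma unst_tendsto:
  assumes "unst b"
  shows "((\<lambda>t. flow t b) \<longlongrightarrow> 0) at_bot"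
proof -
  have "\<exists>l. ((\<lambda>u. - (flow (- 1 * u) b $ 1)) \<longlongrightarrow> l) at_top \<and> (\<forall>u\<ge>0. - (flow (- 1 * u) b $ 1) \<le> l)"
  proof (rule mono_bounded_tendsto_at_top[where B = 0])
    fix u v :: real assume "0 \<le> u" "u \<le> v"
    then show "- (flow (- 1 * u) b $ 1) \<le> - (flow (- 1 * v) b $ 1)"
      using x_mono[of "- v" "- u" b] assms unst_region[OF assms] by (auto simp: unst_def less_imp_le)
  qed (use assms in \<open>auto simp: unst_def less_imp_le\<close>)
  then obtain l where "((\<lambda>u. - (flow (- 1 * u) b $ 1)) \<longlongrightarrow> l) at_top" by blast
  from tendsto_minus[OF this] have l: "((\<lambda>u. flow (- 1 * u) b $ 1) \<longlongrightarrow> - l) at_top" by simp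
  have "((\<lambda>u. flow (- 1 * u) b) \<longlongrightarrow> eq_at (- l)) at_top \<and> eq_at (- l) \<in> cball 0 d0"
    using limit_equilibrium[of "- 1" "cball 0 d0" 0 b "- l"] l cball_0_trap assms by (auto simp: unst_def)
  moreover from this have "- l = 0" using eq_at_near_0 by blast
  ultimately have "((\<lambda>u. flow (- u) b) \<longlongrightarrow> 0) at_top" by (simp add: eq_at_def)
  then show ?thesis by (simp add: filterlim_at_bot_mirror)
qed

lemma no_forward_stay:
  assumes near: "\<And>t. t \<ge> 0 \<Longrightarrow> flow t P \<in> cball 0 d0" and P: "P $ 1 > 0" "W P \<ge> 0"
  shows False
proof -
  have q1: "flow t P $ 1 > 0 \<and> W (flow t P) \<ge> 0" if "t \<ge> 0" for t
    using quadrant_1[of 0 t P t] near P that by (cases "t = 0") (auto intro: less_imp_le)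
  have "\<exists>l. ((\<lambda>u. flow (1 * u) P $ 1) \<longlongrightarrow> l) at_top \<and> (\<forall>u\<ge>0. flow (1 * u) P $ 1 \<le> l)"
  proof (rule mono_bounded_tendsto_at_top)
    fix u v :: real assume "0 \<le> u" "u \<le> v"
    then show "flow (1 * u) P $ 1 \<le> flow (1 * v) P $ 1"
      using q1 near by (simp add: x_mono near_0_region)
  next
    fix u :: real assume "0 \<le> u"
    then show "flow (1 * u) P $ 1 \<le> d0"
      using near[of u] component_le_norm_cart[of "flow u P" 1] by simp
  qed
  then obtain l where l: "((\<lambda>u. flow (1 * u) P $ 1) \<longlongrightarrow> l) at_top" "\<And>u. u \<ge> 0 \<Longrightarrow> flow (1 * u) P $ 1 \<le> l"
    by blast
  have "eq_at l \<in> cball 0 d0"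
    using limit_equilibrium[of 1 "cball 0 d0" 0 P l] l(1) near cball_0_trap by auto
  then have "l = 0" by (rule eq_at_near_0)
  then show False using l(2)[of 0] P by simp
qed

text \<open>Leaving the quadrant means entering one in which \<open>\<bar>x\<bar>\<close> grows, and
  an orbit there cannot remain near the origin.\<close>

lemma stay_near_0:
  assumes near: "\<And>t. t \<ge> b \<Longrightarrow> flow t P \<in> cball 0 d0" and P: "flow b P $ 1 > 0" "W (flow b P) < 0"
  shows "(\<forall>t\<ge>b. flow t P $ 1 > 0 \<and> W (flow t P) < 0) \<and> ((\<lambda>t. flow t P) \<longlongrightarrow> 0) at_top"
proof -
  have sg: "flow t P $ 1 > 0 \<and> W (flow t P) < 0" if t: "t \<ge> b" for t
  proof (rule ccontr)
    assume n: "\<not> ?thesis"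
    \<comment> \<open>The orbit is inspected at \<open>t + 1\<close>, strictly after a possible exit
      time, where both signs are strict.\<close>
    have nr: "flow u P \<in> cball 0 d0" if "u \<in> {b..t + 1}" for u using near that by auto
    have shifted: "flow u (flow (t + 1) P) \<in> cball 0 d0" if "u \<ge> 0" for u
      using near[of "u + (t + 1)"] that t by (simp add: flow_add)
    have tt: "t + 1 \<in> {b..t + 1}" "t \<in> {b..t + 1}" "b \<le> t + 1" using t by auto
    from passage_near_0[OF nr tt(3) P] consider "\<forall>u\<in>{b..t + 1}. flow u P $ 1 > 0 \<and> W (flow u P) < 0"
      | u where "\<forall>v\<in>{b..<u}. flow v P $ 1 > 0" "\<forall>v\<in>{b..t + 1}. W (flow v P) < 0" "\<forall>v\<in>{u<..t + 1}. flow v P $ 1 < 0"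
      | u where "\<forall>v\<in>{b..<u}. W (flow v P) < 0" "\<forall>v\<in>{b..t + 1}. flow v P $ 1 > 0" "\<forall>v\<in>{u<..t + 1}. W (flow v P) > 0"
      by blast
    then show False
    proof cases
      case 1 then show ?thesis using n tt(2) by blast
    next
      case 2
      have "\<not> t < u" using 2(1,2) n t by auto
      then have "flow (t + 1) P $ 1 < 0" "W (flow (t + 1) P) < 0" using 2 tt(1) by auto
      then show ?thesis
        using no_forward_stay[of "rfl (flow (t + 1) P)"] shifted by (force simp: flow_rfl)
    next
      case 3
      have "\<not> t < u" using 3(1,2) n t by auto
      then have "flow (t + 1) P $ 1 > 0" "W (flow (t + 1) P) > 0" using 3 tt(1) by auto
      then show ?thesis
        using no_forward_stay[of "flow (t + 1) P"] shifted by force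
    qed
  qed
  have "\<exists>l. ((\<lambda>u. - flow u P $ 1) \<longlongrightarrow> l) at_top \<and> (\<forall>u\<ge>b. - flow u P $ 1 \<le> l)"
  proof (rule mono_bounded_tendsto_at_top)
    fix u v :: real assume uv: "b \<le> u" "u \<le> v"
    have "flow v P $ 1 \<le> flow u P $ 1"
      by (rule x_antimono[OF uv(2)]) (use sg near near_0_region uv in \<open>auto intro: less_imp_le\<close>)
    then show "- flow u P $ 1 \<le> - flow v P $ 1" by simp
  next
    fix u :: real assume "b \<le> u"
    then show "- flow u P $ 1 \<le> 0" using sg[of u] by simp
  qed
  then obtain l where "((\<lambda>u. - flow u P $ 1) \<longlongrightarrow> l) at_top" by blast
  from tendsto_minus[OF this] have l: "((\<lambda>u. flow (1 * u) P $ 1) \<longlongrightarrow> - l) at_top" by simp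
  have L: "((\<lambda>u. flow u P) \<longlongrightarrow> eq_at (- l)) at_top \<and> eq_at (- l) \<in> cball 0 d0"
    using limit_equilibrium[of 1 "cball 0 d0" b P "- l", OF _ _ cball_0_trap _ l] near by auto
  then have "- l = 0" using eq_at_near_0 by blast
  then have "eq_at (- l) = 0" by (simp add: eq_at_def)
  then show ?thesis using sg L by simp
qed

subsection \<open>Sign changes under perturbation\<close>

lemma W_isolated:
  assumes "flow t P \<in> region" "flow t P $ 1 \<noteq> 0" "field P \<noteq> 0"
  shows "\<exists>e>0. \<forall>u. 0 < \<bar>u - t\<bar> \<and> \<bar>u - t\<bar> < e \<longrightarrow> W (flow u P) \<noteq> 0"
proof (cases "W (flow t P) = 0")
  case False
  then obtain e where "e > 0" "\<And>u. \<bar>u - t\<bar> < e \<Longrightarrow> W (flow u P) \<noteq> 0"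
    using W_near[OF open_sets(6), of t P] by auto
  then show ?thesis by blast
next
  case True
  have "\<exists>e>0. \<forall>h. 0 < h \<and> h < e \<longrightarrow> W (flow (t - h) P) \<noteq> 0 \<and> W (flow (t + h) P) \<noteq> 0"
  proof (cases "Z (flow t P) = 0")
    case False
    then have "flow t P $ 1 * Z (flow t P) < 0 \<or> 0 < flow t P $ 1 * Z (flow t P)"
      using assms(2) by (auto simp: neq_iff[symmetric] simp del: mult_less_0_iff zero_less_mult_iff)
    then show ?thesis using W_crossing[OF assms(1) True] by (metis less_irrefl)
  next
    case Z0: True
    have "field (flow t P) \<noteq> 0" using flow_eq_equilibriumD[of t P] assms by auto
    then have "flow t P $ 1 * ((flow t P $ 1)\<^sup>2 - q * (R - 1)) \<noteq> 0"
      using field_nonzero_x True Z0 assms(2) by auto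
    then have "0 < flow t P $ 1 * ((flow t P $ 1)\<^sup>2 - q * (R - 1)) \<or>
        flow t P $ 1 * ((flow t P $ 1)\<^sup>2 - q * (R - 1)) < 0" by linarith
    then show ?thesis using W_touching[OF assms(1) True Z0] by (metis less_irrefl)
  qed
  then obtain e where e: "e > 0" "\<And>h. 0 < h \<Longrightarrow> h < e \<Longrightarrow> W (flow (t - h) P) \<noteq> 0 \<and> W (flow (t + h) P) \<noteq> 0"
    by blast
  have "W (flow u P) \<noteq> 0" if "0 < \<bar>u - t\<bar>" "\<bar>u - t\<bar> < e" for u
    using e(2)[of "\<bar>u - t\<bar>"] that by (cases "u < t") auto
  then show ?thesis using e(1) by blast
qed

lemma finite_zeros:
  assumes "\<And>t. t \<in> {a..b} \<Longrightarrow> flow t P \<in> region \<and> flow t P $ 1 \<noteq> 0" "field P \<noteq> 0"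
  shows "finite {t \<in> {a..b}. W (flow t P) = 0}"
proof -
  have "finite ({a..b} \<inter> {t. W (flow t P) = 0})"
  proof (rule finite_not_islimpt_in_compact)
    fix t assume "t \<in> {a..b}"
    then obtain e where e: "e > 0" "\<And>u. 0 < \<bar>u - t\<bar> \<Longrightarrow> \<bar>u - t\<bar> < e \<Longrightarrow> W (flow u P) \<noteq> 0"
      using W_isolated[of t P] assms by blast
    show "\<not> t islimpt {t. W (flow t P) = 0}"
      unfolding islimpt_approachable using e by (auto simp: dist_real_def intro!: exI[of _ e])
  qed simp
  then show ?thesis by (rule rev_finite_subset) auto
qed

text \<open>All zeros of \<open>W\<close> on the interval are tangencies. The infimum of the times
  with \<open>W < 0\<close> would be one of them, and both a strict maximum and a strict minimum
  there contradict its choice.\<close>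

lemma W_nonneg_persists:
  assumes reg: "\<And>t. t \<in> {a..b} \<Longrightarrow> flow t P \<in> region \<and> flow t P $ 1 \<noteq> 0" "field P \<noteq> 0"
    and no: "\<And>t. t \<in> {a..b} \<Longrightarrow> W (flow t P) = 0 \<Longrightarrow> Z (flow t P) = 0"
    and "W (flow a P) > 0" "a \<le> b"
  shows "W (flow b P) \<ge> 0"
proof (rule ccontr)
  define B where "B = {t \<in> {a..b}. W (flow t P) < 0}"
  assume "\<not> W (flow b P) \<ge> 0"
  then have bB: "b \<in> B" using assms(5) by (simp add: B_def)
  define u where "u = Inf B"
  have bdd: "bdd_below B" by (auto simp: B_def intro: bdd_belowI[of _ a])
  have u: "a \<le> u" "u \<le> b"
    unfolding u_def using bB bdd by (auto intro!: cInf_greatest cInf_lower simp: B_def)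
  have bef: "W (flow t P) \<ge> 0" if "a \<le> t" "t < u" for t
    using that u cInf_lower[OF _ bdd, of t] by (force simp: u_def B_def not_le[symmetric])
  have W0: "W (flow u P) = 0"
  proof (rule ccontr)
    assume "W (flow u P) \<noteq> 0"
    then consider "W (flow u P) < 0" | "W (flow u P) > 0" by linarith
    then show False
    proof cases
      case 1
      then obtain e where e: "e > 0" "\<And>v. \<bar>v - u\<bar> < e \<Longrightarrow> W (flow v P) < 0"
        using W_near[OF open_sets(1), of u P] by auto
      have "a < u" using 1 u assms(4) by (cases "a = u") auto
      define v where "v = max a (u - e / 2)"
      have "a \<le> v" "v < u" "\<bar>v - u\<bar> < e" using e \<open>a < u\<close> by (auto simp: v_def max_def)
      then show False using bef[of v] e(2)[of v] by simp
    next
      case 2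
      then obtain e where e: "e > 0" "\<And>v. \<bar>v - u\<bar> < e \<Longrightarrow> W (flow v P) > 0"
        using W_near[OF open_sets(2), of u P] by auto
      obtain v where "v \<in> B" "v < u + e" using cInf_lessD[of B "u + e"] bB e(1) by (auto simp: u_def)
      moreover have "u \<le> v" using \<open>v \<in> B\<close> bdd by (auto simp: u_def intro: cInf_lower)
      ultimately show False using e(2)[of v] by (auto simp: B_def)
    qed
  qed
  have ru: "flow u P \<in> region" "flow u P $ 1 \<noteq> 0" using reg(1)[of u] u by auto
  have Z0: "Z (flow u P) = 0" using no[of u] u W0 by auto
  have au: "a < u" using W0 assms(4) u by (cases "a = u") auto
  have "field (flow u P) \<noteq> 0" using flow_eq_equilibriumD[of u P] assms(2) ru by auto
  then have "flow u P $ 1 * ((flow u P $ 1)\<^sup>2 - q * (R - 1)) \<noteq> 0"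
    using field_nonzero_x W0 Z0 ru by auto
  then consider "0 < flow u P $ 1 * ((flow u P $ 1)\<^sup>2 - q * (R - 1))"
    | "flow u P $ 1 * ((flow u P $ 1)\<^sup>2 - q * (R - 1)) < 0" by linarith
  then show False
  proof cases
    case 1
    then obtain e where e: "e > 0" "\<And>h. 0 < h \<Longrightarrow> h < e \<Longrightarrow> W (flow (u - h) P) < 0"
      using W_touching(1)[OF ru(1) W0 Z0] by blast
    define h where "h = min e (u - a) / 2"
    have "0 < h" "h < e" "a \<le> u - h" using e au by (auto simp: h_def min_def field_simps)
    then show False using e(2)[of h] bef[of "u - h"] by auto
  next
    case 2
    then obtain e where e: "e > 0" "\<And>h. 0 < h \<Longrightarrow> h < e \<Longrightarrow> W (flow (u + h) P) > 0"
      using W_touching(2)[OF ru(1) W0 Z0] by blast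
    obtain v where v: "v \<in> B" "v < u + e" using cInf_lessD[of B "u + e"] bB e(1) by (auto simp: u_def)
    moreover have "u \<le> v" using \<open>v \<in> B\<close> bdd by (auto simp: u_def intro: cInf_lower)
    ultimately show False using e(2)[of "v - u"] W0 by (cases "u = v") (auto simp: B_def)
  qed
qed

lemma W_one_signed:
  assumes reg: "\<And>t. t \<in> S \<Longrightarrow> flow t P \<in> region \<and> flow t P $ 1 \<noteq> 0" "field P \<noteq> 0"
    and no: "\<And>t. t \<in> S \<Longrightarrow> W (flow t P) = 0 \<Longrightarrow> Z (flow t P) = 0" and S: "is_interval S"
  shows "(\<forall>t\<in>S. W (flow t P) \<ge> 0) \<or> (\<forall>t\<in>S. W (flow t P) \<le> 0)"
proof (rule ccontr)
  assume "\<not> ?thesis"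
  then obtain t1 t2 where t: "t1 \<in> S" "t2 \<in> S" "W (flow t1 P) > 0" "W (flow t2 P) < 0"
    by (auto simp: not_le)
  have sub: "u \<in> S" if "t1 \<le> u \<and> u \<le> t2 \<or> t2 \<le> u \<and> u \<le> t1" for u
    using that mem_is_interval_1_I[OF S] t by blast
  have fr: "field (rfl P) \<noteq> 0" using assms(2) by (metis field_rfl rfl_0 rfl_rfl)
  consider "t1 \<le> t2" | "t2 \<le> t1" by linarith
  then show False
  proof cases
    case 1
    have "W (flow t2 P) \<ge> 0"
      by (rule W_nonneg_persists[of t1 t2 P]) (use reg no sub t 1 in auto)
    then show False using t by simp
  next
    case 2
    have "W (flow t1 (rfl P)) \<ge> 0"
      by (rule W_nonneg_persists[of t2 t1 "rfl P"]) (use reg no sub t 2 fr in \<open>auto simp: flow_rfl\<close>)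
    then show False using t by (simp add: flow_rfl)
  qed
qed

lemma zero_persists:
  assumes "flow t Q \<in> region" "flow t Q $ 1 \<noteq> 0" "W (flow t Q) = 0" "Z (flow t Q) \<noteq> 0" "d > 0"
  shows "\<forall>\<^sub>F C in nhds Q. \<exists>u. \<bar>u - t\<bar> < d \<and> W (flow u C) = 0 \<and> Z (flow u C) \<noteq> 0"
proof -
  obtain e where e: "e > 0" "\<And>h. 0 < h \<Longrightarrow> h < e \<Longrightarrow> W (flow (t - h) Q) < 0 \<and> 0 < W (flow (t + h) Q)
      \<or> 0 < W (flow (t - h) Q) \<and> W (flow (t + h) Q) < 0"
  proof -
    have "flow t Q $ 1 * Z (flow t Q) < 0 \<or> 0 < flow t Q $ 1 * Z (flow t Q)"
      using assms(2,4) by (auto simp: neq_iff[symmetric] simp del: mult_less_0_iff zero_less_mult_iff)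
    then show ?thesis using W_crossing[OF assms(1,3)] that by meson
  qed
  obtain e' where e': "e' > 0" "\<And>u. \<bar>u - t\<bar> < e' \<Longrightarrow> Z (flow u Q) \<noteq> 0"
    using W_near[OF open_sets(5), of t Q] assms(4) by auto
  define h where "h = min (min e e') d / 2"
  have h: "0 < h" "h < e" "h < e'" "h < d" using e e' assms(5) by (auto simp: h_def min_def)
  have Zt: "\<forall>\<^sub>F C in nhds Q. \<forall>u\<in>{t - h..t + h}. flow u C \<in> {p. Z p \<noteq> 0}"
    by (rule flow_tube[OF _ open_sets(5)]) (use e' h in auto)
  consider "W (flow (t - h) Q) < 0" "0 < W (flow (t + h) Q)" | "0 < W (flow (t - h) Q)" "W (flow (t + h) Q) < 0"
    using e(2)[of h] h by blast
  then show ?thesis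
  proof cases
    case 1
    have "\<forall>\<^sub>F C in nhds Q. \<forall>u\<in>{t - h}. flow u C \<in> {p. W p < 0}"
      by (rule flow_tube[OF _ open_sets(1)]) (use 1 in auto)
    moreover have "\<forall>\<^sub>F C in nhds Q. \<forall>u\<in>{t + h}. flow u C \<in> {p. W p > 0}"
      by (rule flow_tube[OF _ open_sets(2)]) (use 1 in auto)
    ultimately show ?thesis using Zt
    proof eventually_elim
      case (elim C)
      then obtain u where "t - h \<le> u" "u \<le> t + h" "W (flow u C) = 0"
        using IVT'[of "\<lambda>u. W (flow u C)" "t - h" 0 "t + h"] h continuous_on_Wf by auto
      then show ?case using elim h by (intro exI[of _ u]) auto
    qed
  next
    case 2
    have "\<forall>\<^sub>F C in nhds Q. \<forall>u\<in>{t - h}. flow u C \<in> {p. W p > 0}"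
      by (rule flow_tube[OF _ open_sets(2)]) (use 2 in auto)
    moreover have "\<forall>\<^sub>F C in nhds Q. \<forall>u\<in>{t + h}. flow u C \<in> {p. W p < 0}"
      by (rule flow_tube[OF _ open_sets(1)]) (use 2 in auto)
    ultimately show ?thesis using Zt
    proof eventually_elim
      case (elim C)
      then obtain u where "t - h \<le> u" "u \<le> t + h" "W (flow u C) = 0"
        using IVT2'[of "\<lambda>u. W (flow u C)" "t + h" 0 "t - h"] h continuous_on_Wf by auto
      then show ?case using elim h by (intro exI[of _ u]) auto
    qed
  qed
qed

lemma zeros_persist:
  assumes "finite K" "d > 0"
    and K: "\<And>t. t \<in> K \<Longrightarrow> flow t Q \<in> region \<and> flow t Q $ 1 \<noteq> 0 \<and> W (flow t Q) = 0 \<and> Z (flow t Q) \<noteq> 0"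
  shows "\<forall>\<^sub>F C in nhds Q. \<exists>g. inj_on g K \<and>
           (\<forall>t\<in>K. \<bar>g t - t\<bar> < d \<and> W (flow (g t) C) = 0 \<and> Z (flow (g t) C) \<noteq> 0)"
proof -
  define D where "D = (\<lambda>(a, b). \<bar>a - b\<bar> / 2) ` {(a, b). a \<in> K \<and> b \<in> K \<and> a \<noteq> b}"
  have "{(a, b). a \<in> K \<and> b \<in> K \<and> a \<noteq> b} \<subseteq> K \<times> K" by auto
  then have "finite D" unfolding D_def using assms(1) by (intro finite_imageI finite_subset[OF _ finite_cartesian_product]) auto
  \<comment> \<open>At most half of the smallest gap between zeros, so that zeros perturbed by less
    than \<open>e\<close> stay distinct.\<close>
  define e where "e = Min (insert d D)"
  have e: "e > 0" "e \<le> d" using \<open>finite D\<close> assms(2) by (auto simp: e_def D_def)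
  have sep: "2 * e \<le> \<bar>a - b\<bar>" if "a \<in> K" "b \<in> K" "a \<noteq> b" for a b
  proof -
    have "\<bar>a - b\<bar> / 2 \<in> insert d D" using that by (force simp: D_def)
    then have "e \<le> \<bar>a - b\<bar> / 2" unfolding e_def using \<open>finite D\<close> by (intro Min_le) auto
    then show ?thesis by simp
  qed
  have "\<forall>\<^sub>F C in nhds Q. \<forall>t\<in>K. \<exists>u. \<bar>u - t\<bar> < e \<and> W (flow u C) = 0 \<and> Z (flow u C) \<noteq> 0"
    using assms(1) by (rule eventually_ball_finite) (use K e zero_persists in blast)
  then show ?thesis
  proof eventually_elim
    case (elim C)
    then obtain g where g: "\<And>t. t \<in> K \<Longrightarrow> \<bar>g t - t\<bar> < e \<and> W (flow (g t) C) = 0 \<and> Z (flow (g t) C) \<noteq> 0"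
      by metis
    have "inj_on g K"
    proof (rule inj_onI, rule ccontr)
      fix a b assume ab: "a \<in> K" "b \<in> K" "g a = g b" "a \<noteq> b"
      then show False using sep[of a b] g[of a] g[of b] by auto
    qed
    then show ?case using g e by (intro exI[of _ g]) force
  qed
qed

text \<open>A count on a window that survives perturbation of \<open>P\<close>: there are no
  tangencies, and \<open>W\<close> is nonzero at the two ends, where a zero could otherwise enter or
  leave.\<close>

definition cnt :: "real ^ 3 \<Rightarrow> real \<Rightarrow> real \<Rightarrow> nat \<Rightarrow> bool" where
  "cnt P a b n \<longleftrightarrow> a < b \<and>
     (\<forall>t\<in>{a..b}. flow t P \<in> region \<and> flow t P $ 1 > 0 \<and> (W (flow t P) = 0 \<longrightarrow> Z (flow t P) \<noteq> 0)) \<and>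
     W (flow a P) \<noteq> 0 \<and> W (flow b P) \<noteq> 0 \<and>
     finite {t \<in> {a..b}. W (flow t P) = 0} \<and> card {t \<in> {a..b}. W (flow t P) = 0} = n"

text \<open>No zero is lost because transversal zeros persist. None is gained: near an old zero
  \<open>W'\<close> stays nonzero, which allows one zero only, and on the compact rest of the window
  \<open>W\<close> stays nonzero.\<close>

lemma cnt_perturb:
  assumes "cnt Q a b n"
  shows "\<forall>\<^sub>F C in nhds Q. cnt C a b n"
proof -
  define K where "K = {t \<in> {a..b}. W (flow t Q) = 0}"
  have ab: "a < b" and Q: "\<And>t. t \<in> {a..b} \<Longrightarrow> flow t Q \<in> region \<and> flow t Q $ 1 > 0 \<and> (W (flow t Q) = 0 \<longrightarrow> Z (flow t Q) \<noteq> 0)"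
    and ends: "W (flow a Q) \<noteq> 0" "W (flow b Q) \<noteq> 0" and K: "finite K" "card K = n"
    using assms unfolding cnt_def K_def by auto
  define U1 where "U1 = {p. - (s + 1) * W p - p $ 1 * Z p \<noteq> 0}"
  have oU1: "open U1" unfolding U1_def by (rule open_sets)
  have "\<exists>e>0. \<forall>u. \<bar>u - t\<bar> < e \<longrightarrow> flow u Q \<in> U1 \<and> a \<le> u \<and> u \<le> b" if "t \<in> K" for t
  proof -
    have t: "t \<in> {a..b}" "W (flow t Q) = 0" using that by (auto simp: K_def)
    then have "flow t Q \<in> U1" using Q[of t] by (auto simp: U1_def)
    then obtain e where e: "e > 0" "\<And>u. \<bar>u - t\<bar> < e \<Longrightarrow> flow u Q \<in> U1"
      using W_near[OF oU1, of t Q] by blast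
    have "a < t" "t < b" using t ends by (auto simp: less_le)
    then show ?thesis using e by (intro exI[of _ "min e (min (t - a) (b - t))"]) auto
  qed
  then obtain ef where ef: "\<And>t. t \<in> K \<Longrightarrow> ef t > 0"
    "\<And>t u. t \<in> K \<Longrightarrow> \<bar>u - t\<bar> < ef t \<Longrightarrow> flow u Q \<in> U1 \<and> a \<le> u \<and> u \<le> b"
    by metis
  define e where "e = Min (insert 1 (ef ` K)) / 2"
  have e: "e > 0" using K ef(1) by (auto simp: e_def)
  have eK: "e < ef t" if "t \<in> K" for t
  proof -
    have "Min (insert 1 (ef ` K)) \<le> ef t" using K that by (intro Min_le) auto
    then show ?thesis using ef(1)[OF that] by (simp add: e_def)
  qed
  define N where "N = (\<Union>t\<in>K. {t - e..t + e})"
  have "compact N" unfolding N_def using K by (intro compact_UN) auto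
  then have tN: "\<forall>\<^sub>F C in nhds Q. \<forall>t\<in>N. flow t C \<in> region \<inter> U1"
  proof (rule flow_tube)
    show "open (region \<inter> U1)" using open_region oU1 by auto
    fix u assume "u \<in> N"
    then obtain t where t: "t \<in> K" "\<bar>u - t\<bar> \<le> e" by (auto simp: N_def abs_le_iff)
    then have "flow u Q \<in> U1 \<and> a \<le> u \<and> u \<le> b" using ef(2)[of t u] eK[of t] by auto
    then show "flow u Q \<in> region \<inter> U1" using Q by auto
  qed
  define F where "F = {a..b} - (\<Union>t\<in>K. {t - e<..<t + e})"
  have "compact F" unfolding F_def by (intro compact_diff compact_Icc open_UN ballI open_greaterThanLessThan)
  then have tF: "\<forall>\<^sub>F C in nhds Q. \<forall>t\<in>F. flow t C \<in> {p. W p \<noteq> 0}"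
    by (rule flow_tube[OF _ open_sets(6)]) (use e in \<open>force simp: F_def K_def\<close>)
  define U0 where "U0 = region \<inter> {p. p $ 1 > 0} \<inter> ({p. W p \<noteq> 0} \<union> {p. Z p \<noteq> 0})"
  have "open U0" unfolding U0_def by (intro open_Int open_Un open_region open_sets)
  then have t0: "\<forall>\<^sub>F C in nhds Q. \<forall>t\<in>{a..b}. flow t C \<in> U0"
    by (rule flow_tube[OF compact_Icc]) (use Q in \<open>auto simp: U0_def\<close>)
  have te: "\<forall>\<^sub>F C in nhds Q. \<forall>t\<in>{a, b}. flow t C \<in> {p. W p \<noteq> 0}"
    by (rule flow_tube[OF _ open_sets(6)]) (use ends in auto)
  have tz: "\<forall>\<^sub>F C in nhds Q. \<exists>g. inj_on g K \<and>
           (\<forall>t\<in>K. \<bar>g t - t\<bar> < e \<and> W (flow (g t) C) = 0 \<and> Z (flow (g t) C) \<noteq> 0)"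
    by (rule zeros_persist[OF K(1) e]) (use Q in \<open>force simp: K_def\<close>)
  show ?thesis using tN tF t0 te tz
  proof eventually_elim
    case (elim C)
    then obtain g where g: "inj_on g K" "\<And>t. t \<in> K \<Longrightarrow> \<bar>g t - t\<bar> < e" "\<And>t. t \<in> K \<Longrightarrow> W (flow (g t) C) = 0"
      by blast
    have "{t \<in> {a..b}. W (flow t C) = 0} = g ` K"
    proof (intro equalityI subsetI)
      fix u assume u: "u \<in> {t \<in> {a..b}. W (flow t C) = 0}"
      then have "u \<notin> F" using elim(2) by auto
      then obtain t where t: "t \<in> K" "t - e < u" "u < t + e" using u by (auto simp: F_def)
      have "u = g t"
      proof (rule ccontr)
        assume ne: "u \<noteq> g t"
        define l where "l = min u (g t)"
        define r where "r = max u (g t)"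
        have lr: "l < r" "W (flow l C) = 0" "W (flow r C) = 0" "t - e < l" "r < t + e"
          using ne u t g(2,3)[OF t(1)] by (auto simp: l_def r_def min_def max_def)
        have inN: "v \<in> N" if "l \<le> v" "v \<le> r" for v using that lr t(1) by (force simp: N_def)
        have "\<exists>z>l. z < r \<and> W (flow r C) - W (flow l C) = (r - l) * (- (s + 1) * W (flow z C) - flow z C $ 1 * Z (flow z C))"
          by (rule MVT2[OF lr(1)], rule flow_W) (use elim(1) inN in auto)
        then obtain z where z: "l < z" "z < r" "- (s + 1) * W (flow z C) - flow z C $ 1 * Z (flow z C) = 0"
          using lr by auto
        then show False using elim(1) inN[of z] by (auto simp: U1_def)
      qed
      then show "u \<in> g ` K" using t by auto
    next
      fix u assume "u \<in> g ` K"
      then obtain t where t: "t \<in> K" "u = g t" by auto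
      then have "\<bar>u - t\<bar> < ef t" using g(2)[of t] eK[of t] by auto
      then show "u \<in> {t \<in> {a..b}. W (flow t C) = 0}" using ef(2)[of t u] g(3)[of t] t by auto
    qed
    then show ?case
      using elim ab K g(1) by (auto simp: cnt_def card_image U0_def)
  qed
qed

lemma cnt_concat:
  assumes "cnt P a b m" "cnt P b c n"
  shows "cnt P a c (m + n)"
proof -
  let ?Q = "\<lambda>t. flow t P \<in> region \<and> flow t P $ 1 > 0 \<and> (W (flow t P) = 0 \<longrightarrow> Z (flow t P) \<noteq> 0)"
  let ?A = "{t \<in> {a..b}. W (flow t P) = 0}" and ?B = "{t \<in> {b..c}. W (flow t P) = 0}"
  have A: "a < b" "\<And>t. t \<in> {a..b} \<Longrightarrow> ?Q t" "W (flow a P) \<noteq> 0" "W (flow b P) \<noteq> 0" "finite ?A" "card ?A = m"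
    using assms(1) by (auto simp: cnt_def)
  have B: "b < c" "\<And>t. t \<in> {b..c} \<Longrightarrow> ?Q t" "W (flow c P) \<noteq> 0" "finite ?B" "card ?B = n"
    using assms(2) by (auto simp: cnt_def)
  have eq: "{t \<in> {a..c}. W (flow t P) = 0} = ?A \<union> ?B"
    using A(1) B(1) by auto
  have disj: "?A \<inter> ?B = {}"
  proof (rule equals0I)
    fix t assume t: "t \<in> ?A \<inter> ?B"
    then have "t = b" by auto
    then show False using t A(4) by auto
  qed
  have "?Q t" if "t \<in> {a..c}" for t
    using A(2)[of t] B(2)[of t] that by (cases "t \<le> b") auto
  then show ?thesis
    unfolding cnt_def eq using A B card_Un_disjoint[OF A(5) B(4) disj] by (auto simp del: Un_iff)
qed

lemma cnt_shift: "cnt (flow u P) a b n \<longleftrightarrow> cnt P (a + u) (b + u) n"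
proof -
  have f: "flow t (flow u P) = flow (t + u) P" for t by (simp add: flow_add)
  have "{t \<in> {a + u..b + u}. W (flow t P) = 0} = (\<lambda>t. t + u) ` {t \<in> {a..b}. W (flow (t + u) P) = 0}"
  proof (intro equalityI subsetI)
    fix t assume "t \<in> {t \<in> {a + u..b + u}. W (flow t P) = 0}"
    then show "t \<in> (\<lambda>t. t + u) ` {t \<in> {a..b}. W (flow (t + u) P) = 0}"
      by (intro image_eqI[of _ _ "t - u"]) auto
  qed auto
  then have 1: "card {t \<in> {a + u..b + u}. W (flow t P) = 0} = card {t \<in> {a..b}. W (flow (t + u) P) = 0}"
    "finite {t \<in> {a + u..b + u}. W (flow t P) = 0} \<longleftrightarrow> finite {t \<in> {a..b}. W (flow (t + u) P) = 0}"
    by (simp_all add: card_image finite_image_iff inj_on_def)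
  have 2: "(\<forall>t\<in>{a + u..b + u}. Q t) \<longleftrightarrow> (\<forall>t\<in>{a..b}. Q (t + u))" for Q
  proof
    assume h: "\<forall>t\<in>{a..b}. Q (t + u)"
    show "\<forall>t\<in>{a + u..b + u}. Q t"
    proof
      fix t assume "t \<in> {a + u..b + u}"
      then show "Q t" using h[rule_format, of "t - u"] by auto
    qed
  qed auto
  show ?thesis unfolding cnt_def f 1 2 by simp
qed

lemma cnt_1:
  assumes "a < u" "u < b" "\<And>t. t \<in> {a..b} \<Longrightarrow> flow t P \<in> region \<and> flow t P $ 1 > 0 \<and> (W (flow t P) = 0 \<longleftrightarrow> t = u)"
    "Z (flow u P) \<noteq> 0"
  shows "cnt P a b 1"
proof -
  have "{t \<in> {a..b}. W (flow t P) = 0} = {u}" using assms by force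
  then show ?thesis using assms by (auto simp: cnt_def)
qed

lemma cnt_exists:
  assumes "a < b" "\<And>t. t \<in> {a..b} \<Longrightarrow> flow t P \<in> region \<and> flow t P $ 1 > 0 \<and> (W (flow t P) = 0 \<longrightarrow> Z (flow t P) \<noteq> 0)"
    "W (flow a P) \<noteq> 0" "W (flow b P) \<noteq> 0" "field P \<noteq> 0"
  shows "cnt P a b (card {t \<in> {a..b}. W (flow t P) = 0})"
  using assms finite_zeros[of a b P] by (force simp: cnt_def)

text \<open>The zero of \<open>x\<close> at \<open>T\<close> is transversal because
  \<open>W < 0\<close> there, so it moves little; the signs before it are open conditions.\<close>

lemma hit_near:
  assumes reg: "flow T Q \<in> region" and b: "b < T" and neg: "\<And>t. t \<in> {b..T} \<Longrightarrow> W (flow t Q) < 0"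
    and pos: "\<And>t. t \<in> {b..<T} \<Longrightarrow> flow t Q $ 1 > 0" and T: "flow T Q $ 1 = 0" and d: "d > 0"
  shows "\<forall>\<^sub>F C in nhds Q. \<exists>T'>b. \<bar>T' - T\<bar> < d \<and> (\<forall>t\<in>{b..<T'}. flow t C $ 1 > 0) \<and> flow T' C $ 1 = 0 \<and>
           (\<forall>t\<in>{b..T'}. W (flow t C) < 0)"
proof -
  have WT: "W (flow T Q) < 0" using neg[of T] b by simp
  obtain h1 where h1: "h1 > 0" "\<And>h. 0 < h \<Longrightarrow> h < h1 \<Longrightarrow> flow (T + h) Q $ 1 < 0"
    using x_zero_crossing(1)[OF reg T WT] by blast
  obtain h2 where h2: "h2 > 0" "\<And>u. \<bar>u - T\<bar> < h2 \<Longrightarrow> W (flow u Q) < 0"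
    using W_near[OF open_sets(1), of T Q] WT by auto
  define h where "h = min h1 (min h2 d) / 2"
  have h: "0 < h" "h < h1" "h < h2" "h < d" using h1(1) h2(1) d by (auto simp: h_def min_def)
  define b' where "b' = max b (T - h)"
  have b': "b \<le> b'" "b' < T" "T - h \<le> b'" using b h by (auto simp: b'_def)
  have "\<forall>\<^sub>F C in nhds Q. \<forall>t\<in>{b..b'}. flow t C \<in> {p. p $ 1 > 0}"
    by (rule flow_tube[OF _ open_sets(3)]) (use pos b' in auto)
  moreover have "\<forall>\<^sub>F C in nhds Q. \<forall>t\<in>{b..T + h}. flow t C \<in> {p. W p < 0}"
  proof (rule flow_tube[OF _ open_sets(1)])
    fix t assume t: "t \<in> {b..T + h}"
    then show "flow t Q \<in> {p. W p < 0}" using neg[of t] h2(2)[of t] h by (cases "t \<le> T") auto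
  qed simp
  moreover have "\<forall>\<^sub>F C in nhds Q. \<forall>t\<in>{T + h}. flow t C \<in> {p. p $ 1 < 0}"
    by (rule flow_tube[OF _ open_sets(4)]) (use h1(2)[of h] h in auto)
  ultimately show ?thesis
  proof eventually_elim
    case (elim C)
    have x: "flow b' C $ 1 > 0" "flow (T + h) C $ 1 < 0" using elim b' by auto
    have "T + h \<in> {b'..T + h}" using b' h by simp
    then obtain T' where T': "b' < T'" "T' \<le> T + h" "flow T' C $ 1 = 0" "\<forall>v\<in>{b'..<T'}. flow v C $ 1 > 0"
      using first_nonpos[OF continuous_on_x[of "{b'..T + h}" C] x(1), of "T + h"] x(2) by auto
    have "\<forall>t\<in>{b..<T'}. flow t C $ 1 > 0"
    proof
      fix t assume "t \<in> {b..<T'}"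
      then show "flow t C $ 1 > 0" using elim T'(4) by (cases "t \<le> b'") auto
    qed
    moreover have "\<bar>T' - T\<bar> < d" using T' b' h by linarith
    moreover have "\<forall>t\<in>{b..T'}. W (flow t C) < 0" using elim T' by auto
    ultimately show ?case using T' b' by (intro exI[of _ T']) auto
  qed
qed

text \<open>Joint continuity in time and point, for arrival times that move with the starting
  point.\<close>

lemma flow_rfl_near:
  assumes "\<forall>\<^sub>F p in nhds (rfl (flow T Q)). \<Phi> p"
  shows "\<exists>d>0. \<forall>\<^sub>F C in nhds Q. \<forall>T'. \<bar>T' - T\<bar> < d \<longrightarrow> \<Phi> (rfl (flow T' C))"
proof -
  have "filterlim (\<lambda>w. rfl (flow (fst w) (snd w))) (nhds (rfl (flow T Q))) (nhds T \<times>\<^sub>F nhds Q)"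
    by (intro tendsto_rfl tendsto_flow filterlim_fst filterlim_snd)
  then have "\<forall>\<^sub>F w in nhds T \<times>\<^sub>F nhds Q. \<Phi> (rfl (flow (fst w) (snd w)))"
    using assms unfolding filterlim_iff by blast
  then obtain Pf Pg where P: "eventually Pf (nhds T)" "eventually Pg (nhds Q)"
    "\<And>T' C. Pf T' \<Longrightarrow> Pg C \<Longrightarrow> \<Phi> (rfl (flow T' C))"
    unfolding eventually_prod_filter by auto
  obtain d where d: "d > 0" "\<And>T'. dist T' T < d \<Longrightarrow> Pf T'"
    using P(1) unfolding eventually_nhds_metric by blast
  have "\<forall>\<^sub>F C in nhds Q. \<forall>T'. \<bar>T' - T\<bar> < d \<longrightarrow> \<Phi> (rfl (flow T' C))"
    using P(2)
  proof eventually_elim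
    case (elim C)
    then show ?case using P(3) d(2) by (simp add: dist_real_def)
  qed
  then show ?thesis using d(1) by blast
qed

section \<open>Counts up to the next zero of \<open>x\<close> and the return map\<close>

text \<open>Formulated without a return time, so that it also makes sense for orbits which never
  come back to \<open>x = 0\<close>.\<close>

definition SC :: "real ^ 3 \<Rightarrow> real set" where
  "SC P = {t. t > 0 \<and> (\<forall>u\<in>{0<..t}. flow u P $ 1 > 0) \<and> W (flow t P) = 0 \<and> Z (flow t P) \<noteq> 0}"

definition hit :: "real ^ 3 \<Rightarrow> real \<Rightarrow> bool" where
  "hit P T \<longleftrightarrow> T > 0 \<and> (\<forall>u\<in>{0<..<T}. flow u P $ 1 > 0) \<and> flow T P $ 1 = 0"

text \<open>A lower bound for the count. It is stable under perturbation without any control of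
  tangencies, and it includes infinite counts.\<close>

definition many :: "nat \<Rightarrow> real ^ 3 \<Rightarrow> bool" where
  "many k P \<longleftrightarrow> (\<exists>K\<subseteq>SC P. finite K \<and> card K = k)"

lemma hit_unique: "hit P T \<Longrightarrow> hit P T' \<Longrightarrow> T = T'"
proof (rule ccontr)
  assume h: "hit P T" "hit P T'" "T \<noteq> T'"
  then consider "T < T'" | "T' < T" by linarith
  then show False
  proof cases
    case 1
    then have "T \<in> {0<..<T'}" using h(1) by (simp add: hit_def)
    then have "flow T P $ 1 > 0" using h(2) by (simp add: hit_def)
    then show False using h(1) by (simp add: hit_def)
  next
    case 2
    then have "T' \<in> {0<..<T}" using h(2) by (simp add: hit_def)
    then have "flow T' P $ 1 > 0" using h(1) by (simp add: hit_def)
    then show False using h(2) by (simp add: hit_def)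
  qed
qed

text \<open>Reflected, so that every leg of an orbit can be treated as one with
  \<open>x > 0\<close>.\<close>

definition nxt :: "real ^ 3 \<Rightarrow> real ^ 3" where "nxt P = rfl (flow (THE T. hit P T) P)"

lemma nxt_eq: "hit P T \<Longrightarrow> nxt P = rfl (flow T P)"
  unfolding nxt_def using the_equality[of "hit P" T, OF _ hit_unique] by simp

text \<open>Off the invariant axis \<open>x\<close> and \<open>W\<close> never vanish together; in
  particular every zero of \<open>x\<close> is transversal.\<close>

definition off :: "real ^ 3 \<Rightarrow> bool" where "off P \<longleftrightarrow> P $ 1 \<noteq> 0 \<or> W P \<noteq> 0"

lemma off_flow [simp]: "off (flow t P) = off P"
  unfolding off_def using z_axis_iff[of t P] by blast

lemma W_isolated_off:
  assumes "flow t P \<in> region" "off P" "field P \<noteq> 0"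
  shows "\<exists>e>0. \<forall>u. 0 < \<bar>u - t\<bar> \<and> \<bar>u - t\<bar> < e \<longrightarrow> W (flow u P) \<noteq> 0"
proof (cases "flow t P $ 1 = 0")
  case True
  then have "W (flow t P) \<noteq> 0" using assms(2) off_flow[of t P] by (auto simp: off_def simp del: off_flow)
  then obtain e where "e > 0" "\<And>u. \<bar>u - t\<bar> < e \<Longrightarrow> W (flow u P) \<noteq> 0"
    using W_near[OF open_sets(6), of t P] by auto
  then show ?thesis by blast
qed (use W_isolated assms in blast)

lemma finite_zeros_off:
  assumes "\<And>t. t \<in> {a..b} \<Longrightarrow> flow t P \<in> region" "off P" "field P \<noteq> 0"
  shows "finite {t \<in> {a..b}. W (flow t P) = 0}"
proof -
  have "finite ({a..b} \<inter> {t. W (flow t P) = 0})"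
  proof (rule finite_not_islimpt_in_compact)
    fix t assume "t \<in> {a..b}"
    then obtain e where e: "e > 0" "\<And>u. 0 < \<bar>u - t\<bar> \<Longrightarrow> \<bar>u - t\<bar> < e \<Longrightarrow> W (flow u P) \<noteq> 0"
      using W_isolated_off[of t P] assms by blast
    show "\<not> t islimpt {t. W (flow t P) = 0}"
      unfolding islimpt_approachable using e by (auto simp: dist_real_def intro!: exI[of _ e])
  qed simp
  then show ?thesis by (rule rev_finite_subset) auto
qed

lemma isCont_W_flow: "isCont (\<lambda>t. W (flow t P)) t"
  unfolding isCont_def by (intro tendsto_W tendsto_flow tendsto_ident_at tendsto_const)

lemma changes_sign_at_W_off:
  assumes "flow t P \<in> region" "off P" "field P \<noteq> 0"
  shows "changes_sign_at (\<lambda>u. W (flow u P)) t \<longleftrightarrow> W (flow t P) = 0 \<and> Z (flow t P) \<noteq> 0"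
proof (cases "flow t P $ 1 = 0")
  case True
  then have "W (flow t P) \<noteq> 0" using assms(2) off_flow[of t P] by (auto simp: off_def simp del: off_flow)
  then show ?thesis using changes_sign_at_imp_zero[OF _ isCont_W_flow] by blast
qed (use changes_sign_at_W_iff assms in blast)

subsection \<open>Lyapunov functions\<close>

lemma exp_weight_derivative:
  assumes "(f has_real_derivative f') (at t)"
  shows "((\<lambda>t. exp (k * t) * f t) has_real_derivative exp (k * t) * (f' + k * f t)) (at t)"
proof -
  have "((\<lambda>v. exp (k * v)) has_real_derivative exp (k * t) * k) (at t)"
    by (rule DERIV_cong[OF DERIV_fun_exp[OF DERIV_cmult_Id]]) simp
  from DERIV_mult[OF this assms] show ?thesis
    by (rule DERIV_cong) (simp add: algebra_simps)
qed

definition U :: "real ^ 3 \<Rightarrow> real" where "U p = Z p + (R - 1) - (p $ 1)\<^sup>2 / (2 * s)"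

text \<open>In the second-order form \<open>x'' + (s + 1) x' + s x (U + x\<^sup>2 / (2 s) - (R - 1)) = 0\<close>,
  \<open>U' = - q U + (1 - q / (2 s)) x\<^sup>2\<close> of the system, \<open>lyap 0 0\<close> is the energy of the oscillator.\<close>

definition lyap :: "real \<Rightarrow> real \<Rightarrow> real ^ 3 \<Rightarrow> real" where
  "lyap a b p = s\<^sup>2 * (W p)\<^sup>2 / 2 + s * Z p * (p $ 1)\<^sup>2 / 2 - (p $ 1) ^ 4 / 8
     + a * s * (p $ 1 * W p) + b * (p $ 1)\<^sup>2"

lemma flow_U:
  assumes "flow t P \<in> region"
  shows "((\<lambda>t. U (flow t P)) has_real_derivative
    - q * U (flow t P) + (1 - q / (2 * s)) * (flow t P $ 1)\<^sup>2) (at t)"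
  unfolding U_def
  by (rule DERIV_cong[OF DERIV_diff[OF DERIV_add[OF flow_Z[OF assms] DERIV_const]
        DERIV_cdivide[OF DERIV_power[OF flow_x[OF assms]]]]])
     (use s_pos in \<open>simp add: W_def Z_def power2_eq_square field_simps\<close>)

text \<open>The derivative is sorted by the five monomials \<open>W\<^sup>2\<close>,
  \<open>U * x\<^sup>2\<close>, \<open>x ^ 4\<close>, \<open>x * W\<close> and
  \<open>x\<^sup>2\<close>. Each application chooses \<open>k\<close>, \<open>a\<close> and
  \<open>b\<close> so that the coefficients vanish or have a definite sign.\<close>

lemma flow_lyap:
  fixes k a b :: real
  assumes "flow t P \<in> region"
  defines "x \<equiv> flow t P $ 1" and "w \<equiv> W (flow t P)" and "u \<equiv> U (flow t P)"
  shows "((\<lambda>t. exp (k * t) * lyap a b (flow t P)) has_real_derivative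
    exp (k * t) * ((- (s + 1) + a + k / 2) * (s\<^sup>2 * w\<^sup>2) + (s / 2) * (k - q - 2 * a) * (u * x\<^sup>2)
      + (s / 2 - q / 4 - a / 2 + k / 8) * x ^ 4 + (a * (k - s - 1) + 2 * b) * (s * (x * w))
      + (s * (R - 1) * (a - k / 2) + k * b) * x\<^sup>2)) (at t)"
proof -
  define z where "z = Z (flow t P)"
  note D = flow_x[OF assms(1)] flow_W[OF assms(1)] flow_Z[OF assms(1)]
  have y: "flow t P $ 2 = w + x" "flow t P $ 3 = z + (R - 1)" by (simp_all add: w_def x_def z_def W_def Z_def)
  have "((\<lambda>t. lyap a b (flow t P)) has_real_derivative
      s\<^sup>2 * w * (- (s + 1) * w - x * z) + s / 2 * ((x * (w + x) - q * (z + (R - 1))) * x\<^sup>2 + z * (2 * x * (s * w)))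
      - x ^ 3 / 2 * (s * w) + a * s * (s * w * w + x * (- (s + 1) * w - x * z)) + b * (2 * x * (s * w))) (at t)"
    unfolding lyap_def
    by (rule DERIV_cong[OF DERIV_add[OF DERIV_add[OF DERIV_diff[OF DERIV_add[OF
            DERIV_cdivide[OF DERIV_cmult[OF DERIV_power[OF D(2)]]]
            DERIV_cdivide[OF DERIV_mult[OF DERIV_cmult[OF D(3)] DERIV_power[OF D(1)]]]]
            DERIV_cdivide[OF DERIV_power[OF D(1)]]]
            DERIV_cmult[OF DERIV_mult[OF D(1) D(2)]]] DERIV_cmult[OF DERIV_power[OF D(1)]]]])
       (simp add: y w_def[symmetric] x_def[symmetric] z_def[symmetric] field_simps power2_eq_square power3_eq_cube)
  from exp_weight_derivative[OF this, of k] show ?thesis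
  proof (rule DERIV_cong)
    have su: "s * u = s * z + s * (R - 1) - x\<^sup>2 / 2"
      using s_pos by (simp add: u_def U_def z_def x_def field_simps)
    have "(s / 2) * (k - q - 2 * a) * (u * x\<^sup>2) = (k - q - 2 * a) / 2 * (s * u) * x\<^sup>2" by simp
    also have "\<dots> = (k - q - 2 * a) / 2 * (s * z + s * (R - 1) - x\<^sup>2 / 2) * x\<^sup>2" by (simp only: su)
    finally have e: "(s / 2) * (k - q - 2 * a) * (u * x\<^sup>2) =
        (k - q - 2 * a) / 2 * (s * z + s * (R - 1) - x\<^sup>2 / 2) * x\<^sup>2" .
    have l: "lyap a b (flow t P) = s\<^sup>2 * w\<^sup>2 / 2 + s * z * x\<^sup>2 / 2 - x ^ 4 / 8 + a * s * (x * w) + b * x\<^sup>2"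
      by (simp add: lyap_def w_def x_def z_def)
    show "exp (k * t) * (s\<^sup>2 * w * (- (s + 1) * w - x * z) + s / 2 * ((x * (w + x) - q * (z + (R - 1))) * x\<^sup>2 + z * (2 * x * (s * w)))
      - x ^ 3 / 2 * (s * w) + a * s * (s * w * w + x * (- (s + 1) * w - x * z)) + b * (2 * x * (s * w)) + k * lyap a b (flow t P)) =
      exp (k * t) * ((- (s + 1) + a + k / 2) * (s\<^sup>2 * w\<^sup>2) + (s / 2) * (k - q - 2 * a) * (u * x\<^sup>2)
      + (s / 2 - q / 4 - a / 2 + k / 8) * x ^ 4 + (a * (k - s - 1) + 2 * b) * (s * (x * w))
      + (s * (R - 1) * (a - k / 2) + k * b) * x\<^sup>2)"
      unfolding e l mult_cancel_left
      by (intro disjI2) (simp add: field_simps power2_eq_square power3_eq_cube power4_eq_xxxx)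
  qed
qed

lemma tendsto_state_unst:
  assumes "unst b"
  shows "((\<lambda>t. flow t b $ 1) \<longlongrightarrow> 0) at_bot" "((\<lambda>t. W (flow t b)) \<longlongrightarrow> 0) at_bot"
    "((\<lambda>t. Z (flow t b)) \<longlongrightarrow> - (R - 1)) at_bot"
proof -
  note l = unst_tendsto[OF assms]
  show "((\<lambda>t. flow t b $ 1) \<longlongrightarrow> 0) at_bot" using tendsto_vec_nth[OF l, of 1] by simp
  show "((\<lambda>t. W (flow t b)) \<longlongrightarrow> 0) at_bot" using tendsto_W[OF l] by (simp add: W_def)
  show "((\<lambda>t. Z (flow t b)) \<longlongrightarrow> - (R - 1)) at_bot" using tendsto_Z[OF l] by (simp add: Z_def)
qed

lemma tendsto_lyap_unst:
  assumes "unst p"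
  shows "((\<lambda>t. lyap a b (flow t p)) \<longlongrightarrow> 0) at_bot"
proof -
  note T = tendsto_state_unst[OF assms]
  have "((\<lambda>t. lyap a b (flow t p)) \<longlongrightarrow> s\<^sup>2 * 0\<^sup>2 / 2 + s * (- (R - 1)) * 0\<^sup>2 / 2 - 0 ^ 4 / 8
     + a * s * (0 * 0) + b * 0\<^sup>2) at_bot"
    unfolding lyap_def by (intro tendsto_add tendsto_diff tendsto_divide tendsto_mult tendsto_power tendsto_const T) auto
  then show ?thesis by simp
qed

lemma tendsto_U_unst:
  assumes "unst p"
  shows "((\<lambda>t. U (flow t p)) \<longlongrightarrow> 0) at_bot"
proof -
  note T = tendsto_state_unst[OF assms]
  have "((\<lambda>t. U (flow t p)) \<longlongrightarrow> - (R - 1) + (R - 1) - 0\<^sup>2 / (2 * s)) at_bot"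
    unfolding U_def by (intro tendsto_add tendsto_diff tendsto_divide tendsto_power tendsto_const T) (use s_pos in auto)
  then show ?thesis by simp
qed

lemma unst_functional_nonneg:
  assumes "k > 0" and lim: "(f \<longlongrightarrow> 0) at_bot"
    and D: "\<And>t. t \<le> T \<Longrightarrow> ((\<lambda>t. exp (k * t) * f t) has_real_derivative f' t) (at t)"
    and nn: "\<And>t. t < T \<Longrightarrow> f' t \<ge> 0"
  shows "f T \<ge> 0"
proof -
  have "0 \<le> exp (k * T) * f T"
    by (rule nonneg_derivative_from_at_bot[where f = "\<lambda>t. exp (k * t) * f t" and f' = f' and T = T])
       (use D nn exp_weighted_tendsto_0_at_bot[OF lim assms(1)] DERIV_isCont[OF D[of T]] in auto)
  then show ?thesis by (simp add: zero_le_mult_iff)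
qed

lemma unst_functional_nonpos:
  assumes "k > 0" and lim: "(f \<longlongrightarrow> 0) at_bot"
    and D: "\<And>t. t \<le> T \<Longrightarrow> ((\<lambda>t. exp (k * t) * f t) has_real_derivative f' t) (at t)"
    and nn: "\<And>t. t < T \<Longrightarrow> f' t \<le> 0"
  shows "f T \<le> 0"
proof -
  have "- f T \<ge> 0"
  proof (rule unst_functional_nonneg[OF assms(1), where f = "\<lambda>t. - f t" and f' = "\<lambda>t. - f' t"])
    show "((\<lambda>t. exp (k * t) * - f t) has_real_derivative - f' t) (at t)" if "t \<le> T" for t
      using DERIV_minus[OF D[OF that]] by simp
  qed (use tendsto_minus[OF lim] nn in auto)
  then show ?thesis by simp
qed

lemma U_nonneg_unst:
  assumes "unst p" "q \<le> 2 * s"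
  shows "U (flow t p) \<ge> 0"
proof (rule unst_functional_nonneg[OF q_pos tendsto_U_unst[OF assms(1)]])
  fix v show "((\<lambda>t. exp (q * t) * U (flow t p)) has_real_derivative
      exp (q * v) * (- q * U (flow v p) + (1 - q / (2 * s)) * (flow v p $ 1)\<^sup>2 + q * U (flow v p))) (at v)"
    by (rule exp_weight_derivative[OF flow_U[OF unst_region[OF assms(1)]]])
next
  fix v
  have "0 \<le> (1 - q / (2 * s)) * (flow v p $ 1)\<^sup>2"
    using assms(2) s_pos by (intro mult_nonneg_nonneg) auto
  then show "0 \<le> exp (q * v) * (- q * U (flow v p) + (1 - q / (2 * s)) * (flow v p $ 1)\<^sup>2 + q * U (flow v p))"
    by simp
qed

lemma unst_off: "unst b \<Longrightarrow> off b"
  by (auto simp: unst_def off_def dest!: spec[of _ 0])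

lemma unst_field: "unst b \<Longrightarrow> field b \<noteq> 0"
  using s_pos by (auto simp: unst_def field_zero_iff dest!: spec[of _ 0])

text \<open>Following Leonov, \<open>3 s \<le> 2 q + 1\<close> keeps a Lyapunov function negative along the
  unstable branch, which then cannot reach \<open>x = 0\<close>.\<close>

lemma unst_no_return:
  assumes b: "unst b" and small: "3 * s \<le> 2 * q + 1" and x: "flow T b $ 1 = 0"
  shows False
proof -
  have reg: "flow t b \<in> region" for t by (rule unst_region[OF b])
  have WT: "W (flow T b) \<noteq> 0" using unst_off[OF b] x off_flow[of T b] by (auto simp: off_def simp del: off_flow)
  \<comment> \<open>At a zero of \<open>x\<close> only the term
    \<open>s\<^sup>2 * (W p)\<^sup>2 / 2\<close> survives, whatever the parameters. It remains to
    find one function of the family that is nonpositive along the branch.\<close>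
  have pos: "lyap a c (flow T b) > 0" for a c using x WT s_pos by (simp add: lyap_def)
  have caseV: False
    if k: "k > 0" and c1: "- (s + 1) + a + k / 2 \<le> 0"
      and c2: "k - q - 2 * a \<le> 0 \<and> q \<le> 2 * s \<or> k - q - 2 * a = 0"
      and c3: "s / 2 - q / 4 - a / 2 + k / 8 \<le> 0" and c4: "a * (k - s - 1) + 2 * c = 0"
      and c5: "s * (R - 1) * (a - k / 2) + k * c \<le> 0" for k a c
  proof -
    have "lyap a c (flow T b) \<le> 0"
    proof (rule unst_functional_nonpos[OF k tendsto_lyap_unst[OF b] flow_lyap[OF reg]])
      fix t
      let ?x = "flow t b $ 1" and ?w = "W (flow t b)" and ?u = "U (flow t b)"
      have "(- (s + 1) + a + k / 2) * (s\<^sup>2 * ?w\<^sup>2) \<le> 0" using c1 by (intro mult_nonpos_nonneg) auto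
      moreover have "(s / 2) * (k - q - 2 * a) * (?u * ?x\<^sup>2) \<le> 0"
        using c2
      proof
        assume c: "k - q - 2 * a \<le> 0 \<and> q \<le> 2 * s"
        then have "?u \<ge> 0" using U_nonneg_unst[OF b] by blast
        then show ?thesis using c s_pos by (intro mult_nonpos_nonneg mult_nonneg_nonpos) auto
      qed simp
      moreover have "(s / 2 - q / 4 - a / 2 + k / 8) * ?x ^ 4 \<le> 0" using c3 by (intro mult_nonpos_nonneg) auto
      moreover have "(a * (k - s - 1) + 2 * c) * (s * (?x * ?w)) = 0" using c4 by simp
      moreover have "(s * (R - 1) * (a - k / 2) + k * c) * ?x\<^sup>2 \<le> 0" using c5 by (intro mult_nonpos_nonneg) auto
      ultimately show "exp (k * t) * ((- (s + 1) + a + k / 2) * (s\<^sup>2 * ?w\<^sup>2) + (s / 2) * (k - q - 2 * a) * (?u * ?x\<^sup>2)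
        + (s / 2 - q / 4 - a / 2 + k / 8) * ?x ^ 4 + (a * (k - s - 1) + 2 * c) * (s * (?x * ?w))
        + (s * (R - 1) * (a - k / 2) + k * c) * ?x\<^sup>2) \<le> 0"
        by (intro mult_nonneg_nonpos) auto
    qed
    then show False using pos[of a c] by simp
  qed
  consider "q > 2 * s" | "q \<le> 2 * s" "6 * s \<ge> q + 2" | "q \<le> 2 * s" "6 * s \<le> q + 2" by linarith
  then show False
  proof cases
    case 1
    \<comment> \<open>In this case \<open>U\<close> has no helpful sign. The added term
      \<open>g * U\<^sup>2 / 2\<close> has \<open>g\<close> chosen so that everything in
      \<open>U\<close> and \<open>x\<^sup>2\<close> becomes a negative multiple of the square of
      \<open>U'\<close>; \<open>v\<close> below is \<open>- U'\<close>.\<close>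
    define g where "g = s\<^sup>2 * q / (q - 2 * s)"
    have g: "g > 0" using 1 s_pos q_pos by (simp add: g_def)
    define V where "V t = lyap 0 0 (flow t b) + g * (U (flow t b))\<^sup>2 / 2" for t
    have Vlim: "(V \<longlongrightarrow> 0) at_bot"
    proof -
      have "(V \<longlongrightarrow> 0 + g * 0\<^sup>2 / 2) at_bot"
        unfolding V_def by (intro tendsto_intros tendsto_lyap_unst[OF b] tendsto_U_unst[OF b]) auto
      then show ?thesis by simp
    qed
    define V' where "V' t = (- (s + 1) + 0 + 0 / 2) * (s\<^sup>2 * (W (flow t b))\<^sup>2)
        + (s / 2) * (0 - q - 2 * 0) * (U (flow t b) * (flow t b $ 1)\<^sup>2)
      + (s / 2 - q / 4 - 0 / 2 + 0 / 8) * (flow t b $ 1) ^ 4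
      + g * U (flow t b) * (- q * U (flow t b) + (1 - q / (2 * s)) * (flow t b $ 1)\<^sup>2)" for t
    have VD: "(V has_real_derivative V' t) (at t)" for t
    proof -
      have "((\<lambda>t. lyap 0 0 (flow t b)) has_real_derivative (- (s + 1) + 0 + 0 / 2) * (s\<^sup>2 * (W (flow t b))\<^sup>2)
        + (s / 2) * (0 - q - 2 * 0) * (U (flow t b) * (flow t b $ 1)\<^sup>2)
        + (s / 2 - q / 4 - 0 / 2 + 0 / 8) * (flow t b $ 1) ^ 4) (at t)"
        using flow_lyap[OF reg, of 0 0 0 t] by simp
      moreover have "((\<lambda>t. g * (h t)\<^sup>2 / 2) has_real_derivative g * h t * h') (at t)"
        if "(h has_real_derivative h') (at t)" for h h'
        by (rule DERIV_cong[OF DERIV_cdivide[OF DERIV_cmult[OF DERIV_power[OF that]]]]) simp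
      note this[OF flow_U[OF reg[of t]]]
      ultimately show ?thesis unfolding V_def V'_def by (rule DERIV_add)
    qed
    have Vneg: "V' t \<le> 0" for t
    proof -
      let ?x = "flow t b $ 1" and ?w = "W (flow t b)" and ?u = "U (flow t b)"
      define v where "v = q * ?u + (q / (2 * s) - 1) * ?x\<^sup>2"
      have e: "(s / 2) * (0 - q - 2 * 0) * (?u * ?x\<^sup>2) + (s / 2 - q / 4 - 0 / 2 + 0 / 8) * ?x ^ 4
          + g * ?u * (- q * ?u + (1 - q / (2 * s)) * ?x\<^sup>2) = - (s\<^sup>2 / (q - 2 * s)) * v\<^sup>2"
      proof -
        define d where "d = q - 2 * s"
        have d: "d > 0" "q = d + 2 * s" using 1 by (auto simp: d_def)
        show ?thesis unfolding g_def v_def d_def[symmetric]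
          using d(1) s_pos by (simp add: d(2) field_simps power2_eq_square power4_eq_xxxx)
      qed
      have "(s\<^sup>2 / (q - 2 * s)) * v\<^sup>2 \<ge> 0" using 1 by (intro mult_nonneg_nonneg divide_nonneg_pos) auto
      moreover have "(s + 1) * (s\<^sup>2 * ?w\<^sup>2) \<ge> 0" using s_pos by (intro mult_nonneg_nonneg) auto
      moreover have "V' t = (- (s + 1) + 0 + 0 / 2) * (s\<^sup>2 * ?w\<^sup>2) + - (s\<^sup>2 / (q - 2 * s)) * v\<^sup>2"
        unfolding V'_def using e by linarith
      moreover have "(- (s + 1) + 0 + 0 / 2) * (s\<^sup>2 * ?w\<^sup>2) = - ((s + 1) * (s\<^sup>2 * ?w\<^sup>2))"
        by (simp only: mult_minus_left add_0_right div_0)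
      ultimately show ?thesis by linarith
    qed
    have "0 \<le> - V T"
    proof (rule nonneg_derivative_from_at_bot[where f = "\<lambda>t. - V t" and f' = "\<lambda>t. - V' t" and T = T and l = 0 and t = T])
      show "((\<lambda>t. - V t) has_real_derivative - V' t) (at t)" for t by (rule DERIV_minus[OF VD])
      show "((\<lambda>t. - V t) \<longlongrightarrow> 0) at_bot" using tendsto_minus[OF Vlim] by simp
      show "isCont (\<lambda>t. - V t) T" by (rule DERIV_isCont[OF DERIV_minus[OF VD]])
    qed (use Vneg in auto)
    moreover have "V T > 0" using pos[of 0 0] g by (auto simp: V_def intro: add_pos_nonneg)
    ultimately show False by simp
  next
    case 2
    \<comment> \<open>\<open>k\<close> annihilates the coefficient of \<open>W\<^sup>2\<close>,
      \<open>a\<close> that of \<open>x ^ 4\<close> and \<open>c\<close> that of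
      \<open>x * W\<close>. The coefficient of \<open>U * x\<^sup>2\<close> is nonpositive by
      \<open>6 * s \<ge> q + 2\<close>, that of \<open>x\<^sup>2\<close> by
      \<open>3 * s \<le> 2 * q + 1\<close>.\<close>
    define a where "a = s + (1 - q) / 3"
    define k where "k = 2 * (s + 1 - a)"
    define c where "c = a * (2 * a - s - 1) / 2"
    have a3: "3 * a = 3 * s + 1 - q" by (simp add: a_def)
    have k2: "k = 2 * s + 2 - 2 * a" by (simp add: k_def)
    have a: "a \<ge> 0" using 2 s_pos a3 by linarith
    have k: "k > 0" using q_pos a3 k2 by linarith
    have f: "2 * a - (s + 1) \<le> 0" using small a3 by linarith
    show False
    proof (rule caseV[OF k, of a c])
      show "- (s + 1) + a + k / 2 \<le> 0" using k2 by linarith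
      have "k - q - 2 * a \<le> 0" using 2(2) k2 a3 by linarith
      then show "k - q - 2 * a \<le> 0 \<and> q \<le> 2 * s \<or> k - q - 2 * a = 0" using 2 by blast
      show "s / 2 - q / 4 - a / 2 + k / 8 \<le> 0" using k2 a3 by linarith
      have c2: "2 * c = a * (2 * a - s - 1)" by (simp add: c_def)
      have "k - s - 1 = - (2 * a - s - 1)" using k2 by linarith
      then show "a * (k - s - 1) + 2 * c = 0" by (simp only: c2 mult_minus_right add.left_inverse)
      have kh: "k / 2 = s + 1 - a" using k2 by linarith
      have "k * c = k / 2 * (2 * c)" by simp
      then have "k * c = (s + 1 - a) * (a * (2 * a - s - 1))" unfolding kh c2 .
      then have "s * (R - 1) * (a - k / 2) + k * c = (2 * a - (s + 1)) * (s * (R - 1) + k / 2 * a)"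
        unfolding kh by (simp only: algebra_simps)
      also have "\<dots> \<le> 0" using f a k s_pos R_gt_1 by (intro mult_nonpos_nonneg add_nonneg_nonneg) auto
      finally show "s * (R - 1) * (a - k / 2) + k * c \<le> 0" .
    qed
  next
    case 3
    \<comment> \<open>Here \<open>a\<close> and \<open>k\<close> annihilate the coefficients of
      \<open>W\<^sup>2\<close> and \<open>U * x\<^sup>2\<close>, and \<open>c\<close> that of
      \<open>x * W\<close>; the coefficient of \<open>x ^ 4\<close> is a positive multiple of
      \<open>6 * s - q - 2\<close>.\<close>
    define a where "a = (s + 1 - q / 2) / 2"
    define k where "k = s + 1 + q / 2"
    define c where "c = - (a * q / 4)"
    have k: "k > 0" using q_pos s_pos by (simp add: k_def)
    have a2: "2 * a = s + 1 - q / 2" by (simp add: a_def)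
    have a: "a \<ge> 0" using 3 s_pos a2 by linarith
    show False
    proof (rule caseV[OF k, of a c])
        show "- (s + 1) + a + k / 2 \<le> 0" using k_def a2 by linarith
        have "k - q - 2 * a = 0" using k_def a2 by linarith
        then show "k - q - 2 * a \<le> 0 \<and> q \<le> 2 * s \<or> k - q - 2 * a = 0" by blast
        show "s / 2 - q / 4 - a / 2 + k / 8 \<le> 0" using 3 k_def a2 by linarith
        have "2 * c = - (a * (q / 2))" "k - s - 1 = q / 2" by (simp_all add: c_def k_def)
        then show "a * (k - s - 1) + 2 * c = 0" by simp
        have "a - k / 2 = - (q / 2)" using k_def a2 by linarith
        then have "s * (R - 1) * (a - k / 2) = - (s * (R - 1) * (q / 2))" by (simp only: mult_minus_right)
        moreover have "k * c \<le> 0" using k a q_pos by (simp add: c_def mult_nonneg_nonneg)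
        moreover have "s * (R - 1) * (q / 2) \<ge> 0" using s_pos R_gt_1 q_pos by simp
        ultimately show "s * (R - 1) * (a - k / 2) + k * c \<le> 0" by linarith
    qed
  qed
qed

section \<open>The unstable branch under Condition A\<close>

text \<open>Points that tend to the origin inside the quadrant \<open>x > 0\<close>,
  \<open>W > 0\<close> all leave the ball; a limit of their exit points has its whole past near the
  origin.\<close>

lemma unst_exists: "\<exists>b. unst b"
proof -
  define a :: "nat \<Rightarrow> real ^ 3" where "a n = inverse (real (Suc n)) *\<^sub>R vector [1, 2, 0]" for n
  have ax: "a n $ 1 > 0" "W (a n) > 0" for n
    by (simp_all add: a_def W_def vector_3 field_simps)
  have "a \<longlonglongrightarrow> 0 *\<^sub>R vector [1, 2, 0]"
    unfolding a_def by (intro tendsto_scaleR LIMSEQ_inverse_real_of_nat tendsto_const)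
  then have lim: "a \<longlonglongrightarrow> 0" by simp
  have stay: "dist (flow t 0) 0 < d0" for t
    using flow_equilibrium[OF field_0, of t] zero_trap trap_subset_region d0 by auto
  have leave: "\<exists>t\<ge>0. dist (flow t (a n)) 0 \<ge> d0" for n
  proof (rule ccontr)
    assume stays: "\<not> ?thesis"
    have near: "flow t (a n) \<in> cball 0 d0" if "t \<ge> 0" for t
    proof -
      have "dist (flow t (a n)) 0 < d0" using stays that by (meson not_le)
      then show ?thesis by simp
    qed
    show False by (rule no_forward_stay[OF near]) (use ax[of n] in \<open>auto intro: less_imp_le\<close>)
  qed
  obtain b r T where b: "strict_mono (r :: nat \<Rightarrow> nat)" "(\<lambda>n. flow (T n) (a (r n))) \<longlonglongrightarrow> b" "dist b 0 = d0"
    "\<And>t. t \<le> 0 \<Longrightarrow> dist (flow t b) 0 \<le> d0" "filterlim T at_top sequentially" "\<And>n. T n \<ge> 0"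
    "\<And>n t. 0 \<le> t \<Longrightarrow> t \<le> T n \<Longrightarrow> dist (flow t (a (r n))) 0 \<le> d0"
    by (rule departure[OF lim stay leave], rule that)
  have near: "flow t b \<in> cball 0 d0" if "t \<le> 0" for t using b(4)[OF that] by simp
  have "b \<noteq> 0" using b(3) d0 by auto
  have "(\<lambda>n. flow (T n) (a (r n)) $ 1) \<longlonglongrightarrow> b $ 1" by (rule tendsto_vec_nth[OF b(2)])
  moreover have "flow (T n) (a (r n)) $ 1 > 0" for n
    using quadrant_1[of 0 "T n" "a (r n)" "T n"] b(6,7) ax[of "r n"] by (auto intro: less_imp_le)
  ultimately have "b $ 1 \<ge> 0"
    by (intro LIMSEQ_le_const[of _ "b $ 1" 0]) (auto intro: less_imp_le)
  have "\<not> (\<forall>t\<le>0. flow t b $ 1 < 0 \<and> W (flow t b) < 0)"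
  proof
    assume "\<forall>t\<le>0. flow t b $ 1 < 0 \<and> W (flow t b) < 0"
    from this[rule_format, of 0] \<open>b $ 1 \<ge> 0\<close> show False by simp
  qed
  then have "\<forall>t\<le>0. flow t b $ 1 > 0 \<and> W (flow t b) > 0"
    using backward_near_0[OF near \<open>b \<noteq> 0\<close>] by blast
  then show ?thesis using near by (auto simp: unst_def)
qed

lemma flow_true_derivative:
  "flow t P \<in> region \<Longrightarrow> ((\<lambda>t. flow t P) has_vector_derivative lorenz s q R (flow t P)) (at t)"
  using flow_has_vector_derivative[of P t] by (simp add: trunc_region)

lemma solution_UNIV:
  assumes "\<And>t. flow t b \<in> region"
  shows "solution s q R UNIV (\<lambda>t. flow t b)"
  unfolding solution_def solves_on_def using flow_true_derivative[OF assms] by auto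

text \<open>Positivity of \<open>z\<close> comes from the derivative
  \<open>exp (q * t) * (x * y)\<close> of \<open>exp (q * t) * z\<close> and its limit 0 in the
  past: this gives \<open>z \<ge> 0\<close> one unit of time earlier, and strict growth from
  there.\<close>

lemma unst_solution:
  assumes b: "unst b"
  shows "unstable_branch_solution s q R UNIV (\<lambda>t. flow t b)"
proof -
  have z: "flow t b $ 3 > 0" if "t \<le> 0" for t
  proof -
    have D: "((\<lambda>t. exp (q * t) * flow t b $ 3) has_real_derivative
        exp (q * v) * (flow v b $ 1 * flow v b $ 2 - q * flow v b $ 3 + q * flow v b $ 3)) (at v)" for v
      by (rule exp_weight_derivative[OF flow_z[OF unst_region[OF b]]])
    have pos: "0 < exp (q * v) * (flow v b $ 1 * flow v b $ 2 - q * flow v b $ 3 + q * flow v b $ 3)" if "v \<le> 0" for v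
    proof -
      have "flow v b $ 1 > 0" "W (flow v b) > 0" using b that by (auto simp: unst_def)
      then have "flow v b $ 1 * flow v b $ 2 > 0" by (intro mult_pos_pos) (auto simp: W_def)
      then show ?thesis by simp
    qed
    have "flow (t - 1) b $ 3 \<ge> 0"
    proof (rule unst_functional_nonneg[where f = "\<lambda>t. flow t b $ 3" and T = "t - 1", OF q_pos _ D])
      show "((\<lambda>t. flow t b $ 3) \<longlongrightarrow> 0) at_bot"
        using tendsto_vec_nth[OF unst_tendsto[OF b], of 3] by simp
    qed (use pos that in \<open>auto intro!: less_imp_le\<close>)
    moreover have "exp (q * (t - 1)) * flow (t - 1) b $ 3 < exp (q * t) * flow t b $ 3"
    proof (rule DERIV_pos_imp_increasing[where f = "\<lambda>t. exp (q * t) * flow t b $ 3"])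
      fix v assume "t - 1 \<le> v" "v \<le> t"
      then show "\<exists>y. ((\<lambda>t. exp (q * t) * flow t b $ 3) has_real_derivative y) (at v) \<and> 0 < y"
        using D[of v] pos[of v] that by (meson order_trans)
    qed simp
    moreover have "0 \<le> exp (q * (t - 1)) * flow (t - 1) b $ 3" using calculation(1) by simp
    ultimately have "0 < exp (q * t) * flow t b $ 3" by linarith
    then show ?thesis by (simp add: zero_less_mult_iff)
  qed
  have "\<forall>\<^sub>F t in at_bot. flow t b $ 1 > 0 \<and> flow t b $ 2 > 0 \<and> flow t b $ 3 > 0"
    using eventually_le_at_bot[of 0]
  proof eventually_elim
    case (elim t)
    then have "flow t b $ 1 > 0" "W (flow t b) > 0" using b by (auto simp: unst_def)
    then show ?case using z[OF elim] by (auto simp: W_def)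
  qed
  then show ?thesis
    unfolding unstable_branch_solution_def
    using solution_UNIV[OF unst_region[OF b]] unst_tendsto[OF b] by auto
qed

text \<open>A maximal solution is known to agree with the clamped flow on \<open>J\<close> only. As
  \<open>J\<close> is open, derivatives and sign changes at its points are not affected.\<close>

lemma sign_changes_flow:
  assumes reg: "\<And>t. t \<in> I \<Longrightarrow> flow t b \<in> region" and "off b" "field b \<noteq> 0" "open J" "I \<subseteq> J"
    and p: "\<And>t. t \<in> J \<Longrightarrow> p t = flow t b" "\<And>t. t \<in> J \<Longrightarrow> flow t b \<in> region"
  shows "sign_changes_x' p I = {t \<in> I. W (flow t b) = 0 \<and> Z (flow t b) \<noteq> 0}"
proof -
  have "changes_sign_at (deriv (\<lambda>t. p t $ 1)) t \<longleftrightarrow> W (flow t b) = 0 \<and> Z (flow t b) \<noteq> 0" if "t \<in> I" for t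
  proof -
    have tJ: "t \<in> J" using that assms(5) by auto
    have der: "deriv (\<lambda>t. p t $ 1) u = s * W (flow u b)" if "u \<in> J" for u
    proof -
      have "((\<lambda>t. p t $ 1) has_real_derivative s * W (flow u b)) (at u)"
        by (rule has_field_derivative_transform_within_open[OF flow_x[OF p(2)[OF that]] \<open>open J\<close> that])
           (simp add: p(1))
      then show ?thesis by (rule DERIV_imp_deriv)
    qed
    have evJ: "\<forall>\<^sub>F u in at t within A. u \<in> J" for A
      using \<open>open J\<close> tJ by (meson eventually_at_topological)
    have ev: "\<forall>\<^sub>F u in at t within A. deriv (\<lambda>t. p t $ 1) u = s * W (flow u b)" for A
      using evJ by eventually_elim (rule der)
    have "changes_sign_at (deriv (\<lambda>t. p t $ 1)) t \<longleftrightarrow> changes_sign_at (\<lambda>u. s * W (flow u b)) t"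
    proof -
      have "(\<forall>\<^sub>F u in at t within A. deriv (\<lambda>t. p t $ 1) u < 0) \<longleftrightarrow> (\<forall>\<^sub>F u in at t within A. s * W (flow u b) < 0)"
        "(\<forall>\<^sub>F u in at t within A. deriv (\<lambda>t. p t $ 1) u > 0) \<longleftrightarrow> (\<forall>\<^sub>F u in at t within A. s * W (flow u b) > 0)" for A
        by (rule eventually_subst, rule eventually_mono[OF ev], simp)+
      then show ?thesis unfolding changes_sign_at_def by simp
    qed
    also have "\<dots> \<longleftrightarrow> W (flow t b) = 0 \<and> Z (flow t b) \<noteq> 0"
      using changes_sign_at_W_off[OF reg[OF that] assms(2,3)] changes_sign_at_cmult[OF s_pos] by simp
    finally show ?thesis .
  qed
  then show ?thesis by (auto simp: sign_changes_x'_def)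
qed

text \<open>Of the five sign changes one precedes the first zero \<open>t1\<close> of
  \<open>x\<close> and the other four, collected in \<open>K\<close>, follow it. That
  \<open>x < 0\<close> holds up to the fifth is the condition on the second zero: a return to
  \<open>x = 0\<close> before would be that second zero.\<close>

lemma condition_A_unst:
  assumes A: "condition_A s q R" and b: "unst b"
  obtains \<tau>1 t1 K where "0 < \<tau>1" "\<tau>1 < t1" "W (flow \<tau>1 b) = 0" "Z (flow \<tau>1 b) \<noteq> 0"
    "\<And>t. t < t1 \<Longrightarrow> W (flow t b) = 0 \<Longrightarrow> Z (flow t b) \<noteq> 0 \<Longrightarrow> t = \<tau>1"
    "\<And>t. t < t1 \<Longrightarrow> flow t b $ 1 > 0" "flow t1 b $ 1 = 0" "W (flow t1 b) < 0"
    "finite K" "card K = 4" "\<And>t. t \<in> K \<Longrightarrow> t1 < t \<and> W (flow t b) = 0 \<and> Z (flow t b) \<noteq> 0 \<and>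
        (\<forall>u\<in>{t1<..t}. flow u b $ 1 < 0)"
proof -
  note reg = unst_region[OF b] and off = unst_off[OF b] and fld = unst_field[OF b]
  let ?p = "\<lambda>t. flow t b"
  define N where "N = {t. W (flow t b) = 0 \<and> Z (flow t b) \<noteq> 0}"
  have sc: "sign_changes_x' ?p UNIV = N"
    unfolding N_def using sign_changes_flow[of UNIV b UNIV ?p] reg off fld by auto
  have zx: "zeros_x ?p UNIV = {t. flow t b $ 1 = 0}" by (auto simp: zeros_x_def)
  have pos0: "flow t b $ 1 > 0" "W (flow t b) > 0" if "t \<le> 0" for t using b that by (auto simp: unst_def)
  have sol: "solution s q R UNIV ?p" by (rule solution_UNIV[OF reg])
  have "b = ?p 0" by simp
  then have "b \<in> gamma_plus s q R"
    unfolding gamma_plus_def mem_Collect_eq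
    by (intro exI[of _ UNIV] exI[of _ "\<lambda>t. flow t b"] exI[of _ 0] conjI)
       (use unst_solution[OF b] in simp_all)
  then have C: "\<exists>T\<subseteq>N. card T = 5" "{t. flow t b $ 1 = 0} \<noteq> {}"
    and ord: "\<And>\<tau>1 \<tau>2 \<tau>3 \<tau>4 \<tau>5 t1. first_elements [\<tau>1, \<tau>2, \<tau>3, \<tau>4, \<tau>5] N \<Longrightarrow>
           first_elements [t1] {t. flow t b $ 1 = 0} \<Longrightarrow>
             \<tau>1 < t1 \<and> t1 < \<tau>2 \<and> \<tau>2 < \<tau>3 \<and> \<tau>3 < \<tau>4 \<and> \<tau>4 < \<tau>5 \<and>
             (\<forall>t2. first_elements [t1, t2] {t. flow t b $ 1 = 0} \<longrightarrow> \<tau>5 < t2)"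
    using A[unfolded condition_A_def, rule_format, of UNIV ?p] sol unfolding sc zx by auto
  have N0: "t > 0" if "t \<in> N" for t using pos0(2)[of t] that by (force simp: N_def)
  have fin: "finite (N \<inter> {..B})" for B
  proof (rule finite_subset)
    show "N \<inter> {..B} \<subseteq> {t \<in> {0..B}. W (flow t b) = 0}" using N0 by (auto simp: N_def less_imp_le)
    show "finite {t \<in> {0..B}. W (flow t b) = 0}" by (rule finite_zeros_off[OF reg off fld])
  qed
  obtain T where T: "T \<subseteq> N" "card T = 5" using C(1) by blast
  then have "finite T" by (simp add: card_ge_0_finite)
  obtain us where us: "length us = 5" "first_elements us N"
    using first_elements_exist[OF fin T(1) \<open>finite T\<close> T(2)] by blast
  then obtain \<tau>1 \<tau>2 \<tau>3 \<tau>4 \<tau>5 where us5: "us = [\<tau>1, \<tau>2, \<tau>3, \<tau>4, \<tau>5]"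
    by (auto simp: length_Suc_conv eval_nat_numeral)
  obtain z where z: "flow z b $ 1 = 0" using C(2) by blast
  then have "z > 0" using pos0(1)[of z] by (cases "z > 0") auto
  then obtain t1 where t1: "0 < t1" "flow t1 b $ 1 = 0" "\<forall>v\<in>{0..<t1}. flow v b $ 1 > 0"
    using first_nonpos[OF continuous_on_x[of "{0..z}" b 1], of z] pos0(1)[of 0] z by auto
  have xpos: "flow t b $ 1 > 0" if "t < t1" for t
    using t1(3) pos0(1)[of t] that by (cases "t \<le> 0") auto
  have fe1: "first_elements [t1] {t. flow t b $ 1 = 0}"
  proof -
    have "t1 < v" if "flow v b $ 1 = 0" "v \<noteq> t1" for v
      using xpos[of v] that by (cases "v < t1") auto
    then show ?thesis using t1 by (auto simp: first_elements_def)
  qed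
  note oo = ord[OF us(2)[unfolded us5] fe1]
  have o: "\<tau>1 < t1" "t1 < \<tau>2" "\<tau>2 < \<tau>3" "\<tau>3 < \<tau>4" "\<tau>4 < \<tau>5"
    and o2: "\<And>t2. first_elements [t1, t2] {t. flow t b $ 1 = 0} \<Longrightarrow> \<tau>5 < t2"
    using oo by blast+
  have inN: "\<tau>1 \<in> N" "\<tau>2 \<in> N" "\<tau>3 \<in> N" "\<tau>4 \<in> N" "\<tau>5 \<in> N"
    using us(2) by (auto simp: us5 first_elements_def)
  have others: "\<tau>5 < t" if "t \<in> N" "t \<notin> {\<tau>1, \<tau>2, \<tau>3, \<tau>4, \<tau>5}" for t
    using us(2) that by (auto simp: us5 first_elements_def)
  have only: "t = \<tau>1" if "t < t1" "t \<in> N" for t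
    using others[OF that(2)] that(1) o by (cases "t \<in> {\<tau>1, \<tau>2, \<tau>3, \<tau>4, \<tau>5}") auto
  have Wn: "W (flow t1 b) \<noteq> 0" using off off_flow[of t1 b] t1(2) by (auto simp: off_def simp del: off_flow)
  have Wt1: "W (flow t1 b) < 0"
  proof (rule ccontr)
    assume "\<not> W (flow t1 b) < 0"
    then have "W (flow t1 b) > 0" using Wn by simp
    then obtain e where e: "e > 0" "\<And>h. 0 < h \<Longrightarrow> h < e \<Longrightarrow> flow (t1 - h) b $ 1 < 0"
      using x_zero_crossing(2)[OF reg t1(2)] by blast
    have "0 < e / 2" "e / 2 < e" using e(1) by auto
    from e(2)[OF this] xpos[of "t1 - e / 2"] e(1) show False by auto
  qed
  obtain e where e: "e > 0" "\<And>h. 0 < h \<Longrightarrow> h < e \<Longrightarrow> flow (t1 + h) b $ 1 < 0"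
    using x_zero_crossing(1)[OF reg t1(2) Wt1] by blast
  have xneg: "flow u b $ 1 < 0" if u: "t1 < u" "u \<le> \<tau>5" for u
  proof (rule ccontr)
    assume n: "\<not> flow u b $ 1 < 0"
    define h where "h = min e (u - t1) / 2"
    have h: "0 < h" "h < e" "t1 + h < u" using e u by (auto simp: h_def min_def field_simps)
    have "continuous_on {t1 + h..u} (\<lambda>t. - flow t b $ 1)" by (intro continuous_on_minus continuous_on_x)
    then obtain t2 where t2: "t1 + h < t2" "t2 \<le> u" "flow t2 b $ 1 = 0" "\<forall>v\<in>{t1 + h..<t2}. flow v b $ 1 < 0"
      using first_nonpos[of "t1 + h" u "\<lambda>t. - flow t b $ 1" u] e(2)[of h] h n by auto
    have btw: "flow v b $ 1 < 0" if "t1 < v" "v < t2" for v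
      using t2(4) e(2)[of "v - t1"] that h by (cases "v < t1 + h") auto
    have "first_elements [t1, t2] {t. flow t b $ 1 = 0}"
      unfolding first_elements_def
    proof (intro conjI ballI)
      fix v w assume v: "v \<in> {t. flow t b $ 1 = 0} - set [t1, t2]" and w: "w \<in> set [t1, t2]"
      have "\<not> v < t1" using xpos[of v] v by auto
      moreover have "\<not> (t1 < v \<and> v < t2)" using btw[of v] v by auto
      ultimately have "v > t2" using v by auto
      then show "w < v" using w t2(1) h by auto
    qed (use t1 t2 h in auto)
    then show False using o2[of t2] t2 u by auto
  qed
  show ?thesis
  proof (rule that[of \<tau>1 t1 "{\<tau>2, \<tau>3, \<tau>4, \<tau>5}"])
    show "card {\<tau>2, \<tau>3, \<tau>4, \<tau>5} = 4" using o by simp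
    show "t1 < t \<and> W (flow t b) = 0 \<and> Z (flow t b) \<noteq> 0 \<and> (\<forall>u\<in>{t1<..t}. flow u b $ 1 < 0)"
      if "t \<in> {\<tau>2, \<tau>3, \<tau>4, \<tau>5}" for t
    proof -
      have "t1 < t" "t \<le> \<tau>5" "t \<in> N" using that o inN by auto
      then show ?thesis using xneg by (simp add: N_def)
    qed
    show "t = \<tau>1" if "t < t1" "W (flow t b) = 0" "Z (flow t b) \<noteq> 0" for t
      using only[of t] that by (simp add: N_def)
    show "W (flow \<tau>1 b) = 0" "Z (flow \<tau>1 b) \<noteq> 0" using inN(1) by (simp_all add: N_def)
  qed (use N0[OF inN(1)] o(1) xpos t1(2) Wt1 in simp_all)
qed

text \<open>A negative \<open>Z\<close> would make \<open>W\<close> cross upward, although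
  \<open>W > 0\<close> before \<open>T\<close>. For \<open>Z = 0\<close>, the bound
  \<open>x \<le> c\<close> up to time \<open>T\<close> bounds \<open>U\<close> by the equilibrium
  value of its linear equation, which amounts to \<open>c\<^sup>2 \<ge> q * (R - 1)\<close>; then
  the tangency is a maximum of \<open>W\<close> and again \<open>W < 0\<close> just before.\<close>

lemma unst_first_turn:
  assumes b: "unst b" and "q \<le> 2 * s" and T: "0 < T" "W (flow T b) = 0"
    and before: "\<And>t. t < T \<Longrightarrow> W (flow t b) > 0"
  shows "Z (flow T b) > 0"
proof -
  note reg = unst_region[OF b]
  have xm: "flow u b $ 1 \<le> flow v b $ 1" if "u \<le> v" "v \<le> T" for u v
    using that before T(2) by (intro x_mono reg) (metis less_eq_real_def order_trans)+
  have xT: "flow T b $ 1 > 0" using xm[of 0 T] b T by (auto simp: unst_def dest!: spec[of _ 0])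
  have Znz: "Z (flow T b) \<noteq> 0"
  proof
    assume Z0: "Z (flow T b) = 0"
    define c where "c = flow T b $ 1"
    define \<beta> where "\<beta> = 1 - q / (2 * s)"
    have \<beta>: "\<beta> \<ge> 0" using assms(2) s_pos by (simp add: \<beta>_def)
    have "U (flow T b) - \<beta> * c\<^sup>2 / q \<le> 0"
    proof -
      have "exp (q * T) * (U (flow T b) - \<beta> * c\<^sup>2 / q) \<le> 0"
      proof -
        have D: "((\<lambda>t. exp (q * t) * (U (flow t b) - \<beta> * c\<^sup>2 / q)) has_real_derivative
            exp (q * t) * ((- q * U (flow t b) + \<beta> * (flow t b $ 1)\<^sup>2 - 0) + q * (U (flow t b) - \<beta> * c\<^sup>2 / q))) (at t)" for t
          unfolding \<beta>_def by (rule exp_weight_derivative[OF DERIV_diff[OF flow_U[OF reg] DERIV_const]])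
        have "0 \<le> - (exp (q * T) * (U (flow T b) - \<beta> * c\<^sup>2 / q))"
        proof (rule nonneg_derivative_from_at_bot[where T = T and t = T, OF DERIV_minus[OF D]])
          fix t assume "t < T"
          then have xx: "0 < flow t b $ 1" "flow t b $ 1 \<le> c"
            using xm[of t T] xm[of 0 t] b by (auto simp: c_def unst_def intro: less_le_trans)
              (metis b less_le_trans linorder_le_cases unst_def xm less_imp_le)
          then have "(flow t b $ 1)\<^sup>2 \<le> c\<^sup>2" by (intro power_mono) auto
          then have "\<beta> * (flow t b $ 1)\<^sup>2 \<le> \<beta> * c\<^sup>2" using \<beta> by (rule mult_left_mono)
          moreover have "(- q * U (flow t b) + \<beta> * (flow t b $ 1)\<^sup>2 - 0) + q * (U (flow t b) - \<beta> * c\<^sup>2 / q)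
              = \<beta> * (flow t b $ 1)\<^sup>2 - \<beta> * c\<^sup>2" using q_pos by (simp add: field_simps)
          ultimately have "(- q * U (flow t b) + \<beta> * (flow t b $ 1)\<^sup>2 - 0) + q * (U (flow t b) - \<beta> * c\<^sup>2 / q) \<le> 0" by linarith
          then show "0 \<le> - (exp (q * t) * ((- q * U (flow t b) + \<beta> * (flow t b $ 1)\<^sup>2 - 0) + q * (U (flow t b) - \<beta> * c\<^sup>2 / q)))"
            by (simp add: mult_nonneg_nonpos)
        next
          have "filterlim (\<lambda>t. q * t) at_bot at_bot"
            using q_pos by (simp add: filterlim_tendsto_pos_mult_at_bot[OF tendsto_const] filterlim_ident)
          then have "((\<lambda>t. exp (q * t)) \<longlongrightarrow> 0) at_bot" by (rule filterlim_compose[OF exp_at_bot])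
          then have "((\<lambda>t. - (exp (q * t) * (U (flow t b) - \<beta> * c\<^sup>2 / q))) \<longlongrightarrow> - (0 * (0 - \<beta> * c\<^sup>2 / q))) at_bot"
            by (intro tendsto_minus tendsto_mult tendsto_diff tendsto_const tendsto_U_unst[OF b])
          then show "((\<lambda>t. - (exp (q * t) * (U (flow t b) - \<beta> * c\<^sup>2 / q))) \<longlongrightarrow> 0) at_bot" by simp
          show "isCont (\<lambda>t. - (exp (q * t) * (U (flow t b) - \<beta> * c\<^sup>2 / q))) T"
            by (rule DERIV_isCont[OF DERIV_minus[OF D]])
        qed simp
        then show ?thesis by simp
      qed
      then show ?thesis by (simp add: mult_le_0_iff)
    qed
    moreover have "U (flow T b) = (R - 1) - c\<^sup>2 / (2 * s)" using Z0 by (simp add: U_def c_def)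
    moreover have "\<beta> * c\<^sup>2 / q = c\<^sup>2 / q - c\<^sup>2 / (2 * s)" using q_pos s_pos by (simp add: \<beta>_def field_simps)
    ultimately have "R - 1 \<le> c\<^sup>2 / q" by linarith
    then have "q * (R - 1) \<le> c\<^sup>2" using q_pos by (simp add: field_simps)
    moreover have "c\<^sup>2 \<noteq> q * (R - 1)"
      using field_nonzero_x[of "flow T b"] flow_eq_equilibriumD[OF _ reg] unst_field[OF b] T(2) Z0 by (metis c_def)
    ultimately have "0 < flow T b $ 1 * ((flow T b $ 1)\<^sup>2 - q * (R - 1))"
      using xT by (intro mult_pos_pos) (auto simp: c_def)
    then obtain e where e: "e > 0" "\<And>h. 0 < h \<Longrightarrow> h < e \<Longrightarrow> W (flow (T - h) b) < 0"
      using W_touching(1)[OF reg T(2) Z0] by blast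
    have "0 < e / 2" "e / 2 < e" using e(1) by auto
    from e(2)[OF this] before[of "T - e / 2"] e(1) show False by auto
  qed
  show ?thesis
  proof (rule ccontr)
    assume "\<not> Z (flow T b) > 0"
    then have "flow T b $ 1 * Z (flow T b) < 0" using Znz xT by (simp add: mult_pos_neg)
    then obtain e where e: "e > 0" "\<And>h. 0 < h \<Longrightarrow> h < e \<Longrightarrow> W (flow (T - h) b) < 0"
      using W_crossing(1)[OF reg T(2)] by blast
    have "0 < e / 2" "e / 2 < e" using e(1) by auto
    from e(2)[OF this] before[of "T - e / 2"] e(1) show False by auto
  qed
qed

text \<open>On \<open>W = 0\<close>, \<open>x > 0\<close> this says that the Lyapunov function used
  for the unstable branch is nonnegative. For \<open>x\<^sup>2 > q * (R - 1)\<close> it is also what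
  makes the function in \<open>no_tangency\<close> start nonnegative. Its left side is convex in
  \<open>x\<close>, so it passes from the crossing point to the segment.\<close>

definition steep :: "real ^ 3 \<Rightarrow> bool" where
  "steep P \<longleftrightarrow> (P $ 1)\<^sup>2 - q * (R - 1) \<le> 4 * s * Z P"

lemma unst_turn_steep:
  assumes b: "unst b" and big: "3 * s > 2 * q + 1" and T: "W (flow T b) = 0" "flow T b $ 1 > 0"
    and before: "\<And>t. t < T \<Longrightarrow> W (flow t b) > 0 \<and> flow t b $ 1 > 0"
  shows "steep (flow T b)"
proof -
  \<comment> \<open>These values annihilate the coefficients of \<open>U * x\<^sup>2\<close>,
    \<open>x ^ 4\<close> and \<open>x\<^sup>2\<close>; those of \<open>W\<^sup>2\<close> and
    \<open>x * W\<close> are nonnegative by \<open>big\<close>, and \<open>x * W > 0\<close> before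
    the turn.\<close>
  define a k c where "a = 2 * s - q / 2" and "k = 4 * s" and "c = q * (R - 1) / 8"
  have k: "k > 0" using s_pos by (simp add: k_def)
  have "lyap a c (flow T b) \<ge> 0"
  proof (rule unst_functional_nonneg[OF k tendsto_lyap_unst[OF b] flow_lyap[OF unst_region[OF b]]])
    fix t assume t: "t < T"
    let ?x = "flow t b $ 1" and ?w = "W (flow t b)" and ?u = "U (flow t b)"
    have "(- (s + 1) + a + k / 2) * (s\<^sup>2 * ?w\<^sup>2) \<ge> 0"
      using big q_pos by (intro mult_nonneg_nonneg) (auto simp: a_def k_def field_simps)
    moreover have "(s / 2) * (k - q - 2 * a) * (?u * ?x\<^sup>2) = 0" by (simp add: a_def k_def)
    moreover have "(s / 2 - q / 4 - a / 2 + k / 8) * ?x ^ 4 = 0" by (simp add: a_def k_def field_simps)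
    moreover have "(a * (k - s - 1) + 2 * c) * (s * (?x * ?w)) \<ge> 0"
    proof -
      have "a \<ge> 0" "k - s - 1 \<ge> 0" "c \<ge> 0" using big q_pos R_gt_1 by (auto simp: a_def k_def c_def)
      then show ?thesis using before[OF t] s_pos by (intro mult_nonneg_nonneg add_nonneg_nonneg) auto
    qed
    moreover have "(s * (R - 1) * (a - k / 2) + k * c) * ?x\<^sup>2 = 0" by (simp add: a_def k_def c_def field_simps)
    ultimately show "0 \<le> exp (k * t) * ((- (s + 1) + a + k / 2) * (s\<^sup>2 * ?w\<^sup>2) + (s / 2) * (k - q - 2 * a) * (?u * ?x\<^sup>2)
        + (s / 2 - q / 4 - a / 2 + k / 8) * ?x ^ 4 + (a * (k - s - 1) + 2 * c) * (s * (?x * ?w))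
        + (s * (R - 1) * (a - k / 2) + k * c) * ?x\<^sup>2)"
      by (intro mult_nonneg_nonneg) auto
  qed
  moreover have "lyap a c (flow T b) = (flow T b $ 1)\<^sup>2 / 8 * (4 * s * Z (flow T b) - (flow T b $ 1)\<^sup>2 + q * (R - 1))"
    using T by (simp add: lyap_def c_def field_simps power2_eq_square power4_eq_xxxx)
  ultimately have "0 \<le> (flow T b $ 1)\<^sup>2 / 8 * (4 * s * Z (flow T b) - (flow T b $ 1)\<^sup>2 + q * (R - 1))" by simp
  moreover have "(flow T b $ 1)\<^sup>2 / 8 > 0" using T by simp
  ultimately have "0 \<le> 4 * s * Z (flow T b) - (flow T b $ 1)\<^sup>2 + q * (R - 1)"
    by (metis less_le_not_le mult_pos_neg not_le)
  then show ?thesis by (simp add: steep_def)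
qed

subsection \<open>No tangency with the plane \<open>x = y\<close> on the way down\<close>

text \<open>A tangency that ends a stretch with \<open>W < 0\<close> is a maximum of
  \<open>W\<close>, so \<open>X T > 0\<close>, and since \<open>x\<close> decreases,
  \<open>X > 0\<close> on the whole stretch. With the weight \<open>exp ((s + 1) * t)\<close> the
  function \<open>V\<close> does not decrease, yet it leads from \<open>V 0 \<ge> 0\<close>, by
  steepness, to \<open>V T = - (X T)\<^sup>2 / 8\<close>.\<close>

lemma no_tangency:
  assumes big: "3 * s > 2 * q + 1" and reg: "\<And>t. 0 \<le> t \<Longrightarrow> t \<le> T \<Longrightarrow> flow t P \<in> region"
    and P: "W P = 0" "steep P" "field P \<noteq> 0" and T: "0 < T" "W (flow T P) = 0"
    and neg: "\<And>t. 0 < t \<Longrightarrow> t < T \<Longrightarrow> W (flow t P) < 0"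
    and x: "\<And>t. 0 \<le> t \<Longrightarrow> t \<le> T \<Longrightarrow> flow t P $ 1 > 0"
  shows "Z (flow T P) \<noteq> 0"
proof
  assume Z0: "Z (flow T P) = 0"
  define X0 where "X0 = q * (R - 1)"
  define X where "X t = (flow t P $ 1)\<^sup>2 - X0" for t
  \<comment> \<open>A variant of \<open>lyap\<close> centred at the equilibrium:
    \<open>x\<^sup>2\<close> is replaced by \<open>X\<close>, and in the mixed term \<open>x\<close>
    is replaced by \<open>X / x\<close>.\<close>
  define V where "V t = s\<^sup>2 * (W (flow t P))\<^sup>2 / 2 - (X t)\<^sup>2 / 8 + s * (Z (flow t P) * X t) / 2
     + (s + 1) * s * ((flow t P $ 1 - X0 / (flow t P $ 1)) * W (flow t P)) / 2" for t
  define \<beta> where "\<beta> = 1 - q / (2 * s)"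
  define y where "y t = U (flow t P) - (R - 1) * \<beta>" for t
  have X0p: "X0 > 0" using X0_pos by (simp add: X0_def)
  have rT: "flow T P \<in> region" using reg T by simp
  have xT: "flow T P $ 1 > 0" using x T by simp
  have "X T > 0"
  proof (rule ccontr)
    assume n: "\<not> X T > 0"
    have "field (flow T P) \<noteq> 0" using flow_eq_equilibriumD[OF _ rT] P(3) by auto
    then have "X T \<noteq> 0" using field_nonzero_x T(2) Z0 by (auto simp: X_def X0_def)
    then have "flow T P $ 1 * ((flow T P $ 1)\<^sup>2 - q * (R - 1)) < 0"
      using n xT by (intro mult_pos_neg) (auto simp: X_def X0_def)
    then obtain e where e: "e > 0" "\<And>h. 0 < h \<Longrightarrow> h < e \<Longrightarrow> 0 < W (flow (T - h) P)"
      using W_touching(2)[OF rT T(2) Z0] by blast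
    define h where "h = min e T / 2"
    have h: "0 < h" "h < e" "h < T" using e T by (auto simp: h_def min_def)
    show False using e(2)[OF h(1,2)] neg[of "T - h"] h by simp
  qed
  have W0: "W (flow t P) \<le> 0" if "0 \<le> t" "t \<le> T" for t
    using neg[of t] that T P by (cases "t = 0 \<or> t = T") (auto intro: less_imp_le)
  have Xpos: "X t > 0" if t: "0 \<le> t" "t \<le> T" for t
  proof -
    have "flow T P $ 1 \<le> flow t P $ 1" using t by (intro x_antimono reg W0) auto
    then have "(flow T P $ 1)\<^sup>2 \<le> (flow t P $ 1)\<^sup>2" using xT by (intro power_mono) auto
    then show ?thesis using \<open>X T > 0\<close> by (simp add: X_def)
  qed
  have \<beta>: "\<beta> > 0" using big s_pos q_pos by (simp add: \<beta>_def field_simps)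
  have Zy: "Z (flow t P) = y t + X t / (2 * s)" for t
    using s_pos by (simp add: y_def U_def X_def X0_def \<beta>_def field_simps)
  \<comment> \<open>\<open>y' + q * y = \<beta> * X > 0\<close>, so the weighted \<open>y\<close>
    increases towards its value at \<open>T\<close>, where \<open>Z = 0\<close> gives
    \<open>y T = - X T / (2 * s)\<close>.\<close>
  have yneg: "y t < 0" if t: "0 \<le> t" "t \<le> T" for t
  proof -
    have "exp (q * t) * y t \<le> exp (q * T) * y T"
    proof (rule DERIV_nonneg_imp_nondecreasing[OF t(2)])
      fix u assume u: "t \<le> u" "u \<le> T"
      have r: "flow u P \<in> region" using reg u t by simp
      have "((\<lambda>t. exp (q * t) * y t) has_real_derivative
          exp (q * u) * ((- q * U (flow u P) + \<beta> * (flow u P $ 1)\<^sup>2 - 0) + q * y u)) (at u)"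
        unfolding y_def \<beta>_def by (rule exp_weight_derivative[OF DERIV_diff[OF flow_U[OF r] DERIV_const]])
      moreover have "(- q * U (flow u P) + \<beta> * (flow u P $ 1)\<^sup>2 - 0) + q * y u = \<beta> * X u"
        by (simp add: y_def X_def X0_def algebra_simps)
      moreover have "0 \<le> exp (q * u) * (\<beta> * X u)" using Xpos[of u] u t \<beta> by (simp add: less_imp_le)
      ultimately show "\<exists>d. ((\<lambda>t. exp (q * t) * y t) has_real_derivative d) (at u) \<and> 0 \<le> d"
        by metis
    qed
    also have "\<dots> < 0"
    proof -
      have "y T = - (X T / (2 * s))" using Zy[of T] Z0 by linarith
      then have "y T < 0" using \<open>X T > 0\<close> s_pos by simp
      then show ?thesis by (simp add: mult_pos_neg)
    qed
    finally show ?thesis by (simp add: mult_less_0_iff)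
  qed
  have "exp ((s + 1) * 0) * V 0 \<le> exp ((s + 1) * T) * V T"
  proof (rule DERIV_nonneg_imp_nondecreasing[where f = "\<lambda>t. exp ((s + 1) * t) * V t"])
    fix t assume t: "0 \<le> t" "t \<le> T"
    have r: "flow t P \<in> region" using reg t by simp
    note D = flow_x[OF r] flow_W[OF r] flow_Z[OF r]
    define a where "a = flow t P $ 1"
    define w where "w = W (flow t P)"
    define z where "z = Z (flow t P)"
    define m where "m = a - X0 / a"
    define n where "n = 1 + X0 / a\<^sup>2"
    have a: "a > 0" using x[OF t] by (simp add: a_def)
    have ma: "m * a = X t" using a by (simp add: m_def X_def a_def[symmetric] field_simps power2_eq_square)
    have yz: "flow t P $ 2 = w + a" "flow t P $ 3 = z + (R - 1)" by (simp_all add: w_def a_def z_def W_def Z_def)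
    have zd: "flow t P $ 1 * flow t P $ 2 - q * flow t P $ 3 = X t + a * w - q * z"
      unfolding yz by (simp add: X_def X0_def a_def[symmetric] power2_eq_square algebra_simps)
    have DZ: "((\<lambda>t. Z (flow t P)) has_real_derivative X t + a * w - q * z) (at t)"
      using D(3) unfolding zd .
    have DX: "(X has_real_derivative 2 * a * (s * w)) (at t)"
      unfolding X_def by (rule DERIV_cong[OF DERIV_diff[OF DERIV_power[OF D(1)] DERIV_const]])
        (simp add: a_def w_def)
    have Dm: "((\<lambda>t. flow t P $ 1 - X0 / (flow t P $ 1)) has_real_derivative n * (s * w)) (at t)"
      by (rule DERIV_cong[OF DERIV_diff[OF D(1) DERIV_divide[OF DERIV_const D(1)]]])
         (use a in \<open>simp_all add: a_def[symmetric] w_def[symmetric] n_def power2_eq_square field_simps\<close>)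
    define V' where "V' = s\<^sup>2 * w * (- (s + 1) * w - a * z) - X t * (a * s * w) / 2
        + s * ((X t + a * w - q * z) * X t + z * (2 * a * (s * w))) / 2
        + (s + 1) * s * (n * (s * w) * w + m * (- (s + 1) * w - a * z)) / 2"
    have DV: "(V has_real_derivative V') (at t)"
      unfolding V_def V'_def
      by (rule DERIV_cong[OF DERIV_add[OF DERIV_add[OF DERIV_diff[OF
            DERIV_cdivide[OF DERIV_cmult[OF DERIV_power[OF D(2)]]]
            DERIV_cdivide[OF DERIV_power[OF DX]]]
            DERIV_cdivide[OF DERIV_cmult[OF DERIV_mult[OF DZ DX]]]]
            DERIV_cdivide[OF DERIV_cmult[OF DERIV_mult[OF Dm D(2)]]]]])
         (simp add: a_def[symmetric] w_def[symmetric] z_def[symmetric] m_def[symmetric] field_simps)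
    \<comment> \<open>The terms with \<open>z\<close> combine to \<open>X * y\<close>, whose sign is
      known, and the assumption on \<open>s\<close> and \<open>q\<close> appears as the coefficient
      of \<open>(X t)\<^sup>2\<close>.\<close>
    have eq: "V' + (s + 1) * V t = s\<^sup>2 * w\<^sup>2 * ((s + 1) * (n - 1) / 2) - s * q / 2 * (X t * y t)
        + (X t)\<^sup>2 * (3 * s - 2 * q - 1) / 8"
    proof -
      have 1: "m * (- (s + 1) * w - a * z) = - (s + 1) * (m * w) - X t * z"
        using ma by (simp add: algebra_simps)
      have 2: "s * y t = s * z - X t / 2"
        using Zy[of t] s_pos by (simp add: z_def field_simps)
      have "s * q / 2 * (X t * y t) = q / 2 * X t * (s * y t)" by simp
      also have "\<dots> = q / 2 * X t * (s * z - X t / 2)" by (simp only: 2)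
      finally have 3: "s * q / 2 * (X t * y t) = q / 2 * X t * (s * z - X t / 2)" .
      have 4: "V t = s\<^sup>2 * w\<^sup>2 / 2 - (X t)\<^sup>2 / 8 + s * (z * X t) / 2 + (s + 1) * s * (m * w) / 2"
        by (simp add: V_def w_def z_def a_def m_def)
      show ?thesis unfolding V'_def 1 3 4
        by (simp add: field_simps power2_eq_square)
    qed
    have "V' + (s + 1) * V t \<ge> 0"
    proof -
      have "n - 1 > 0" using X0p a by (simp add: n_def)
      then have "s\<^sup>2 * w\<^sup>2 * ((s + 1) * (n - 1) / 2) \<ge> 0" using s_pos by simp
      moreover have "X t * y t \<le> 0" using Xpos[OF t] yneg[OF t] by (simp add: mult_nonneg_nonpos)
      then have "s * q / 2 * (X t * y t) \<le> 0" using s_pos q_pos by (simp add: mult_nonneg_nonpos)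
      moreover have "(X t)\<^sup>2 * (3 * s - 2 * q - 1) / 8 \<ge> 0" using big by simp
      ultimately show ?thesis unfolding eq by linarith
    qed
    then have "0 \<le> exp ((s + 1) * t) * (V' + (s + 1) * V t)" by simp
    then show "\<exists>d. ((\<lambda>t. exp ((s + 1) * t) * V t) has_real_derivative d) (at t) \<and> 0 \<le> d"
      using exp_weight_derivative[OF DV] by blast
  qed (use T in simp)
  moreover have "V 0 \<ge> 0"
  proof -
    have "V 0 = X 0 / 8 * (4 * s * Z P - X 0)"
      using P(1) by (simp add: V_def field_simps power2_eq_square)
    moreover have "4 * s * Z P - X 0 \<ge> 0" using P(2) by (simp add: steep_def X_def X0_def)
    moreover have "X 0 / 8 * (4 * s * Z P - X 0) \<ge> 0"
      using Xpos[of 0] T calculation(2) by (intro mult_nonneg_nonneg) auto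
    ultimately show ?thesis by simp
  qed
  moreover have "V T < 0"
    using T(2) Z0 \<open>X T > 0\<close> by (simp add: V_def)
  then have "exp ((s + 1) * T) * V T < 0" by (simp add: mult_pos_neg)
  ultimately show False by simp
qed

lemma many_0 [simp]: "many 0 P"
  unfolding many_def by (intro exI[of _ "{}"]) auto

subsection \<open>Leaving a neighbourhood of the equilibrium\<close>

text \<open>Small enough for \<open>x > 0\<close> on the ball: an orbit inside makes no return, and
  \<open>p0 q R\<close> is the only equilibrium there.\<close>

definition d1 :: real where "d1 = min 1 (sqrt (q * (R - 1)) / 2)"

lemma d1: "d1 > 0" "d1 \<le> 1" "d1 < sqrt (q * (R - 1))"
  using X0_pos by (auto simp: d1_def min_less_iff_disj)

lemma near_p0:
  assumes "p \<in> cball (p0 q R) d1"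
  shows "p \<in> region" "p \<in> trap" "p $ 1 > 0"
proof -
  show "p \<in> trap" using assms cball_p0_trap d1 by (auto simp: subset_iff)
  then show "p \<in> region" using trap_subset_region by blast
  have "\<bar>(p0 q R - p) $ 1\<bar> \<le> d1"
    using component_le_norm_cart[of "p0 q R - p" 1] assms by (simp add: dist_norm)
  then show "p $ 1 > 0" using d1 by simp
qed

lemma eq_at_near_p0:
  assumes "eq_at l \<in> cball (p0 q R) d1" "l = 0 \<or> l\<^sup>2 = q * (R - 1)"
  shows "eq_at l = p0 q R"
proof -
  have pos: "eq_at l $ 1 > 0" using near_p0(3)[OF assms(1)] .
  then have "l > 0" by (auto simp: eq_at_def vector_3 split: if_splits)
  then have "l = sqrt (q * (R - 1))" using assms(2) by (metis less_irrefl real_sqrt_unique less_imp_le)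
  then show ?thesis using \<open>l > 0\<close> by (intro vec3_eqI) (auto simp: eq_at_def vector_3)
qed

lemma equilibrium_near_p0:
  assumes "p \<in> cball (p0 q R) d1" "field p = 0"
  shows "p = p0 q R"
proof -
  have x: "p $ 1 > 0" using near_p0(3)[OF assms(1)] .
  have "W p = 0" "Z p = 0" "p $ 1 * p $ 2 = q * p $ 3" using assms(2) x by (auto simp: field_zero_iff)
  then have c: "p $ 2 = p $ 1" "p $ 3 = R - 1" "(p $ 1)\<^sup>2 = q * (R - 1)" by (auto simp: W_def Z_def power2_eq_square)
  then have "p $ 1 = sqrt (q * (R - 1))" using x by (metis less_imp_le real_sqrt_unique)
  then show ?thesis using c by (intro vec3_eqI) auto
qed

text \<open>A backward orbit cannot approach the equilibrium monotonically in \<open>x\<close>: if \<open>W \<ge> 0\<close>, then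
  \<open>x\<^sup>2 - q (R - 1)\<close>, hence \<open>U - (R - 1) (1 - q / (2 s))\<close>, hence \<open>Z\<close> are nonnegative, which makes
  \<open>W\<close> nonpositive.\<close>

lemma monotone_departure_impossible:
  assumes "q \<le> 2 * s" and near: "\<And>t. t \<le> T \<Longrightarrow> flow t b \<in> cball (p0 q R) d1"
    and sgn: "\<sigma> = 1 \<or> \<sigma> = - 1" "\<And>t. t \<le> T \<Longrightarrow> \<sigma> * W (flow t b) \<ge> 0"
  shows "W (flow T b) = 0"
proof -
  have reg: "flow t b \<in> region" and xp: "flow t b $ 1 > 0" if "t \<le> T" for t
    using near_p0[OF near[OF that]] by auto
  define X0 where "X0 = q * (R - 1)"
  have mono: "\<sigma> * flow u b $ 1 \<le> \<sigma> * flow v b $ 1" if "u \<le> v" "v \<le> T" for u v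
    using sgn(1)
  proof
    assume "\<sigma> = 1"
    then show ?thesis using x_mono[of u v b] reg sgn(2) that by auto
  next
    assume "\<sigma> = - 1"
    then show ?thesis using x_antimono[of u v b] reg sgn(2) that by auto
  qed
  have "\<exists>l. ((\<lambda>u. - (\<sigma> * (flow (- 1 * u) b $ 1))) \<longlongrightarrow> l) at_top \<and> (\<forall>u\<ge>- T. - (\<sigma> * (flow (- 1 * u) b $ 1)) \<le> l)"
  proof (rule mono_bounded_tendsto_at_top)
    fix u v :: real assume "- T \<le> u" "u \<le> v"
    then show "- (\<sigma> * (flow (- 1 * u) b $ 1)) \<le> - (\<sigma> * (flow (- 1 * v) b $ 1))"
      using mono[of "- v" "- u"] by simp
  next
    fix u :: real assume "- T \<le> u"
    then have "\<bar>flow (- u) b $ 1\<bar> \<le> rho" using reg[of "- u"] by (auto simp: region_def less_imp_le)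
    then show "- (\<sigma> * (flow (- 1 * u) b $ 1)) \<le> rho" using sgn(1) by auto
  qed
  then obtain l where l: "((\<lambda>u. - (\<sigma> * (flow (- 1 * u) b $ 1))) \<longlongrightarrow> l) at_top"
    "\<And>u. u \<ge> - T \<Longrightarrow> - (\<sigma> * (flow (- 1 * u) b $ 1)) \<le> l" by blast
  have sl: "((\<lambda>u. flow (- 1 * u) b $ 1) \<longlongrightarrow> - (\<sigma> * l)) at_top"
  proof -
    have "((\<lambda>u. - \<sigma> * - (\<sigma> * (flow (- 1 * u) b $ 1))) \<longlongrightarrow> - \<sigma> * l) at_top"
      by (rule tendsto_mult[OF tendsto_const l(1)])
    then show ?thesis using sgn(1) by auto
  qed
  have lim: "((\<lambda>u. flow (- 1 * u) b) \<longlongrightarrow> eq_at (- (\<sigma> * l))) at_top \<and> eq_at (- (\<sigma> * l)) \<in> cball (p0 q R) d1 \<and>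
      (- (\<sigma> * l) = 0 \<or> (- (\<sigma> * l))\<^sup>2 = q * (R - 1))"
    by (rule limit_equilibrium[of "- 1" "cball (p0 q R) d1" "- T"]) (use near sl near_p0 in auto)
  then have ep: "eq_at (- (\<sigma> * l)) = p0 q R" using eq_at_near_p0 by blast
  have "((\<lambda>u. flow (- u) b) \<longlongrightarrow> p0 q R) at_top" using lim ep by simp
  then have lp: "((\<lambda>t. flow t b) \<longlongrightarrow> p0 q R) at_bot" by (simp add: filterlim_at_bot_mirror)
  define c where "c = sqrt (q * (R - 1))"
  have cp: "c > 0" "c\<^sup>2 = q * (R - 1)" using X0_pos by (auto simp: c_def)
  have lc: "- (\<sigma> * l) = c"
    using arg_cong[OF ep, of "\<lambda>p. p $ 1"] cp(1) by (auto simp: eq_at_def vector_3 c_def split: if_splits)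
  have xc: "\<sigma> * flow t b $ 1 \<ge> \<sigma> * c" if "t \<le> T" for t
    using l(2)[of "- t"] that lc sgn(1) by auto
  \<comment> \<open>Since \<open>\<sigma> * x\<close> is nondecreasing and tends to
    \<open>\<sigma> * c\<close> in the past, it stays above that limit. This sign is passed on to
    \<open>y\<close>, to \<open>Z\<close> and, reversed, to \<open>W\<close>.\<close>
  have Xs: "\<sigma> * ((flow t b $ 1)\<^sup>2 - q * (R - 1)) \<ge> 0" if t: "t \<le> T" for t
  proof -
    have "\<sigma> * ((flow t b $ 1)\<^sup>2 - c\<^sup>2) = (\<sigma> * flow t b $ 1 - \<sigma> * c) * (flow t b $ 1 + c)"
      by (simp add: power2_eq_square algebra_simps)
    also have "\<dots> \<ge> 0" using xc[OF t] xp[OF t] cp by (intro mult_nonneg_nonneg) auto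
    finally show ?thesis by (simp add: cp)
  qed
  define \<beta> where "\<beta> = 1 - q / (2 * s)"
  have \<beta>: "\<beta> \<ge> 0" using assms(1) s_pos by (simp add: \<beta>_def)
  define y where "y t = U (flow t b) - (R - 1) * \<beta>" for t
  have ylim: "((\<lambda>t. \<sigma> * y t) \<longlongrightarrow> 0) at_bot"
  proof -
    have "((\<lambda>t. \<sigma> * y t) \<longlongrightarrow> \<sigma> * ((Z (p0 q R) + (R - 1) - (p0 q R $ 1)\<^sup>2 / (2 * s)) - (R - 1) * \<beta>)) at_bot"
      unfolding y_def U_def
      by (intro tendsto_mult tendsto_diff tendsto_add tendsto_divide tendsto_power tendsto_const
            tendsto_Z[OF lp] tendsto_vec_nth[OF lp]) (use s_pos in auto)
    moreover have "(Z (p0 q R) + (R - 1) - (p0 q R $ 1)\<^sup>2 / (2 * s)) - (R - 1) * \<beta> = 0"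
      using s_pos X0_pos by (simp add: Z_def \<beta>_def field_simps)
    ultimately show ?thesis by simp
  qed
  have ys: "\<sigma> * y t \<ge> 0" if t: "t \<le> T" for t
  proof (rule unst_functional_nonneg[where f = "\<lambda>t. \<sigma> * y t" and T = t, OF q_pos ylim])
    fix u assume u: "u \<le> t"
    then have r: "flow u b \<in> region" using reg t by simp
    show "((\<lambda>t. exp (q * t) * (\<sigma> * y t)) has_real_derivative
        exp (q * u) * (\<sigma> * (- q * U (flow u b) + \<beta> * (flow u b $ 1)\<^sup>2 - 0) + q * (\<sigma> * y u))) (at u)"
      unfolding y_def \<beta>_def
      by (rule exp_weight_derivative[OF DERIV_cmult[OF DERIV_diff[OF flow_U[OF r] DERIV_const]]])
  next
    fix u assume u: "u < t"
    have "\<sigma> * (- q * U (flow u b) + \<beta> * (flow u b $ 1)\<^sup>2 - 0) + q * (\<sigma> * y u)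
        = \<beta> * (\<sigma> * ((flow u b $ 1)\<^sup>2 - q * (R - 1)))"
      by (simp add: y_def algebra_simps)
    also have "\<dots> \<ge> 0" by (rule mult_nonneg_nonneg[OF \<beta> Xs]) (use u t in simp)
    finally show "0 \<le> exp (q * u) * (\<sigma> * (- q * U (flow u b) + \<beta> * (flow u b $ 1)\<^sup>2 - 0) + q * (\<sigma> * y u))"
      by simp
  qed
  have Zs: "\<sigma> * Z (flow t b) \<ge> 0" if t: "t \<le> T" for t
  proof -
    have "\<sigma> * Z (flow t b) = \<sigma> * y t + \<sigma> * ((flow t b $ 1)\<^sup>2 - q * (R - 1)) / (2 * s)"
      using s_pos by (simp add: y_def U_def \<beta>_def field_simps)
    moreover have "\<sigma> * ((flow t b $ 1)\<^sup>2 - q * (R - 1)) / (2 * s) \<ge> 0" using Xs[OF t] s_pos by simp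
    ultimately show ?thesis using ys[OF t] by linarith
  qed
  have Wlim: "((\<lambda>t. \<sigma> * W (flow t b)) \<longlongrightarrow> 0) at_bot"
    using tendsto_mult[OF tendsto_const tendsto_W[OF lp], of \<sigma>] by (simp add: W_def)
  have Ws: "\<sigma> * W (flow t b) \<le> 0" if t: "t \<le> T" for t
  proof (rule unst_functional_nonpos[where f = "\<lambda>t. \<sigma> * W (flow t b)" and T = t and k = "s + 1", OF _ Wlim])
    show "0 < s + 1" using s_pos by simp
    fix u assume u: "u \<le> t"
    then have r: "flow u b \<in> region" using reg t by simp
    show "((\<lambda>t. exp ((s + 1) * t) * (\<sigma> * W (flow t b))) has_real_derivative
        exp ((s + 1) * u) * (\<sigma> * (- (s + 1) * W (flow u b) - flow u b $ 1 * Z (flow u b)) + (s + 1) * (\<sigma> * W (flow u b)))) (at u)"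
      by (rule exp_weight_derivative[OF DERIV_cmult[OF flow_W[OF r]]])
  next
    fix u assume u: "u < t"
    have "\<sigma> * (- (s + 1) * W (flow u b) - flow u b $ 1 * Z (flow u b)) + (s + 1) * (\<sigma> * W (flow u b))
        = - (flow u b $ 1 * (\<sigma> * Z (flow u b)))" by (simp add: algebra_simps)
    also have "\<dots> \<le> 0" using xp[of u] Zs[of u] u t by simp
    finally show "exp ((s + 1) * u) * (\<sigma> * (- (s + 1) * W (flow u b) - flow u b $ 1 * Z (flow u b)) + (s + 1) * (\<sigma> * W (flow u b))) \<le> 0"
      by (intro mult_nonneg_nonpos) auto
  qed
  show ?thesis using Ws[of T] sgn(2)[of T] sgn(1) by auto
qed

text \<open>With only finitely many sign changes \<open>W\<close> would keep a sign on a half-line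
  in the past. The preceding lemma makes it vanish at all these times, whereas zeros of
  \<open>W\<close> are isolated.\<close>

lemma leaving_p0_many:
  assumes "q \<le> 2 * s" and near: "\<And>t. t \<le> 0 \<Longrightarrow> flow t b \<in> cball (p0 q R) d1" and b: "b \<noteq> p0 q R"
  shows "\<exists>K. finite K \<and> card K = 4 \<and> (\<forall>t\<in>K. t < 0 \<and> W (flow t b) = 0 \<and> Z (flow t b) \<noteq> 0)"
proof (rule ccontr)
  assume none: "\<not> ?thesis"
  define N where "N = {t. t < 0 \<and> W (flow t b) = 0 \<and> Z (flow t b) \<noteq> 0}"
  have reg: "flow t b \<in> region" and xp: "flow t b $ 1 > 0" if "t \<le> 0" for t
    using near_p0[OF near[OF that]] by auto
  have fld: "field b \<noteq> 0" using equilibrium_near_p0[of b] near[of 0] b by auto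
  have "finite N"
  proof (rule ccontr)
    assume "infinite N"
    then obtain K where "finite K" "card K = 4" "K \<subseteq> N" using infinite_arbitrarily_large by blast
    then show False using none by (auto simp: N_def)
  qed
  define T where "T = Min (insert (- 1) N) - 1"
  have T: "T < 0" "\<And>t. t \<in> N \<Longrightarrow> T < t"
  proof -
    have "Min (insert (- 1) N) \<le> - 1" using \<open>finite N\<close> by (intro Min_le) auto
    then show "T < 0" by (simp add: T_def)
    fix t assume "t \<in> N"
    then have "Min (insert (- 1) N) \<le> t" using \<open>finite N\<close> by (intro Min_le) auto
    then show "T < t" by (simp add: T_def)
  qed
  have one: "(\<forall>t\<in>{..T}. W (flow t b) \<ge> 0) \<or> (\<forall>t\<in>{..T}. W (flow t b) \<le> 0)"
  proof (rule W_one_signed)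
    fix t assume t: "t \<in> {..T}"
    then show "flow t b \<in> region \<and> flow t b $ 1 \<noteq> 0" using reg[of t] xp[of t] T by auto
    show "Z (flow t b) = 0" if "W (flow t b) = 0" using T(2)[of t] T(1) t that by (force simp: N_def)
  qed (use fld in \<open>auto simp: is_interval_1\<close>)
  obtain \<sigma> :: real where \<sigma>: "\<sigma> = 1 \<or> \<sigma> = - 1" "\<And>t. t \<le> T \<Longrightarrow> \<sigma> * W (flow t b) \<ge> 0"
  proof -
    have "\<And>t. t \<le> T \<Longrightarrow> 1 * W (flow t b) \<ge> 0" if "\<forall>t\<in>{..T}. W (flow t b) \<ge> 0" using that by auto
    moreover have "\<And>t. t \<le> T \<Longrightarrow> - 1 * W (flow t b) \<ge> 0" if "\<forall>t\<in>{..T}. W (flow t b) \<le> 0" using that by auto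
    ultimately show ?thesis using one that by metis
  qed
  obtain e where e: "e > 0" "\<And>u. 0 < \<bar>u - T\<bar> \<Longrightarrow> \<bar>u - T\<bar> < e \<Longrightarrow> W (flow u b) \<noteq> 0"
    using W_isolated[of T b] reg[of T] xp[of T] fld T(1) by auto
  define T' where "T' = T - e / 2"
  have "W (flow T' b) \<noteq> 0" using e(2)[of T'] e(1) by (simp add: T'_def)
  moreover have "T' \<le> T" using e(1) by (simp add: T'_def)
  moreover have "W (flow T' b) = 0"
    using monotone_departure_impossible[OF assms(1), of T' b \<sigma>] near \<sigma> \<open>T' \<le> T\<close> T(1) by auto
  ultimately show False by blast
qed

subsection \<open>Maximal solutions\<close>

text \<open>The field is Lipschitz on bounded sets only, and solutions may leave
  \<open>region\<close>; the Lipschitz constant is taken from a bound for both solutions on the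
  compact interval between the two times.\<close>

lemma solves_on_unique:
  assumes u: "solves_on s q R K u" and v: "solves_on s q R K' v" and t: "a \<in> K \<inter> K'" "t \<in> K \<inter> K'"
    and eq: "u a = v a"
  shows "u t = v t"
proof -
  have iv: "is_interval (K \<inter> K')" using u v by (auto simp: solves_on_def intro: is_interval_Int)
  have sub: "closed_segment a t \<subseteq> K \<inter> K'"
    using iv t by (intro closed_segment_subset) (auto simp: is_interval_convex)
  have du: "(u has_vector_derivative field (u x)) (at x)" if "x \<in> closed_segment a t" for x
    using u sub that by (auto simp: solves_on_def)
  have dv: "(v has_vector_derivative field (v x)) (at x)" if "x \<in> closed_segment a t" for x
    using v sub that by (auto simp: solves_on_def)
  have "bounded (u ` closed_segment a t \<union> v ` closed_segment a t)"
  proof (intro bounded_Un[THEN iffD2] conjI compact_imp_bounded compact_continuous_image compact_segment)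
    show "continuous_on (closed_segment a t) u" "continuous_on (closed_segment a t) v"
      using du dv by (meson continuous_at_imp_continuous_on has_vector_derivative_continuous)+
  qed
  then obtain c where c: "\<And>p. p \<in> u ` closed_segment a t \<union> v ` closed_segment a t \<Longrightarrow> norm p \<le> c"
    by (auto simp: bounded_iff)
  have "norm (u t - v t) \<le> exp ((2 * s + (R + 1 + 2 * c) + (2 * c + q)) * \<bar>t - a\<bar>) * norm (u a - v a)"
  proof (rule lipschitz_ode_dist[OF du dv])
    fix x assume "x \<in> closed_segment a t"
    then have "norm (u x) \<le> c" "norm (v x) \<le> c" using c by auto
    then have "\<bar>u x $ i\<bar> \<le> c" "\<bar>v x $ i\<bar> \<le> c" for i
      using component_le_norm_cart[of "u x" i] component_le_norm_cart[of "v x" i] by linarith+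
    then show "norm (field (u x) - field (v x)) \<le> (2 * s + (R + 1 + 2 * c) + (2 * c + q)) * norm (u x - v x)"
      by (rule field_lipschitz)
  qed
  then show ?thesis using eq by simp
qed

text \<open>The clamped flow solves the system only inside \<open>region\<close>, whereas
  \<open>solution\<close> asks for maximality among all extensions. The maximal solution is glued
  from all solutions through \<open>Q\<close>, which agree by uniqueness. The part of the past up to
  \<open>- c\<close> is kept because Condition B looks backward.\<close>

lemma maximal_solution_exists:
  assumes reg: "\<And>t. t \<ge> - c \<Longrightarrow> flow t Q \<in> region" and c: "c \<ge> 0"
  shows "\<exists>J p. solution s q R J p \<and> {-c..} \<subseteq> J \<and> (\<forall>t\<ge>-c. p t = flow t Q)"
proof -
  obtain e where e: "e > 0" "\<And>u. \<bar>u - (- c)\<bar> < e \<Longrightarrow> flow u Q \<in> region"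
    using flow_region_near[OF reg[OF order_refl]] by blast
  define K0 where "K0 = {- c - e<..}"
  have regK: "flow t Q \<in> region" if "t \<in> K0" for t
    using that reg[of t] e(2)[of t] by (cases "t \<ge> - c") (auto simp: K0_def)
  have K0: "solves_on s q R K0 (\<lambda>t. flow t Q)"
    unfolding solves_on_def using flow_true_derivative[OF regK] by (auto simp: K0_def is_interval_1 intro: exI[of _ 0])
  define S where "S = {(K, u). solves_on s q R K u \<and> 0 \<in> K \<and> u 0 = Q}"
  have S0: "(K0, \<lambda>t. flow t Q) \<in> S" using K0 c e(1) by (simp add: S_def K0_def)
  define J where "J = (\<Union>(K, u)\<in>S. K)"
  define p where "p t = (snd (SOME Ku. Ku \<in> S \<and> t \<in> fst Ku)) t" for t
  have pu: "p t = u t" if "(K, u) \<in> S" "t \<in> K" for K u t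
  proof -
    define Ku where "Ku = (SOME Ku. Ku \<in> S \<and> t \<in> fst Ku)"
    have "Ku \<in> S \<and> t \<in> fst Ku"
      unfolding Ku_def by (rule someI[of _ "(K, u)"]) (use that in auto)
    then have "snd Ku t = u t"
      using solves_on_unique[of "fst Ku" "snd Ku" K u 0 t] that by (auto simp: S_def)
    then show ?thesis by (simp add: p_def Ku_def)
  qed
  have opn: "open J" unfolding J_def by (auto simp: S_def solves_on_def)
  have iv: "is_interval J"
  proof -
    have "connected (\<Union>((\<lambda>(K, u). K) ` S))"
      by (rule connected_Union) (auto simp: S_def solves_on_def is_interval_connected_1)
    then show ?thesis by (simp add: J_def is_interval_connected_1)
  qed
  have J0: "{-c..} \<subseteq> J" "0 \<in> J" using S0 e(1) c by (force simp: J_def K0_def)+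
  have sol: "solves_on s q R J p"
    unfolding solves_on_def
  proof (intro conjI ballI)
    fix t assume "t \<in> J"
    then obtain K u where Ku: "(K, u) \<in> S" "t \<in> K" by (auto simp: J_def)
    then have "(u has_vector_derivative field (u t)) (at t)" "open K" by (auto simp: S_def solves_on_def)
    then have "(p has_vector_derivative field (u t)) (at t)"
      by (rule has_vector_derivative_transform_within_open[OF _ _ Ku(2)]) (simp add: pu[OF Ku(1)])
    then show "(p has_vector_derivative field (p t)) (at t)" by (simp add: pu[OF Ku])
  qed (use opn iv J0 in auto)
  have p0: "p 0 = Q" using pu[OF S0] e(1) c by (simp add: K0_def)
  have "K = J" if "solves_on s q R K u \<and> J \<subseteq> K \<and> (\<forall>t\<in>J. u t = p t)" for K u
  proof
    have "(K, u) \<in> S" using that J0 p0 by (auto simp: S_def)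
    then show "K \<subseteq> J" by (auto simp: J_def)
  qed (use that in blast)
  then have "solution s q R J p" using sol by (auto simp: solution_def)
  moreover have "p t = flow t Q" if "t \<ge> - c" for t using pu[OF S0] that e(1) by (simp add: K0_def)
  ultimately show ?thesis using J0 by blast
qed

end

locale lorenz_shooting = lorenz_system +
  assumes A: "condition_A s q R" and B: "condition_B s q R"
begin

subsection \<open>The segment from \<open>p\<^sub>0\<close> to the first crossing point\<close>

text \<open>Condition A provides a zero of \<open>x\<close> on the unstable branch, which
  \<open>unst_no_return\<close> forbids in the opposite case.\<close>

lemma big_s: "3 * s > 2 * q + 1"
proof (rule ccontr)
  assume n: "\<not> 3 * s > 2 * q + 1"
  obtain b where b: "unst b" using unst_exists by blast
  obtain t1 where "flow t1 b $ 1 = 0" by (rule condition_A_unst[OF A b])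
  then show False using unst_no_return[OF b] n by simp
qed

lemma q_le_2s: "q \<le> 2 * s"
  using big_s q_pos by linarith

text \<open>Condition A controls sign changes but not tangencies. At the first zero of
  \<open>W\<close> a tangency is excluded by \<open>unst_first_turn\<close>, and afterwards by
  \<open>no_tangency\<close>, so that \<open>W\<close> keeps its sign between the turn and the zero
  \<open>t1\<close> of \<open>x\<close>.\<close>

lemma unst_profile:
  assumes b: "unst b"
  shows "\<exists>\<tau> t1. 0 < \<tau> \<and> \<tau> < t1 \<and> (\<forall>t<\<tau>. W (flow t b) > 0) \<and> W (flow \<tau> b) = 0 \<and> Z (flow \<tau> b) > 0 \<and>
    (\<forall>t\<in>{\<tau><..t1}. W (flow t b) < 0) \<and> (\<forall>t<t1. flow t b $ 1 > 0) \<and> flow t1 b $ 1 = 0 \<and>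
    steep (flow \<tau> b) \<and> many 4 (rfl (flow t1 b))"
proof (rule condition_A_unst[OF A b])
  fix \<tau>1 t1 K
  assume \<tau>1: "0 < \<tau>1" "\<tau>1 < t1" "W (flow \<tau>1 b) = 0" "Z (flow \<tau>1 b) \<noteq> 0"
    and only: "\<And>t. t < t1 \<Longrightarrow> W (flow t b) = 0 \<Longrightarrow> Z (flow t b) \<noteq> 0 \<Longrightarrow> t = \<tau>1"
    and x: "\<And>t. t < t1 \<Longrightarrow> flow t b $ 1 > 0" "flow t1 b $ 1 = 0" and Wt1: "W (flow t1 b) < 0"
    and K: "finite K" "card K = 4" "\<And>t. t \<in> K \<Longrightarrow> t1 < t \<and> W (flow t b) = 0 \<and> Z (flow t b) \<noteq> 0 \<and>
        (\<forall>u\<in>{t1<..t}. flow u b $ 1 < 0)"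
  note reg = unst_region[OF b]
  have W0: "W (flow 0 b) > 0" and W0': "\<And>t. t \<le> 0 \<Longrightarrow> W (flow t b) > 0" using b by (auto simp: unst_def)
  obtain \<tau> where \<tau>: "0 < \<tau>" "\<tau> \<le> \<tau>1" "W (flow \<tau> b) = 0" "\<forall>v\<in>{0..<\<tau>}. W (flow v b) > 0"
    using first_nonpos[OF continuous_on_Wf[of "{0..\<tau>1}"] W0, of \<tau>1] \<tau>1 by auto
  have bef: "W (flow t b) > 0" if "t < \<tau>" for t using \<tau>(4) W0'[of t] that by (cases "t \<le> 0") auto
  have Zp: "Z (flow \<tau> b) > 0" by (rule unst_first_turn[OF b q_le_2s \<tau>(1,3) bef])
  then have eq: "\<tau> = \<tau>1" using only[of \<tau>] \<tau> \<tau>1 by auto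
  have xt: "flow \<tau> b $ 1 > 0" using x(1) \<tau> \<tau>1 by auto
  have st: "steep (flow \<tau> b)"
    by (rule unst_turn_steep[OF b big_s \<tau>(3) xt]) (use bef x(1) \<tau> \<tau>1 in auto)
  have "0 < flow \<tau> b $ 1 * Z (flow \<tau> b)" using xt Zp by simp
  then obtain e where e: "e > 0" "\<And>h. 0 < h \<Longrightarrow> h < e \<Longrightarrow> W (flow (\<tau> + h) b) < 0"
    using W_crossing(2)[OF reg \<tau>(3)] by blast
  have aft: "W (flow t b) < 0" if t: "\<tau> < t" "t \<le> t1" for t
  proof (rule ccontr)
    assume n: "\<not> W (flow t b) < 0"
    define h where "h = min e (t - \<tau>) / 2"
    have h: "0 < h" "h < e" "\<tau> + h < t" using e t by (auto simp: h_def min_def field_simps)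
    obtain T where T: "\<tau> + h < T" "T \<le> t" "W (flow T b) = 0" "\<forall>v\<in>{\<tau> + h..<T}. W (flow v b) < 0"
      using first_ge_zero[OF continuous_on_Wf[of "{\<tau> + h..t}"] e(2)[OF h(1,2)], of t] n h by auto
    have Tt: "T < t1" using T t Wt1 by (cases "T = t1") auto
    have "Z (flow (T - \<tau>) (flow \<tau> b)) \<noteq> 0"
    proof (rule no_tangency[OF big_s])
      show "flow v (flow \<tau> b) \<in> region" for v using reg[of "v + \<tau>"] by (simp add: flow_add)
      show "W (flow \<tau> b) = 0" "steep (flow \<tau> b)" by fact+
      show "field (flow \<tau> b) \<noteq> 0" using flow_eq_equilibriumD[OF _ reg] unst_field[OF b] by metis
      show "0 < T - \<tau>" using T h by simp
      show "W (flow (T - \<tau>) (flow \<tau> b)) = 0" using T by (simp flip: flow_add)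
      show "W (flow v (flow \<tau> b)) < 0" if "0 < v" "v < T - \<tau>" for v
      proof (cases "v < h")
        case True then show ?thesis using e(2)[of v] that h by (simp add: add.commute flip: flow_add)
      next
        case False
        then have "v + \<tau> \<in> {\<tau> + h..<T}" using that by auto
        then show ?thesis using T(4) by (simp flip: flow_add)
      qed
      show "flow v (flow \<tau> b) $ 1 > 0" if "0 \<le> v" "v \<le> T - \<tau>" for v
        using x(1)[of "v + \<tau>"] that Tt by (simp flip: flow_add)
    qed
    then have "Z (flow T b) \<noteq> 0" by (simp flip: flow_add)
    then show False using only[OF Tt T(3)] eq T h by simp
  qed
  have "many 4 (rfl (flow t1 b))"
    unfolding many_def
  proof (intro exI[of _ "(\<lambda>t. t - t1) ` K"] conjI subsetI)
    fix u assume "u \<in> (\<lambda>t. t - t1) ` K"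
    then obtain t where t: "t \<in> K" "u = t - t1" by auto
    have f: "flow v (rfl (flow t1 b)) = rfl (flow (v + t1) b)" for v by (simp add: flow_rfl flow_add)
    show "u \<in> SC (rfl (flow t1 b))"
      using K(3)[OF t(1)] t(2) by (auto simp: SC_def f)
  next
    show "card ((\<lambda>t. t - t1) ` K) = 4" using K by (subst card_image) (auto simp: inj_on_def)
  qed (use K in auto)
  then show ?thesis using \<tau> \<tau>1 eq bef Zp aft x st by (intro exI[of _ \<tau>] exI[of _ t1]) auto
qed

text \<open>The crossing point is fixed once by choice together with the data of a branch through
  it, so that a single segment \<open>L\<close> is meant from here on.\<close>

definition turn :: "real ^ 3" where
  "turn = (SOME P. \<exists>b \<tau> t1. unst b \<and> P = flow \<tau> b \<and> 0 < \<tau> \<and> \<tau> < t1 \<and> (\<forall>t<\<tau>. W (flow t b) > 0) \<and>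
    W (flow \<tau> b) = 0 \<and> Z (flow \<tau> b) > 0 \<and>
    (\<forall>t\<in>{\<tau><..t1}. W (flow t b) < 0) \<and> (\<forall>t<t1. flow t b $ 1 > 0) \<and> flow t1 b $ 1 = 0 \<and>
    steep (flow \<tau> b) \<and> many 4 (rfl (flow t1 b)))"

lemma turn_spec:
  obtains b \<tau> t1 where "unst b" "turn = flow \<tau> b" "0 < \<tau>" "\<tau> < t1" "\<And>t. t < \<tau> \<Longrightarrow> W (flow t b) > 0"
    "W (flow \<tau> b) = 0" "Z (flow \<tau> b) > 0" "\<And>t. t \<in> {\<tau><..t1} \<Longrightarrow> W (flow t b) < 0"
    "\<And>t. t < t1 \<Longrightarrow> flow t b $ 1 > 0" "flow t1 b $ 1 = 0" "steep (flow \<tau> b)" "many 4 (rfl (flow t1 b))"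
proof -
  obtain b where b: "unst b" using unst_exists by blast
  have "\<exists>P b \<tau> t1. unst b \<and> P = flow \<tau> b \<and> 0 < \<tau> \<and> \<tau> < t1 \<and> (\<forall>t<\<tau>. W (flow t b) > 0) \<and>
    W (flow \<tau> b) = 0 \<and> Z (flow \<tau> b) > 0 \<and>
    (\<forall>t\<in>{\<tau><..t1}. W (flow t b) < 0) \<and> (\<forall>t<t1. flow t b $ 1 > 0) \<and> flow t1 b $ 1 = 0 \<and>
    steep (flow \<tau> b) \<and> many 4 (rfl (flow t1 b))"
    using unst_profile[OF b] b by blast
  from someI_ex[OF this] show ?thesis unfolding turn_def[symmetric] using that by blast
qed

lemma turn_props: "turn \<in> trap" "W turn = 0" "Z turn > 0" "turn $ 1 > 0" "steep turn"
  by (rule turn_spec, use flow_trap[OF unst_trap] in fastforce)+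

lemma first_crossing_turn: "first_crossing s q R turn"
proof (rule turn_spec)
  fix b \<tau> t1
  assume b: "unst b" and eq: "turn = flow \<tau> b" and "0 < \<tau>" "\<tau> < t1" and bef: "\<And>t. t < \<tau> \<Longrightarrow> W (flow t b) > 0"
    and z: "W (flow \<tau> b) = 0" "Z (flow \<tau> b) > 0"
  have cs: "changes_sign_at (\<lambda>t. flow t b $ 1 - flow t b $ 2) t \<longleftrightarrow> W (flow t b) = 0 \<and> Z (flow t b) \<noteq> 0" for t
  proof -
    have "(\<lambda>t. flow t b $ 1 - flow t b $ 2) = (\<lambda>t. - W (flow t b))" by (simp add: W_def)
    then show ?thesis
      using changes_sign_at_W_off[OF unst_region[OF b] unst_off[OF b] unst_field[OF b], of t]
      by (simp add: changes_sign_at_uminus)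
  qed
  have "first_elements [\<tau>] {t \<in> UNIV. changes_sign_at (\<lambda>t. flow t b $ 1 - flow t b $ 2) t}"
    unfolding first_elements_def cs
  proof (intro conjI ballI)
    fix v u assume v: "v \<in> {t \<in> UNIV. W (flow t b) = 0 \<and> Z (flow t b) \<noteq> 0} - set [\<tau>]" and u: "u \<in> set [\<tau>]"
    then show "u < v" using bef[of v] by (cases "v < \<tau>") auto
  qed (use z in auto)
  then show ?thesis
    unfolding first_crossing_def
    by (intro exI[of _ UNIV] exI[of _ "\<lambda>t. flow t b"] exI[of _ \<tau>] conjI unst_solution[OF b] eq)
qed

definition seg :: "real \<Rightarrow> real ^ 3" where "seg r = (1 - r) *\<^sub>R p0 q R + r *\<^sub>R turn"

lemma sq_convex: "((1 - r) * a + r * b)\<^sup>2 \<le> (1 - r) * a\<^sup>2 + r * b\<^sup>2" if "0 \<le> r" "r \<le> 1" for a b r :: real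
proof -
  have "(1 - r) * a\<^sup>2 + r * b\<^sup>2 - ((1 - r) * a + r * b)\<^sup>2 = r * (1 - r) * (a - b)\<^sup>2"
    by (simp add: power2_eq_square algebra_simps)
  also have "\<dots> \<ge> 0" using that by simp
  finally show ?thesis by simp
qed

lemma seg_in_segment: "0 \<le> r \<Longrightarrow> r \<le> 1 \<Longrightarrow> seg r \<in> closed_segment (p0 q R) turn"
  by (auto simp: seg_def in_segment)

lemma seg_trap: "0 \<le> r \<Longrightarrow> r \<le> 1 \<Longrightarrow> seg r \<in> trap"
proof -
  assume r: "0 \<le> r" "r \<le> 1"
  have c: "seg r $ i = (1 - r) * p0 q R $ i + r * turn $ i" for i by (simp add: seg_def)
  have 3: "seg r $ 3 - 2 * R = (1 - r) * (p0 q R $ 3 - 2 * R) + r * (turn $ 3 - 2 * R)"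
    by (simp add: c algebra_simps)
  have "energy (seg r) \<le> R * ((1 - r) * (p0 q R $ 1)\<^sup>2 + r * (turn $ 1)\<^sup>2) + s * ((1 - r) * (p0 q R $ 2)\<^sup>2 + r * (turn $ 2)\<^sup>2)
      + s * ((1 - r) * (p0 q R $ 3 - 2 * R)\<^sup>2 + r * (turn $ 3 - 2 * R)\<^sup>2)"
    unfolding energy_def 3 unfolding c using s_pos R_gt_1
    by (intro add_mono mult_left_mono sq_convex r) auto
  also have "\<dots> = (1 - r) * energy (p0 q R) + r * energy turn"
    by (simp add: energy_def algebra_simps del: p0_nth)
  also have "\<dots> \<le> (1 - r) * level + r * level"
    using r p0_trap turn_props(1) by (intro add_mono mult_left_mono) (auto simp: trap_def)
  finally show ?thesis by (simp add: trap_def algebra_simps)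
qed

lemma seg_props:
  assumes "0 < r" "r \<le> 1"
  shows "W (seg r) = 0" "Z (seg r) > 0" "seg r $ 1 > 0" "steep (seg r)" "field (seg r) \<noteq> 0" "off (seg r)"
proof -
  define c where "c = sqrt (q * (R - 1))"
  have c: "c > 0" "c\<^sup>2 = q * (R - 1)" using X0_pos by (auto simp: c_def)
  have x: "seg r $ 1 = (1 - r) * c + r * turn $ 1" by (simp add: seg_def c_def)
  show xp: "seg r $ 1 > 0" unfolding x using assms c turn_props(4) by (intro add_nonneg_pos) auto
  have "W (seg r) = (1 - r) * W (p0 q R) + r * W turn" by (simp add: W_def seg_def algebra_simps)
  also have "\<dots> = 0" using turn_props(2) by (simp add: W_def)
  finally show "W (seg r) = 0" .
  have z: "Z (seg r) = r * Z turn" by (simp add: Z_def seg_def algebra_simps)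
  then show zp: "Z (seg r) > 0" using assms turn_props(3) by simp
  show "field (seg r) \<noteq> 0" using xp zp by (auto simp: field_zero_iff)
  show "off (seg r)" using xp by (simp add: off_def)
  \<comment> \<open>Both sides of the steepness inequality vanish at \<open>p0 q R\<close>, and the
    square is convex, so the inequality at \<open>turn\<close> scales down to
    \<open>seg r\<close>.\<close>
  have "(seg r $ 1)\<^sup>2 \<le> (1 - r) * c\<^sup>2 + r * (turn $ 1)\<^sup>2" unfolding x using assms by (intro sq_convex) auto
  then have "(seg r $ 1)\<^sup>2 - q * (R - 1) \<le> r * ((turn $ 1)\<^sup>2 - q * (R - 1))" by (simp add: c algebra_simps)
  also have "\<dots> \<le> r * (4 * s * Z turn)" using turn_props(5) assms by (intro mult_left_mono) (auto simp: steep_def)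
  finally show "steep (seg r)" by (simp add: steep_def z mult_ac)
qed

lemma seg_0 [simp]: "seg 0 = p0 q R" and seg_1 [simp]: "seg 1 = turn"
  by (simp_all add: seg_def)

lemma continuous_on_seg: "continuous_on S seg"
  unfolding seg_def by (intro continuous_intros)

section \<open>Starting sets and tangencies on orbits from the segment\<close>

text \<open>The tangency point lies on the line \<open>M\<close> and its past meets
  \<open>L\<close>, so alternative (2b) of Condition B must hold for the solution through it.
  Shifting time by \<open>h\<close> turns the interval of (2b) into one for
  \<open>Q\<close>.\<close>

lemma touching_many:
  assumes r: "0 < r" "r \<le> 1" and t: "t \<ge> 0" and Q: "Q = flow t (seg r)" "Q $ 1 = 0" and h: "h > 0"
    "W (flow h Q) = 0" "Z (flow h Q) = 0"
  shows "\<exists>I. is_interval I \<and> h \<in> I \<and> I \<subseteq> {0<..} \<and> (\<forall>u\<in>I. flow u Q $ 1 \<noteq> 0) \<and>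
    card {u \<in> I. W (flow u Q) = 0 \<and> Z (flow u Q) \<noteq> 0} = 4"
proof -
  define H where "H = flow h Q"
  have tr: "seg r \<in> trap" using seg_trap r by simp
  have H: "H = flow (h + t) (seg r)" by (simp add: H_def Q flow_add)
  have reg: "flow u H \<in> region" if "u \<ge> - (h + t)" for u
    using flow_region[OF tr, of "u + (h + t)"] that by (simp add: H flow_add[symmetric])
  obtain J p where J: "solution s q R J p" "{- (h + t)..} \<subseteq> J" "\<forall>u\<ge>- (h + t). p u = flow u H"
    using maximal_solution_exists[of "h + t" H] reg h t by auto
  have Jo: "open J" using J(1) by (auto simp: solution_def solves_on_def)
  have J0: "0 \<in> J" using J(2) h t by auto
  have p0H: "p 0 = H" using J(3) h t by simp
  have pm: "p (- (h + t)) = seg r" using J(3) by (simp add: H flow_add[symmetric])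
  have nonc: "\<not> p constant_on J"
  proof
    assume "p constant_on J"
    then have "p 0 = p (- (h + t))" using J0 J(2) unfolding constant_on_def by (metis atLeast_iff order_refl subsetD)
    then have "Z H = Z (seg r)" using p0H pm by simp
    then show False using seg_props(2)[OF r] h H_def by simp
  qed
  have lM: "p 0 \<in> line_M R" using h p0H by (auto simp: line_M_def H_def W_def Z_def)
  have "\<not> (\<forall>t\<in>J. t < 0 \<longrightarrow> p t \<notin> closed_segment (p0 q R) turn)"
    using pm seg_in_segment[of r] r J(2) h t by (auto intro!: bexI[of _ "- (h + t)"])
  then obtain I where I: "I \<subseteq> J" "is_interval I" "0 \<in> I" "\<forall>t\<in>I. p t $ 1 \<noteq> 0" "card (sign_changes_x' p I) = 4"
    using B[unfolded condition_B_def, rule_format, OF first_crossing_turn, of J p] J(1) J0 nonc lM by blast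
  \<comment> \<open>The interval of (2b) cannot extend back to \<open>Q\<close>, where
    \<open>x = 0\<close>. Hence its four sign changes lie on the leg that starts at
    \<open>Q\<close>.\<close>
  have Ih: "u > - h" if "u \<in> I" for u
  proof (rule ccontr)
    assume "\<not> u > - h"
    then have "- h \<in> I" using mem_is_interval_1_I[OF I(2) that I(3), of "- h"] h by auto
    moreover have "p (- h) = Q" using J(3) t by (simp add: H_def)
    ultimately show False using I(4) Q by auto
  qed
  have sc: "sign_changes_x' p I = {u \<in> I. W (flow u H) = 0 \<and> Z (flow u H) \<noteq> 0}"
  proof (rule sign_changes_flow)
    show "off H" "field H \<noteq> 0"
      using seg_props[OF r] flow_eq_equilibriumD[OF _ flow_region[OF tr], of "h + t"] h t by (auto simp: H)
    show "open {- (h + t)<..}" by simp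
  qed (use Ih J(3) reg t in \<open>auto intro: less_imp_le dest!: Ih\<close>)
  define I' where "I' = (\<lambda>u. u + h) ` I"
  have I'iff: "u \<in> I' \<longleftrightarrow> u - h \<in> I" for u by (force simp: I'_def image_iff)
  have fl: "flow (u - h) H = flow u Q" for u by (simp add: H_def flip: flow_add)
  have "{u \<in> I'. W (flow u Q) = 0 \<and> Z (flow u Q) \<noteq> 0} = (\<lambda>u. u + h) ` {u \<in> I. W (flow u H) = 0 \<and> Z (flow u H) \<noteq> 0}"
    by (force simp: I'_def H_def flow_add)
  then have c: "card {u \<in> I'. W (flow u Q) = 0 \<and> Z (flow u Q) \<noteq> 0} = 4"
    using I(5) sc by (simp add: card_image)
  show ?thesis
  proof (intro exI[of _ I'] conjI)
    show "is_interval I'"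
      unfolding is_interval_1
    proof (intro ballI allI impI)
      fix u v x assume "u \<in> I'" "v \<in> I'" "u \<le> x \<and> x \<le> v"
      then show "x \<in> I'"
        using mem_is_interval_1_I[OF I(2), of "u - h" "v - h" "x - h"] by (simp add: I'iff)
    qed
    show "h \<in> I'" using I(3) by (simp add: I'iff)
    show "I' \<subseteq> {0<..}" using Ih by (force simp: I'iff)
    show "\<forall>u\<in>I'. flow u Q $ 1 \<noteq> 0"
    proof
      fix u assume "u \<in> I'"
      then have "u - h \<in> I" by (simp add: I'iff)
      then have "p (u - h) $ 1 \<noteq> 0" "u - h > - h" using I(4) Ih by auto
      then show "flow u Q $ 1 \<noteq> 0" using J(3)[rule_format, of "u - h"] t fl by auto
    qed
  qed (rule c)
qed

text \<open>Starting points have \<open>x = 0\<close> or \<open>W = 0\<close> themselves. The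
  definition provides an initial interval, common to all nearby starting points of \<open>D\<close>,
  on which nothing is counted; counting windows begin at its end.\<close>

definition locally_started :: "(real ^ 3) set \<Rightarrow> bool" where
  "locally_started D \<longleftrightarrow> D \<subseteq> trap \<and> (\<forall>Q\<in>D. field Q \<noteq> 0 \<and> off Q \<and>
     (\<exists>e>0. \<forall>\<^sub>F C in nhds Q. C \<in> D \<longrightarrow> (\<forall>t\<in>{0<..e}. flow t C $ 1 > 0 \<and> W (flow t C) \<noteq> 0)))"

text \<open>At \<open>W = Z = 0\<close> a zero of \<open>W\<close> is a tangency and disappears or splits under perturbation.\<close>

definition touch_bound :: "(real ^ 3) set \<Rightarrow> nat \<Rightarrow> bool" where
  "touch_bound D j \<longleftrightarrow> (\<forall>Q\<in>D. \<forall>h>0. (\<forall>u\<in>{0<..h}. flow u Q $ 1 > 0) \<and> W (flow h Q) = 0 \<and> Z (flow h Q) = 0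
     \<longrightarrow> many j Q)"

definition cross :: "nat \<Rightarrow> real ^ 3 \<Rightarrow> bool" where
  "cross m P \<longleftrightarrow> (\<exists>T. hit P T) \<and> finite (SC P) \<and> card (SC P) = m"

definition settle :: "nat \<Rightarrow> real ^ 3 \<Rightarrow> bool" where
  "settle m P \<longleftrightarrow> (\<forall>u>0. flow u P $ 1 > 0) \<and> ((\<lambda>t. flow t P) \<longlongrightarrow> 0) at_top \<and> finite (SC P) \<and> card (SC P) = m"

lemma many_card: "many k P \<Longrightarrow> finite (SC P) \<Longrightarrow> k \<le> card (SC P)"
  unfolding many_def by (metis card_mono)

lemma many_card_SC: "finite (SC P) \<Longrightarrow> many (card (SC P)) P"
  unfolding many_def by blast

lemma many_infinite: "infinite (SC P) \<Longrightarrow> many k P"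
  unfolding many_def using infinite_arbitrarily_large by metis

lemma hit_W_neg:
  assumes "hit P T" "P \<in> trap" "off P"
  shows "W (flow T P) < 0"
proof (rule ccontr)
  assume n: "\<not> W (flow T P) < 0"
  have T: "T > 0" "flow T P $ 1 = 0" using assms(1) by (auto simp: hit_def)
  have "W (flow T P) \<noteq> 0" using off_flow[of T P] assms(3) T(2) by (auto simp: off_def simp del: off_flow)
  then have "W (flow T P) > 0" using n by simp
  then obtain e where e: "e > 0" "\<And>h. 0 < h \<Longrightarrow> h < e \<Longrightarrow> flow (T - h) P $ 1 < 0"
    using x_zero_crossing(2)[OF flow_region[OF assms(2)] T(2)] T by (meson less_imp_le)
  define h where "h = min e T / 2"
  have h: "0 < h" "h < e" "h < T" using e T by (auto simp: h_def min_def)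
  have "flow (T - h) P $ 1 > 0" using assms(1) h by (simp add: hit_def)
  then show False using e(2)[OF h(1,2)] by simp
qed

definition SS :: "(real ^ 3) set" where "SS = {C \<in> trap. C $ 1 = 0 \<and> W C > 0}"

lemma nxt_SS:
  assumes "hit P T" "P \<in> trap" "off P"
  shows "nxt P \<in> SS"
  using hit_W_neg[OF assms] assms(1) flow_trap[OF assms(2), of T]
  unfolding nxt_eq[OF assms(1)] by (auto simp: SS_def hit_def)

lemma SS_off: "C \<in> SS \<Longrightarrow> off C" and SS_field: "C \<in> SS \<Longrightarrow> field C \<noteq> 0"
  by (auto simp: SS_def off_def field_zero_iff)

lemma locally_started_SS: "locally_started SS"
  unfolding locally_started_def
proof (intro conjI ballI)
  show "SS \<subseteq> trap" by (auto simp: SS_def)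
  fix Q assume Q: "Q \<in> SS"
  then show "field Q \<noteq> 0" "off Q" using SS_field SS_off by auto
  obtain e where e: "e > 0" "\<And>u. \<bar>u - 0\<bar> < e \<Longrightarrow> W (flow u Q) > 0"
    using W_near[OF open_sets(2), of 0 Q] Q by (auto simp: SS_def)
  have "\<forall>\<^sub>F C in nhds Q. \<forall>t\<in>{0..e/2}. flow t C \<in> {p. W p > 0}"
    by (rule flow_tube[OF _ open_sets(2)]) (use e in auto)
  then have "\<forall>\<^sub>F C in nhds Q. C \<in> SS \<longrightarrow> (\<forall>t\<in>{0<..e/2}. flow t C $ 1 > 0 \<and> W (flow t C) \<noteq> 0)"
  proof eventually_elim
    case (elim C)
    show ?case
    proof (intro impI ballI)
      fix t assume C: "C \<in> SS" and t: "t \<in> {0<..e/2}"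
      have "flow 0 C $ 1 < flow t C $ 1"
      proof (rule DERIV_pos_imp_increasing[where f = "\<lambda>t. flow t C $ 1"])
        fix u assume u: "0 \<le> u" "u \<le> t"
        then have "flow u C \<in> region" using C by (intro flow_region) (auto simp: SS_def)
        then show "\<exists>y. ((\<lambda>t. flow t C $ 1) has_real_derivative y) (at u) \<and> 0 < y"
          using flow_x[of u C] elim u t s_pos by (intro exI[of _ "s * W (flow u C)"]) auto
      qed (use t in auto)
      moreover have "W (flow t C) > 0" using bspec[OF elim, of t] t by simp
      ultimately show "flow t C $ 1 > 0 \<and> W (flow t C) \<noteq> 0" using C by (simp add: SS_def)
    qed
  qed
  then show "\<exists>e>0. \<forall>\<^sub>F C in nhds Q. C \<in> SS \<longrightarrow> (\<forall>t\<in>{0<..e}. flow t C $ 1 > 0 \<and> W (flow t C) \<noteq> 0)"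
    using e(1) by (intro exI[of _ "e/2"]) auto
qed

lemma locally_started_subset:
  assumes D: "locally_started D" and sub: "D' \<subseteq> D"
  shows "locally_started D'"
  unfolding locally_started_def
proof (intro conjI ballI)
  show "D' \<subseteq> trap" using assms by (auto simp: locally_started_def)
  fix Q assume "Q \<in> D'"
  then have Q: "Q \<in> D" using sub by auto
  then show "field Q \<noteq> 0" "off Q" using D by (auto simp: locally_started_def)
  obtain e where e: "e > 0" "\<forall>\<^sub>F C in nhds Q. C \<in> D \<longrightarrow> (\<forall>t\<in>{0<..e}. flow t C $ 1 > 0 \<and> W (flow t C) \<noteq> 0)"
    using D Q unfolding locally_started_def by blast
  have "\<forall>\<^sub>F C in nhds Q. C \<in> D' \<longrightarrow> (\<forall>t\<in>{0<..e}. flow t C $ 1 > 0 \<and> W (flow t C) \<noteq> 0)"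
    using e(2) by (rule eventually_mono) (use sub in blast)
  then show "\<exists>e>0. \<forall>\<^sub>F C in nhds Q. C \<in> D' \<longrightarrow> (\<forall>t\<in>{0<..e}. flow t C $ 1 > 0 \<and> W (flow t C) \<noteq> 0)"
    using e(1) by blast
qed

definition LL :: "(real ^ 3) set" where "LL = seg ` {0<..1}"

text \<open>Points of the section whose past meets the segment, up to reflection: these are the
  points to which Condition B applies.\<close>

definition SL :: "(real ^ 3) set" where
  "SL = {C \<in> SS. \<exists>r\<in>{0<..1}. \<exists>t\<ge>0. flow t (seg r) = C \<or> flow t (seg r) = rfl C}"

lemma locally_started_SL: "locally_started SL"
  by (rule locally_started_subset[OF locally_started_SS]) (auto simp: SL_def)

lemma locally_started_LL: "locally_started LL"
  unfolding locally_started_def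
proof (intro conjI ballI)
  show "LL \<subseteq> trap" using seg_trap by (auto simp: LL_def)
  fix Q assume "Q \<in> LL"
  then obtain r where r: "0 < r" "r \<le> 1" "Q = seg r" by (auto simp: LL_def)
  then show "field Q \<noteq> 0" "off Q" using seg_props by auto
  \<comment> \<open>The derivative of \<open>W\<close> is negative on \<open>U1\<close>, so all
    segment points near \<open>Q\<close>, having \<open>W = 0\<close>, move into
    \<open>W < 0\<close> at a uniform rate of time.\<close>
  define U1 where "U1 = {p. - (s + 1) * W p - p $ 1 * Z p < 0} \<inter> {p. p $ 1 > 0}"
  have oU: "open U1" unfolding U1_def
    by (intro open_Int open_Collect_less continuous_intros)
  have QU: "flow 0 Q \<in> U1" using seg_props[OF r(1,2)] r(3) by (simp add: U1_def)
  obtain e where e: "e > 0" "\<And>u. \<bar>u - 0\<bar> < e \<Longrightarrow> flow u Q \<in> U1"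
    using W_near[OF oU QU] by blast
  have "\<forall>\<^sub>F C in nhds Q. \<forall>t\<in>{0..e/2}. flow t C \<in> U1"
    by (rule flow_tube[OF _ oU]) (use e in auto)
  then have "\<forall>\<^sub>F C in nhds Q. C \<in> LL \<longrightarrow> (\<forall>t\<in>{0<..e/2}. flow t C $ 1 > 0 \<and> W (flow t C) \<noteq> 0)"
  proof eventually_elim
    case (elim C)
    show ?case
    proof (intro impI ballI)
      fix t assume C: "C \<in> LL" and t: "t \<in> {0<..e/2}"
      have Ct: "C \<in> trap" "W C = 0" using C seg_trap seg_props(1) by (auto simp: LL_def)
      have "W (flow t C) < W (flow 0 C)"
      proof (rule DERIV_neg_imp_decreasing[where f = "\<lambda>t. W (flow t C)"])
        fix u assume u: "0 \<le> u" "u \<le> t"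
        then show "\<exists>y. ((\<lambda>t. W (flow t C)) has_real_derivative y) (at u) \<and> y < 0"
          using flow_W[OF flow_region[OF Ct(1) u(1)]] elim t by (auto simp: U1_def)
      qed (use t in auto)
      then show "flow t C $ 1 > 0 \<and> W (flow t C) \<noteq> 0" using Ct elim t by (auto simp: U1_def)
    qed
  qed
  then show "\<exists>e>0. \<forall>\<^sub>F C in nhds Q. C \<in> LL \<longrightarrow> (\<forall>t\<in>{0<..e}. flow t C $ 1 > 0 \<and> W (flow t C) \<noteq> 0)"
    using e(1) by (intro exI[of _ "e/2"]) auto
qed

lemma locally_startedE:
  assumes "locally_started D" "Q \<in> D"
  obtains e where "e > 0" "\<forall>\<^sub>F C in nhds Q. C \<in> D \<longrightarrow> (\<forall>t\<in>{0<..e}. flow t C $ 1 > 0 \<and> W (flow t C) \<noteq> 0)"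
    "\<And>t. t \<in> {0<..e} \<Longrightarrow> flow t Q $ 1 > 0 \<and> W (flow t Q) \<noteq> 0"
    "Q \<in> trap" "field Q \<noteq> 0" "off Q"
proof -
  obtain e where e: "e > 0" "\<forall>\<^sub>F C in nhds Q. C \<in> D \<longrightarrow> (\<forall>t\<in>{0<..e}. flow t C $ 1 > 0 \<and> W (flow t C) \<noteq> 0)"
    using assms unfolding locally_started_def by blast
  from eventually_nhds_x_imp_x[OF e(2)] assms(2)
  have "\<forall>t\<in>{0<..e}. flow t Q $ 1 > 0 \<and> W (flow t Q) \<noteq> 0" by blast
  then show ?thesis using that e assms unfolding locally_started_def by blast
qed

text \<open>By \<open>no_tangency\<close> the first zero of \<open>W\<close> after leaving the
  segment is a genuine sign change, so a tangency can only come after one. This suffices as long as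
  the count is 0.\<close>

lemma touch_bound_LL: "touch_bound LL 1"
  unfolding touch_bound_def
proof (intro ballI allI impI)
  fix Q h assume "Q \<in> LL" and h: "h > (0 :: real)"
    and H: "(\<forall>u\<in>{0<..h}. flow u Q $ 1 > 0) \<and> W (flow h Q) = 0 \<and> Z (flow h Q) = 0"
  then obtain r where r: "0 < r" "r \<le> 1" "Q = seg r" by (auto simp: LL_def)
  note P = seg_props[OF r(1,2), folded r(3)]
  have tr: "Q \<in> trap" using seg_trap r by auto
  have "0 < flow 0 Q $ 1 * Z (flow 0 Q)" using P by simp
  then obtain e where e: "e > 0" "\<And>k. 0 < k \<Longrightarrow> k < e \<Longrightarrow> W (flow (0 + k) Q) < 0"
    using W_crossing(2)[of 0 Q] P trap_subset_region tr by (metis flow_0 subsetD)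
  define k where "k = min e h / 2"
  have k: "0 < k" "k < e" "k < h" using e h by (auto simp: k_def min_def)
  have "W (flow k Q) < 0" using e(2)[OF k(1,2)] by simp
  then obtain T where T: "k < T" "T \<le> h" "W (flow T Q) = 0" "\<forall>v\<in>{k..<T}. W (flow v Q) < 0"
    using first_ge_zero[OF continuous_on_Wf[of "{k..h}" Q], of h] H k by auto
  have xx: "flow t Q $ 1 > 0" if "0 \<le> t" "t \<le> h" for t using H P that by (cases "t = 0") auto
  have "Z (flow T Q) \<noteq> 0"
  proof (rule no_tangency[OF big_s])
    show "flow t Q \<in> region" if "0 \<le> t" for t using flow_region[OF tr that] .
    show "W (flow t Q) < 0" if "0 < t" "t < T" for t
      using e(2)[of t] T(4) that k by (cases "t < k") auto
    show "flow t Q $ 1 > 0" if "0 \<le> t" "t \<le> T" for t using xx that T by auto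
  qed (use P T k in auto)
  then have "T \<in> SC Q" using T k H by (auto simp: SC_def)
  then show "many 1 Q" unfolding many_def by (intro exI[of _ "{T}"]) auto
qed

text \<open>The interval of Condition B contains the tangency time and no zero of \<open>x\<close>;
  by connectedness all of it precedes the next zero of \<open>x\<close>, so its four sign changes
  belong to \<open>SC C\<close>.\<close>

lemma touch_bound_SL: "touch_bound SL 4"
  unfolding touch_bound_def
proof (intro ballI allI impI)
  fix C h assume C: "C \<in> SL" and h: "h > (0 :: real)"
    and H: "(\<forall>u\<in>{0<..h}. flow u C $ 1 > 0) \<and> W (flow h C) = 0 \<and> Z (flow h C) = 0"
  obtain r t where r: "0 < r" "r \<le> 1" "t \<ge> 0" "flow t (seg r) = C \<or> flow t (seg r) = rfl C"
    using C by (auto simp: SL_def)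
  define Q where "Q = flow t (seg r)"
  have QC: "Q = C \<or> Q = rfl C" using r(4) by (simp add: Q_def)
  have Q0: "Q $ 1 = 0" "W (flow h Q) = 0" "Z (flow h Q) = 0"
    using QC C H by (auto simp: SL_def SS_def flow_rfl)
  obtain I where I: "is_interval I" "h \<in> I" "I \<subseteq> {0<..}" "\<forall>u\<in>I. flow u Q $ 1 \<noteq> 0"
    "card {u \<in> I. W (flow u Q) = 0 \<and> Z (flow u Q) \<noteq> 0} = 4"
    using touching_many[OF r(1-3) Q_def Q0(1) h Q0(2,3)] by blast
  have same: "flow u Q $ 1 = 0 \<longleftrightarrow> flow u C $ 1 = 0" "W (flow u Q) = 0 \<longleftrightarrow> W (flow u C) = 0"
    "Z (flow u Q) = Z (flow u C)" for u
    using QC by (auto simp: flow_rfl)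
  have xI: "flow u C $ 1 > 0" if u: "u \<in> I" for u
  proof (rule ccontr)
    assume n: "\<not> flow u C $ 1 > 0"
    have "0 < u" using I(3) u by auto
    then have "h < u" using H n by (meson greaterThanAtMost_iff not_le)
    have c: "continuous_on {h..u} (\<lambda>t. flow t C $ 1)" by (rule continuous_on_x)
    have "0 \<le> flow h C $ 1" using H h by (simp add: less_imp_le)
    moreover have "flow u C $ 1 \<le> 0" "h \<le> u" using n \<open>h < u\<close> by auto
    ultimately obtain v where v: "h \<le> v" "v \<le> u" "flow v C $ 1 = 0"
      using IVT2'[of "\<lambda>t. flow t C $ 1" u 0 h] c by auto
    then have "v \<in> I" using mem_is_interval_1_I[OF I(1,2) u] by blast
    then show False using I(4) same(1) v by blast
  qed
  have xall: "flow v C $ 1 > 0" if u: "u \<in> I" and v: "0 < v" "v \<le> u" for u v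
  proof (cases "v \<le> h")
    case True then show ?thesis using H v by auto
  next
    case False
    then have "v \<in> I" using mem_is_interval_1_I[OF I(1,2) u, of v] v by auto
    then show ?thesis by (rule xI)
  qed
  have "{u \<in> I. W (flow u Q) = 0 \<and> Z (flow u Q) \<noteq> 0} \<subseteq> SC C"
    using I(3) xall same by (auto simp: SC_def)
  moreover have "finite {u \<in> I. W (flow u Q) = 0 \<and> Z (flow u Q) \<noteq> 0}"
    by (rule card_ge_0_finite) (use I(5) in linarith)
  ultimately show "many 4 C" unfolding many_def using I(5) by (intro exI conjI)
qed

subsection \<open>Counting the sign changes before the next zero\<close>

lemma card_SC_window:
  assumes "e > 0" "\<And>t. t \<in> {0<..e} \<Longrightarrow> flow t P $ 1 > 0 \<and> W (flow t P) \<noteq> 0" "cnt P e b n" "SC P \<subseteq> {..b}"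
  shows "finite (SC P) \<and> card (SC P) = n"
proof -
  have c: "e < b" "\<And>t. t \<in> {e..b} \<Longrightarrow> flow t P $ 1 > 0 \<and> (W (flow t P) = 0 \<longrightarrow> Z (flow t P) \<noteq> 0)"
    "finite {t \<in> {e..b}. W (flow t P) = 0}" "card {t \<in> {e..b}. W (flow t P) = 0} = n"
    using assms(3) by (auto simp: cnt_def)
  have x: "flow t P $ 1 > 0" if "0 < t" "t \<le> b" for t
    using assms(2)[of t] c(2)[of t] that by (cases "t \<le> e") auto
  have "SC P = {t \<in> {e..b}. W (flow t P) = 0}"
  proof (intro equalityI subsetI)
    fix t assume t: "t \<in> SC P"
    then have "\<not> t \<le> e" using assms(2)[of t] by (auto simp: SC_def)
    then show "t \<in> {t \<in> {e..b}. W (flow t P) = 0}" using t assms(4) by (auto simp: SC_def)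
  next
    fix t assume t: "t \<in> {t \<in> {e..b}. W (flow t P) = 0}"
    then show "t \<in> SC P" using c(2)[of t] x assms(1) by (auto simp: SC_def)
  qed
  then show ?thesis using c by simp
qed

lemma cross_intro:
  assumes "e > 0" "\<And>t. t \<in> {0<..e} \<Longrightarrow> flow t P $ 1 > 0 \<and> W (flow t P) \<noteq> 0" "cnt P e b n"
    and T: "b < T" "\<And>t. b \<le> t \<Longrightarrow> t < T \<Longrightarrow> flow t P $ 1 > 0 \<and> W (flow t P) < 0" "flow T P $ 1 = 0"
  shows "hit P T \<and> cross n P"
proof -
  have c: "e < b" "\<And>t. t \<in> {e..b} \<Longrightarrow> flow t P $ 1 > 0" using assms(3) by (auto simp: cnt_def)
  have x: "flow t P $ 1 > 0" if "0 < t" "t < T" for t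
    using assms(2)[of t] c(2)[of t] T(2)[of t] that by (cases "t \<le> e"; cases "t \<le> b") auto
  have h: "hit P T" using c(1) T x assms(1) by (auto simp: hit_def)
  have "SC P \<subseteq> {..b}"
  proof
    fix t assume t: "t \<in> SC P"
    have "t < T"
    proof (rule ccontr)
      assume "\<not> t < T"
      then have "flow T P $ 1 > 0" using t c(1) T(1) assms(1) by (auto simp: SC_def)
      then show False using T(3) by simp
    qed
    then show "t \<in> {..b}" using T(2)[of t] t by (cases "t \<le> b") (auto simp: SC_def)
  qed
  then show ?thesis using card_SC_window[OF assms(1-3)] h by (auto simp: cross_def)
qed

lemma settle_intro:
  assumes "e > 0" "\<And>t. t \<in> {0<..e} \<Longrightarrow> flow t P $ 1 > 0 \<and> W (flow t P) \<noteq> 0" "cnt P e b n"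
    and T: "\<And>t. b \<le> t \<Longrightarrow> flow t P $ 1 > 0 \<and> W (flow t P) < 0" "((\<lambda>t. flow t P) \<longlongrightarrow> 0) at_top"
  shows "settle n P"
proof -
  have c: "e < b" "\<And>t. t \<in> {e..b} \<Longrightarrow> flow t P $ 1 > 0" using assms(3) by (auto simp: cnt_def)
  have x: "flow t P $ 1 > 0" if "0 < t" for t
    using assms(2)[of t] c(2)[of t] T(1)[of t] that by (cases "t \<le> e"; cases "t \<le> b") auto
  have "SC P \<subseteq> {..b}"
  proof
    fix t assume t: "t \<in> SC P"
    then show "t \<in> {..b}" using T(1)[of t] by (cases "t \<le> b") (auto simp: SC_def)
  qed
  then show ?thesis using card_SC_window[OF assms(1-3)] x T(2) by (auto simp: settle_def)
qed

lemma no_touch: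
  assumes "touch_bound D j" "Q \<in> D" "finite (SC Q)" "card (SC Q) < j"
    and "h > 0" "\<And>u. u \<in> {0<..h} \<Longrightarrow> flow u Q $ 1 > 0" "W (flow h Q) = 0"
  shows "Z (flow h Q) \<noteq> 0"
proof
  assume "Z (flow h Q) = 0"
  then have "many j Q" using assms unfolding touch_bound_def by blast
  then show False using many_card[of j Q] assms(3,4) by simp
qed

lemma window_cnt:
  assumes D: "locally_started D" "touch_bound D j" "Q \<in> D" and m: "finite (SC Q)" "card (SC Q) = m" "m < j"
    and e: "e > 0" "\<And>t. t \<in> {0<..e} \<Longrightarrow> flow t Q $ 1 > 0 \<and> W (flow t Q) \<noteq> 0"
    and b: "e < b" "\<And>t. 0 < t \<Longrightarrow> t \<le> b \<Longrightarrow> flow t Q $ 1 > 0" "W (flow b Q) \<noteq> 0" "SC Q \<subseteq> {..b}"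
  shows "cnt Q e b m"
proof -
  have tr: "Q \<in> trap" "field Q \<noteq> 0" using D(1,3) by (auto simp: locally_started_def)
  have c: "cnt Q e b (card {t \<in> {e..b}. W (flow t Q) = 0})"
  proof (rule cnt_exists[OF b(1) _ _ b(3) tr(2)])
    fix t assume t: "t \<in> {e..b}"
    have "Z (flow t Q) \<noteq> 0" if "W (flow t Q) = 0"
      by (rule no_touch[OF D(2,3) m(1)]) (use m b(2) t e(1) that in auto)
    then show "flow t Q \<in> region \<and> flow t Q $ 1 > 0 \<and> (W (flow t Q) = 0 \<longrightarrow> Z (flow t Q) \<noteq> 0)"
      using flow_region[OF tr(1), of t] b(2)[of t] t e(1) by auto
  qed (use e(1) e(2)[of e] in auto)
  have "card (SC Q) = card {t \<in> {e..b}. W (flow t Q) = 0}"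
    using card_SC_window[OF e c b(4)] by simp
  then show ?thesis using c m(2) by simp
qed

text \<open>The window ends shortly before the return, where already \<open>W < 0\<close>. Its count
  is perturbed by \<open>cnt_perturb\<close>, the remaining descent by
  \<open>hit_near\<close>.\<close>

lemma cross_elim:
  assumes D: "locally_started D" "touch_bound D j" "Q \<in> D" and m: "cross m Q" "m < j" and T: "hit Q T"
    and e: "e > 0" "\<And>t. t \<in> {0<..e} \<Longrightarrow> flow t Q $ 1 > 0 \<and> W (flow t Q) \<noteq> 0"
  obtains b where "e < b" "b < T" "cnt Q e b m" "\<And>t. b \<le> t \<Longrightarrow> t \<le> T \<Longrightarrow> W (flow t Q) < 0"
proof -
  have tr: "Q \<in> trap" "off Q" using D(1,3) by (auto simp: locally_started_def)
  have WT: "W (flow T Q) < 0" by (rule hit_W_neg[OF T tr])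
  have T': "T > 0" "flow T Q $ 1 = 0" "\<And>t. 0 < t \<Longrightarrow> t < T \<Longrightarrow> flow t Q $ 1 > 0" using T by (auto simp: hit_def)
  have eT: "e < T" using e(2)[of T] T' by (cases "e < T") auto
  obtain d where d: "d > 0" "\<And>u. \<bar>u - T\<bar> < d \<Longrightarrow> W (flow u Q) < 0"
    using W_near[OF open_sets(1), of T Q] WT by auto
  define b where "b = max ((e + T) / 2) (T - d / 2)"
  have b: "e < b" "b < T" "T - d < b" using eT d by (auto simp: b_def max_def)
  have neg: "W (flow t Q) < 0" if "b \<le> t" "t \<le> T" for t using d(2)[of t] b that by auto
  have "cnt Q e b m"
  proof (rule window_cnt[OF D _ _ m(2) e b(1)])
    show "finite (SC Q)" "card (SC Q) = m" using m(1) by (auto simp: cross_def)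
    show "SC Q \<subseteq> {..b}"
    proof
      fix t assume t: "t \<in> SC Q"
      have "t < T" using t T' by (force simp: SC_def not_less)
      then show "t \<in> {..b}" using neg[of t] t by (cases "t \<le> b") (auto simp: SC_def)
    qed
  qed (use T' b neg[of b] in auto)
  then show ?thesis using that b neg by blast
qed

lemma no_turn_after:
  assumes D: "touch_bound D j" "Q \<in> D" and S: "finite (SC Q)" "card (SC Q) < j"
    and x: "\<And>u. u > 0 \<Longrightarrow> flow u Q $ 1 > 0"
  shows "\<exists>b0\<ge>e. (\<forall>t>b0. W (flow t Q) \<noteq> 0) \<and> SC Q \<subseteq> {..b0}"
proof -
  define b0 where "b0 = Max (insert (max e 0) (SC Q))"
  have b0: "max e 0 \<le> b0" "\<And>t. t \<in> SC Q \<Longrightarrow> t \<le> b0" using S(1) by (auto simp: b0_def simp del: max.bounded_iff)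
  have nz: "W (flow t Q) \<noteq> 0" if "t > b0" for t
  proof
    assume w: "W (flow t Q) = 0"
    have "Z (flow t Q) \<noteq> 0" by (rule no_touch[OF D S]) (use x w that b0 in auto)
    then have "t \<in> SC Q" using w x that b0 by (auto simp: SC_def)
    then show False using b0(2) that by force
  qed
  then show ?thesis using b0 by (intro exI[of _ b0]) auto
qed

lemma settle_elim:
  assumes D: "locally_started D" "touch_bound D j" "Q \<in> D" and m: "settle m Q" "m < j"
    and e: "e > 0" "\<And>t. t \<in> {0<..e} \<Longrightarrow> flow t Q $ 1 > 0 \<and> W (flow t Q) \<noteq> 0"
  shows "\<exists>b0. \<forall>b>b0. e < b \<and> cnt Q e b m \<and> (\<forall>t\<ge>b. W (flow t Q) < 0)"
proof -
  have tr: "Q \<in> trap" using D(1,3) by (auto simp: locally_started_def)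
  have S: "finite (SC Q)" "card (SC Q) = m" and x: "\<And>u. u > 0 \<Longrightarrow> flow u Q $ 1 > 0"
    and lim: "((\<lambda>t. flow t Q) \<longlongrightarrow> 0) at_top" using m(1) by (auto simp: settle_def)
  obtain b0 where b0: "b0 \<ge> e" "\<And>t. t > b0 \<Longrightarrow> W (flow t Q) \<noteq> 0" "SC Q \<subseteq> {..b0}"
    using no_turn_after[OF D(2,3) S(1) _ x, of e] S(2) m(2) by auto
  note nz = b0(2)
  \<comment> \<open>After the last zero of \<open>W\<close> a positive sign would make
    \<open>x\<close> increase, so that it could not tend to 0.\<close>
  have neg: "W (flow t Q) < 0" if t: "t > b0" for t
  proof (rule ccontr)
    assume "\<not> W (flow t Q) < 0"
    then have p: "W (flow t Q) > 0" using nz[OF t] by simp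
    have pos: "W (flow u Q) > 0" if u: "u \<ge> t" for u
    proof (rule ccontr)
      assume "\<not> W (flow u Q) > 0"
      then obtain v where "t < v" "W (flow v Q) = 0"
        using first_nonpos[OF continuous_on_Wf[of "{t..u}"] p, of u] u by auto
      then show False using nz[of v] t by simp
    qed
    have "flow t Q $ 1 \<le> 0"
    proof (rule tendsto_lowerbound)
      show "((\<lambda>t. flow t Q $ 1) \<longlongrightarrow> 0) at_top" using tendsto_vec_nth[OF lim, of 1] by simp
      show "\<forall>\<^sub>F u in at_top. flow t Q $ 1 \<le> flow u Q $ 1"
        using eventually_ge_at_top[of t]
      proof eventually_elim
        case (elim u)
        then show ?case
          using flow_region[OF tr] pos t b0(1) e(1) by (intro x_mono) (auto intro: less_imp_le)
      qed
    qed simp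
    then show False using x[of t] t b0 e by simp
  qed
  have "e < b \<and> cnt Q e b m \<and> (\<forall>t\<ge>b. W (flow t Q) < 0)" if b: "b > b0" for b
  proof (intro conjI allI impI)
    show eb: "e < b" using b b0 by simp
    show "cnt Q e b m"
    proof (rule window_cnt[OF D S m(2) e eb])
      show "SC Q \<subseteq> {..b}" using b0(3) b by force
    qed (use x nz[OF b] in auto)
  qed (use neg b in auto)
  then show ?thesis by blast
qed

subsection \<open>Dependence on the starting point\<close>

lemma cross_persist:
  assumes D: "locally_started D" "touch_bound D j" "Q \<in> D" and m: "cross m Q" "m < j" and T: "hit Q T" and d: "d > 0"
  shows "\<forall>\<^sub>F C in nhds Q. C \<in> D \<longrightarrow> cross m C \<and> (\<exists>T'. hit C T' \<and> \<bar>T' - T\<bar> < d)"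
proof -
  obtain e where e: "e > 0" "\<forall>\<^sub>F C in nhds Q. C \<in> D \<longrightarrow> (\<forall>t\<in>{0<..e}. flow t C $ 1 > 0 \<and> W (flow t C) \<noteq> 0)"
    "\<And>t. t \<in> {0<..e} \<Longrightarrow> flow t Q $ 1 > 0 \<and> W (flow t Q) \<noteq> 0" "Q \<in> trap"
    by (rule locally_startedE[OF D(1,3)], rule that)
  obtain b where b: "e < b" "b < T" "cnt Q e b m" "\<And>t. b \<le> t \<Longrightarrow> t \<le> T \<Longrightarrow> W (flow t Q) < 0"
    by (rule cross_elim[OF D m T e(1,3)], assumption, rule that)
  have T': "T > 0" "flow T Q $ 1 = 0" "\<And>t. 0 < t \<Longrightarrow> t < T \<Longrightarrow> flow t Q $ 1 > 0" using T by (auto simp: hit_def)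
  have "\<forall>\<^sub>F C in nhds Q. \<exists>T'>b. \<bar>T' - T\<bar> < d \<and> (\<forall>t\<in>{b..<T'}. flow t C $ 1 > 0) \<and> flow T' C $ 1 = 0 \<and>
           (\<forall>t\<in>{b..T'}. W (flow t C) < 0)"
    by (rule hit_near) (use flow_region[OF e(4), of T] b T' e(1) d in auto)
  then show ?thesis using e(2) cnt_perturb[OF b(3)]
  proof eventually_elim
    case (elim C)
    then obtain T1 where T1: "T1 > b" "\<bar>T1 - T\<bar> < d" "\<forall>t\<in>{b..<T1}. flow t C $ 1 > 0" "flow T1 C $ 1 = 0"
      "\<forall>t\<in>{b..T1}. W (flow t C) < 0" by blast
    show ?case
    proof
      assume "C \<in> D"
      then have "hit C T1 \<and> cross m C"
        using elim(2,3) T1 by (intro cross_intro[OF e(1) _ elim(3)]) auto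
      then show "cross m C \<and> (\<exists>T'. hit C T' \<and> \<bar>T' - T\<bar> < d)" using T1(2) by blast
    qed
  qed
qed

lemma nxt_persist:
  assumes D: "locally_started D" "touch_bound D j" "Q \<in> D" and m: "cross m Q" "m < j"
    and "\<forall>\<^sub>F p in nhds (nxt Q). \<Phi> p"
  shows "\<forall>\<^sub>F C in nhds Q. C \<in> D \<longrightarrow> \<Phi> (nxt C)"
proof -
  obtain T where T: "hit Q T" using m(1) by (auto simp: cross_def)
  obtain d where d: "d > 0" "\<forall>\<^sub>F C in nhds Q. \<forall>T'. \<bar>T' - T\<bar> < d \<longrightarrow> \<Phi> (rfl (flow T' C))"
    using flow_rfl_near assms(6) unfolding nxt_eq[OF T] by blast
  show ?thesis using cross_persist[OF D m T d(1)] d(2)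
    by eventually_elim (auto simp: nxt_eq)
qed

lemma many_persist:
  assumes D: "locally_started D" "Q \<in> D" and k: "many k Q"
  shows "\<forall>\<^sub>F C in nhds Q. C \<in> D \<longrightarrow> many k C"
proof (cases "k = 0")
  case False
  obtain e where e: "e > 0" "\<forall>\<^sub>F C in nhds Q. C \<in> D \<longrightarrow> (\<forall>t\<in>{0<..e}. flow t C $ 1 > 0 \<and> W (flow t C) \<noteq> 0)"
    "\<And>t. t \<in> {0<..e} \<Longrightarrow> flow t Q $ 1 > 0 \<and> W (flow t Q) \<noteq> 0" "Q \<in> trap"
    by (rule locally_startedE[OF D], rule that)
  obtain K where K: "K \<subseteq> SC Q" "finite K" "card K = k" using k by (auto simp: many_def)
  then have ne: "K \<noteq> {}" using False by auto
  define t1 where "t1 = Max K"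
  have t1: "t1 \<in> K" "\<And>t. t \<in> K \<Longrightarrow> t \<le> t1" using K ne by (auto simp: t1_def)
  have x1: "flow t Q $ 1 > 0" if "0 < t" "t \<le> t1" for t using t1(1) K(1) that by (auto simp: SC_def)
  have Kp: "0 < t" "W (flow t Q) = 0" "Z (flow t Q) \<noteq> 0" "t \<le> t1" if "t \<in> K" for t
    using that K(1) t1 by (auto simp: SC_def)
  have eK: "e < t" if "t \<in> K" for t using Kp[OF that] e(3)[of t] by (cases "t \<le> e") auto
  obtain h where h: "h > 0" "\<And>u. \<bar>u - t1\<bar> < h \<Longrightarrow> flow u Q $ 1 > 0"
    using W_near[OF open_sets(3), of t1 Q] x1[of t1] Kp[OF t1(1)] by auto
  \<comment> \<open>\<open>d < e\<close> keeps the perturbed zeros at positive times, and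
    \<open>d < h\<close> keeps them in the range where \<open>x > 0\<close> is known.\<close>
  define d where "d = min e h / 2"
  have d: "0 < d" "d < e" "d < h" using e(1) h(1) by (auto simp: d_def min_def)
  have "\<forall>\<^sub>F C in nhds Q. \<forall>t\<in>{e..t1 + d}. flow t C \<in> {p. p $ 1 > 0}"
  proof (rule flow_tube[OF _ open_sets(3)])
    fix t assume t: "t \<in> {e..t1 + d}"
    then show "flow t Q \<in> {p. p $ 1 > 0}" using x1[of t] h(2)[of t] d e(1) by (cases "t \<le> t1") auto
  qed simp
  moreover have "\<forall>\<^sub>F C in nhds Q. \<exists>g. inj_on g K \<and>
      (\<forall>t\<in>K. \<bar>g t - t\<bar> < d \<and> W (flow (g t) C) = 0 \<and> Z (flow (g t) C) \<noteq> 0)"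
  proof (rule zeros_persist[OF K(2) d(1)])
    fix t assume t: "t \<in> K"
    show "flow t Q \<in> region \<and> flow t Q $ 1 \<noteq> 0 \<and> W (flow t Q) = 0 \<and> Z (flow t Q) \<noteq> 0"
      using flow_region[OF e(4), of t] x1[of t] Kp[OF t] by auto
  qed
  ultimately show ?thesis using e(2)
  proof eventually_elim
    case (elim C)
    then obtain g where g: "inj_on g K" "\<And>t. t \<in> K \<Longrightarrow> \<bar>g t - t\<bar> < d \<and> W (flow (g t) C) = 0 \<and> Z (flow (g t) C) \<noteq> 0"
      by blast
    show ?case
    proof
      assume "C \<in> D"
      have "g t \<in> SC C" if t: "t \<in> K" for t
      proof -
        have gt: "0 < g t" "g t \<le> t1 + d" using g(2)[OF t] eK[OF t] Kp(4)[OF t] d by linarith+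
        have "flow u C $ 1 > 0" if "0 < u" "u \<le> g t" for u
          using elim(1,3) \<open>C \<in> D\<close> that gt by (cases "u \<le> e") auto
        then show ?thesis using gt g(2)[OF t] by (auto simp: SC_def)
      qed
      then have "g ` K \<subseteq> SC C" by blast
      then show "many k C" unfolding many_def using K g(1) by (intro exI[of _ "g ` K"]) (auto simp: card_image)
    qed
  qed
qed simp

text \<open>With a count below \<open>j\<close> there are no tangencies, so after the last sign
  change \<open>W\<close> has no zeros at all; \<open>x\<close> is then monotone and converges,
  necessarily to a nonnegative limit.\<close>

lemma no_hit_limit:
  assumes D: "locally_started D" "touch_bound D j" "Q \<in> D" and S: "finite (SC Q)" "card (SC Q) < j"
    and x: "\<And>u. u > 0 \<Longrightarrow> flow u Q $ 1 > 0"
  shows "((\<lambda>t. flow t Q) \<longlongrightarrow> 0) at_top \<or> ((\<lambda>t. flow t Q) \<longlongrightarrow> p0 q R) at_top"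
proof -
  have tr: "Q \<in> trap" "field Q \<noteq> 0" using D(1,3) by (auto simp: locally_started_def)
  obtain b0 where b0: "b0 \<ge> 0" "\<And>t. t > b0 \<Longrightarrow> W (flow t Q) \<noteq> 0"
    using no_turn_after[OF D(2,3) S x, of 0] by blast
  have "(\<forall>t\<in>{b0<..}. W (flow t Q) \<ge> 0) \<or> (\<forall>t\<in>{b0<..}. W (flow t Q) \<le> 0)"
  proof (rule W_one_signed[OF _ tr(2)])
    fix t assume t: "t \<in> {b0<..}"
    then show "flow t Q \<in> region \<and> flow t Q $ 1 \<noteq> 0" using flow_region[OF tr(1), of t] x[of t] b0(1) by auto
    show "W (flow t Q) = 0 \<Longrightarrow> Z (flow t Q) = 0" using b0(2)[of t] t by simp
  qed simp
  then have "(\<forall>t>b0. W (flow t Q) \<ge> 0) \<or> (\<forall>t>b0. W (flow t Q) \<le> 0)" by (meson greaterThan_iff)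
  then obtain l where l: "((\<lambda>t. flow t Q $ 1) \<longlongrightarrow> l) at_top" "((\<lambda>t. flow t Q) \<longlongrightarrow> eq_at l) at_top"
    "l = 0 \<or> l\<^sup>2 = q * (R - 1)"
    using one_signed_limit[OF tr(1) b0(1)] by blast
  have "\<forall>\<^sub>F t in at_top. 0 \<le> flow t Q $ 1"
    using eventually_gt_at_top[of 0] by eventually_elim (use x in \<open>auto intro: less_imp_le\<close>)
  then have "0 \<le> l" by (intro tendsto_lowerbound[OF l(1)]) simp_all
  then consider "l = 0" | "l > 0" by linarith
  then show ?thesis
  proof cases
    case 1 then show ?thesis using l(2) by (simp add: eq_at_def)
  next
    case 2 then show ?thesis using l(2,3) eq_at_p0 by simp
  qed
qed

text \<open>Orbits following one that converges to \<open>p\<^sub>0\<close> must spiral away before their next zero of \<open>x\<close>.\<close>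

lemma p0_escape:
  assumes C: "C \<longlonglongrightarrow> Q" and T: "T \<ge> 0" and x: "\<And>n t. 0 < t \<Longrightarrow> t \<le> T \<Longrightarrow> flow t (C n) $ 1 > 0"
    and near: "\<And>t. t \<ge> T \<Longrightarrow> dist (flow t Q) (p0 q R) < d1"
    and leave: "\<And>n. \<exists>t\<ge>T. dist (flow t (C n)) (p0 q R) \<ge> d1"
  shows "\<exists>n. many 4 (C n)"
proof -
  have lim: "(\<lambda>n. flow T (C n)) \<longlonglongrightarrow> flow T Q" by (intro tendsto_flow tendsto_const C)
  have st: "dist (flow t (flow T Q)) (p0 q R) < d1" if "t \<ge> 0" for t
    using near[of "t + T"] that by (simp add: flow_add)
  have lv: "\<exists>t\<ge>0. dist (flow t (flow T (C n))) (p0 q R) \<ge> d1" for n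
  proof -
    obtain t where "t \<ge> T" "dist (flow t (C n)) (p0 q R) \<ge> d1" using leave by blast
    then show ?thesis by (intro exI[of _ "t - T"]) (simp add: flow_add[symmetric])
  qed
  obtain b r S where b: "strict_mono (r :: nat \<Rightarrow> nat)" "(\<lambda>n. flow (S n) (flow T (C (r n)))) \<longlonglongrightarrow> b"
    "dist b (p0 q R) = d1" "\<And>t. t \<le> 0 \<Longrightarrow> dist (flow t b) (p0 q R) \<le> d1" "filterlim S at_top sequentially"
    "\<And>n. S n \<ge> 0" "\<And>n t. 0 \<le> t \<Longrightarrow> t \<le> S n \<Longrightarrow> dist (flow t (flow T (C (r n)))) (p0 q R) \<le> d1"
    by (rule departure[OF lim st lv], assumption, rule that)
  have d1: "d1 > 0" using X0_pos by (simp add: d1_def)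
  have bn: "flow t b \<in> cball (p0 q R) d1" if "t \<le> 0" for t using b(4)[OF that] by (simp add: dist_commute)
  have "b \<noteq> p0 q R" using b(3) d1 by auto
  from leaving_p0_many[OF q_le_2s bn this]
  obtain K where K: "finite K" "card K = 4" "\<And>t. t \<in> K \<Longrightarrow> t < 0 \<and> W (flow t b) = 0 \<and> Z (flow t b) \<noteq> 0"
    by blast
  have "K \<noteq> {}" using K(2) by auto
  define d where "d = - Max K"
  have MK: "Max K \<in> K" "\<And>t. t \<in> K \<Longrightarrow> t \<le> Max K" "\<And>t. t \<in> K \<Longrightarrow> Min K \<le> t" using K(1) \<open>K \<noteq> {}\<close> by auto
  have d: "d > 0" "\<And>t. t \<in> K \<Longrightarrow> t \<le> - d" using K(3)[OF MK(1)] MK(2) by (auto simp: d_def)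
  have ev1: "\<forall>\<^sub>F C in nhds b. \<exists>g. inj_on g K \<and>
      (\<forall>t\<in>K. \<bar>g t - t\<bar> < d \<and> W (flow (g t) C) = 0 \<and> Z (flow (g t) C) \<noteq> 0)"
  proof (rule zeros_persist[OF K(1) d(1)])
    fix t assume t: "t \<in> K"
    show "flow t b \<in> region \<and> flow t b $ 1 \<noteq> 0 \<and> W (flow t b) = 0 \<and> Z (flow t b) \<noteq> 0"
      using near_p0[OF bn[of t]] K(3)[OF t] by auto
  qed
  \<comment> \<open>The zeros in \<open>K\<close> are dated backward from the exit of the ball. Once
    the exit time is this large, their perturbations fall between the entry at \<open>T\<close> and
    the exit.\<close>
  have "\<forall>\<^sub>F n in sequentially. S n > d - Min K" using b(5) by (simp add: filterlim_at_top_dense)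
  moreover have "\<forall>\<^sub>F n in sequentially. \<exists>g. inj_on g K \<and>
      (\<forall>t\<in>K. \<bar>g t - t\<bar> < d \<and> W (flow (g t) (flow (S n) (flow T (C (r n))))) = 0 \<and>
         Z (flow (g t) (flow (S n) (flow T (C (r n))))) \<noteq> 0)"
    by (rule eventually_compose_filterlim[OF ev1 b(2)])
  ultimately have "\<forall>\<^sub>F n in sequentially. many 4 (C (r n))"
  proof eventually_elim
    case (elim n)
    then obtain g where g: "inj_on g K" "\<And>t. t \<in> K \<Longrightarrow> \<bar>g t - t\<bar> < d \<and>
         W (flow (g t) (flow (S n) (flow T (C (r n))))) = 0 \<and> Z (flow (g t) (flow (S n) (flow T (C (r n))))) \<noteq> 0"
      by blast
    define h where "h t = g t + (S n + T)" for t
    have "h t \<in> SC (C (r n))" if t: "t \<in> K" for t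
    proof -
      have gt: "g t < 0" "g t > - S n"
        using g(2)[OF t] d(2)[OF t] MK(3)[OF t] elim(1) d(1) by linarith+
      have "flow u (C (r n)) $ 1 > 0" if u: "0 < u" "u \<le> h t" for u
      proof (cases "u \<le> T")
        case True then show ?thesis using x u by blast
      next
        case False
        have "dist (flow (u - T) (flow T (C (r n)))) (p0 q R) \<le> d1"
          using b(7)[of "u - T" n] False u gt by (simp add: h_def)
        then have "flow u (C (r n)) \<in> cball (p0 q R) d1" by (simp add: flow_add[symmetric] dist_commute)
        then show ?thesis by (rule near_p0(3))
      qed
      moreover have "W (flow (h t) (C (r n))) = 0 \<and> Z (flow (h t) (C (r n))) \<noteq> 0"
        using g(2)[OF t] by (simp add: h_def flow_add)
      moreover have "h t > 0" using gt T by (simp add: h_def)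
      ultimately show ?thesis by (auto simp: SC_def)
    qed
    then have "h ` K \<subseteq> SC (C (r n))" by blast
    moreover have "inj_on h K" using g(1) by (auto simp: h_def inj_on_def)
    ultimately show ?case
      unfolding many_def using K by (intro exI[of _ "h ` K"]) (auto simp: card_image)
  qed
  then obtain n where "many 4 (C (r n))" by (meson eventually_happens sequentially_bot)
  then show ?thesis by blast
qed

text \<open>What the unstable branch does according to Condition A, as an open condition.\<close>

definition tracks :: "real \<Rightarrow> real ^ 3 \<Rightarrow> bool" where
  "tracks t' C \<longleftrightarrow> cnt C 0 t' 1 \<and> W C > 0 \<and> (C \<in> trap \<longrightarrow> (\<exists>T'>t'. (\<forall>t\<in>{t'..<T'}. flow t C $ 1 > 0) \<and>
    flow T' C $ 1 = 0 \<and> (\<forall>t\<in>{t'..T'}. W (flow t C) < 0) \<and> many 4 (rfl (flow T' C))))"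

lemma follow_unst:
  assumes b: "unst b"
  shows "\<exists>t'>0. \<forall>\<^sub>F C in nhds b. tracks t' C"
proof -
  obtain \<tau> t1 where u: "0 < \<tau>" "\<tau> < t1" "\<forall>t<\<tau>. W (flow t b) > 0" "W (flow \<tau> b) = 0" "Z (flow \<tau> b) > 0"
    "\<forall>t\<in>{\<tau><..t1}. W (flow t b) < 0" "\<forall>t<t1. flow t b $ 1 > 0" "flow t1 b $ 1 = 0" "many 4 (rfl (flow t1 b))"
    using unst_profile[OF b] by blast
  define t' where "t' = (\<tau> + t1) / 2"
  have t': "\<tau> < t'" "t' < t1" using u by (auto simp: t'_def)
  have c: "cnt b 0 t' 1"
  proof (rule cnt_1[OF u(1) t'(1)])
    fix t assume t: "t \<in> {0..t'}"
    have "W (flow t b) = 0 \<longleftrightarrow> t = \<tau>"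
      using u(3,4,6) t t' by (cases t \<tau> rule: linorder_cases) (auto simp: less_le)
    then show "flow t b \<in> region \<and> flow t b $ 1 > 0 \<and> (W (flow t b) = 0) = (t = \<tau>)"
      using unst_region[OF b] u(7) t t' by auto
  qed (use u(5) in auto)
  have WB: "\<forall>\<^sub>F C in nhds b. W C > 0"
    using flow_tube[OF _ open_sets(2), of "{0}" b] u(3)[rule_format, OF u(1)] by simp
  have n1: "W (flow t1 b) < 0" using u by auto
  have S: "rfl (flow t1 b) \<in> SS" using flow_trap[OF unst_trap[OF b], of t1] u n1 by (auto simp: SS_def)
  obtain d where d: "d > 0" "\<forall>\<^sub>F C in nhds b. \<forall>T'. \<bar>T' - t1\<bar> < d \<longrightarrow> rfl (flow T' C) \<in> SS \<longrightarrow> many 4 (rfl (flow T' C))"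
    using flow_rfl_near[OF many_persist[OF locally_started_SS S u(9)]] by blast
  have "\<forall>\<^sub>F C in nhds b. \<exists>T'>t'. \<bar>T' - t1\<bar> < d \<and> (\<forall>t\<in>{t'..<T'}. flow t C $ 1 > 0) \<and> flow T' C $ 1 = 0 \<and>
           (\<forall>t\<in>{t'..T'}. W (flow t C) < 0)"
    by (rule hit_near) (use unst_region[OF b] u t' d in auto)
  then have "\<forall>\<^sub>F C in nhds b. tracks t' C"
    using cnt_perturb[OF c] d(2) WB
  proof eventually_elim
    case (elim C)
    then obtain T' where T': "T' > t'" "\<bar>T' - t1\<bar> < d" "\<forall>t\<in>{t'..<T'}. flow t C $ 1 > 0" "flow T' C $ 1 = 0"
      "\<forall>t\<in>{t'..T'}. W (flow t C) < 0" by blast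
    have "many 4 (rfl (flow T' C))" if "C \<in> trap"
    proof -
      have "rfl (flow T' C) \<in> SS" using flow_trap[OF that, of T'] T' t' u(1) by (auto simp: SS_def)
      then show ?thesis using elim(3) T'(2) by blast
    qed
    then show ?case unfolding tracks_def using elim(2,4) T' by blast
  qed
  then show ?thesis using t' u(1) by (intro exI[of _ t']) auto
qed

text \<open>A nearby orbit that does not itself settle leaves the ball about the origin close to one
  of the two branches. On the side \<open>x > 0\<close> it has turned once near the origin and turns
  once more along the branch before its next zero of \<open>x\<close>, which gives
  \<open>m + 2\<close>. On the side \<open>x < 0\<close> the zero of \<open>x\<close> near the
  origin closes the leg with count \<open>m\<close>, and the next leg follows the mirrored branch
  with count 1. The leg after either of these is governed by the four later sign changes of the
  branch.\<close>

lemma exit_near_settle: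
  assumes D: "locally_started D" "touch_bound D j" "Q \<in> D" and m: "settle m Q" "m < j"
  shows "\<forall>\<^sub>F C in nhds Q. C \<in> D \<longrightarrow> settle m C \<or> (cross m C \<and> cross 1 (nxt C) \<and> many 4 (nxt (nxt C))) \<or>
    (cross (m + 2) C \<and> many 4 (nxt C))" (is "\<forall>\<^sub>F C in nhds Q. ?\<Phi> C")
proof (rule ccontr)
  assume "\<not> ?thesis"
  then obtain C0 where C0: "C0 \<longlonglongrightarrow> Q" "\<And>n. \<not> ?\<Phi> (C0 n)"
    using not_eventually_nhds_sequence[of ?\<Phi> Q] by blast
  obtain e where e: "e > 0" "\<forall>\<^sub>F C in nhds Q. C \<in> D \<longrightarrow> (\<forall>t\<in>{0<..e}. flow t C $ 1 > 0 \<and> W (flow t C) \<noteq> 0)"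
    "\<And>t. t \<in> {0<..e} \<Longrightarrow> flow t Q $ 1 > 0 \<and> W (flow t Q) \<noteq> 0" "Q \<in> trap"
    by (rule locally_startedE[OF D(1,3)], rule that)
  obtain b0 where b0: "\<forall>b>b0. e < b \<and> cnt Q e b m \<and> (\<forall>t\<ge>b. W (flow t Q) < 0)"
    using settle_elim[OF D m e(1,3)] by blast
  have lim0: "((\<lambda>t. flow t Q) \<longlongrightarrow> 0) at_top" using m(1) by (simp add: settle_def)
  have "\<forall>\<^sub>F t in at_top. dist (flow t Q) 0 < d0" using lim0 d0 by (intro tendstoD) auto
  then obtain b1 where b1: "\<And>t. t \<ge> b1 \<Longrightarrow> dist (flow t Q) 0 < d0" by (auto simp: eventually_at_top_linorder)
  define b where "b = max (b0 + 1) b1"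
  have b: "e < b" "cnt Q e b m" "W (flow b Q) < 0" using b0[rule_format, of b] by (auto simp: b_def)
  have stay: "dist (flow t (flow b Q)) 0 < d0" if "t \<ge> 0" for t
    using b1[of "t + b"] that by (simp add: flow_add[symmetric] b_def)
  have "\<forall>\<^sub>F C in nhds Q. \<forall>t\<in>{b}. flow t C \<in> {p. W p < 0}" by (rule flow_tube[OF _ open_sets(1)]) (use b in auto)
  then have "\<forall>\<^sub>F C in nhds Q. cnt C e b m \<and> W (flow b C) < 0 \<and>
      (C \<in> D \<longrightarrow> (\<forall>t\<in>{0<..e}. flow t C $ 1 > 0 \<and> W (flow t C) \<noteq> 0))"
    using cnt_perturb[OF b(2)] e(2) by eventually_elim auto
  then have "\<forall>\<^sub>F n in sequentially. cnt (C0 n) e b m \<and> W (flow b (C0 n)) < 0 \<and>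
      (C0 n \<in> D \<longrightarrow> (\<forall>t\<in>{0<..e}. flow t (C0 n) $ 1 > 0 \<and> W (flow t (C0 n)) \<noteq> 0))"
    by (rule eventually_compose_filterlim[OF _ C0(1)])
  then obtain N where N: "\<And>n. n \<ge> N \<Longrightarrow> cnt (C0 n) e b m \<and> W (flow b (C0 n)) < 0 \<and>
      (C0 n \<in> D \<longrightarrow> (\<forall>t\<in>{0<..e}. flow t (C0 n) $ 1 > 0 \<and> W (flow t (C0 n)) \<noteq> 0))"
    by (auto simp: eventually_sequentially)
  define C where "C n = C0 (n + N)" for n
  have CQ: "C \<longlonglongrightarrow> Q" using LIMSEQ_ignore_initial_segment[OF C0(1), of N] by (simp add: C_def[abs_def])
  have CD: "C n \<in> D" "\<not> settle m (C n)" "cross m (C n) \<Longrightarrow> cross 1 (nxt (C n)) \<Longrightarrow> \<not> many 4 (nxt (nxt (C n)))"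
    "cross (m + 2) (C n) \<Longrightarrow> \<not> many 4 (nxt (C n))" for n
    using C0(2)[of "n + N"] by (auto simp: C_def)
  have Ctr: "C n \<in> trap" "off (C n)" for n using CD(1)[of n] D(1) by (auto simp: locally_started_def)
  have Cc: "cnt (C n) e b m" "W (flow b (C n)) < 0" for n using N[of "n + N"] by (auto simp: C_def)
  have Ce: "flow t (C n) $ 1 > 0 \<and> W (flow t (C n)) \<noteq> 0" if "t \<in> {0<..e}" for t n
    using N[of "n + N"] CD(1)[of n] that by (auto simp: C_def)
  have xb: "flow b (C n) $ 1 > 0" for n using Cc(1)[of n] b(1) by (auto simp: cnt_def)
  have leave: "\<exists>t\<ge>0. dist (flow t (flow b (C n))) 0 \<ge> d0" for n
  proof (rule ccontr)
    assume stays: "\<not> ?thesis"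
    have near: "flow t (C n) \<in> cball 0 d0" if "t \<ge> b" for t
    proof -
      have "\<not> dist (flow (t - b) (flow b (C n))) 0 \<ge> d0" using stays that by (meson diff_ge_0_iff_ge)
      then show ?thesis by (simp add: flow_add[symmetric])
    qed
    have st: "(\<forall>t\<ge>b. flow t (C n) $ 1 > 0 \<and> W (flow t (C n)) < 0) \<and> ((\<lambda>t. flow t (C n)) \<longlongrightarrow> 0) at_top"
      by (rule stay_near_0[OF near xb Cc(2)])
    have "settle m (C n)"
      by (rule settle_intro[OF e(1) Ce Cc(1)]) (use st in auto)
    then show False using CD(2) by blast
  qed
  have lim: "(\<lambda>n. flow b (C n)) \<longlonglongrightarrow> flow b Q" by (intro tendsto_flow tendsto_const CQ)
  obtain B r S where B: "strict_mono (r :: nat \<Rightarrow> nat)" "(\<lambda>n. flow (S n) (flow b (C (r n)))) \<longlonglongrightarrow> B"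
    "dist B 0 = d0" "\<And>t. t \<le> 0 \<Longrightarrow> dist (flow t B) 0 \<le> d0" "filterlim S at_top sequentially"
    "\<And>n. S n \<ge> 0" "\<And>n t. 0 \<le> t \<Longrightarrow> t \<le> S n \<Longrightarrow> dist (flow t (flow b (C (r n)))) 0 \<le> d0"
    by (rule departure[OF lim stay leave], assumption, rule that)
  have near: "flow t (C (r n)) \<in> cball 0 d0" if "t \<in> {b..b + S n}" for t n
    using B(7)[of "t - b" n] that by (simp add: flow_add[symmetric])
  define E where "E n = flow (b + S n) (C (r n))" for n
  have EB: "E \<longlonglongrightarrow> B" using B(2) by (simp add: E_def[abs_def] flow_add[symmetric] add.commute)
  have Etr: "E n \<in> trap" for n using Ctr(1) b(1) e(1) B(6)[of n] by (auto simp: E_def intro!: flow_trap)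
  have bn: "flow t B \<in> cball 0 d0" if "t \<le> 0" for t using B(4)[OF that] by simp
  have "B \<noteq> 0" using B(3) d0 by auto
  from backward_near_0[OF bn this] consider "unst B" | "unst (rfl B)"
    using bn by (auto simp: unst_def flow_rfl)
  then show False
  proof cases
    case 1
    from follow_unst[OF this] obtain t' where t': "t' > 0" "\<forall>\<^sub>F C in nhds B. tracks t' C" by blast
    have "\<forall>\<^sub>F n in sequentially. tracks t' (E n)"
      by (rule eventually_compose_filterlim[OF t'(2) EB])
    then obtain n where tn: "tracks t' (E n)" using eventually_happens'[OF sequentially_bot] by blast
    then have n: "cnt (E n) 0 t' 1" "W (E n) > 0" by (auto simp: tracks_def)
    obtain T' where T': "T' > t'" "\<forall>t\<in>{t'..<T'}. flow t (E n) $ 1 > 0" "flow T' (E n) $ 1 = 0"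
      "\<forall>t\<in>{t'..T'}. W (flow t (E n)) < 0" "many 4 (rfl (flow T' (E n)))"
      using tn Etr[of n] unfolding tracks_def rfl_trap by blast
    define P where "P = C (r n)"
    define a where "a = b + S n"
    have ab: "b \<le> a" "a \<in> {b..a}" using B(6)[of n] by (auto simp: a_def)
    have nP: "flow t P \<in> cball 0 d0" if "t \<in> {b..a}" for t using near[of t n] that by (simp add: P_def a_def)
    have EP: "flow t (E n) = flow (t + a) P" for t by (simp add: E_def P_def a_def flow_add)
    have "\<forall>t\<in>{0..t'}. flow t (E n) $ 1 > 0" using n(1) by (auto simp: cnt_def)
    then have "flow 0 (E n) $ 1 > 0" using t'(1) by (meson atLeastAtMost_iff less_imp_le order_refl)
    then have Ea: "W (flow a P) > 0" "flow a P $ 1 > 0" using n(2) EP[of 0] by simp_all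
    have Pb: "flow b P $ 1 > 0" "W (flow b P) < 0" using xb Cc(2) by (auto simp: P_def)
    have "\<not> (\<forall>t\<in>{b..a}. W (flow t P) < 0)"
    proof
      assume "\<forall>t\<in>{b..a}. W (flow t P) < 0"
      from bspec[OF this ab(2)] Ea(1) show False by simp
    qed
    with passage_near_0[OF nP ab(1) Pb] obtain u where u: "b < u" "u \<le> a" "W (flow u P) = 0" "\<forall>t\<in>{b..<u}. W (flow t P) < 0"
      "\<forall>t\<in>{b..a}. flow t P $ 1 > 0" "\<forall>t\<in>{u<..a}. W (flow t P) > 0"
      by blast
    have ua: "u < a" using u(2,3) Ea(1) by (cases "u = a") auto
    have c1: "cnt P b a 1"
    proof (rule cnt_1[OF u(1) ua])
      fix t assume t: "t \<in> {b..a}"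
      have "W (flow t P) = 0 \<longleftrightarrow> t = u"
        using u(3,4,6) t by (cases t u rule: linorder_cases) (auto simp: less_le)
      then show "flow t P \<in> region \<and> flow t P $ 1 > 0 \<and> (W (flow t P) = 0) = (t = u)"
        using near_0_region[OF nP[OF t]] u(5) t by blast
    next
      show "Z (flow u P) \<noteq> 0" using Z_neg_near_0[OF nP[of u]] u(1,2) by auto
    qed
    have "cnt (flow a P) 0 t' 1" using n(1) EP[of 0] by simp
    then have c2: "cnt P a (t' + a) 1" by (simp add: cnt_shift)
    \<comment> \<open>The summands are the count before the neighbourhood of the origin, the turn
      inside it and the turn of the branch.\<close>
    have c3: "cnt P e (t' + a) (m + 1 + 1)"
      by (rule cnt_concat[OF cnt_concat[OF _ c1] c2]) (simp add: P_def Cc)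
    have hc: "hit P (T' + a) \<and> cross (m + 1 + 1) P"
    proof (rule cross_intro[OF e(1) _ c3])
      show "flow t P $ 1 > 0 \<and> W (flow t P) \<noteq> 0" if "t \<in> {0<..e}" for t using Ce[OF that] by (simp add: P_def)
      show "t' + a < T' + a" using T' by simp
      show "flow t P $ 1 > 0 \<and> W (flow t P) < 0" if "t' + a \<le> t" "t < T' + a" for t
      proof -
        have "t - a \<in> {t'..<T'}" "t - a \<in> {t'..T'}" using that by auto
        then have "flow (t - a) (E n) $ 1 > 0 \<and> W (flow (t - a) (E n)) < 0" using T'(2,4) by blast
        then show ?thesis by (simp add: EP)
      qed
      show "flow (T' + a) P $ 1 = 0" using T'(3) EP by simp
    qed
    then have "nxt P = rfl (flow T' (E n))" using nxt_eq[of P "T' + a"] EP by simp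
    then show False using CD(4)[of "r n"] hc T'(5) by (simp add: P_def)
  next
    case 2
    from follow_unst[OF this] obtain t' where t': "t' > 0" "\<forall>\<^sub>F C in nhds (rfl B). tracks t' C" by blast
    have "\<forall>\<^sub>F n in sequentially. tracks t' (rfl (E n))"
      by (rule eventually_compose_filterlim[OF t'(2) tendsto_rfl[OF EB]])
    then obtain n where tn: "tracks t' (rfl (E n))" using eventually_happens'[OF sequentially_bot] by blast
    then have n: "cnt (rfl (E n)) 0 t' 1" "W (rfl (E n)) > 0" by (auto simp: tracks_def)
    obtain T' where T': "T' > t'" "\<forall>t\<in>{t'..<T'}. flow t (rfl (E n)) $ 1 > 0" "flow T' (rfl (E n)) $ 1 = 0"
      "\<forall>t\<in>{t'..T'}. W (flow t (rfl (E n))) < 0" "many 4 (rfl (flow T' (rfl (E n))))"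
      using tn Etr[of n] unfolding tracks_def rfl_trap by blast
    define P where "P = C (r n)"
    define a where "a = b + S n"
    have ab: "b \<le> a" "a \<in> {b..a}" using B(6)[of n] by (auto simp: a_def)
    have nP: "flow t P \<in> cball 0 d0" if "t \<in> {b..a}" for t using near[of t n] that by (simp add: P_def a_def)
    have EP: "flow t (rfl (E n)) = rfl (flow (t + a) P)" for t by (simp add: E_def P_def a_def flow_add flow_rfl)
    have "\<forall>t\<in>{0..t'}. flow t (rfl (E n)) $ 1 > 0" using n(1) by (auto simp: cnt_def)
    then have "flow 0 (rfl (E n)) $ 1 > 0" using t'(1) by (meson atLeastAtMost_iff less_imp_le order_refl)
    moreover have "rfl (E n) = rfl (flow a P)" using EP[of 0] by simp
    ultimately have Ea: "W (flow a P) < 0" "flow a P $ 1 < 0" using n(2) by simp_all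
    have Pb: "flow b P $ 1 > 0" "W (flow b P) < 0" using xb Cc(2) by (auto simp: P_def)
    have "\<not> (\<forall>t\<in>{b..a}. flow t P $ 1 > 0)"
    proof
      assume "\<forall>t\<in>{b..a}. flow t P $ 1 > 0"
      from bspec[OF this ab(2)] Ea(2) show False by simp
    qed
    with passage_near_0[OF nP ab(1) Pb] obtain u where u: "b < u" "u \<le> a" "flow u P $ 1 = 0" "\<forall>t\<in>{b..<u}. flow t P $ 1 > 0"
      "\<forall>t\<in>{b..a}. W (flow t P) < 0" "\<forall>t\<in>{u<..a}. flow t P $ 1 < 0"
      by blast
    have ua: "u < a" using u(2,3) Ea(2) by (cases "u = a") auto
    have hc: "hit P u \<and> cross m P"
    proof (rule cross_intro[OF e(1)])
      show "flow t P $ 1 > 0 \<and> W (flow t P) \<noteq> 0" if "t \<in> {0<..e}" for t using Ce[OF that] by (simp add: P_def)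
      show "cnt P e b m" using Cc(1) by (simp add: P_def)
    qed (use u in auto)
    \<comment> \<open>The time from the zero of \<open>x\<close> to the exit from the ball. It is
      the initial interval of the next leg on which nothing is counted.\<close>
    define w where "w = a - u"
    have w: "w > 0" using ua by (simp add: w_def)
    have nx: "nxt P = rfl (flow u P)" using hc nxt_eq by blast
    have fn: "flow t (nxt P) = rfl (flow (t + u) P)" for t by (simp add: nx flow_rfl flow_add)
    have fE: "flow w (nxt P) = rfl (E n)" using fn[of w] EP[of 0] by (simp add: w_def)
    have fE': "flow t (rfl (E n)) = flow (t + w) (nxt P)" for t by (simp add: fE flow_add)
    have c1: "cnt (nxt P) w (t' + w) 1" using n(1) by (simp add: fE[symmetric] cnt_shift)
    have hc2: "hit (nxt P) (T' + w) \<and> cross 1 (nxt P)"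
    proof (rule cross_intro[OF w _ c1])
      show "flow t (nxt P) $ 1 > 0 \<and> W (flow t (nxt P)) \<noteq> 0" if "t \<in> {0<..w}" for t
      proof -
        have "t + u \<in> {b..a}" "t + u \<in> {u<..a}" using that u(1) by (auto simp: w_def)
        then have "W (flow (t + u) P) < 0 \<and> flow (t + u) P $ 1 < 0" using u(5,6) by blast
        then show ?thesis by (simp add: fn)
      qed
      show "t' + w < T' + w" using T' by simp
      show "flow t (nxt P) $ 1 > 0 \<and> W (flow t (nxt P)) < 0" if "t' + w \<le> t" "t < T' + w" for t
      proof -
        have "t - w \<in> {t'..<T'}" "t - w \<in> {t'..T'}" using that by auto
        then have "flow (t - w) (rfl (E n)) $ 1 > 0 \<and> W (flow (t - w) (rfl (E n))) < 0" using T'(2,4) by blast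
        then show ?thesis by (simp add: fE')
      qed
      show "flow (T' + w) (nxt P) $ 1 = 0" using T'(3) fE' by simp
    qed
    then have "nxt (nxt P) = rfl (flow T' (rfl (E n)))" using nxt_eq[of "nxt P" "T' + w"] fE' by simp
    then show False using CD(3)[of "r n"] hc hc2 T'(5) by (simp add: P_def)
  qed
qed

lemma cross_unique: "cross m P \<Longrightarrow> cross k P \<Longrightarrow> m = k"
  by (simp add: cross_def)

lemma settle_unique: "settle m P \<Longrightarrow> settle k P \<Longrightarrow> m = k"
  by (simp add: settle_def)

lemma cross_not_settle: "cross m P \<Longrightarrow> \<not> settle k P"
  unfolding cross_def settle_def hit_def by fastforce

lemma cross_not_many: "cross m P \<Longrightarrow> m < k \<Longrightarrow> \<not> many k P"
  using many_card[of k P] by (auto simp: cross_def)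

lemma settle_not_many: "settle m P \<Longrightarrow> m < k \<Longrightarrow> \<not> many k P"
  using many_card[of k P] by (auto simp: settle_def)

lemma cross_sequentially:
  assumes D: "locally_started D" "touch_bound D j" "Q \<in> D" and m: "cross m Q" "m < j"
    and C: "(C \<longlongrightarrow> Q) F" "\<forall>\<^sub>F n in F. C n \<in> D"
  shows "\<forall>\<^sub>F n in F. cross m (C n)"
proof -
  obtain T where "hit Q T" using m(1) by (auto simp: cross_def)
  then have "\<forall>\<^sub>F C in nhds Q. C \<in> D \<longrightarrow> cross m C \<and> (\<exists>T'. hit C T' \<and> \<bar>T' - T\<bar> < 1)"
    by (rule cross_persist[OF D m]) simp
  then have "\<forall>\<^sub>F n in F. C n \<in> D \<longrightarrow> cross m (C n) \<and> (\<exists>T'. hit (C n) T' \<and> \<bar>T' - T\<bar> < 1)"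
    by (rule eventually_compose_filterlim[OF _ C(1)])
  then show ?thesis using C(2) by eventually_elim blast
qed

lemma hit_or_positive:
  assumes e: "e > 0" "\<And>t. t \<in> {0<..e} \<Longrightarrow> flow t Q $ 1 > 0"
  shows "(\<exists>T. hit Q T) \<or> (\<forall>u>0. flow u Q $ 1 > 0)"
proof (rule disjCI)
  assume n: "\<not> (\<forall>u>0. flow u Q $ 1 > 0)"
  then obtain u where u: "u > 0" "flow u Q $ 1 \<le> 0" by (auto simp: not_less)
  then have "e < u" using e(2)[of u] by force
  then obtain T where T: "e < T" "T \<le> u" "flow T Q $ 1 = 0" "\<forall>v\<in>{e..<T}. flow v Q $ 1 > 0"
    using first_nonpos[OF continuous_on_x[of "{e..u}" Q 1], of u] e u by auto
  have "flow v Q $ 1 > 0" if "0 < v" "v < T" for v using e(2)[of v] T(4) that by (cases "v \<le> e") auto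
  then show "\<exists>T. hit Q T" using T e(1) by (intro exI[of _ T]) (auto simp: hit_def)
qed

text \<open>The count of the limit is at most \<open>m\<close> because lower bounds persist. If the
  limit returns, its count persists and equals \<open>m\<close>. If it runs into the origin, nearby
  counts equal its count or exceed it by 2. It cannot run into \<open>p0 q R\<close>, since the
  sequence would have to spiral away with at least four sign changes.\<close>

lemma limit_of_cross:
  assumes D: "locally_started D" "touch_bound D j" "Q \<in> D" and m: "m < j" "m < 4"
    and C: "C \<longlonglongrightarrow> Q" "\<And>n. C n \<in> D" "\<And>n. cross m (C n) \<or> settle m (C n)"
  shows "cross m Q \<or> settle m Q \<or> (\<exists>k. k + 2 = m \<and> settle k Q)"
proof -
  obtain e where e: "e > 0" "\<forall>\<^sub>F C in nhds Q. C \<in> D \<longrightarrow> (\<forall>t\<in>{0<..e}. flow t C $ 1 > 0 \<and> W (flow t C) \<noteq> 0)"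
    "\<And>t. t \<in> {0<..e} \<Longrightarrow> flow t Q $ 1 > 0 \<and> W (flow t Q) \<noteq> 0" "Q \<in> trap"
    by (rule locally_startedE[OF D(1,3)], rule that)
  have nm: "\<not> many k Q" if "k > m" for k
  proof
    assume "many k Q"
    from eventually_compose_filterlim[OF many_persist[OF D(1,3) this] C(1)]
    have "\<forall>\<^sub>F n in sequentially. many k (C n)" using C(2) by simp
    then obtain n where "many k (C n)" by (meson eventually_happens sequentially_bot)
    then show False using C(3)[of n] cross_not_many settle_not_many that by blast
  qed
  have fin: "finite (SC Q)" using nm[of "Suc m"] many_infinite by blast
  have le: "card (SC Q) \<le> m" using nm[of "card (SC Q)"] many_card_SC[OF fin] by (meson not_le)
  have kj: "card (SC Q) < j" using le m(1) by simp
  from hit_or_positive[OF e(1)] e(3) consider "\<exists>T. hit Q T" | "\<forall>u>0. flow u Q $ 1 > 0" by blast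
  then show ?thesis
  proof cases
    case 1
    then have cr: "cross (card (SC Q)) Q" using fin by (simp add: cross_def)
    have "\<forall>\<^sub>F n in sequentially. cross (card (SC Q)) (C n)"
      by (rule cross_sequentially[OF D cr kj C(1)]) (simp add: C(2))
    then obtain n where "cross (card (SC Q)) (C n)" by (meson eventually_happens sequentially_bot)
    then have "card (SC Q) = m" using C(3)[of n] cross_unique cross_not_settle by blast
    then show ?thesis using cr by simp
  next
    case x: 2
    then consider "((\<lambda>t. flow t Q) \<longlongrightarrow> 0) at_top" | "((\<lambda>t. flow t Q) \<longlongrightarrow> p0 q R) at_top"
      using no_hit_limit[OF D fin kj] by blast
    then show ?thesis
    proof cases
      case 1
      then have st: "settle (card (SC Q)) Q" using x fin by (simp add: settle_def)
      from eventually_compose_filterlim[OF exit_near_settle[OF D st kj] C(1)]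
      have "\<forall>\<^sub>F n in sequentially. settle (card (SC Q)) (C n) \<or> cross (card (SC Q)) (C n) \<or> cross (card (SC Q) + 2) (C n)"
        by eventually_elim (use C(2) in blast)
      from eventually_happens'[OF sequentially_bot this]
      obtain n where "settle (card (SC Q)) (C n) \<or> cross (card (SC Q)) (C n) \<or> cross (card (SC Q) + 2) (C n)"
        by blast
      then have "card (SC Q) = m \<or> card (SC Q) + 2 = m"
        using C(3)[of n] cross_unique cross_not_settle settle_unique by blast
      then show ?thesis using st by blast
    next
      case 2
      have d1: "d1 > 0" using X0_pos by (simp add: d1_def)
      have "\<forall>\<^sub>F t in at_top. dist (flow t Q) (p0 q R) < d1" by (rule tendstoD[OF 2 d1])
      then obtain T0 where T0: "\<And>t. t \<ge> T0 \<Longrightarrow> dist (flow t Q) (p0 q R) < d1"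
        by (auto simp: eventually_at_top_linorder)
      define T where "T = max T0 e"
      have "\<forall>\<^sub>F C in nhds Q. \<forall>t\<in>{e..T}. flow t C \<in> {p. p $ 1 > 0}"
        by (rule flow_tube[OF _ open_sets(3)]) (use x e(1) in auto)
      then have "\<forall>\<^sub>F C in nhds Q. C \<in> D \<longrightarrow> (\<forall>t\<in>{0<..T}. flow t C $ 1 > 0)"
        using e(2)
      proof eventually_elim
        case (elim C)
        show ?case
        proof (intro impI ballI)
          fix t assume "C \<in> D" "t \<in> {0<..T}"
          then show "flow t C $ 1 > 0" using elim by (cases "t \<le> e") auto
        qed
      qed
      from eventually_compose_filterlim[OF this C(1)]
      obtain N where N: "\<And>n. n \<ge> N \<Longrightarrow> \<forall>t\<in>{0<..T}. flow t (C n) $ 1 > 0"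
        using C(2) by (auto simp: eventually_sequentially)
      have leave: "\<exists>t\<ge>T. dist (flow t (C n)) (p0 q R) \<ge> d1" if n: "n \<ge> N" for n
      proof (rule ccontr)
        assume "\<not> ?thesis"
        then have lt: "dist (flow t (C n)) (p0 q R) < d1" if "t \<ge> T" for t
          using that by (meson not_le)
        have near: "flow t (C n) \<in> cball (p0 q R) d1" if "t \<ge> T" for t
          using lt[OF that] by (simp add: dist_commute)
        show False using C(3)[of n]
        proof
          assume "cross m (C n)"
          then obtain T1 where T1: "T1 > 0" "flow T1 (C n) $ 1 = 0" by (auto simp: cross_def hit_def)
          then show False using near_p0(3)[OF near, of T1] N[OF n] by (cases "T1 \<le> T") force+
        next
          assume "settle m (C n)"
          then have lim: "((\<lambda>t. flow t (C n)) \<longlongrightarrow> 0) at_top" by (simp add: settle_def)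
          have "\<forall>\<^sub>F t in at_top. flow t (C n) \<in> cball (p0 q R) d1"
            using eventually_ge_at_top[of T] by eventually_elim (rule near)
          then have "0 \<in> cball (p0 q R) d1" by (intro Lim_in_closed_set[OF closed_cball _ _ lim]) simp_all
          then show False using near_p0(3)[of 0] by simp
        qed
      qed
      have "\<exists>n. many 4 (C (n + N))"
      proof (rule p0_escape[where T = T])
        show "(\<lambda>n. C (n + N)) \<longlonglongrightarrow> Q" by (rule LIMSEQ_ignore_initial_segment[OF C(1)])
        show "T \<ge> 0" using e(1) by (simp add: T_def)
        show "flow t (C (n + N)) $ 1 > 0" if "0 < t" "t \<le> T" for n t using N[of "n + N"] that by simp
        show "dist (flow t Q) (p0 q R) < d1" if "t \<ge> T" for t using T0[of t] that by (simp add: T_def)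
        show "\<exists>t\<ge>T. dist (flow t (C (n + N))) (p0 q R) \<ge> d1" for n by (rule leave) simp
      qed
      then show ?thesis using C(3) cross_not_many settle_not_many m(2) by blast
    qed
  qed
qed

text \<open>Having count \<open>m\<close> is an open condition along the curve, so there is a
  smallest parameter where it fails; that point is a limit of points with count
  \<open>m\<close>.\<close>

lemma first_settle:
  assumes D: "locally_started D" "touch_bound D j" and m: "m < j" "m < 4"
    and c: "continuous_on {0..1} c" "c ` {0..1} \<subseteq> D" and ends: "cross m (c 0)" "\<not> cross m (c 1)"
  obtains r where "0 < r" "r \<le> (1 :: real)" "\<And>t. 0 \<le> t \<Longrightarrow> t < r \<Longrightarrow> cross m (c t)"
    "settle m (c r) \<or> (\<exists>k. k + 2 = m \<and> settle k (c r))"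
proof -
  have cD: "c t \<in> D" if "t \<in> {0..1}" for t using c(2) that by blast
  have seqc: "(\<lambda>n. c (x n)) \<longlonglongrightarrow> c l" if "\<And>n. x n \<in> {0..1}" "x \<longlonglongrightarrow> l" for x :: "nat \<Rightarrow> real" and l
  proof -
    have "l \<in> {0..1}" using closed_sequentially[of "{0..1::real}" x l] that by auto
    then show ?thesis by (rule continuous_on_tendsto_compose[OF c(1) that(2)]) (use that in auto)
  qed
  define G where "G = {r\<in>{0..1}. \<not> cross m (c r)}"
  have "closed G"
    unfolding closed_sequential_limits
  proof (intro allI impI, elim conjE)
    fix x l assume x: "\<forall>n. x n \<in> G" "x \<longlonglongrightarrow> l"
    have x1: "x n \<in> {0..1}" for n using x(1) by (auto simp: G_def)
    have l: "l \<in> {0..1}" using closed_sequentially[of "{0..1::real}" x l] x1 x(2) by auto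
    have "\<not> cross m (c l)"
    proof
      assume cl: "cross m (c l)"
      have "\<forall>\<^sub>F n in sequentially. cross m (c (x n))"
        by (rule cross_sequentially[OF D cD[OF l] cl m(1) seqc[OF x1 x(2)]]) (simp add: cD x1 del: atLeastAtMost_iff)
      then obtain n where "cross m (c (x n))" by (meson eventually_happens sequentially_bot)
      then show False using x(1) by (auto simp: G_def)
    qed
    then show "l \<in> G" using l by (simp add: G_def)
  qed
  moreover have "bounded G" by (rule bounded_subset[of "{0..1}"]) (auto simp: G_def)
  ultimately have "compact G" by (simp add: compact_eq_bounded_closed)
  moreover have "1 \<in> G" using ends by (simp add: G_def)
  ultimately obtain r where r: "r \<in> G" "\<And>t. t \<in> G \<Longrightarrow> r \<le> t" using compact_attains_inf[of G] by blast
  have r1: "0 < r" "r \<le> 1" "\<not> cross m (c r)" using r(1) ends(1) by (auto simp: G_def less_le)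
  have cr: "cross m (c t)" if "0 \<le> t" "t < r" for t
    using r(2)[of t] that r1(2) by (auto simp: G_def)
  define x where "x n = r * (1 - inverse (real (Suc n)))" for n
  have x: "0 \<le> x n" "x n < r" for n using r1(1) by (auto simp: x_def field_simps)
  have "x \<longlonglongrightarrow> r * (1 - 0)"
    unfolding x_def by (intro tendsto_mult tendsto_diff tendsto_const LIMSEQ_inverse_real_of_nat)
  then have xr: "x \<longlonglongrightarrow> r" by simp
  have x1: "x n \<in> {0..1}" for n using x[of n] r1(2) by auto
  have "cross m (c r) \<or> settle m (c r) \<or> (\<exists>k. k + 2 = m \<and> settle k (c r))"
    by (rule limit_of_cross[OF D cD m seqc[OF x1 xr] cD[OF x1]]) (use r1 cr[OF x] in auto)
  then show ?thesis using that r1 cr by blast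
qed

subsection \<open>Curves of starting points\<close>

text \<open>The end at parameter 0 is missing: in the construction it would be the image of a point
  whose orbit runs into the origin. Only the eventual behaviour near it is recorded.\<close>

definition good_curve :: "(real \<Rightarrow> real ^ 3) \<Rightarrow> bool" where
  "good_curve Q \<longleftrightarrow> continuous_on {0<..1} Q \<and> Q ` {0<..1} \<subseteq> SL \<and> many 4 (Q 1) \<and>
     (\<forall>\<^sub>F r in at_right 0. cross 1 (Q r) \<and> many 4 (nxt (Q r)))"

lemma nxt_LL: "P \<in> LL \<Longrightarrow> hit P T \<Longrightarrow> nxt P \<in> SL"
proof -
  assume P: "P \<in> LL" "hit P T"
  then obtain r where r: "r \<in> {0<..1}" "P = seg r" by (auto simp: LL_def)
  have "nxt P \<in> SS" using nxt_SS[OF P(2)] P(1) locally_started_LL by (auto simp: locally_started_def)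
  moreover have "flow T (seg r) = rfl (nxt P)" "T \<ge> 0" using nxt_eq[OF P(2)] r P(2) by (simp_all add: hit_def)
  ultimately show ?thesis using r(1) unfolding SL_def by blast
qed

lemma nxt_SL: "P \<in> SL \<Longrightarrow> hit P T \<Longrightarrow> nxt P \<in> SL"
proof -
  assume P: "P \<in> SL" "hit P T"
  then obtain r t where r: "r \<in> {0<..1}" "t \<ge> 0" "flow t (seg r) = P \<or> flow t (seg r) = rfl P"
    by (auto simp: SL_def)
  have "nxt P \<in> SS" using nxt_SS[OF P(2)] P(1) locally_started_SL by (auto simp: locally_started_def)
  moreover have "flow (T + t) (seg r) = nxt P \<or> flow (T + t) (seg r) = rfl (nxt P)" "T + t \<ge> 0"
    using nxt_eq[OF P(2)] r P(2) by (auto simp: hit_def flow_add flow_rfl)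
  ultimately show ?thesis using r(1) unfolding SL_def by blast
qed

lemma good_curve_nxt:
  assumes D: "locally_started D" "touch_bound D j" "m < j" and SL: "\<And>P T. P \<in> D \<Longrightarrow> hit P T \<Longrightarrow> nxt P \<in> SL"
    and c: "continuous_on {0..1} c" "c ` {0..1} \<subseteq> D" and st: "settle m (c 0)"
    and cr: "\<And>t. t \<in> {0<..1} \<Longrightarrow> cross m (c t)" and four: "many 4 (nxt (c 1))"
  shows "good_curve (\<lambda>t. nxt (c t))"
proof -
  have cD: "c t \<in> D" if "t \<in> {0..1}" for t using c(2) that by blast
  have "continuous_on {0<..1} (\<lambda>t. nxt (c t))"
    unfolding continuous_on_def
  proof
    fix t :: real assume t: "t \<in> {0<..1}"
    have lim: "(c \<longlongrightarrow> c t) (at t within {0<..1})"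
    proof -
      have "continuous_on {0<..1} c" by (rule continuous_on_subset[OF c(1)]) auto
      then show ?thesis using t unfolding continuous_on_def by blast
    qed
    have tD: "c t' \<in> D" if "t' \<in> {0<..1}" for t' using cD[of t'] that by simp
    show "((\<lambda>t. nxt (c t)) \<longlongrightarrow> nxt (c t)) (at t within {0<..1})"
      unfolding filterlim_iff
    proof (intro allI impI)
      fix \<Phi> assume "\<forall>\<^sub>F p in nhds (nxt (c t)). \<Phi> p"
      from nxt_persist[OF D(1,2) tD[OF t] cr[OF t] D(3) this]
      have "\<forall>\<^sub>F t' in at t within {0<..1}. c t' \<in> D \<longrightarrow> \<Phi> (nxt (c t'))"
        by (rule eventually_compose_filterlim[OF _ lim])
      moreover have "\<forall>\<^sub>F t' in at t within {0<..1}. t' \<in> {0<..1}" by (simp add: eventually_at_filter)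
      ultimately show "\<forall>\<^sub>F t' in at t within {0<..1}. \<Phi> (nxt (c t'))"
        by eventually_elim (use tD in blast)
    qed
  qed
  moreover have "(\<lambda>t. nxt (c t)) ` {0<..1} \<subseteq> SL"
  proof
    fix p assume "p \<in> (\<lambda>t. nxt (c t)) ` {0<..1}"
    then obtain t where t: "t \<in> {0<..1}" "p = nxt (c t)" by blast
    obtain T where "hit (c t) T" using cr[OF t(1)] by (auto simp: cross_def)
    moreover have "c t \<in> D" using cD[of t] t by simp
    ultimately show "p \<in> SL" using SL t(2) by blast
  qed
  moreover have lim: "(c \<longlongrightarrow> c 0) (at_right 0)"
  proof -
    have "(c \<longlongrightarrow> c 0) (at 0 within {0..1})" using c(1) by (auto simp: continuous_on_def)
    then show ?thesis by (simp add: at_within_Icc_at_right)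
  qed
  have 0: "c 0 \<in> D" using cD by simp
  have "\<forall>\<^sub>F t in at_right 0. t \<in> {0<..1::real}"
    by (rule eventually_mono[OF eventually_at_right_real[of 0 "1::real"]]) auto
  with eventually_compose_filterlim[OF exit_near_settle[OF D(1,2) 0 st D(3)] lim]
  have "\<forall>\<^sub>F t in at_right 0. cross 1 (nxt (c t)) \<and> many 4 (nxt (nxt (c t)))"
  proof eventually_elim
    case (elim t)
    have "c t \<in> D" using cD[of t] elim(2) by simp
    \<comment> \<open>Near 0 the count is \<open>m\<close> by assumption, so of the three
      alternatives only leaving the origin on the far side remains.\<close>
    then show ?case using elim(1) cr[OF elim(2)] cross_not_settle cross_unique[of m "c t" "m + 2"] by auto
  qed
  ultimately show ?thesis using four by (simp add: good_curve_def)
qed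

text \<open>The path is cut at its first point without count \<open>m\<close> and run backward from
  there, so that the settling point sits at parameter 0. The last assumption excludes that the count
  was reached by the jump by 2.\<close>

lemma good_curve_from_path:
  assumes D: "locally_started D" "touch_bound D j" and m: "m < j" "m < 4"
    and SL: "\<And>P T. P \<in> D \<Longrightarrow> hit P T \<Longrightarrow> nxt P \<in> SL"
    and c: "continuous_on {0..1} c" "c ` {0..1} \<subseteq> D" and ends: "cross m (c 0)" "\<not> cross m (c 1)"
    and four: "many 4 (nxt (c 0))" and no: "\<And>t k. t \<in> {0..1} \<Longrightarrow> k + 2 = m \<Longrightarrow> \<not> settle k (c t)"
  shows "\<exists>r. 0 < r \<and> r \<le> 1 \<and> (\<forall>t\<in>{0<..1}. cross m (c (r * (1 - t)))) \<and> good_curve (\<lambda>t. nxt (c (r * (1 - t))))"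
proof -
  obtain r where r: "0 < r" "r \<le> (1 :: real)" "\<And>t. 0 \<le> t \<Longrightarrow> t < r \<Longrightarrow> cross m (c t)"
    "settle m (c r) \<or> (\<exists>k. k + 2 = m \<and> settle k (c r))"
    by (rule first_settle[OF D m c ends], rule that)
  have st: "settle m (c r)" using r(4) no[of r] r(1,2) by auto
  have sub: "r * (1 - t) \<in> {0..1}" if "t \<in> {0..1}" for t
    using that r(1,2) mult_mono[of r 1 "1 - t" 1] by auto
  have cr: "cross m (c (r * (1 - t)))" if "t \<in> {0<..1}" for t
    using r(1) that by (intro r(3)) (auto simp: mult_less_cancel_left1 algebra_simps)
  have "good_curve (\<lambda>t. nxt (c (r * (1 - t))))"
  proof (rule good_curve_nxt[OF D m(1) SL])
    show "continuous_on {0..1} (\<lambda>t. c (r * (1 - t)))"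
      by (rule continuous_on_compose2[OF c(1)]) (use sub in \<open>auto intro!: continuous_intros simp del: atLeastAtMost_iff\<close>)
    show "(\<lambda>t. c (r * (1 - t))) ` {0..1} \<subseteq> D" using c(2) sub by blast
  qed (use st cr four in auto)
  then show ?thesis using r(1,2) cr by blast
qed

text \<open>Condition A read from the turn onward: no further sign change before the zero of
  \<open>x\<close>, and at least four after it.\<close>

lemma cross_turn: "cross 0 turn" and many_nxt_turn: "many 4 (nxt turn)"
proof -
  obtain b \<tau> t1 where b: "unst b" "turn = flow \<tau> b" "0 < \<tau>" "\<tau> < t1" "\<And>t. t \<in> {\<tau><..t1} \<Longrightarrow> W (flow t b) < 0"
    "\<And>t. t < t1 \<Longrightarrow> flow t b $ 1 > 0" "flow t1 b $ 1 = 0" "many 4 (rfl (flow t1 b))"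
    by (rule turn_spec, rule that)
  have ft: "flow u turn = flow (u + \<tau>) b" for u by (simp add: b(2) flow_add)
  have h: "hit turn (t1 - \<tau>)" using b(4,6,7) by (auto simp: hit_def ft)
  have "SC turn = {}"
  proof (rule equals0I)
    fix t assume t: "t \<in> SC turn"
    show False
    proof (cases "t \<le> t1 - \<tau>")
      case True
      then show ?thesis using t b(5)[of "t + \<tau>"] by (auto simp: SC_def ft)
    next
      case False
      then have "t1 - \<tau> \<in> {0<..t}" using b(4) by auto
      then have "flow (t1 - \<tau>) turn $ 1 > 0" using t unfolding SC_def by blast
      then show ?thesis using b(7) by (simp add: ft)
    qed
  qed
  then show "cross 0 turn" using h by (auto simp: cross_def)
  show "many 4 (nxt turn)" using b(8) by (simp add: nxt_eq[OF h] ft)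
qed

text \<open>The count is 0 at \<open>turn\<close> but cannot be 0 all the way to
  \<open>p0 q R\<close>, because orbits starting close to that equilibrium oscillate before they
  return.\<close>

lemma good_curve_exists: "\<exists>Q. good_curve Q"
proof -
  have d1: "d1 > 0" using X0_pos by (simp add: d1_def)
  define C where "C n = seg (inverse (real (Suc n)))" for n
  have r: "0 < inverse (real (Suc n))" "inverse (real (Suc n)) \<le> 1" for n by (simp_all add: field_simps)
  have "\<exists>n. \<not> cross 0 (C n)"
  proof (rule ccontr)
    assume "\<not> ?thesis"
    then have cr: "cross 0 (C n)" for n by blast
    have "C \<longlonglongrightarrow> seg 0"
      unfolding C_def
    proof (rule continuous_on_tendsto_compose[OF continuous_on_seg[of UNIV] LIMSEQ_inverse_real_of_nat])
    qed auto
    then have lim: "C \<longlonglongrightarrow> p0 q R" by simp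
    have "\<exists>n. many 4 (C n)"
    proof (rule p0_escape[OF lim, of 0])
      show "dist (flow t (p0 q R)) (p0 q R) < d1" if "t \<ge> 0" for t
        using flow_equilibrium[OF field_p0, of t] p0_trap trap_subset_region d1 by auto
      show "\<exists>t\<ge>0. dist (flow t (C n)) (p0 q R) \<ge> d1" for n
      proof -
        obtain T where T: "T > 0" "flow T (C n) $ 1 = 0" using cr[of n] by (auto simp: cross_def hit_def)
        have "flow T (C n) \<notin> cball (p0 q R) d1" using near_p0(3)[of "flow T (C n)"] T(2) by auto
        then show ?thesis using T(1) by (intro exI[of _ T]) (auto simp: dist_commute)
      qed
    qed auto
    then show False using cross_not_many[OF cr] by auto
  qed
  then obtain \<rho> where \<rho>: "0 < \<rho>" "\<rho> \<le> 1" "\<not> cross 0 (seg \<rho>)" using r unfolding C_def by blast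
  \<comment> \<open>Runs from \<open>turn\<close> to \<open>seg \<rho>\<close> and so avoids
    \<open>p0 q R\<close>, which is not a starting point in \<open>LL\<close>.\<close>
  define c where "c t = seg (1 - t * (1 - \<rho>))" for t
  have rng: "1 - t * (1 - \<rho>) \<in> {0<..1}" if "t \<in> {0..1}" for t
    using \<rho>(1,2) that mult_mono[of t 1 "1 - \<rho>" "1 - \<rho>"] by (auto simp: mult_nonneg_nonneg)
  have "\<exists>r. 0 < r \<and> r \<le> 1 \<and> (\<forall>t\<in>{0<..1}. cross 0 (c (r * (1 - t)))) \<and> good_curve (\<lambda>t. nxt (c (r * (1 - t))))"
  proof (rule good_curve_from_path[OF locally_started_LL touch_bound_LL])
    show "nxt P \<in> SL" if "P \<in> LL" "hit P T" for P T using nxt_LL that .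
    show "continuous_on {0..1} c"
      unfolding c_def by (intro continuous_on_compose2[OF continuous_on_seg[of UNIV]] continuous_intros) auto
    show "c ` {0..1} \<subseteq> LL" using rng by (auto simp: c_def LL_def simp del: atLeastAtMost_iff greaterThanAtMost_iff)
  qed (use \<rho> cross_turn many_nxt_turn in \<open>auto simp: c_def\<close>)
  then show ?thesis by blast
qed

lemma good_curve_step_from:
  assumes Q: "good_curve Q" and m: "m < 4" and \<rho>: "0 < \<rho>" "\<rho> < 1" and cr: "cross m (Q \<rho>)" "many 4 (nxt (Q \<rho>))"
    and no: "\<And>r k. r \<in> {\<rho>..1} \<Longrightarrow> k + 2 = m \<Longrightarrow> \<not> settle k (Q r)"
  shows "\<exists>\<alpha> \<beta>. \<alpha> \<in> {0<..1} \<and> \<beta> \<in> {0<..1} \<and> \<alpha> \<noteq> \<beta> \<and> (\<forall>t\<in>{0<..1}. cross m (Q (\<alpha> + t * (\<beta> - \<alpha>)))) \<and>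
    good_curve (\<lambda>t. nxt (Q (\<alpha> + t * (\<beta> - \<alpha>))))"
proof -
  define c where "c t = Q (\<rho> + t * (1 - \<rho>))" for t
  have rng: "\<rho> + t * (1 - \<rho>) \<in> {\<rho>..1}" if "t \<in> {0..1}" for t
  proof -
    have "t * (1 - \<rho>) \<le> 1 * (1 - \<rho>)" "0 \<le> t * (1 - \<rho>)"
      using \<rho> that by (auto intro!: mult_right_mono mult_nonneg_nonneg)
    moreover have "1 * (1 - \<rho>) = 1 - \<rho>" by simp
    ultimately show ?thesis unfolding atLeastAtMost_iff by (intro conjI; linarith)
  qed
  have sub: "{\<rho>..1} \<subseteq> {0<..1}" using \<rho>(1) by auto
  have "\<exists>r. 0 < r \<and> r \<le> 1 \<and> (\<forall>t\<in>{0<..1}. cross m (c (r * (1 - t)))) \<and> good_curve (\<lambda>t. nxt (c (r * (1 - t))))"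
  proof (rule good_curve_from_path[OF locally_started_SL touch_bound_SL])
    show "nxt P \<in> SL" if "P \<in> SL" "hit P T" for P T using nxt_SL that .
    show "continuous_on {0..1} c"
      unfolding c_def
    proof (rule continuous_on_compose2[of "{0<..1}" Q])
      show "continuous_on {0<..1} Q" using Q by (simp add: good_curve_def)
      show "(\<lambda>t. \<rho> + t * (1 - \<rho>)) ` {0..1} \<subseteq> {0<..1}" using rng sub by blast
    qed (intro continuous_intros)
    show "c ` {0..1} \<subseteq> SL"
    proof
      fix p assume "p \<in> c ` {0..1}"
      then obtain t where "t \<in> {0..1}" "p = c t" by blast
      then show "p \<in> SL" using Q rng[of t] sub unfolding good_curve_def c_def by blast
    qed
    show "\<not> cross m (c 1)" using Q cross_not_many[of m "Q 1" 4] m by (auto simp: good_curve_def c_def)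
    show "\<not> settle k (c t)" if "t \<in> {0..1}" "k + 2 = m" for t k
      using no[OF rng[OF that(1)] that(2)] by (simp add: c_def)
  qed (use m cr in \<open>auto simp: c_def\<close>)
  then obtain r where r: "0 < r" "r \<le> 1" "\<forall>t\<in>{0<..1}. cross m (c (r * (1 - t)))" "good_curve (\<lambda>t. nxt (c (r * (1 - t))))"
    by blast
  \<comment> \<open>The parameter of the settling point, which becomes the missing end of the new
    curve; its other end is \<rho>.\<close>
  define \<alpha> where "\<alpha> = \<rho> + r * (1 - \<rho>)"
  have c: "c (r * (1 - t)) = Q (\<alpha> + t * (\<rho> - \<alpha>))" for t
    by (simp add: c_def \<alpha>_def algebra_simps)
  have "\<alpha> \<in> {0<..1}" using rng[of r] r \<rho>(1) by (simp add: \<alpha>_def)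
  moreover have "\<alpha> \<noteq> \<rho>" using r \<rho> by (simp add: \<alpha>_def)
  ultimately show ?thesis using r(3,4) \<rho> unfolding c by (intro exI[of _ \<alpha>] exI[of _ \<rho>]) auto
qed

text \<open>Count 1 is available next to parameter 0. Count 3 arises as \<open>1 + 2\<close> just
  beyond the last parameter that still has count 1 or settles with it.\<close>

lemma good_curve_step:
  assumes Q: "good_curve Q" and m: "m = 1 \<or> m = 3"
  shows "\<exists>\<alpha> \<beta>. \<alpha> \<in> {0<..1} \<and> \<beta> \<in> {0<..1} \<and> \<alpha> \<noteq> \<beta> \<and> (\<forall>t\<in>{0<..1}. cross m (Q (\<alpha> + t * (\<beta> - \<alpha>)))) \<and>
    good_curve (\<lambda>t. nxt (Q (\<alpha> + t * (\<beta> - \<alpha>))))"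
proof -
  have Q': "continuous_on {0<..1} Q" "\<And>r. r \<in> {0<..1} \<Longrightarrow> Q r \<in> SL" "many 4 (Q 1)"
    "\<forall>\<^sub>F r in at_right 0. cross 1 (Q r) \<and> many 4 (nxt (Q r))" using Q by (auto simp: good_curve_def)
  have "\<forall>\<^sub>F r in at_right 0. r \<in> {0<..<1::real}" by (rule eventually_at_right_real) simp
  with Q'(4) have "\<forall>\<^sub>F r in at_right 0. r \<in> {0<..<1} \<and> cross 1 (Q r) \<and> many 4 (nxt (Q r))"
    by eventually_elim blast
  from eventually_happens'[OF trivial_limit_at_right_real this]
  obtain \<rho> where \<rho>: "0 < \<rho>" "\<rho> < 1" "cross 1 (Q \<rho>)" "many 4 (nxt (Q \<rho>))" by auto
  show ?thesis
    using m
  proof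
    assume [simp]: "m = 1"
    show ?thesis by (rule good_curve_step_from[OF Q _ \<rho>(1,2)]) (use \<rho> in auto)
  next
    assume m3: "m = 3"
    define G where "G = {r \<in> {\<rho>..1}. cross 1 (Q r) \<or> settle 1 (Q r)}"
    have sub: "{\<rho>..1} \<subseteq> {0<..1}" using \<rho>(1) by auto
    have "closed G"
      unfolding closed_sequential_limits
    proof (intro allI impI, elim conjE)
      fix x l assume x: "\<forall>n. x n \<in> G" "x \<longlonglongrightarrow> l"
      have x1: "x n \<in> {\<rho>..1}" and x2: "cross 1 (Q (x n)) \<or> settle 1 (Q (x n))" for n using x(1) by (auto simp: G_def)
      have l: "l \<in> {\<rho>..1}" using closed_sequentially[of "{\<rho>..1}" x l] x1 x(2) by auto
      have lim: "(\<lambda>n. Q (x n)) \<longlonglongrightarrow> Q l"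
      proof (rule continuous_on_tendsto_compose[OF Q'(1) x(2)])
        show "l \<in> {0<..1}" using l sub by blast
        show "\<forall>\<^sub>F n in sequentially. x n \<in> {0<..1}" using x1 sub by (intro always_eventually) blast
      qed
      have "cross 1 (Q l) \<or> settle 1 (Q l) \<or> (\<exists>k. k + 2 = 1 \<and> settle k (Q l))"
        by (rule limit_of_cross[OF locally_started_SL touch_bound_SL Q'(2) _ _ lim Q'(2) x2])
          (use l sub x1 in \<open>auto simp del: atLeastAtMost_iff greaterThanAtMost_iff\<close>)
      then show "l \<in> G" using l by (auto simp: G_def)
    qed
    moreover have "bounded G" by (rule bounded_subset[of "{\<rho>..1}"]) (auto simp: G_def)
    ultimately have "compact G" by (simp add: compact_eq_bounded_closed)
    moreover have "\<rho> \<in> G" using \<rho> by (simp add: G_def)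
    ultimately obtain g where g: "g \<in> G" "\<And>r. r \<in> G \<Longrightarrow> r \<le> g" using compact_attains_sup[of G] by blast
    have "1 \<notin> G" using Q'(3) cross_not_many[of 1 "Q 1" 4] settle_not_many[of 1 "Q 1" 4] by (auto simp: G_def)
    then have g1: "\<rho> \<le> g" "g < 1" using g(1) by (auto simp: G_def less_le)
    have gS: "g \<in> {0<..1}" using g1 \<rho> by auto
    have not1: "\<not> cross 1 (Q r) \<and> \<not> settle 1 (Q r)" if "g < r" "r \<le> 1" for r
      using g(2)[of r] that g1 by (auto simp: G_def)
    have "(Q \<longlongrightarrow> Q g) (at g within {0<..1})" using Q'(1) gS by (simp add: continuous_on_def)
    then have "(Q \<longlongrightarrow> Q g) (at g within {g..1})" by (rule tendsto_within_subset) (use gS in auto)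
    then have lim: "(Q \<longlongrightarrow> Q g) (at_right g)" using g1(2) by (simp add: at_within_Icc_at_right)
    have ev: "\<forall>\<^sub>F r in at_right g. r \<in> {g<..<1}" using g1(2) by (rule eventually_at_right_real)
    \<comment> \<open>The orbit at \<open>g\<close> must settle, as count 1 is an open condition and
      \<open>g\<close> is the last such parameter. To the right of \<open>g\<close> only the
      alternative with count \<open>1 + 2\<close> survives.\<close>
    have SLg: "\<forall>\<^sub>F r in at_right g. Q r \<in> SL" using ev by eventually_elim (use Q'(2) gS in auto)
    have "\<not> cross 1 (Q g)"
    proof
      assume "cross 1 (Q g)"
      from cross_sequentially[OF locally_started_SL touch_bound_SL Q'(2)[OF gS] this _ lim SLg]
      have "\<forall>\<^sub>F r in at_right g. cross 1 (Q r)" by simp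
      with ev have "\<forall>\<^sub>F r in at_right g. False" by eventually_elim (use not1 in auto)
      then show False by simp
    qed
    then have st: "settle 1 (Q g)" using g(1) by (simp add: G_def)
    from eventually_compose_filterlim[OF exit_near_settle[OF locally_started_SL touch_bound_SL Q'(2)[OF gS] st] lim]
    have "\<forall>\<^sub>F r in at_right g. Q r \<in> SL \<longrightarrow> settle 1 (Q r) \<or> (cross 1 (Q r) \<and> cross 1 (nxt (Q r)) \<and> many 4 (nxt (nxt (Q r)))) \<or>
      (cross (1 + 2) (Q r) \<and> many 4 (nxt (Q r)))" by simp
    with ev SLg have "\<forall>\<^sub>F r in at_right g. r \<in> {g<..<1} \<and> cross (1 + 2) (Q r) \<and> many 4 (nxt (Q r))"
      by eventually_elim (use not1 in force)
    from eventually_happens'[OF trivial_limit_at_right_real this]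
    obtain \<sigma> where \<sigma>: "g < \<sigma>" "\<sigma> < 1" "cross 3 (Q \<sigma>)" "many 4 (nxt (Q \<sigma>))"
      by (auto simp: numeral_3_eq_3)
    show ?thesis
    proof (rule good_curve_step_from[OF Q])
      \<comment> \<open>Beyond \<open>g\<close> no orbit settles with count 1, so where count 3
        ends, an orbit must settle with count 3.\<close>
      show "\<not> settle k (Q r)" if "r \<in> {\<sigma>..1}" "k + 2 = m" for r k
        using not1[of r] that \<sigma>(1) m3 by auto
    qed (use \<sigma> gS m3 in auto)
  qed
qed

section \<open>Realizing a prescribed sequence\<close>

text \<open>Each curve is the image under \<open>nxt\<close> of a subcurve of its predecessor. The
  parameter changes are affine and injective, so a coherent sequence of parameters exists, and the
  points at these parameters form one orbit of the return map.\<close>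

lemma itinerary_exists:
  assumes M: "\<And>n. M n = 1 \<or> M n = 3"
  shows "\<exists>P. \<forall>n. P n \<in> SS \<and> cross (M n) (P n) \<and> P (Suc n) = nxt (P n)"
proof -
  define next_par where "next_par Q m \<alpha> \<beta> \<longleftrightarrow> \<alpha> \<in> {0<..1} \<and> \<beta> \<in> {0<..1} \<and> \<alpha> \<noteq> \<beta> \<and>
    (\<forall>t\<in>{0<..1}. cross m (Q (\<alpha> + t * (\<beta> - \<alpha>)))) \<and> good_curve (\<lambda>t. nxt (Q (\<alpha> + t * (\<beta> - \<alpha>))))"
    for Q m and \<alpha> \<beta> :: real
  obtain Q0 where Q0: "good_curve Q0" using good_curve_exists by blast
  have "\<exists>f. \<forall>n. good_curve (f n) \<and> (\<exists>\<alpha> \<beta>. next_par (f n) (M n) \<alpha> \<beta> \<and> f (Suc n) = (\<lambda>t. nxt (f n (\<alpha> + t * (\<beta> - \<alpha>)))))"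
  proof (rule dependent_nat_choice)
    show "\<exists>Q. good_curve Q" using Q0 by blast
    fix Q n assume "good_curve Q"
    from good_curve_step[OF this M[of n]] obtain \<alpha> \<beta> where "next_par Q (M n) \<alpha> \<beta>"
      unfolding next_par_def by blast
    then show "\<exists>Q'. good_curve Q' \<and> (\<exists>\<alpha> \<beta>. next_par Q (M n) \<alpha> \<beta> \<and> Q' = (\<lambda>t. nxt (Q (\<alpha> + t * (\<beta> - \<alpha>)))))"
      unfolding next_par_def by blast
  qed
  then obtain f where f: "\<And>n. good_curve (f n)"
    "\<And>n. \<exists>\<alpha> \<beta>. next_par (f n) (M n) \<alpha> \<beta> \<and> f (Suc n) = (\<lambda>t. nxt (f n (\<alpha> + t * (\<beta> - \<alpha>))))" by blast
  then obtain \<alpha> \<beta> where ab: "\<And>n. next_par (f n) (M n) (\<alpha> n) (\<beta> n)"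
    "\<And>n. f (Suc n) = (\<lambda>t. nxt (f n (\<alpha> n + t * (\<beta> n - \<alpha> n))))" by metis
  define A where "A n t = \<alpha> n + t * (\<beta> n - \<alpha> n)" for n t
  \<comment> \<open>Both end points \<alpha> and \<beta> are positive, so the closed interval is
    mapped into the half-open one and the coherent parameters avoid 0.\<close>
  have rng: "A n t \<in> {0<..1}" if "t \<in> {0..1}" for n t
  proof -
    have ab01: "0 < \<alpha> n" "\<alpha> n \<le> 1" "0 < \<beta> n" "\<beta> n \<le> 1" using ab(1)[of n] by (auto simp: next_par_def)
    have "A n t = (1 - t) * \<alpha> n + t * \<beta> n" by (simp add: A_def algebra_simps)
    moreover have "(1 - t) * \<alpha> n + t * \<beta> n \<le> (1 - t) * 1 + t * 1"
      using ab01 that by (intro add_mono mult_left_mono) auto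
    moreover have "0 < (1 - t) * \<alpha> n + t * \<beta> n"
      using ab01 that by (cases "t = 0") (auto intro: add_nonneg_pos)
    ultimately show ?thesis by simp
  qed
  obtain x where x: "\<And>n. x n \<in> {0..1}" "\<And>n. x n = A n (x (Suc n))"
  proof -
    have "\<exists>x. \<forall>n. x n \<in> {0..1} \<and> x n = A n (x (Suc n))"
    proof (rule inverse_limit_intervals)
      show "continuous_on {0..1} (A n)" for n unfolding A_def[abs_def] by (intro continuous_intros)
      show "inj_on (A n) {0..1}" for n using ab(1)[of n] by (auto simp: inj_on_def A_def next_par_def)
      show "A n ` {0..1} \<subseteq> {0..1}" for n using rng[of _ n] by fastforce
    qed
    then show ?thesis using that by blast
  qed
  have x': "x n \<in> {0<..1}" for n using rng[OF x(1)[of "Suc n"], of n] x(2)[of n] by simp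
  define P where "P n = f n (x n)" for n
  have PA: "P n = f n (\<alpha> n + x (Suc n) * (\<beta> n - \<alpha> n))" for n
    unfolding P_def by (subst x(2)[of n]) (simp add: A_def)
  have "P n \<in> SS" for n using f(1)[of n] x'[of n] unfolding P_def good_curve_def SL_def by blast
  moreover have "cross (M n) (P n)" for n using ab(1)[of n] x'[of "Suc n"] unfolding PA next_par_def by blast
  moreover have "P (Suc n) = nxt (P n)" for n unfolding PA[of n] by (simp add: P_def ab(2))
  ultimately show ?thesis by blast
qed

lemma shooting:
  fixes M :: "nat \<Rightarrow> nat"
  assumes M: "\<And>j. j \<ge> 1 \<Longrightarrow> M j = 1 \<or> M j = 3"
  shows "\<exists>J p t. solution s q R J p \<and> {0..} \<subseteq> J \<and> infinite (zeros_x p {0<..}) \<and>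
    strict_mono_on {1..} t \<and> t ` {1..} = zeros_x p {0..} \<and>
    (\<forall>i\<ge>1. card (sign_changes_x' p {t i<..<t (i + 1)}) = M i)"
proof -
  obtain P where P: "\<And>n. P n \<in> SS" "\<And>n. cross (M (Suc n)) (P n)" "\<And>n. P (Suc n) = nxt (P n)"
    using itinerary_exists[of "\<lambda>n. M (Suc n)"] M by (metis le_add1 plus_1_eq_Suc)
  have "\<exists>T. hit (P n) T" for n using P(2)[of n] by (auto simp: cross_def)
  then obtain T where T: "\<And>n. hit (P n) (T n)" by metis
  have Tp: "T n > 0" for n using T by (simp add: hit_def)
  define S where "S n = sum T {..<n}" for n
  have S: "S 0 = 0" "S (Suc n) = S n + T n" for n by (simp_all add: S_def)
  define X where "X = P 0"
  have X: "X \<in> trap" "X $ 1 = 0" "W X > 0" "off X" "field X \<noteq> 0" using P(1)[of 0] SS_off SS_field by (auto simp: X_def SS_def)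
  have PX: "P n = flow (S n) X \<or> P n = rfl (flow (S n) X)" for n
  proof (induction n)
    case (Suc n)
    have "P (Suc n) = rfl (flow (T n) (P n))" using P(3) nxt_eq[OF T] by simp
    moreover have "flow (S (Suc n)) X = flow (T n) (flow (S n) X)" by (simp add: S flow_add[symmetric] add.commute)
    ultimately show ?case using Suc by (auto simp: flow_rfl)
  qed (simp add: S X_def)
  have same: "flow (u + S n) X $ 1 = 0 \<longleftrightarrow> flow u (P n) $ 1 = 0" "W (flow (u + S n) X) = 0 \<longleftrightarrow> W (flow u (P n)) = 0"
    "Z (flow (u + S n) X) = Z (flow u (P n))" for u n
    using PX[of n] by (auto simp: flow_add flow_rfl)
  have Smono: "strict_mono S" by (rule strict_monoI_Suc) (simp add: S Tp)
  have S0: "S n \<ge> 0" for n using strict_mono_less_eq[OF Smono, of 0 n] S(1) by simp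
  have zS: "flow (S n) X $ 1 = 0" for n using same(1)[of 0 n] P(1)[of n] by (simp add: SS_def)
  have between: "flow u X $ 1 \<noteq> 0" if "S n < u" "u < S (Suc n)" for u n
  proof -
    have "flow (u - S n) (P n) $ 1 > 0" using T[of n] that by (auto simp: hit_def S)
    then show ?thesis using same(1)[of "u - S n" n] by simp
  qed
  have SCin: "t \<in> {0<..<T n} \<and> W (flow t (P n)) = 0" if "t \<in> SC (P n)" for t n
  proof -
    have "\<not> T n \<le> t"
    proof
      assume "T n \<le> t"
      then have "flow (T n) (P n) $ 1 > 0" using that Tp[of n] by (auto simp: SC_def)
      then show False using T[of n] by (simp add: hit_def)
    qed
    then show ?thesis using that by (auto simp: SC_def)
  qed
  \<comment> \<open>If the return times converged, so would the zeros of \<open>W\<close> between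
    them, which exist because all counts are positive. At the limit \<open>x\<close> and
    \<open>W\<close> would both vanish, but the orbit is off the invariant axis.\<close>
  have unb: "\<exists>n. S n > u" for u
  proof (rule ccontr)
    assume "\<not> ?thesis"
    then have le: "S n \<le> u" for n by (simp add: not_less)
    have "incseq S" using Smono by (rule strict_mono_mono)
    then obtain l where l: "S \<longlonglongrightarrow> l" using incseq_convergent[of S u] le by blast
    have "\<exists>v. S n < v \<and> v < S (Suc n) \<and> W (flow v X) = 0" for n
    proof -
      have "card (SC (P n)) = M (Suc n)" using P(2)[of n] by (simp add: cross_def)
      then have "SC (P n) \<noteq> {}" using M[of "Suc n"] by auto
      then obtain t where "t \<in> SC (P n)" by blast
      from SCin[OF this] same(2)[of t n] show ?thesis by (intro exI[of _ "t + S n"]) (simp add: S)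
    qed
    then obtain v where v: "\<And>n. S n < v n" "\<And>n. v n < S (Suc n)" "\<And>n. W (flow (v n) X) = 0" by metis
    have vl: "v \<longlonglongrightarrow> l"
      by (rule tendsto_sandwich[OF _ _ l LIMSEQ_Suc[OF l]]) (use v in \<open>auto intro!: always_eventually less_imp_le\<close>)
    have "(\<lambda>n. W (flow (v n) X)) \<longlonglongrightarrow> W (flow l X)"
      by (intro tendsto_W tendsto_flow vl tendsto_const)
    then have "W (flow l X) = 0" using v(3) by (simp add: LIMSEQ_const_iff)
    moreover have "(\<lambda>n. flow (S n) X $ 1) \<longlonglongrightarrow> flow l X $ 1"
      by (intro tendsto_vec_nth tendsto_flow l tendsto_const)
    then have "flow l X $ 1 = 0" using zS by (simp add: LIMSEQ_const_iff)
    ultimately show False using z_axis_iff[of l X] X(2,3) by simp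
  qed
  have zero_iff: "flow u X $ 1 = 0 \<longleftrightarrow> u \<in> range S" if "u \<ge> 0" for u
  proof
    assume z: "flow u X $ 1 = 0"
    define k where "k = (LEAST n. S n > u)"
    have k: "S k > u" unfolding k_def using unb by (rule LeastI_ex)
    then have "k \<noteq> 0" using that S(1) by (intro notI) simp
    then obtain n where n: "k = Suc n" using not0_implies_Suc by blast
    have "\<not> S n > u" using not_less_Least[of n "\<lambda>n. S n > u"] n by (simp add: k_def)
    then have "u = S n" using between[of n u] z k n by force
    then show "u \<in> range S" by blast
  qed (use zS in auto)
  have regX: "flow t X \<in> region" if "t \<ge> - 0" for t using flow_region[OF X(1)] that by simp
  obtain J p where J: "solution s q R J p" "{0..} \<subseteq> J" "\<And>t. t \<ge> 0 \<Longrightarrow> p t = flow t X"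
    using maximal_solution_exists[of 0 X] regX by auto
  \<comment> \<open>The starting point itself has \<open>x = 0\<close>, so the enumeration from
    index 1 begins with \<open>t 1 = 0\<close>, and leg \<open>n\<close> carries the count
    \<open>M (Suc n)\<close>.\<close>
  define t where "t i = S (i - 1)" for i
  have z0: "zeros_x p {0..} = range S" using zero_iff J(3) S0 by (auto simp: zeros_x_def)
  have "range S = t ` {1..}"
  proof (intro equalityI subsetI)
    fix u assume "u \<in> range S"
    then obtain n where "u = t (Suc n)" by (auto simp: t_def)
    then show "u \<in> t ` {1..}" by simp
  qed (auto simp: t_def)
  moreover have "strict_mono_on {1..} t"
    using Smono by (auto simp: strict_mono_on_def strict_mono_def t_def)
  moreover have "infinite (zeros_x p {0<..})"
  proof -
    have "range (\<lambda>n. S (Suc n)) \<subseteq> zeros_x p {0<..}"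
    proof
      fix u assume "u \<in> range (\<lambda>n. S (Suc n))"
      then obtain n where n: "u = S (Suc n)" by blast
      then have "u > 0" using S0[of n] Tp[of n] by (simp add: S)
      then show "u \<in> zeros_x p {0<..}" using J(3)[of u] zS n by (simp add: zeros_x_def)
    qed
    moreover have "infinite (range (\<lambda>n. S (Suc n)))"
      by (rule range_inj_infinite) (use Smono in \<open>auto simp: inj_on_def strict_mono_eq\<close>)
    ultimately show ?thesis using infinite_super by blast
  qed
  moreover have "card (sign_changes_x' p {t i<..<t (i + 1)}) = M i" if "i \<ge> 1" for i
  proof -
    define n where "n = i - 1"
    have n: "i = Suc n" using that by (simp add: n_def)
    have "sign_changes_x' p {S n<..<S (Suc n)} = {u \<in> {S n<..<S (Suc n)}. W (flow u X) = 0 \<and> Z (flow u X) \<noteq> 0}"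
    proof (rule sign_changes_flow[of _ X "{0<..}"])
      show "{S n<..<S (Suc n)} \<subseteq> {0<..}" using S0[of n] by auto
    qed (use S0[of n] flow_region[OF X(1)] X(4,5) J(3) in auto)
    moreover have "{u \<in> {S n<..<S (Suc n)}. W (flow u X) = 0 \<and> Z (flow u X) \<noteq> 0} = (\<lambda>v. v + S n) ` SC (P n)"
    proof (intro equalityI subsetI)
      fix u assume u: "u \<in> {u \<in> {S n<..<S (Suc n)}. W (flow u X) = 0 \<and> Z (flow u X) \<noteq> 0}"
      then have "u - S n \<in> SC (P n)"
        using T[of n] same(2,3)[of "u - S n" n] by (auto simp: SC_def hit_def S)
      then show "u \<in> (\<lambda>v. v + S n) ` SC (P n)" by (intro image_eqI[of _ _ "u - S n"]) auto
    next
      fix u assume "u \<in> (\<lambda>v. v + S n) ` SC (P n)"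
      then obtain v where v: "v \<in> SC (P n)" "u = v + S n" by blast
      then show "u \<in> {u \<in> {S n<..<S (Suc n)}. W (flow u X) = 0 \<and> Z (flow u X) \<noteq> 0}"
        using SCin[OF v(1)] same(2,3)[of v n] by (auto simp: SC_def S)
    qed
    moreover have "card ((\<lambda>v. v + S n) ` SC (P n)) = M i"
      using P(2)[of n] n by (subst card_image) (auto simp: inj_on_def cross_def)
    ultimately show ?thesis by (simp add: t_def n)
  qed
  ultimately show ?thesis using J(1,2) z0 by (intro exI[of _ J] exI[of _ p] exI[of _ t]) simp
qed

end

theorem theorem2:
  fixes s q R :: real and M :: "nat \<Rightarrow> nat"
  assumes "s > 0" and "q > 0" and "R > 1"
    and "condition_A s q R"
    and "condition_B s q R"
    and "\<exists>c d. c \<noteq> d \<and> c \<notin> \<real> \<and> d \<notin> \<real> \<and>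
           complex_eigenvalue (jacobian (lorenz s q R) (at (p0 q R))) c \<and>
           complex_eigenvalue (jacobian (lorenz s q R) (at (p0 q R))) d"
    and "\<forall>j\<ge>1. M j \<in> {1, 3}"
  shows "\<exists>J p t. solution s q R J p \<and> {0..} \<subseteq> J \<and>
           infinite (zeros_x p {0<..}) \<and>
           strict_mono_on {1..} t \<and> t ` {1..} = zeros_x p {0..} \<and>
           (\<forall>i\<ge>1. card (sign_changes_x' p {t i<..<t (i + 1)}) = M i)"
proof -
  interpret lorenz_shooting s q R by unfold_locales fact+
  show ?thesis by (rule shooting) (use assms(7) in auto)
qed

end
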